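(* Let $\eta>0$ be fixed and let $\Phi(\xi)=-|\xi|^p+\Phi_1(\xi)$ be a real valued Fourier symbol with $p>3$ and $|\Phi_1(\xi)|\le C(1+|\xi|^q)$ for some constants $C$ and $0\le q<p$. Let $L$ be the linear operator defined by $\widehat{Lf}(\xi)=-\Phi(\xi)\hat f(\xi)$. Then for any $s>1-\frac p2$ and any data $u_0\in H^s(\mathbb{R})$ there exist a time $T=T(\|u_0\|_{H^s})>0$ and a unique solution $u$ in $C([0,T];H^s(\mathbb{R}))$ to the initial value problem $$u_t+u_{xxx}+\eta Lu+(u_x)^2=0,\quad x\in\mathbb{R},\ t\ge 0,\qquad u(x,0)=u_0(x).$$ Moreover, the map $u_0\mapsto u$ is smooth from $H^s(\mathbb{R})$ to $C([0,T];H^s(\mathbb{R}))\cap Y_T^s$, and $u\in C((0,T];H^\infty(\mathbb{R}))$.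
   Context: $\hat f(\xi)=\int_{\mathbb{R}}e^{-ix\xi}f(x)\,dx$ (the factor $1/\sqrt{2\pi}$ is omitted). $H^s(\mathbb{R})=\{f\in\mathcal{S}'(\mathbb{R}):\|f\|_{H^s}<\infty\}$ with $\|f\|_{H^s}=\big(\int_{\mathbb{R}}(1+|\xi|^2)^s|\hat f(\xi)|^2d\xi\big)^{1/2}$, and $H^\infty(\mathbb{R})=\bigcap_{\sigma\in\mathbb{R}}H^\sigma(\mathbb{R})$. The initial value problem is understood in its equivalent integral form $u(t)=V(t)u_0-\int_0^tV(t-t')(u_x)^2(t')\,dt'$, where $\widehat{V(t)w_0}(\xi)=e^{it\xi^3+\eta t\Phi(\xi)}\widehat{w_0}(\xi)$. For $0\le T\le 1$, $Y_T^s$ is the space defined by the norm $$\|f\|_{Y_T^s}=\sup_{t\in[0,T]}\Big\{\|f(t)\|_{H^s}+t^{\frac{1+|s|}{p}}\|\partial_xf(t)\|_{L^2}\Big\}$$ (with the convention $0\cdot\infty=0$ at $t=0$). *)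

theory Defs
  imports "HOL-Analysis.Analysis"
begin

section \<open>Schwartz functions and tempered distributions on the real line\<close>

definition vderiv :: "(real \<Rightarrow> complex) \<Rightarrow> real \<Rightarrow> complex" where
  "vderiv f = (\<lambda>x. vector_derivative f (at x))"

definition schwartz :: "(real \<Rightarrow> complex) set" where
  "schwartz = {\<phi>. (\<forall>n x. (vderiv ^^ n) \<phi> differentiable (at x)) \<and>
     (\<forall>m n. \<exists>B. \<forall>x. \<bar>x\<bar> ^ m * cmod ((vderiv ^^ n) \<phi> x) \<le> B)}"

definition schwartz_norm :: "nat \<Rightarrow> (real \<Rightarrow> complex) \<Rightarrow> real" where
  "schwartz_norm N \<phi> = (\<Sum>m\<le>N. \<Sum>n\<le>N. SUP x. \<bar>x\<bar> ^ m * cmod ((vderiv ^^ n) \<phi> x))"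

lemma schwartz_seminorm_nonneg:
  assumes "\<phi> \<in> schwartz"
  shows "0 \<le> (SUP x. \<bar>x\<bar> ^ m * cmod ((vderiv ^^ n) \<phi> x))"
proof -
  obtain B where "\<forall>x. \<bar>x\<bar> ^ m * cmod ((vderiv ^^ n) \<phi> x) \<le> B"
    using assms unfolding schwartz_def by blast
  then have "bdd_above (range (\<lambda>x. \<bar>x\<bar> ^ m * cmod ((vderiv ^^ n) \<phi> x)))"
    by (auto intro!: bdd_aboveI[of _ B])
  then show ?thesis
    by (rule cSUP_upper2[where x = 0]) auto
qed

lemma schwartz_norm_nonneg: "\<phi> \<in> schwartz \<Longrightarrow> 0 \<le> schwartz_norm N \<phi>"
  unfolding schwartz_norm_def by (intro sum_nonneg schwartz_seminorm_nonneg)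

lemma schwartz_norm_mono:
  assumes "\<phi> \<in> schwartz" "N \<le> M"
  shows "schwartz_norm N \<phi> \<le> schwartz_norm M \<phi>"
proof -
  note nn = schwartz_seminorm_nonneg[OF assms(1)]
  have "schwartz_norm N \<phi> \<le> (\<Sum>m\<le>N. \<Sum>n\<le>M. SUP x. \<bar>x\<bar> ^ m * cmod ((vderiv ^^ n) \<phi> x))"
    unfolding schwartz_norm_def
    by (intro sum_mono sum_mono2) (use assms nn in auto)
  also have "\<dots> \<le> schwartz_norm M \<phi>"
    unfolding schwartz_norm_def
    by (intro sum_mono2 sum_nonneg) (use assms nn in auto)
  finally show ?thesis .
qed

definition tempered_functional :: "((real \<Rightarrow> complex) \<Rightarrow> complex) \<Rightarrow> bool" where
  "tempered_functional \<Lambda> \<longleftrightarrow>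
     (\<forall>\<phi>\<in>schwartz. \<forall>\<psi>\<in>schwartz. \<forall>a b. \<Lambda> (\<lambda>x. a * \<phi> x + b * \<psi> x) = a * \<Lambda> \<phi> + b * \<Lambda> \<psi>) \<and>
     (\<exists>B N. \<forall>\<phi>\<in>schwartz. cmod (\<Lambda> \<phi>) \<le> B * schwartz_norm N \<phi>)"

text \<open>Distributions are normalised to vanish off the Schwartz space, so that equality of
  distributions is equality on Schwartz functions.\<close>

typedef tempered = "{\<Lambda>. tempered_functional \<Lambda> \<and> (\<forall>\<phi>. \<phi> \<notin> schwartz \<longrightarrow> \<Lambda> \<phi> = 0)}"
  morphisms pair Abs_tempered
proof
  show "(\<lambda>_. 0) \<in> {\<Lambda>. tempered_functional \<Lambda> \<and> (\<forall>\<phi>. \<phi> \<notin> schwartz \<longrightarrow> \<Lambda> \<phi> = 0)}"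
    by (auto simp: tempered_functional_def intro!: exI[of _ 0])
qed

setup_lifting type_definition_tempered

lemma tempered_functional_lincomb:
  assumes "tempered_functional \<Lambda>" "tempered_functional \<Gamma>"
  shows "tempered_functional (\<lambda>\<phi>. c * \<Lambda> \<phi> + d * \<Gamma> \<phi>)"
proof -
  obtain B N where B: "\<And>\<phi>. \<phi> \<in> schwartz \<Longrightarrow> cmod (\<Lambda> \<phi>) \<le> B * schwartz_norm N \<phi>"
    using assms(1) unfolding tempered_functional_def by blast
  obtain B' N' where B': "\<And>\<phi>. \<phi> \<in> schwartz \<Longrightarrow> cmod (\<Gamma> \<phi>) \<le> B' * schwartz_norm N' \<phi>"
    using assms(2) unfolding tempered_functional_def by blast
  have "cmod (c * \<Lambda> \<phi> + d * \<Gamma> \<phi>)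
      \<le> (cmod c * \<bar>B\<bar> + cmod d * \<bar>B'\<bar>) * schwartz_norm (max N N') \<phi>"
    if \<phi>: "\<phi> \<in> schwartz" for \<phi>
  proof -
    let ?M = "schwartz_norm (max N N') \<phi>"
    have "B * schwartz_norm N \<phi> \<le> \<bar>B\<bar> * ?M"
      by (intro mult_mono schwartz_norm_mono schwartz_norm_nonneg \<phi>) auto
    then have 1: "cmod (\<Lambda> \<phi>) \<le> \<bar>B\<bar> * ?M" using B[OF \<phi>] by linarith
    have "B' * schwartz_norm N' \<phi> \<le> \<bar>B'\<bar> * ?M"
      by (intro mult_mono schwartz_norm_mono schwartz_norm_nonneg \<phi>) auto
    then have 2: "cmod (\<Gamma> \<phi>) \<le> \<bar>B'\<bar> * ?M" using B'[OF \<phi>] by linarith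
    have "cmod (c * \<Lambda> \<phi> + d * \<Gamma> \<phi>) \<le> cmod c * cmod (\<Lambda> \<phi>) + cmod d * cmod (\<Gamma> \<phi>)"
      by (metis norm_mult norm_triangle_ineq)
    also have "\<dots> \<le> cmod c * (\<bar>B\<bar> * ?M) + cmod d * (\<bar>B'\<bar> * ?M)"
      by (intro add_mono mult_left_mono 1 2) auto
    finally show ?thesis by (simp add: algebra_simps)
  qed
  moreover have "c * \<Lambda> (\<lambda>x. a * \<phi> x + b * \<psi> x) + d * \<Gamma> (\<lambda>x. a * \<phi> x + b * \<psi> x)
      = a * (c * \<Lambda> \<phi> + d * \<Gamma> \<phi>) + b * (c * \<Lambda> \<psi> + d * \<Gamma> \<psi>)"
    if "\<phi> \<in> schwartz" "\<psi> \<in> schwartz" for a b \<phi> \<psi>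
    using assms that unfolding tempered_functional_def by (simp add: algebra_simps)
  ultimately show ?thesis
    unfolding tempered_functional_def by blast
qed

instantiation tempered :: real_vector
begin

lift_definition zero_tempered :: tempered is "\<lambda>_. 0"
  by (auto simp: tempered_functional_def intro!: exI[of _ 0])

lift_definition plus_tempered :: "tempered \<Rightarrow> tempered \<Rightarrow> tempered" is "\<lambda>\<Lambda> \<Gamma> \<phi>. \<Lambda> \<phi> + \<Gamma> \<phi>"
  using tempered_functional_lincomb[where c = 1 and d = 1] by simp

lift_definition minus_tempered :: "tempered \<Rightarrow> tempered \<Rightarrow> tempered" is "\<lambda>\<Lambda> \<Gamma> \<phi>. \<Lambda> \<phi> - \<Gamma> \<phi>"
  using tempered_functional_lincomb[where c = 1 and d = "-1"] by simp

lift_definition uminus_tempered :: "tempered \<Rightarrow> tempered" is "\<lambda>\<Lambda> \<phi>. - \<Lambda> \<phi>"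
  using tempered_functional_lincomb[where c = "-1" and d = 0] by fastforce

lift_definition scaleR_tempered :: "real \<Rightarrow> tempered \<Rightarrow> tempered" is "\<lambda>r \<Lambda> \<phi>. of_real r * \<Lambda> \<phi>"
  subgoal for r \<Lambda>
    using tempered_functional_lincomb[where \<Lambda> = \<Lambda> and \<Gamma> = \<Lambda> and c = "of_real r" and d = 0] by simp
  done

instance
  by standard (transfer; simp add: algebra_simps)+

end

section \<open>Densities, Fourier transform and derivative of a distribution\<close>

text \<open>The functional \<open>\<Lambda>\<close> is integration against the (Lebesgue measurable) function \<open>g\<close>.\<close>

definition has_density :: "((real \<Rightarrow> complex) \<Rightarrow> complex) \<Rightarrow> (real \<Rightarrow> complex) \<Rightarrow> bool" where
  "has_density \<Lambda> g \<longleftrightarrow> g \<in> borel_measurable lebesgue \<and>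
     (\<forall>\<phi>\<in>schwartz. integrable lebesgue (\<lambda>x. g x * \<phi> x) \<and> \<Lambda> \<phi> = (LINT x|lebesgue. g x * \<phi> x))"

text \<open>The density is unique up to a null set, hence integrals of it do not depend on the choice.\<close>

definition density_of :: "((real \<Rightarrow> complex) \<Rightarrow> complex) \<Rightarrow> real \<Rightarrow> complex" where
  "density_of \<Lambda> = (SOME g. has_density \<Lambda> g)"

definition fourier :: "(real \<Rightarrow> complex) \<Rightarrow> real \<Rightarrow> complex" where
  "fourier \<phi> \<xi> = (LINT x|lebesgue. exp (- (\<i> * of_real (x * \<xi>))) * \<phi> x)"

definition fourier_dist :: "tempered \<Rightarrow> (real \<Rightarrow> complex) \<Rightarrow> complex" where
  "fourier_dist f = (\<lambda>\<phi>. pair f (fourier \<phi>))"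

definition deriv_dist :: "tempered \<Rightarrow> (real \<Rightarrow> complex) \<Rightarrow> complex" where
  "deriv_dist f = (\<lambda>\<phi>. - pair f (vderiv \<phi>))"

definition L2_dist :: "((real \<Rightarrow> complex) \<Rightarrow> complex) set" where
  "L2_dist = {\<Lambda>. (\<exists>g. has_density \<Lambda> g) \<and> integrable lebesgue (\<lambda>x. (cmod (density_of \<Lambda> x))\<^sup>2)}"

definition L2_dist_norm :: "((real \<Rightarrow> complex) \<Rightarrow> complex) \<Rightarrow> real" where
  "L2_dist_norm \<Lambda> = sqrt (LINT x|lebesgue. (cmod (density_of \<Lambda> x))\<^sup>2)"

section \<open>Function spaces\<close>

definition sobolev :: "real \<Rightarrow> tempered set" where
  "sobolev s = {f. (\<exists>g. has_density (fourier_dist f) g) \<and>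
     integrable lebesgue (\<lambda>\<xi>. (1 + \<xi>\<^sup>2) powr s * (cmod (density_of (fourier_dist f) \<xi>))\<^sup>2)}"

definition sobolev_norm :: "real \<Rightarrow> tempered \<Rightarrow> real" where
  "sobolev_norm s f =
     sqrt (LINT \<xi>|lebesgue. (1 + \<xi>\<^sup>2) powr s * (cmod (density_of (fourier_dist f) \<xi>))\<^sup>2)"

definition continuous_sobolev :: "real \<Rightarrow> real set \<Rightarrow> (real \<Rightarrow> tempered) \<Rightarrow> bool" where
  "continuous_sobolev s I u \<longleftrightarrow>
     (\<forall>t\<in>I. u t \<in> sobolev s \<and> ((\<lambda>r. sobolev_norm s (u r - u t)) \<longlongrightarrow> 0) (at t within I))"

text \<open>\<open>H\<^sup>\<infinity>\<close> carries the topology generated by all the Sobolev norms.\<close>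

definition continuous_sobolev_infinity :: "real set \<Rightarrow> (real \<Rightarrow> tempered) \<Rightarrow> bool" where
  "continuous_sobolev_infinity I u \<longleftrightarrow> (\<forall>\<sigma>. continuous_sobolev \<sigma> I u)"

text \<open>Since \<open>0 powr a = 0\<close>, the second summand vanishes at \<open>t = 0\<close>, as in the convention
  \<open>0 \<cdot> \<infinity> = 0\<close>.\<close>

definition Y_weight :: "real \<Rightarrow> real \<Rightarrow> (real \<Rightarrow> tempered) \<Rightarrow> real \<Rightarrow> real" where
  "Y_weight p s f t =
     sobolev_norm s (f t) + t powr ((1 + \<bar>s\<bar>) / p) * L2_dist_norm (deriv_dist (f t))"

definition Y_norm :: "real \<Rightarrow> real \<Rightarrow> real \<Rightarrow> (real \<Rightarrow> tempered) \<Rightarrow> real" where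
  "Y_norm p s T f = (SUP t\<in>{0..T}. Y_weight p s f t)"

definition Y_space :: "real \<Rightarrow> real \<Rightarrow> real \<Rightarrow> (real \<Rightarrow> tempered) set" where
  "Y_space p s T = {f. (\<forall>t\<in>{0..T}. f t \<in> sobolev s) \<and>
     (\<forall>t\<in>{0<..T}. deriv_dist (f t) \<in> L2_dist) \<and> bdd_above (Y_weight p s f ` {0..T})}"

text \<open>The intersection \<open>C([0,T]; H\<^sup>s) \<inter> Y\<close>. Its natural norm (the maximum of the two norms)
  is \<open>Y_norm\<close>, which dominates the supremum norm of \<open>C([0,T]; H\<^sup>s)\<close>.\<close>

definition CY_space :: "real \<Rightarrow> real \<Rightarrow> real \<Rightarrow> (real \<Rightarrow> tempered) set" where
  "CY_space p s T = {f \<in> Y_space p s T. continuous_sobolev s {0..T} f}"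

section \<open>The initial value problem\<close>

text \<open>On the Fourier side the linear equation \<open>w\<^sub>t + w\<^sub>x\<^sub>x\<^sub>x + \<eta> L w = 0\<close>, where \<open>L\<close> has symbol
  \<open>-\<Phi>\<close>, is \<open>\<partial>\<^sub>t \<hat>w = (i \<xi>\<^sup>3 + \<eta> \<Phi>) \<hat>w\<close>; the propagator is its solution operator.\<close>

definition propagator :: "real \<Rightarrow> (real \<Rightarrow> real) \<Rightarrow> real \<Rightarrow> tempered \<Rightarrow> tempered" where
  "propagator \<eta> \<Phi> t w = (THE v. has_density (fourier_dist v)
     (\<lambda>\<xi>. exp (\<i> * of_real (t * \<xi> ^ 3) + of_real (\<eta> * t * \<Phi> \<xi>)) * density_of (fourier_dist w) \<xi>))"

definition deriv_square :: "tempered \<Rightarrow> tempered" where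
  "deriv_square f = (THE v. has_density (pair v) (\<lambda>x. (density_of (deriv_dist f) x)\<^sup>2))"

text \<open>Solutions of the integral equation in \<open>C([0,T]; H\<^sup>s)\<close>. For \<open>s < 1\<close> membership in this
  space does not by itself give a meaning to \<open>(u\<^sub>x)\<^sup>2\<close>; the second and third conditions say
  that \<open>(u\<^sub>x)\<^sup>2\<close> is a function in \<open>L\<^sup>1([0,T] \<times> \<real>)\<close> (they are automatic for \<open>s \<ge> 1\<close>).
  The time integral is the integral of a function with values in the tempered distributions.\<close>

definition mild_solution ::
  "real \<Rightarrow> (real \<Rightarrow> real) \<Rightarrow> real \<Rightarrow> real \<Rightarrow> tempered \<Rightarrow> (real \<Rightarrow> tempered) \<Rightarrow> bool" where
  "mild_solution \<eta> \<Phi> s T u0 u \<longleftrightarrow>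
     continuous_sobolev s {0..T} u \<and>
     (AE t in lebesgue. t \<in> {0..T} \<longrightarrow> deriv_dist (u t) \<in> L2_dist) \<and>
     set_integrable lebesgue {0..T} (\<lambda>t. (L2_dist_norm (deriv_dist (u t)))\<^sup>2) \<and>
     (\<forall>t\<in>{0..T}. \<forall>\<phi>\<in>schwartz.
        set_integrable lebesgue {0..t} (\<lambda>r. pair (propagator \<eta> \<Phi> (t - r) (deriv_square (u r))) \<phi>) \<and>
        pair (u t) \<phi> = pair (propagator \<eta> \<Phi> t u0) \<phi> -
          (LINT r:{0..t}|lebesgue. pair (propagator \<eta> \<Phi> (t - r) (deriv_square (u r))) \<phi>))"

definition unique_mild_solution ::
  "real \<Rightarrow> (real \<Rightarrow> real) \<Rightarrow> real \<Rightarrow> real \<Rightarrow> tempered \<Rightarrow> (real \<Rightarrow> tempered) \<Rightarrow> bool" where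
  "unique_mild_solution \<eta> \<Phi> s T u0 u \<longleftrightarrow> mild_solution \<eta> \<Phi> s T u0 u \<and>
     (\<forall>v. mild_solution \<eta> \<Phi> s T u0 v \<longrightarrow> (\<forall>t\<in>{0..T}. v t = u t))"

section \<open>Smooth maps between normed spaces given by carriers and norms\<close>

text \<open>\<open>F\<close>, defined on an open subset \<open>U\<close> of the normed space \<open>(X, NX)\<close>, is infinitely Frechet
  differentiable into the normed space \<open>(Y, NY)\<close>, whose elements are functions with pointwise
  operations. \<open>D k u\<close> is the \<open>k\<close>-th derivative at \<open>u\<close> as a bounded \<open>k\<close>-linear map (its
  arguments form a list of length \<open>k\<close>), and \<open>D (Suc k)\<close> is the Frechet derivative of \<open>D k\<close> with
  respect to the operator norm on bounded \<open>k\<close>-linear maps.\<close>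

definition bounded_multilinear_on :: "('a::real_vector) set \<Rightarrow> ('a \<Rightarrow> real) \<Rightarrow>
    ('i \<Rightarrow> 'b::real_vector) set \<Rightarrow> (('i \<Rightarrow> 'b) \<Rightarrow> real) \<Rightarrow> nat \<Rightarrow> ('a list \<Rightarrow> 'i \<Rightarrow> 'b) \<Rightarrow> bool" where
  "bounded_multilinear_on X NX Y NY k M \<longleftrightarrow>
     (\<forall>vs\<in>lists X. length vs = k \<longrightarrow> M vs \<in> Y) \<and>
     (\<forall>vs\<in>lists X. length vs = k \<longrightarrow> (\<forall>i<k. \<forall>x\<in>X. \<forall>y\<in>X. \<forall>a b t.
        M (vs[i := a *\<^sub>R x + b *\<^sub>R y]) t = a *\<^sub>R M (vs[i := x]) t + b *\<^sub>R M (vs[i := y]) t)) \<and>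
     (\<exists>B. \<forall>vs\<in>lists X. length vs = k \<longrightarrow> NY (M vs) \<le> B * prod_list (map NX vs))"

definition frechet_smooth_on :: "('a::real_vector) set \<Rightarrow> ('a \<Rightarrow> real) \<Rightarrow>
    ('i \<Rightarrow> 'b::real_vector) set \<Rightarrow> (('i \<Rightarrow> 'b) \<Rightarrow> real) \<Rightarrow> 'a set \<Rightarrow> ('a \<Rightarrow> 'i \<Rightarrow> 'b) \<Rightarrow> bool" where
  "frechet_smooth_on X NX Y NY U F \<longleftrightarrow>
     (\<exists>D :: nat \<Rightarrow> 'a \<Rightarrow> 'a list \<Rightarrow> 'i \<Rightarrow> 'b.
        (\<forall>u\<in>U. D 0 u [] = F u) \<and>
        (\<forall>k. \<forall>u\<in>U. bounded_multilinear_on X NX Y NY k (D k u)) \<and>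
        (\<forall>k. \<forall>u\<in>U. \<forall>\<epsilon>>0. \<exists>\<delta>>0. \<forall>h\<in>X. NX h < \<delta> \<longrightarrow> u + h \<in> U \<longrightarrow>
           (\<forall>vs\<in>lists X. length vs = k \<longrightarrow>
              NY (\<lambda>t. D k (u + h) vs t - D k u vs t - D (Suc k) u (h # vs) t)
                \<le> \<epsilon> * NX h * prod_list (map NX vs))))"

definition sobolev_ball :: "real \<Rightarrow> tempered \<Rightarrow> real \<Rightarrow> tempered set" where
  "sobolev_ball s u0 \<delta> = {v \<in> sobolev s. sobolev_norm s (v - u0) < \<delta>}"

end

theory Submission
  imports Defs "HOL-Probability.Characteristic_Functions" "HOL-Probability.Sinc_Integral" "HOL-Real_Asymp.Real_Asymp"
begin

text \<open>The integral equation is solved on the Fourier side for its source rather than for \<open>u\<close>. With \<open>m\<close> the multiplier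
  of the propagator, write \<open>f\<close> for the Fourier transform of \<open>(u\<^sub>x)\<^sup>2\<close>, weighted by \<open>t powr (2 \<beta>) * bracket \<xi> powr k\<close> so
  that it is a bounded Borel function of \<open>(t, \<xi>)\<close>. Then \<open>u\<close> depends linearly on the pair \<open>(u\<^sub>0, f)\<close>, through
  \<open>profile\<close> and \<open>trajectory\<close>, and the equation becomes \<open>f = q (u\<^sub>0, f) (u\<^sub>0, f)\<close> with a bounded bilinear form \<open>q\<close>
  (\<open>source_form\<close>). The dissipation yields \<open>\<bar>m t \<xi>\<bar> \<le> C * t powr (- a / p) * bracket \<xi> powr (- a)\<close> for every \<open>a \<ge> 0\<close>
  (\<open>m_decay\<close>). The singularity \<open>t powr (- 2 \<beta>)\<close> of the source is integrable exactly because \<open>s > 1 - p / 2\<close>, and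
  \<open>q\<close> gains a positive power of the life span in \<open>f\<close> (\<open>quadratic_instance\<close>).

  Existence and smoothness are then abstract (\<open>solution_frechet_smooth\<close>). For a small life span the quadratic
  equation is a contraction; the derivatives of \<open>u\<^sub>0 \<mapsto> f\<close> solve the linear equations obtained by differentiating
  it, and the remainders of the Taylor expansions solve equations of the same kind. Since \<open>u\<close> is a bounded linear
  function of \<open>(u\<^sub>0, f)\<close> with values in \<open>C([0,T]; H\<^sup>s) \<inter> Y\<close> (\<open>trajectory_CY\<close>), the data-to-solution map is smooth, and
  \<open>fixed_point_mild\<close> shows that it yields solutions.

  Uniqueness must hold among all solutions with \<open>u\<^sub>x \<in> L\<^sup>2([0,T] \<times> \<real>)\<close>, which need not come from the fixed point. The
  difference of two of them is tested against the derivative of a Schwartz function; as \<open>p > 3\<close>, the \<open>L\<^sup>2\<close> norm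
  \<open>D t\<close> of the difference of the space derivatives is at most \<open>C \<integral>\<^sub>0\<^sup>t (t - r) powr (- \<gamma>) N r D r dr\<close> with \<open>\<gamma> < 1 / 2\<close> and
  \<open>N\<close> square integrable. This weakly singular Volterra inequality forces \<open>D = 0\<close> (\<open>volterra_zero\<close>, \<open>mild_unique\<close>).

  Values in \<open>H\<^sup>\<infinity>\<close> for positive times come from a bootstrap: the convolution square preserves decay in frequency up to
  two orders, and the propagator regains three of them at an integrable price (\<open>duhamel_gain\<close>,
  \<open>fixed_point_smooth\<close>).\<close>

section \<open>Schwartz functions\<close>

text \<open>To prove that a concrete function is Schwartz it is enough to put it into a class of rapidly
  decreasing functions that is closed under differentiation. This avoids computing the iterated
  derivatives, whose closed forms are awkward for products.\<close>

lemma schwartz_coinduct: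
  assumes f: "f \<in> S"
    and deriv: "\<And>g. g \<in> S \<Longrightarrow> \<exists>g'\<in>S. \<forall>x. (g has_vector_derivative g' x) (at x)"
    and decay: "\<And>g m. g \<in> S \<Longrightarrow> \<exists>B. \<forall>x. \<bar>x\<bar> ^ m * cmod (g x) \<le> B"
  shows "f \<in> schwartz"
proof -
  have vd: "vderiv g \<in> S \<and> (\<forall>x. g differentiable (at x))" if gS: "g \<in> S" for g
  proof -
    obtain g' where g': "g' \<in> S" "\<And>x. (g has_vector_derivative g' x) (at x)"
      using deriv[OF gS] by blast
    have "vderiv g = g'"
      unfolding vderiv_def using g'(2) by (intro ext vector_derivative_at) auto
    then show ?thesis
      using g' by (auto intro: differentiableI_vector)
  qed
  have it: "(vderiv ^^ n) f \<in> S" for n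
    by (induction n) (use f vd in auto)
  show ?thesis
    unfolding schwartz_def using it vd decay by blast
qed

lemma schwartz_has_vderiv:
  assumes "\<phi> \<in> schwartz"
  shows "(\<phi> has_vector_derivative vderiv \<phi> x) (at x)"
proof -
  have "(vderiv ^^ 0) \<phi> differentiable (at x)"
    using assms unfolding schwartz_def by blast
  then show ?thesis
    unfolding vderiv_def by (simp add: vector_derivative_works)
qed

lemma vderiv_eqI: "(\<And>x. (f has_vector_derivative g x) (at x)) \<Longrightarrow> vderiv f = g"
  unfolding vderiv_def by (intro ext vector_derivative_at) auto

lemma schwartz_vderiv:
  assumes "\<phi> \<in> schwartz"
  shows "vderiv \<phi> \<in> schwartz"
proof -
  have eq: "(vderiv ^^ n) (vderiv \<phi>) = (vderiv ^^ Suc n) \<phi>" for n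
    by (simp add: funpow_swap1)
  show ?thesis
    using assms unfolding schwartz_def mem_Collect_eq eq by blast
qed

lemma schwartz_bounded_moment:
  assumes "\<phi> \<in> schwartz"
  shows "\<exists>B. \<forall>x. \<bar>x\<bar> ^ m * cmod (\<phi> x) \<le> B"
proof -
  have "\<exists>B. \<forall>x. \<bar>x\<bar> ^ m * cmod ((vderiv ^^ 0) \<phi> x) \<le> B"
    using assms unfolding schwartz_def by blast
  then show ?thesis by simp
qed

lemma schwartz_lincomb:
  assumes "\<phi> \<in> schwartz" "\<psi> \<in> schwartz"
  shows "(\<lambda>x. a * \<phi> x + b * \<psi> x) \<in> schwartz"
proof (rule schwartz_coinduct[where S = "{\<lambda>x. a * \<phi> x + b * \<psi> x |\<phi> \<psi>. \<phi> \<in> schwartz \<and> \<psi> \<in> schwartz}"])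
  fix g assume "g \<in> {\<lambda>x. a * \<phi> x + b * \<psi> x |\<phi> \<psi>. \<phi> \<in> schwartz \<and> \<psi> \<in> schwartz}"
  then obtain \<phi> \<psi> where g: "g = (\<lambda>x. a * \<phi> x + b * \<psi> x)" and s: "\<phi> \<in> schwartz" "\<psi> \<in> schwartz"
    by blast
  show "\<exists>g'\<in>{\<lambda>x. a * \<phi> x + b * \<psi> x |\<phi> \<psi>. \<phi> \<in> schwartz \<and> \<psi> \<in> schwartz}.
          \<forall>x. (g has_vector_derivative g' x) (at x)"
  proof (rule bexI[where x = "\<lambda>x. a * vderiv \<phi> x + b * vderiv \<psi> x"], intro allI)
    fix x show "(g has_vector_derivative a * vderiv \<phi> x + b * vderiv \<psi> x) (at x)"
      unfolding g using schwartz_has_vderiv[OF s(1)] schwartz_has_vderiv[OF s(2)]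
      by (intro has_vector_derivative_add) (auto intro!: derivative_eq_intros)
  qed (use s schwartz_vderiv in blast)
  fix m
  obtain B C where "\<forall>x. \<bar>x\<bar> ^ m * cmod (\<phi> x) \<le> B" "\<forall>x. \<bar>x\<bar> ^ m * cmod (\<psi> x) \<le> C"
    using schwartz_bounded_moment s by meson
  then have "\<bar>x\<bar> ^ m * cmod (g x) \<le> cmod a * B + cmod b * C" for x
  proof -
    have "\<bar>x\<bar> ^ m * cmod (g x) \<le> \<bar>x\<bar> ^ m * (cmod a * cmod (\<phi> x) + cmod b * cmod (\<psi> x))"
      unfolding g by (intro mult_left_mono) (auto intro: norm_triangle_le simp: norm_mult)
    also have "\<dots> = cmod a * (\<bar>x\<bar> ^ m * cmod (\<phi> x)) + cmod b * (\<bar>x\<bar> ^ m * cmod (\<psi> x))"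
      by (simp add: algebra_simps)
    also have "\<dots> \<le> cmod a * B + cmod b * C"
      by (intro add_mono mult_left_mono) (use \<open>\<forall>x. _ \<le> B\<close> \<open>\<forall>x. _ \<le> C\<close> in auto)
    finally show ?thesis .
  qed
  then show "\<exists>B. \<forall>x. \<bar>x\<bar> ^ m * cmod (g x) \<le> B" by blast
qed (use assms in blast)

lemma schwartz_add: "\<phi> \<in> schwartz \<Longrightarrow> \<psi> \<in> schwartz \<Longrightarrow> (\<lambda>x. \<phi> x + \<psi> x) \<in> schwartz"
  using schwartz_lincomb[of \<phi> \<psi> 1 1] by simp

lemma schwartz_cmult: "\<phi> \<in> schwartz \<Longrightarrow> (\<lambda>x. a * \<phi> x) \<in> schwartz"
  using schwartz_lincomb[of \<phi> \<phi> a 0] by simp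

lemma schwartz_mult_x:
  assumes "\<phi> \<in> schwartz"
  shows "(\<lambda>x. complex_of_real x * \<phi> x) \<in> schwartz"
proof -
  let ?S = "{\<lambda>x. complex_of_real x * \<phi> x + \<psi> x |\<phi> \<psi>. \<phi> \<in> schwartz \<and> \<psi> \<in> schwartz}"
  have "(\<lambda>x. complex_of_real x * \<phi> x + \<psi> x) \<in> schwartz" if s: "\<phi> \<in> schwartz" "\<psi> \<in> schwartz" for \<phi> \<psi>
  proof (rule schwartz_coinduct[where S = ?S])
    fix g assume "g \<in> ?S"
    then obtain \<phi> \<psi> where g: "g = (\<lambda>x. complex_of_real x * \<phi> x + \<psi> x)" and s: "\<phi> \<in> schwartz" "\<psi> \<in> schwartz"
      by blast
    show "\<exists>g'\<in>?S. \<forall>x. (g has_vector_derivative g' x) (at x)"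
    proof (rule bexI[where x = "\<lambda>x. complex_of_real x * vderiv \<phi> x + (\<phi> x + vderiv \<psi> x)"], intro allI)
      fix x
      show "(g has_vector_derivative complex_of_real x * vderiv \<phi> x + (\<phi> x + vderiv \<psi> x)) (at x)"
        unfolding g
        by (auto intro!: derivative_eq_intros schwartz_has_vderiv s simp: algebra_simps)
    next
      show "(\<lambda>x. complex_of_real x * vderiv \<phi> x + (\<phi> x + vderiv \<psi> x)) \<in> ?S"
         using schwartz_vderiv[OF s(1)] schwartz_add[OF s(1) schwartz_vderiv[OF s(2)]]
        by (intro CollectI exI[where x = "vderiv \<phi>"] exI[where x = "\<lambda>x. \<phi> x + vderiv \<psi> x"]) simp
    qed
    fix m
    obtain B C where B: "\<forall>x. \<bar>x\<bar> ^ Suc m * cmod (\<phi> x) \<le> B" "\<forall>x. \<bar>x\<bar> ^ m * cmod (\<psi> x) \<le> C"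
      using schwartz_bounded_moment s by meson
    have "\<bar>x\<bar> ^ m * cmod (g x) \<le> B + C" for x
    proof -
      have "\<bar>x\<bar> ^ m * cmod (g x) \<le> \<bar>x\<bar> ^ m * (\<bar>x\<bar> * cmod (\<phi> x) + cmod (\<psi> x))"
        unfolding g by (intro mult_left_mono) (auto intro: norm_triangle_le simp: norm_mult)
      also have "\<dots> = \<bar>x\<bar> ^ Suc m * cmod (\<phi> x) + \<bar>x\<bar> ^ m * cmod (\<psi> x)"
        by (simp add: algebra_simps)
      also have "\<dots> \<le> B + C"
        by (intro add_mono) (use B in auto)
      finally show ?thesis .
    qed
    then show "\<exists>B. \<forall>x. \<bar>x\<bar> ^ m * cmod (g x) \<le> B" by blast
  qed (use s in blast)
  from this[OF assms schwartz_cmult[OF assms, of 0]] show ?thesis by simp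
qed

lemma schwartz_reflect:
  assumes "\<phi> \<in> schwartz"
  shows "(\<lambda>x. \<phi> (- x)) \<in> schwartz"
proof (rule schwartz_coinduct[where S = "{\<lambda>x. \<phi> (- x) |\<phi>. \<phi> \<in> schwartz}"])
  fix g assume "g \<in> {\<lambda>x. \<phi> (- x) |\<phi>. \<phi> \<in> schwartz}"
  then obtain \<phi> where g: "g = (\<lambda>x. \<phi> (- x))" and s: "\<phi> \<in> schwartz"
    by blast
  show "\<exists>g'\<in>{\<lambda>x. \<phi> (- x) |\<phi>. \<phi> \<in> schwartz}. \<forall>x. (g has_vector_derivative g' x) (at x)"
  proof (rule bexI[where x = "\<lambda>x. (\<lambda>y. (-1) * vderiv \<phi> y) (- x)"], intro allI)
    fix x
    have "(uminus has_vector_derivative (-1)) (at x)"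
      by (auto intro!: derivative_eq_intros)
    from vector_diff_chain_at[OF this schwartz_has_vderiv[OF s, of "-x"]]
    show "(g has_vector_derivative (\<lambda>y. (-1) * vderiv \<phi> y) (- x)) (at x)"
      unfolding g by (simp add: o_def)
  next
    have "(\<lambda>y. (-1) * vderiv \<phi> y) \<in> schwartz"
      by (intro schwartz_cmult schwartz_vderiv s)
    then show "(\<lambda>x. (\<lambda>y. (-1) * vderiv \<phi> y) (- x)) \<in> {\<lambda>x. \<phi> (- x) |\<phi>. \<phi> \<in> schwartz}"
      by (intro CollectI exI[where x = "\<lambda>y. (-1) * vderiv \<phi> y"]) simp
  qed
  fix m
  obtain B where "\<forall>x. \<bar>x\<bar> ^ m * cmod (\<phi> x) \<le> B"
    using schwartz_bounded_moment s by meson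
  then have "\<bar>x\<bar> ^ m * cmod (g x) \<le> B" for x
    unfolding g by (metis abs_minus_cancel)
  then show "\<exists>B. \<forall>x. \<bar>x\<bar> ^ m * cmod (g x) \<le> B" by blast
qed (use assms in blast)

lemma schwartz_cnj:
  assumes "\<phi> \<in> schwartz"
  shows "(\<lambda>x. cnj (\<phi> x)) \<in> schwartz"
proof (rule schwartz_coinduct[where S = "{\<lambda>x. cnj (\<phi> x) |\<phi>. \<phi> \<in> schwartz}"])
  fix g assume "g \<in> {\<lambda>x. cnj (\<phi> x) |\<phi>. \<phi> \<in> schwartz}"
  then obtain \<phi> where g: "g = (\<lambda>x. cnj (\<phi> x))" and s: "\<phi> \<in> schwartz"
    by blast
  show "\<exists>g'\<in>{\<lambda>x. cnj (\<phi> x) |\<phi>. \<phi> \<in> schwartz}. \<forall>x. (g has_vector_derivative g' x) (at x)"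
  proof (rule bexI[where x = "\<lambda>x. cnj (vderiv \<phi> x)"], intro allI)
    fix x
    show "(g has_vector_derivative cnj (vderiv \<phi> x)) (at x)"
      unfolding g by (rule has_vector_derivative_cnj[OF schwartz_has_vderiv[OF s]])
  qed (use s schwartz_vderiv in blast)
  fix m show "\<exists>B. \<forall>x. \<bar>x\<bar> ^ m * cmod (g x) \<le> B"
    unfolding g using schwartz_bounded_moment[OF s] by simp
qed (use assms in blast)

lemma schwartz_continuous: "\<phi> \<in> schwartz \<Longrightarrow> continuous_on A \<phi>"
  by (meson continuous_at_imp_continuous_on has_vector_derivative_continuous schwartz_has_vderiv)

lemma schwartz_borel: "\<phi> \<in> schwartz \<Longrightarrow> \<phi> \<in> borel_measurable borel"
  by (intro borel_measurable_continuous_onI schwartz_continuous)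

lemma schwartz_borel_lebesgue: "\<phi> \<in> schwartz \<Longrightarrow> \<phi> \<in> borel_measurable lebesgue"
  using schwartz_borel by (simp add: measurable_completion)

lemma schwartz_decay:
  assumes "\<phi> \<in> schwartz"
  obtains B where "0 \<le> B" "\<And>x. cmod (\<phi> x) * (1 + x\<^sup>2) ^ N \<le> B"
proof -
  obtain B where B: "\<And>m x. \<bar>x\<bar> ^ m * cmod (\<phi> x) \<le> B m"
    using schwartz_bounded_moment[OF assms] by metis
  have "cmod (\<phi> x) * (1 + x\<^sup>2) ^ N \<le> (\<Sum>k\<le>N. real (N choose k) * B (2 * k))" for x
  proof -
    have "(1 + x\<^sup>2) ^ N = (\<Sum>k\<le>N. real (N choose k) * \<bar>x\<bar> ^ (2 * k))"
      using binomial_ring[of "x\<^sup>2" 1 N] by (simp add: add.commute power_mult)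
    then have "cmod (\<phi> x) * (1 + x\<^sup>2) ^ N = (\<Sum>k\<le>N. real (N choose k) * (\<bar>x\<bar> ^ (2 * k) * cmod (\<phi> x)))"
      by (simp add: sum_distrib_left algebra_simps)
    also have "\<dots> \<le> (\<Sum>k\<le>N. real (N choose k) * B (2 * k))"
      by (intro sum_mono mult_left_mono B) auto
    finally show ?thesis .
  qed
  then show ?thesis
    by (intro that[of "max 0 (\<Sum>k\<le>N. real (N choose k) * B (2 * k))"]) (auto simp: le_max_iff_disj)
qed

lemma integrable_inverse_one_plus_square: "integrable lborel (\<lambda>x::real. 1 / (1 + x\<^sup>2))"
  using integrable_inverse_1_plus_square
  by (simp add: set_integrable_def einterval_def inverse_eq_divide)

lemma schwartz_integrable:
  assumes "\<phi> \<in> schwartz"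
  shows "integrable lborel \<phi>"
proof -
  obtain B where B: "0 \<le> B" "\<And>x. cmod (\<phi> x) * (1 + x\<^sup>2) ^ 1 \<le> B"
    using schwartz_decay[OF assms] by metis
  show ?thesis
  proof (rule Bochner_Integration.integrable_bound)
    show "integrable lborel (\<lambda>x. B * (1 / (1 + x\<^sup>2)))"
      by (intro integrable_mult_right integrable_inverse_one_plus_square)
    show "\<phi> \<in> borel_measurable lborel" using schwartz_borel[OF assms] by simp
    have "cmod (\<phi> x) \<le> norm (B * (1 / (1 + x\<^sup>2)))" for x
    proof -
      have "0 < 1 + x\<^sup>2" by (simp add: add_pos_nonneg)
      then show ?thesis using B(1) B(2)[of x] by (simp add: field_simps abs_mult)
    qed
    then show "AE x in lborel. norm (\<phi> x) \<le> norm (B * (1 / (1 + x\<^sup>2)))" by simp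
  qed
qed

lemma schwartz_bounded:
  assumes "\<phi> \<in> schwartz" obtains B where "0 \<le> B" "\<And>x. cmod (\<phi> x) \<le> B"
proof -
  obtain B where B: "0 \<le> B" "\<And>x. cmod (\<phi> x) * (1 + x\<^sup>2) ^ 0 \<le> B"
    using schwartz_decay[OF assms, of 0] by blast
  from B(2) have "\<And>x. cmod (\<phi> x) \<le> B" by simp
  with B(1) show ?thesis by (rule that)
qed

lemma schwartz_square_integrable:
  assumes "\<phi> \<in> schwartz"
  shows "integrable lborel (\<lambda>x. (cmod (\<phi> x))\<^sup>2)"
proof -
  obtain B where B: "0 \<le> B" "\<And>x. cmod (\<phi> x) \<le> B" using schwartz_bounded[OF assms] by blast
  have m: "\<phi> \<in> borel_measurable lborel" using schwartz_borel[OF assms] by simp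
  show ?thesis
  proof (rule Bochner_Integration.integrable_bound)
    show "integrable lborel (\<lambda>x. B * cmod (\<phi> x))"
      by (intro integrable_mult_right integrable_norm schwartz_integrable assms)
    show "(\<lambda>x. (cmod (\<phi> x))\<^sup>2) \<in> borel_measurable lborel" using m by measurable
    show "AE x in lborel. norm ((cmod (\<phi> x))\<^sup>2) \<le> norm (B * cmod (\<phi> x))"
      using B by (auto simp: power2_eq_square abs_mult intro!: mult_right_mono)
  qed
qed

section \<open>Fourier transform of Schwartz functions\<close>

abbreviation wave :: "real \<Rightarrow> real \<Rightarrow> complex" where
  "wave x \<xi> \<equiv> exp (- (\<i> * of_real (x * \<xi>)))"

lemma fourier_lborel:
  assumes "\<phi> \<in> schwartz"
  shows "fourier \<phi> \<xi> = (LINT x|lborel. wave x \<xi> * \<phi> x)"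
  unfolding fourier_def
proof (rule integral_completion)
  have [measurable]: "\<phi> \<in> borel_measurable borel" by (rule schwartz_borel[OF assms])
  show "(\<lambda>x. wave x \<xi> * \<phi> x) \<in> borel_measurable lborel"
    by measurable
qed

lemma integrable_unimodular:
  fixes f g :: "real \<Rightarrow> complex"
  assumes "integrable M f" "g \<in> borel_measurable M" "\<And>x. cmod (g x) \<le> 1"
  shows "integrable M (\<lambda>x. g x * f x)"
  by (rule Bochner_Integration.integrable_bound[OF assms(1)])
     (use assms(2,3) borel_measurable_integrable[OF assms(1)] in \<open>auto simp: norm_mult intro!: mult_left_le_one_le\<close>)

lemma fourier_integrable:
  assumes "integrable lborel \<phi>"
  shows "integrable lborel (\<lambda>x. wave x \<xi> * \<phi> x)"
  by (rule integrable_unimodular[OF assms]) auto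

text \<open>The fundamental theorem of calculus on \<open>[-n, n]\<close>; the boundary terms vanish as \<open>n\<close> grows.\<close>

lemma integral_vderiv_zero:
  assumes "\<phi> \<in> schwartz"
  shows "(LINT x|lborel. vderiv \<phi> x) = 0"
proof -
  obtain B where B: "0 \<le> B" "\<And>x. cmod (\<phi> x) * (1 + x\<^sup>2) ^ 1 \<le> B"
    using schwartz_decay[OF assms] by metis
  have lim: "(\<phi> \<longlongrightarrow> 0) F" if "filterlim (\<lambda>x::real. 1 + x\<^sup>2) at_top F" for F
  proof (rule Lim_null_comparison)
    show "\<forall>\<^sub>F x in F. norm (\<phi> x) \<le> B / (1 + x\<^sup>2)"
    proof (rule always_eventually, rule allI)
      fix x :: real
      have "0 < 1 + x\<^sup>2" by (simp add: add_pos_nonneg)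
      then show "norm (\<phi> x) \<le> B / (1 + x\<^sup>2)" using B(2)[of x] by (simp add: field_simps)
    qed
    show "((\<lambda>x. B / (1 + x\<^sup>2)) \<longlongrightarrow> 0) F"
      using that by (intro tendsto_divide_0[OF tendsto_const] filterlim_at_top_imp_at_infinity)
  qed
  have "(LBINT x=-\<infinity>..\<infinity>. vderiv \<phi> x) = 0 - 0"
  proof (rule interval_integral_FTC_integrable)
    show "(\<phi> has_vector_derivative vderiv \<phi> x) (at x)" for x
      by (rule schwartz_has_vderiv[OF assms])
    show "isCont (vderiv \<phi>) x" for x
      using schwartz_continuous[OF schwartz_vderiv[OF assms], of UNIV]
      by (simp add: continuous_on_eq_continuous_at)
    show "set_integrable lborel (einterval (- \<infinity>) \<infinity>) (vderiv \<phi>)"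
      using schwartz_integrable[OF schwartz_vderiv[OF assms]]
      by (simp add: set_integrable_def einterval_def)
    have a: "filterlim (\<lambda>x::real. 1 + x\<^sup>2) at_top at_bot" "filterlim (\<lambda>x::real. 1 + x\<^sup>2) at_top at_top"
      by real_asymp+
    show "((\<phi> \<circ> real_of_ereal) \<longlongrightarrow> 0) (at_right (- \<infinity>))"
      using lim[OF a(1)] by (simp only: ereal_tendsto_simps)
    show "((\<phi> \<circ> real_of_ereal) \<longlongrightarrow> 0) (at_left \<infinity>)"
      using lim[OF a(2)] by (simp only: ereal_tendsto_simps)
  qed simp
  then show ?thesis
    by (simp add: interval_lebesgue_integral_def einterval_def set_lebesgue_integral_def)
qed

lemma exp_i_has_vector_derivative:
  "((\<lambda>x. (wave x \<xi>)) has_vector_derivative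
     (- \<i> * \<xi>) * (wave x \<xi>)) (at x)"
  using exp_scaleR_has_vector_derivative_right[of "- \<i> * \<xi>" x UNIV]
  by (simp add: scaleR_conv_of_real mult_ac)

lemma schwartz_mult_cis:
  assumes "\<phi> \<in> schwartz"
  shows "(\<lambda>x. wave x \<xi> * \<phi> x) \<in> schwartz"
proof (rule schwartz_coinduct[where S = "{\<lambda>x. wave x \<xi> * \<phi> x |\<phi>. \<phi> \<in> schwartz}"])
  fix g assume "g \<in> {\<lambda>x. wave x \<xi> * \<phi> x |\<phi>. \<phi> \<in> schwartz}"
  then obtain \<phi> where g: "g = (\<lambda>x. wave x \<xi> * \<phi> x)" and s: "\<phi> \<in> schwartz"
    by blast
  show "\<exists>g'\<in>{\<lambda>x. wave x \<xi> * \<phi> x |\<phi>. \<phi> \<in> schwartz}.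
      \<forall>x. (g has_vector_derivative g' x) (at x)"
  proof (rule bexI[where x = "\<lambda>x. wave x \<xi> * (- \<i> * \<xi> * \<phi> x + 1 * vderiv \<phi> x)"], intro allI)
    fix x
    have e: "((\<lambda>x. (wave x \<xi>)) has_vector_derivative
        (- \<i> * \<xi>) * (wave x \<xi>)) (at x)"
      by (rule exp_i_has_vector_derivative)
    show "(g has_vector_derivative wave x \<xi> * (- \<i> * \<xi> * \<phi> x + 1 * vderiv \<phi> x)) (at x)"
      unfolding g using has_vector_derivative_mult[OF e schwartz_has_vderiv[OF s, of x]]
      by (simp add: algebra_simps)
  next
    show "(\<lambda>x. wave x \<xi> * (- \<i> * \<xi> * \<phi> x + 1 * vderiv \<phi> x))
       \<in> {\<lambda>x. wave x \<xi> * \<phi> x |\<phi>. \<phi> \<in> schwartz}"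
      using schwartz_lincomb[OF s schwartz_vderiv[OF s], of "- \<i> * \<xi>" 1]
      by (intro CollectI exI[where x = "\<lambda>x. - \<i> * \<xi> * \<phi> x + 1 * vderiv \<phi> x"]) simp
  qed
  fix m
  show "\<exists>B. \<forall>x. \<bar>x\<bar> ^ m * cmod (g x) \<le> B"
    unfolding g using schwartz_bounded_moment[OF s] by (simp add: norm_mult)
qed (use assms in blast)

lemma fourier_vderiv:
  assumes "\<phi> \<in> schwartz"
  shows "fourier (vderiv \<phi>) \<xi> = \<i> * of_real \<xi> * fourier \<phi> \<xi>"
proof -
  let ?e = "\<lambda>x. (wave x \<xi>)"
  have e: "(?e has_vector_derivative (- \<i> * \<xi>) * ?e x) (at x)" for x
    by (rule exp_i_has_vector_derivative)
  have "vderiv (\<lambda>x. ?e x * \<phi> x) = (\<lambda>x. ?e x * vderiv \<phi> x - (\<i> * \<xi>) * (?e x * \<phi> x))"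
    using has_vector_derivative_mult[OF e schwartz_has_vderiv[OF assms]]
    by (intro vderiv_eqI) (simp add: algebra_simps)
  then have "0 = (LINT x|lborel. ?e x * vderiv \<phi> x - (\<i> * \<xi>) * (?e x * \<phi> x))"
    using integral_vderiv_zero[OF schwartz_mult_cis[OF assms, of \<xi>]] by simp
  also have "\<dots> = (LINT x|lborel. ?e x * vderiv \<phi> x) - (\<i> * \<xi>) * (LINT x|lborel. ?e x * \<phi> x)"
    using fourier_integrable[OF schwartz_integrable[OF assms]]
      fourier_integrable[OF schwartz_integrable[OF schwartz_vderiv[OF assms]]]
    by (subst Bochner_Integration.integral_diff) auto
  finally show ?thesis
    by (simp add: fourier_lborel[OF assms] fourier_lborel[OF schwartz_vderiv[OF assms]])
qed

text \<open>Differentiation under the integral sign, by dominated convergence with \<open>\<bar>x\<bar> \<bar>\<phi> x\<bar>\<close> as majorant.\<close>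

lemma fourier_has_vderiv:
  assumes "\<phi> \<in> schwartz"
  shows "(fourier \<phi> has_vector_derivative fourier (\<lambda>x. - \<i> * (complex_of_real x * \<phi> x)) \<xi>) (at \<xi>)"
proof -
  have s: "(\<lambda>x. - \<i> * (complex_of_real x * \<phi> x)) \<in> schwartz"
    by (intro schwartz_cmult schwartz_mult_x assms)
  let ?f = "\<lambda>\<xi> x. wave x \<xi> * \<phi> x"
  let ?f' = "\<lambda>\<xi> x. wave x \<xi> * (- \<i> * (complex_of_real x * \<phi> x))"
  have [measurable]: "\<phi> \<in> borel_measurable borel" by (rule schwartz_borel[OF assms])
  have der: "((\<lambda>\<xi>. ?f \<xi> x) has_vector_derivative ?f' \<xi> x) (at \<xi>)" for x \<xi>
  proof -
    have "((\<lambda>\<xi>. (wave x \<xi>)) has_vector_derivative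
        (- \<i> * x) * (wave x \<xi>)) (at \<xi>)"
      using exp_i_has_vector_derivative[of x \<xi>] by (simp only: mult.commute[of x])
    from has_vector_derivative_mult[OF this has_vector_derivative_const[of "\<phi> x"]]
    show ?thesis by (simp add: mult_ac)
  qed
  have lip: "cmod (?f a x - ?f b x) \<le> \<bar>x\<bar> * cmod (\<phi> x) * \<bar>a - b\<bar>" for a b x
  proof -
    have "norm (?f a x - ?f b x) \<le> (\<bar>x\<bar> * cmod (\<phi> x)) * norm (a - b)"
    proof (rule differentiable_bound[where S = UNIV])
      show "((\<lambda>\<xi>. ?f \<xi> x) has_derivative (\<lambda>h. h *\<^sub>R ?f' \<xi> x)) (at \<xi> within UNIV)" for \<xi>
        using der unfolding has_vector_derivative_def by simp
      show "onorm (\<lambda>h. h *\<^sub>R ?f' \<xi> x) \<le> \<bar>x\<bar> * cmod (\<phi> x)" for \<xi>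
        by (rule onorm_le) (simp add: norm_mult)
    qed auto
    then show ?thesis by simp
  qed
  have xs: "integrable lborel (\<lambda>x. \<bar>x\<bar> * cmod (\<phi> x))"
    using integrable_norm[OF schwartz_integrable[OF schwartz_mult_x[OF assms]]] by (simp add: norm_mult)
  show ?thesis
    unfolding has_vector_derivative_def has_derivative_iff_norm
  proof (intro conjI bounded_linear_scaleR_left)
    have "((\<lambda>y. norm (fourier \<phi> y - fourier \<phi> \<xi> - (y - \<xi>) *\<^sub>R fourier (\<lambda>x. - \<i> * (complex_of_real x * \<phi> x)) \<xi>) / norm (y - \<xi>)) \<longlongrightarrow> 0) (at \<xi>)"
      unfolding tendsto_at_iff_sequentially o_def
    proof (intro allI impI)
      fix Y :: "nat \<Rightarrow> real" assume Y: "\<forall>i. Y i \<in> UNIV - {\<xi>}" "Y \<longlonglongrightarrow> \<xi>"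
      let ?q = "\<lambda>i x. (?f (Y i) x - ?f \<xi> x - (Y i - \<xi>) *\<^sub>R ?f' \<xi> x) / of_real (Y i - \<xi>)"
      have "(\<lambda>i. LINT x|lborel. ?q i x) \<longlonglongrightarrow> (LINT (x::real)|lborel. 0)"
      proof (rule integral_dominated_convergence[where w = "\<lambda>x. 2 * (\<bar>x\<bar> * cmod (\<phi> x))"])
        show "integrable lborel (\<lambda>x. 2 * (\<bar>x\<bar> * cmod (\<phi> x)))"
          by (intro integrable_mult_right xs)
        show "AE x in lborel. (\<lambda>i. ?q i x) \<longlonglongrightarrow> 0"
        proof (rule AE_I2)
          fix x
          have "((\<lambda>y. norm (?f y x - ?f \<xi> x - (y - \<xi>) *\<^sub>R ?f' \<xi> x) / norm (y - \<xi>)) \<longlongrightarrow> 0) (at \<xi>)"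
            using der[of x \<xi>] unfolding has_vector_derivative_def has_derivative_iff_norm by simp
          then have "(\<lambda>i. norm (?q i x)) \<longlonglongrightarrow> 0"
            using Y unfolding tendsto_at_iff_sequentially o_def by (simp add: norm_divide del: of_real_diff)
          then show "(\<lambda>i. ?q i x) \<longlonglongrightarrow> 0"
            by (rule tendsto_norm_zero_cancel)
        qed
        fix i
        have ne: "\<bar>Y i - \<xi>\<bar> > 0" using Y(1) by auto
        have "norm (?q i x) \<le> 2 * (\<bar>x\<bar> * cmod (\<phi> x))" for x
        proof -
          have "norm (?f (Y i) x - ?f \<xi> x - (Y i - \<xi>) *\<^sub>R ?f' \<xi> x)
              \<le> cmod (?f (Y i) x - ?f \<xi> x) + \<bar>Y i - \<xi>\<bar> * cmod (?f' \<xi> x)"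
            by (metis norm_triangle_ineq4 norm_scaleR real_norm_def)
          also have "\<dots> \<le> \<bar>x\<bar> * cmod (\<phi> x) * \<bar>Y i - \<xi>\<bar> + \<bar>Y i - \<xi>\<bar> * (\<bar>x\<bar> * cmod (\<phi> x))"
            by (intro add_mono lip) (simp add: norm_mult)
          also have "\<dots> = (2 * (\<bar>x\<bar> * cmod (\<phi> x))) * \<bar>Y i - \<xi>\<bar>" by simp
          finally show ?thesis
            using ne by (simp only: norm_divide norm_of_real pos_divide_le_eq)
        qed
        then show "AE x in lborel. norm (?q i x) \<le> 2 * (\<bar>x\<bar> * cmod (\<phi> x))" by simp
      qed measurable
      moreover have "norm (LINT x|lborel. ?q i x) = norm (fourier \<phi> (Y i) - fourier \<phi> \<xi> - (Y i - \<xi>) *\<^sub>R fourier (\<lambda>x. - \<i> * (complex_of_real x * \<phi> x)) \<xi>) / norm (Y i - \<xi>)" for i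
      proof -
        have i1: "integrable lborel (?f y)" for y
          by (rule fourier_integrable[OF schwartz_integrable[OF assms]])
        have i2: "integrable lborel (?f' \<xi>)"
          by (rule fourier_integrable[OF schwartz_integrable[OF s]])
        have "(LINT x|lborel. ?q i x) = ((LINT x|lborel. ?f (Y i) x) - (LINT x|lborel. ?f \<xi> x) - (Y i - \<xi>) *\<^sub>R (LINT x|lborel. ?f' \<xi> x)) / of_real (Y i - \<xi>)"
          using i1[of "Y i"] i1[of \<xi>] i2 by simp
        then show ?thesis
          unfolding fourier_lborel[OF assms] fourier_lborel[OF s] by (simp only: norm_divide norm_of_real real_norm_def)
      qed
      ultimately show "(\<lambda>i. norm (fourier \<phi> (Y i) - fourier \<phi> \<xi> - (Y i - \<xi>) *\<^sub>R fourier (\<lambda>x. - \<i> * (complex_of_real x * \<phi> x)) \<xi>) / norm (Y i - \<xi>)) \<longlonglongrightarrow> 0"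
        using tendsto_norm by fastforce
    qed
    then show "((\<lambda>y. norm (fourier \<phi> y - fourier \<phi> \<xi> - (y - \<xi>) *\<^sub>R fourier (\<lambda>x. - \<i> * (complex_of_real x * \<phi> x)) \<xi>) / norm (y - \<xi>)) \<longlongrightarrow> 0) (at \<xi> within UNIV)" by simp
  qed
qed

lemma fourier_le_L1:
  assumes "\<phi> \<in> schwartz"
  shows "cmod (fourier \<phi> \<xi>) \<le> (LINT x|lborel. cmod (\<phi> x))"
proof -
  have "cmod (fourier \<phi> \<xi>) \<le> (LINT x|lborel. cmod (wave x \<xi> * \<phi> x))"
    unfolding fourier_lborel[OF assms] by (rule integral_norm_bound)
  then show ?thesis by (simp add: norm_mult)
qed

lemma fourier_vderiv_iterate:
  assumes "\<phi> \<in> schwartz"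
  shows "(vderiv ^^ m) \<phi> \<in> schwartz \<and> fourier ((vderiv ^^ m) \<phi>) \<xi> = (\<i> * of_real \<xi>) ^ m * fourier \<phi> \<xi>"
  by (induction m) (use assms in \<open>auto simp: schwartz_vderiv fourier_vderiv\<close>)

lemma schwartz_fourier:
  assumes "\<phi> \<in> schwartz"
  shows "fourier \<phi> \<in> schwartz"
proof (rule schwartz_coinduct[where S = "fourier ` schwartz"])
  fix g assume "g \<in> fourier ` schwartz"
  then obtain \<phi> where g: "g = fourier \<phi>" and s: "\<phi> \<in> schwartz" by blast
  show "\<exists>g'\<in>fourier ` schwartz. \<forall>x. (g has_vector_derivative g' x) (at x)"
    unfolding g using fourier_has_vderiv[OF s] schwartz_cmult[OF schwartz_mult_x[OF s], of "- \<i>"] by blast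
  fix m
  have "\<bar>\<xi>\<bar> ^ m * cmod (g \<xi>) \<le> (LINT x|lborel. cmod ((vderiv ^^ m) \<phi> x))" for \<xi>
    using fourier_le_L1[of "(vderiv ^^ m) \<phi>" \<xi>] fourier_vderiv_iterate[OF s, of m \<xi>]
    by (simp add: g norm_mult norm_power)
  then show "\<exists>B. \<forall>x. \<bar>x\<bar> ^ m * cmod (g x) \<le> B" by blast
qed (use assms in blast)


text \<open>The Fourier integral again, now against Borel measure: the product theorems of measure theory
  then apply directly, and it is used for arbitrary integrable functions.\<close>

definition ft :: "(real \<Rightarrow> complex) \<Rightarrow> real \<Rightarrow> complex" where
  "ft f \<xi> = (LINT x|lborel. wave x \<xi> * f x)"

definition ift :: "(real \<Rightarrow> complex) \<Rightarrow> real \<Rightarrow> complex" where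
  "ift f x = ft f (- x) / (2 * pi)"

lemma fourier_eq_ft: "\<phi> \<in> schwartz \<Longrightarrow> fourier \<phi> = ft \<phi>"
  by (intro ext) (simp add: fourier_lborel ft_def)

lemma ft_le_L1: "cmod (ft f \<xi>) \<le> (LINT x|lborel. cmod (f x))"
proof -
  have "cmod (ft f \<xi>) \<le> (LINT x|lborel. cmod (wave x \<xi> * f x))"
    unfolding ft_def by (rule integral_norm_bound)
  then show ?thesis by (simp add: norm_mult)
qed

lemma borel_measurable_ft [measurable]:
  assumes [measurable]: "f \<in> borel_measurable borel"
  shows "ft f \<in> borel_measurable borel"
  unfolding ft_def by measurable

lemma integrable_ft_kernel:
  assumes f: "integrable lborel f" and g: "integrable lborel g"
  shows "integrable (lborel \<Otimes>\<^sub>M lborel)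
    (\<lambda>(x, \<xi>). wave x \<xi> * f x * g \<xi>)"
proof -
  have [measurable]: "f \<in> borel_measurable borel" "g \<in> borel_measurable borel"
    using f g by auto
  show ?thesis
  proof (rule lborel_pair.Fubini_integrable)
    have "(LINT \<xi>|lborel. norm (wave x \<xi> * f x * g \<xi>))
        = cmod (f x) * (LINT \<xi>|lborel. cmod (g \<xi>))" for x
      by (simp add: norm_mult)
    then show "integrable lborel (\<lambda>x. LINT \<xi>|lborel. norm (case (x, \<xi>) of (x, \<xi>) \<Rightarrow>
        wave x \<xi> * f x * g \<xi>))"
      using f by simp
    have "integrable lborel (\<lambda>\<xi>. wave x \<xi> * f x * g \<xi>)" for x
      using integrable_mult_right[OF fourier_integrable[OF g, of x], of "f x"]
      by (simp add: mult_ac)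
    then show "AE x in lborel. integrable lborel (\<lambda>\<xi>. case (x, \<xi>) of (x, \<xi>) \<Rightarrow>
        wave x \<xi> * f x * g \<xi>)" by simp
  qed measurable
qed

text \<open>Both sides are the double integral of \<open>f x g \<xi> e\<^sup>-\<^sup>i\<^sup>x\<^sup>\<xi>\<close>.\<close>

lemma ft_multiplication:
  assumes f: "integrable lborel f" and g: "integrable lborel g"
  shows "(LINT \<xi>|lborel. ft f \<xi> * g \<xi>) = (LINT x|lborel. f x * ft g x)"
proof -
  let ?K = "\<lambda>x \<xi>. wave x \<xi> * f x * g \<xi>"
  have "(LINT \<xi>|lborel. LINT x|lborel. ?K x \<xi>) = (LINT x|lborel. LINT \<xi>|lborel. ?K x \<xi>)"
    by (rule lborel_pair.Fubini_integral[OF integrable_ft_kernel[OF f g]])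
  moreover have "(LINT x|lborel. ?K x \<xi>) = ft f \<xi> * g \<xi>" for \<xi>
    unfolding ft_def by simp
  moreover have "(LINT \<xi>|lborel. ?K x \<xi>) = f x * ft g x" for x
  proof -
    have "(LINT \<xi>|lborel. ?K x \<xi>) = (LINT \<xi>|lborel. f x * (wave \<xi> x * g \<xi>))"
      by (intro Bochner_Integration.integral_cong) (auto simp: mult_ac)
    then show ?thesis
      unfolding ft_def by simp
  qed
  ultimately show ?thesis by (simp only:)
qed

lemma ft_scaled_normal:
  assumes "\<epsilon> > 0"
  shows "(LINT \<xi>|lborel. wave a \<xi> * complex_of_real (std_normal_density (\<epsilon> * \<xi>)))
    = complex_of_real (exp (- (a / \<epsilon>)\<^sup>2 / 2) / \<epsilon>)"
proof -
  have "(LINT z|lborel. (wave (a / \<epsilon>) z) * complex_of_real (std_normal_density z))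
      = char std_normal_distribution (- a / \<epsilon>)"
    unfolding char_def
    by (subst integral_density) (auto simp: scaleR_conv_of_real mult_ac)
  also have "\<dots> = complex_of_real (exp (- (a / \<epsilon>)\<^sup>2 / 2))"
    by (simp add: char_std_normal_distribution)
  finally have *: "(LINT z|lborel. (wave (a / \<epsilon>) z) * complex_of_real (std_normal_density z))
      = complex_of_real (exp (- (a / \<epsilon>)\<^sup>2 / 2))" .
  show ?thesis
    using lborel_integral_real_affine[of \<epsilon> "\<lambda>z. (wave (a / \<epsilon>) z) * complex_of_real (std_normal_density z)" 0] assms *
    by (simp add: scaleR_conv_of_real field_simps)
qed

text \<open>Fourier inversion. A Gaussian factor of width \<open>1 / \<epsilon>\<close> is inserted in the outer integral and moved
  onto \<open>\<phi>\<close> by the multiplication formula, where it becomes an approximate identity.\<close>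

lemma fourier_fourier:
  assumes s: "\<phi> \<in> schwartz"
  shows "fourier (fourier \<phi>) x = complex_of_real (2 * pi) * \<phi> (- x)"
proof -
  note sf = schwartz_fourier[OF s]
  have [measurable]: "\<phi> \<in> borel_measurable borel" "fourier \<phi> \<in> borel_measurable borel"
    using s sf schwartz_borel by auto
  obtain B where B: "0 \<le> B" "\<And>x. cmod (\<phi> x) \<le> B" using schwartz_bounded[OF s] by blast
  define e where "e n = inverse (real (Suc n))" for n
  have e: "e n > 0" "e \<longlonglongrightarrow> 0" for n
    unfolding e_def using LIMSEQ_inverse_real_of_nat by auto
  define I where "I n = (LINT \<xi>|lborel. ft \<phi> \<xi> * (wave x \<xi> * std_normal_density (e n * \<xi>)))" for n
  have nd0: "std_normal_density z \<le> std_normal_density 0" for z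
    unfolding normal_density_def by (simp add: field_simps)
  have "I \<longlonglongrightarrow> (LINT \<xi>|lborel. ft \<phi> \<xi> * (wave x \<xi> * std_normal_density 0))"
    unfolding I_def
  proof (rule integral_dominated_convergence[where w = "\<lambda>\<xi>. std_normal_density 0 * cmod (ft \<phi> \<xi>)"])
    show "integrable lborel (\<lambda>\<xi>. std_normal_density 0 * cmod (ft \<phi> \<xi>))"
      using schwartz_integrable[OF sf] by (simp add: fourier_eq_ft[OF s])
    have "(\<lambda>n. std_normal_density (e n * \<xi>)) \<longlonglongrightarrow> std_normal_density (0 * \<xi>)" for \<xi>
      unfolding normal_density_def by (intro tendsto_intros e) auto
    then show "AE \<xi> in lborel. (\<lambda>n. ft \<phi> \<xi> * (wave x \<xi> * std_normal_density (e n * \<xi>)))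
      \<longlonglongrightarrow> ft \<phi> \<xi> * (wave x \<xi> * std_normal_density 0)"
      by (intro AE_I2 tendsto_mult tendsto_const tendsto_of_real) simp
    show "AE \<xi> in lborel. norm (ft \<phi> \<xi> * (wave x \<xi> * std_normal_density (e n * \<xi>)))
       \<le> std_normal_density 0 * cmod (ft \<phi> \<xi>)" for n
    proof (rule AE_I2)
      fix \<xi>
      have "cmod (ft \<phi> \<xi>) * std_normal_density (e n * \<xi>) \<le> cmod (ft \<phi> \<xi>) * std_normal_density 0"
        by (rule mult_left_mono[OF nd0]) simp
      then show "norm (ft \<phi> \<xi> * (wave x \<xi> * std_normal_density (e n * \<xi>)))
        \<le> std_normal_density 0 * cmod (ft \<phi> \<xi>)"
        by (simp add: norm_mult mult.commute)
    qed
  qed measurable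
  moreover have "(LINT \<xi>|lborel. ft \<phi> \<xi> * (wave x \<xi> * std_normal_density 0))
      = fourier (fourier \<phi>) x * std_normal_density 0"
    unfolding fourier_lborel[OF sf] unfolding fourier_eq_ft[OF s]
    by (subst integral_mult_left_zero[symmetric]) (intro Bochner_Integration.integral_cong, auto simp: mult_ac)
  moreover have I2: "I n = (LINT z|lborel. complex_of_real (exp (- z\<^sup>2 / 2)) * \<phi> (- x + e n * z))" for n
  proof -
    have nd: "integrable lborel (\<lambda>\<xi>. complex_of_real (std_normal_density (e n * \<xi>)))"
      using lborel_integrable_real_affine[of std_normal_density "e n" 0] e(1)[of n]
      by (simp add: integrable_of_real)
    have ftn: "ft (\<lambda>\<xi>. wave x \<xi> * std_normal_density (e n * \<xi>)) y
        = complex_of_real (exp (- ((x + y) / e n)\<^sup>2 / 2) / e n)" for y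
      unfolding ft_scaled_normal[OF e(1)[of n], symmetric] ft_def mult.assoc[symmetric] exp_add[symmetric]
      by (intro Bochner_Integration.integral_cong) (auto simp: algebra_simps)
    have "I n = (LINT y|lborel. \<phi> y * ft (\<lambda>\<xi>. wave x \<xi> * std_normal_density (e n * \<xi>)) y)"
      unfolding I_def
      by (intro ft_multiplication schwartz_integrable[OF s] integrable_unimodular nd) auto
    also have "\<dots> = (LINT y|lborel. \<phi> y * complex_of_real (exp (- ((x + y) / e n)\<^sup>2 / 2) / e n))"
      by (simp only: ftn)
    also have "(LINT y|lborel. \<phi> y * complex_of_real (exp (- ((x + y) / e n)\<^sup>2 / 2) / e n))
        = (LINT z|lborel. complex_of_real (exp (- z\<^sup>2 / 2)) * \<phi> (- x + e n * z))"
      using e(1)[of n] by (subst lborel_integral_real_affine[of "e n" _ "- x"])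
        (auto simp: scaleR_conv_of_real field_simps intro!: Bochner_Integration.integral_cong)
    finally show ?thesis .
  qed
  have g: "integrable lborel (\<lambda>z. exp (- z\<^sup>2 / 2) :: real)" "(LINT z|lborel. exp (- z\<^sup>2 / 2) :: real) = sqrt (2 * pi)"
  proof -
    have "(\<lambda>z. exp (- z\<^sup>2 / 2)) = (\<lambda>z. sqrt (2 * pi) * std_normal_density z)"
      by (simp add: normal_density_def)
    then show "integrable lborel (\<lambda>z. exp (- z\<^sup>2 / 2) :: real)" "(LINT z|lborel. exp (- z\<^sup>2 / 2) :: real) = sqrt (2 * pi)"
      by (simp_all del: real_sqrt_mult)
  qed
  have "I \<longlonglongrightarrow> (LINT z|lborel. complex_of_real (exp (- z\<^sup>2 / 2)) * \<phi> (- x))"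
    unfolding I2
  proof (rule integral_dominated_convergence[where w = "\<lambda>z. B * exp (- z\<^sup>2 / 2)"])
    show "integrable lborel (\<lambda>z::real. B * exp (- z\<^sup>2 / 2))"
      using g by simp
    have cont: "isCont \<phi> (- x)"
      using schwartz_continuous[OF s, of UNIV] by (simp add: continuous_on_eq_continuous_at)
    have "(\<lambda>n. - x + e n * z) \<longlonglongrightarrow> - x" for z
      using tendsto_add[OF tendsto_const[of "- x"] tendsto_mult[OF e(2) tendsto_const[of z]]] by simp
    then have "(\<lambda>n. \<phi> (- x + e n * z)) \<longlonglongrightarrow> \<phi> (- x)" for z
      by (rule isCont_tendsto_compose[OF cont])
    then show "AE z in lborel. (\<lambda>n. complex_of_real (exp (- z\<^sup>2 / 2)) * \<phi> (- x + e n * z))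
        \<longlonglongrightarrow> complex_of_real (exp (- z\<^sup>2 / 2)) * \<phi> (- x)"
      by (intro AE_I2 tendsto_mult tendsto_const)
    show "AE z in lborel. norm (complex_of_real (exp (- z\<^sup>2 / 2)) * \<phi> (- x + e n * z)) \<le> B * exp (- z\<^sup>2 / 2)" for n
      using B by (auto simp: norm_mult mult.commute intro!: mult_right_mono)
  qed measurable
  moreover have "(LINT z|lborel. complex_of_real (exp (- z\<^sup>2 / 2)) * \<phi> (- x)) = sqrt (2 * pi) * \<phi> (- x)"
    using g by (simp del: of_real_exp)
  ultimately have "fourier (fourier \<phi>) x * std_normal_density 0 = sqrt (2 * pi) * \<phi> (- x)"
    using LIMSEQ_unique by metis
  then have "fourier (fourier \<phi>) x = complex_of_real (sqrt (2 * pi) * sqrt (2 * pi)) * \<phi> (- x)"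
    by (simp add: normal_density_def field_simps del: real_sqrt_mult real_sqrt_mult_self)
  then show ?thesis by simp
qed

lemma schwartz_ift:
  assumes "\<phi> \<in> schwartz"
  shows "ift \<phi> \<in> schwartz"
proof -
  have "ift \<phi> = (\<lambda>x. (1 / complex_of_real (2 * pi)) * fourier \<phi> (- x))"
    by (intro ext) (simp add: ift_def fourier_eq_ft[OF assms])
  then show ?thesis
    by (simp only:) (intro schwartz_cmult schwartz_reflect[of "fourier \<phi>"] schwartz_fourier assms)
qed

lemma ift_fourier: "\<phi> \<in> schwartz \<Longrightarrow> ift (fourier \<phi>) = \<phi>"
  using fourier_fourier[of \<phi>] by (intro ext) (simp add: ift_def fourier_eq_ft[OF schwartz_fourier, symmetric])

lemma fourier_ift:
  assumes "\<phi> \<in> schwartz"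
  shows "fourier (ift \<phi>) = \<phi>"
proof -
  have "fourier (ift \<phi>) x = ift (fourier \<phi>) x" for x
  proof -
    have "(LINT y|lborel. wave y x * ift \<phi> y)
        = (LINT y|lborel. (wave y (- x)) * (ft \<phi> y / (2 * pi)))"
      using lborel_integral_real_affine[of "-1" "\<lambda>y. wave y x * ift \<phi> y" 0]
      by (simp add: ift_def)
    also have "\<dots> = (LINT y|lborel. ((wave y (- x)) * ft \<phi> y) / (2 * pi))"
      by simp
    also have "\<dots> = ft (ft \<phi>) (- x) / (2 * pi)"
      unfolding ft_def[of "ft \<phi>"] by (rule integral_divide_zero)
    finally show ?thesis
      using fourier_lborel[OF schwartz_ift[OF assms]] by (simp add: ift_def fourier_eq_ft[OF assms])
  qed
  then show ?thesis using ift_fourier[OF assms] by auto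
qed

lemma ift_vderiv:
  assumes "\<phi> \<in> schwartz"
  shows "ift (vderiv \<phi>) \<xi> = - (\<i> * of_real \<xi>) * ift \<phi> \<xi>"
  using fourier_vderiv[OF assms, of "- \<xi>"]
  by (simp add: ift_def fourier_eq_ft[OF assms] fourier_eq_ft[OF schwartz_vderiv[OF assms]])

lemma plancherel_schwartz:
  assumes s: "\<phi> \<in> schwartz"
  shows "(LINT \<xi>|lborel. (cmod (ift \<phi> \<xi>))\<^sup>2) = (LINT x|lborel. (cmod (\<phi> x))\<^sup>2) / (2 * pi)"
proof -
  define \<psi> where "\<psi> = ift \<phi>"
  have \<psi>: "\<psi> \<in> schwartz" "ft \<psi> = \<phi>"
    using schwartz_ift[OF s] fourier_ift[OF s] fourier_eq_ft by (auto simp: \<psi>_def)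
  have s': "(\<lambda>x. cnj (\<phi> x)) \<in> schwartz" by (rule schwartz_cnj[OF s])
  have "ft (\<lambda>x. cnj (\<phi> x)) \<xi> = cnj (2 * pi * \<psi> \<xi>)" for \<xi>
  proof -
    have "ft (\<lambda>x. cnj (\<phi> x)) \<xi> = (LINT x|lborel. cnj ((wave x (- \<xi>)) * \<phi> x))"
      unfolding ft_def by (intro Bochner_Integration.integral_cong) (auto simp: exp_cnj)
    also have "\<dots> = cnj (ft \<phi> (- \<xi>))" unfolding ft_def by (rule Bochner_Integration.integral_cnj)
    finally show ?thesis by (simp add: \<psi>_def ift_def)
  qed
  then have "(LINT x|lborel. \<phi> x * cnj (\<phi> x)) = (LINT \<xi>|lborel. \<psi> \<xi> * cnj (2 * pi * \<psi> \<xi>))"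
    using ft_multiplication[OF schwartz_integrable[OF \<psi>(1)] schwartz_integrable[OF s']] \<psi>(2) by simp
  also have "\<dots> = (LINT \<xi>|lborel. complex_of_real (2 * pi * (cmod (\<psi> \<xi>))\<^sup>2))"
    by (intro Bochner_Integration.integral_cong) (simp_all only: complex_norm_square of_real_mult complex_cnj_mult complex_cnj_complex_of_real mult_ac)
  also have "(LINT x|lborel. \<phi> x * cnj (\<phi> x)) = (LINT x|lborel. complex_of_real ((cmod (\<phi> x))\<^sup>2))"
    by (intro Bochner_Integration.integral_cong) (simp_all only: complex_norm_square)
  finally have "complex_of_real (LINT x|lborel. (cmod (\<phi> x))\<^sup>2) = complex_of_real (2 * pi * (LINT \<xi>|lborel. (cmod (\<psi> \<xi>))\<^sup>2))"
    unfolding integral_complex_of_real by simp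
  then have "(LINT x|lborel. (cmod (\<phi> x))\<^sup>2) = 2 * pi * (LINT \<xi>|lborel. (cmod (\<psi> \<xi>))\<^sup>2)"
    by (simp only: of_real_eq_iff)
  then show ?thesis by (simp add: \<psi>_def)
qed

lemma schwartz_norm_bound:
  assumes s: "\<phi> \<in> schwartz" and mn: "m \<le> N" "n \<le> N"
  shows "\<bar>x\<bar> ^ m * cmod ((vderiv ^^ n) \<phi> x) \<le> schwartz_norm N \<phi>"
proof -
  let ?S = "\<lambda>m n. SUP x. \<bar>x\<bar> ^ m * cmod ((vderiv ^^ n) \<phi> x)"
  obtain B where "\<forall>x. \<bar>x\<bar> ^ m * cmod ((vderiv ^^ n) \<phi> x) \<le> B"
    using s unfolding schwartz_def by blast
  then have "\<bar>x\<bar> ^ m * cmod ((vderiv ^^ n) \<phi> x) \<le> ?S m n"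
    by (intro cSUP_upper bdd_aboveI[of _ B]) auto
  also have "\<dots> \<le> (\<Sum>n\<le>N. ?S m n)"
    using mn by (intro member_le_sum schwartz_seminorm_nonneg s) auto
  also have "\<dots> \<le> (\<Sum>m\<le>N. \<Sum>n\<le>N. ?S m n)"
    using mn by (intro member_le_sum[where f = "\<lambda>m. \<Sum>n\<le>N. ?S m n"] sum_nonneg schwartz_seminorm_nonneg s) auto
  finally show ?thesis unfolding schwartz_norm_def .
qed

text \<open>A power of \<open>1 + \<xi>\<^sup>2\<close> on the Fourier side costs derivatives, hence finitely many Schwartz
  seminorms. Integration against \<open>ift \<phi>\<close> is therefore a tempered functional for every weighted
  square integrable density.\<close>

lemma ift_decay_schwartz_norm:
  assumes s: "\<phi> \<in> schwartz"
  shows "cmod (ift \<phi> \<xi>) * (1 + \<xi>\<^sup>2) ^ N \<le> 2 * 2 ^ N * schwartz_norm (2 * N + 2) \<phi>"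
proof -
  let ?M = "schwartz_norm (2 * N + 2) \<phi>"
  have M0: "0 \<le> ?M" by (rule schwartz_norm_nonneg[OF s])
  have *: "\<bar>\<xi>\<bar> ^ m * cmod (ift \<phi> \<xi>) \<le> ?M" if m: "m \<le> 2 * N" for m
  proof -
    let ?d = "(vderiv ^^ m) \<phi>"
    have d: "?d \<in> schwartz" "fourier ?d (- \<xi>) = (\<i> * of_real (- \<xi>)) ^ m * fourier \<phi> (- \<xi>)"
      using fourier_vderiv_iterate[OF s] by auto
    have "cmod (?d x) \<le> 2 * ?M * (1 / (1 + x\<^sup>2))" for x
    proof -
      have "cmod (?d x) * (1 + x\<^sup>2) = \<bar>x\<bar> ^ 0 * cmod (?d x) + \<bar>x\<bar> ^ 2 * cmod (?d x)"
        by (simp add: algebra_simps)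
      also have "\<dots> \<le> ?M + ?M"
        using m by (intro add_mono schwartz_norm_bound s) auto
      finally have "cmod (?d x) * (1 + x\<^sup>2) \<le> 2 * ?M" by simp
      moreover have "0 < 1 + x\<^sup>2" by (simp add: add_pos_nonneg)
      ultimately show ?thesis by (simp add: field_simps)
    qed
    then have "(LINT x|lborel. cmod (?d x)) \<le> (LINT x|lborel. 2 * ?M * (1 / (1 + x\<^sup>2)))"
      by (intro integral_mono integrable_norm schwartz_integrable d integrable_mult_right integrable_inverse_one_plus_square) auto
    also have "\<dots> = 2 * ?M * (LINT x::real|lborel. 1 / (1 + x\<^sup>2))"
      by (rule integral_mult_right_zero)
    also have "\<dots> = 2 * ?M * pi"
      using LBINT_inverse_1_plus_square
      by (simp add: interval_lebesgue_integral_def einterval_def set_lebesgue_integral_def inverse_eq_divide)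
    finally have "cmod (fourier ?d (- \<xi>)) \<le> 2 * ?M * pi"
      using fourier_le_L1[OF d(1), of "- \<xi>"] by linarith
    then have "\<bar>\<xi>\<bar> ^ m * cmod (fourier \<phi> (- \<xi>)) \<le> 2 * ?M * pi"
      unfolding d(2) by (simp add: norm_mult norm_power)
    then show ?thesis
      by (simp add: ift_def fourier_eq_ft[OF s] norm_divide norm_mult field_simps)
  qed
  have "(1 + \<xi>\<^sup>2) ^ N \<le> 2 ^ N * (1 + \<bar>\<xi>\<bar> ^ (2 * N))"
  proof (cases "\<bar>\<xi>\<bar> \<le> 1")
    case True
    then have "(1 + \<xi>\<^sup>2) ^ N \<le> 2 ^ N"
      by (intro power_mono) (auto simp: abs_square_le_1)
    moreover have "2 ^ N * 1 \<le> 2 ^ N * (1 + \<bar>\<xi>\<bar> ^ (2 * N))"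
      by (intro mult_left_mono) auto
    ultimately show ?thesis by linarith
  next
    case False
    then have "1 \<le> \<bar>\<xi>\<bar>\<^sup>2" by (intro one_le_power) auto
    then have "1 \<le> \<xi>\<^sup>2" by simp
    then have "(1 + \<xi>\<^sup>2) ^ N \<le> (2 * \<bar>\<xi>\<bar>\<^sup>2) ^ N"
      by (intro power_mono) auto
    also have "\<dots> = 2 ^ N * \<bar>\<xi>\<bar> ^ (2 * N)" by (simp add: power_mult_distrib power_mult)
    also have "\<dots> \<le> 2 ^ N * (1 + \<bar>\<xi>\<bar> ^ (2 * N))"
      by (intro mult_left_mono) auto
    finally show ?thesis .
  qed
  then have "cmod (ift \<phi> \<xi>) * (1 + \<xi>\<^sup>2) ^ N \<le> cmod (ift \<phi> \<xi>) * (2 ^ N * (1 + \<bar>\<xi>\<bar> ^ (2 * N)))"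
    by (intro mult_left_mono) auto
  also have "\<dots> = 2 ^ N * (\<bar>\<xi>\<bar> ^ 0 * cmod (ift \<phi> \<xi>) + \<bar>\<xi>\<bar> ^ (2 * N) * cmod (ift \<phi> \<xi>))"
    by (simp add: algebra_simps)
  also have "\<dots> \<le> 2 ^ N * (?M + ?M)"
    by (intro mult_left_mono add_mono *) auto
  finally show ?thesis by simp
qed

section \<open>Density of the Schwartz functions and duality\<close>

lemma square_integrable_product:
  fixes f g :: "'a \<Rightarrow> complex"
  assumes [measurable]: "f \<in> borel_measurable M" "g \<in> borel_measurable M"
    and f: "integrable M (\<lambda>x. (cmod (f x))\<^sup>2)" and g: "integrable M (\<lambda>x. (cmod (g x))\<^sup>2)"
  shows "integrable M (\<lambda>x. f x * g x)"
    and "(LINT x|M. cmod (f x * g x)) \<le> sqrt (LINT x|M. (cmod (f x))\<^sup>2) * sqrt (LINT x|M. (cmod (g x))\<^sup>2)"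
    and "cmod (LINT x|M. f x * g x) \<le> sqrt (LINT x|M. (cmod (f x))\<^sup>2) * sqrt (LINT x|M. (cmod (g x))\<^sup>2)"
proof -
  show fg: "integrable M (\<lambda>x. f x * g x)"
  proof (rule Bochner_Integration.integrable_bound)
    show "integrable M (\<lambda>x. (cmod (f x))\<^sup>2 + (cmod (g x))\<^sup>2)" using f g by simp
    have "cmod (f x) * cmod (g x) \<le> (cmod (f x))\<^sup>2 + (cmod (g x))\<^sup>2" for x
    proof -
      have "0 \<le> cmod (f x) * cmod (g x)" by simp
      moreover have "2 * (cmod (f x) * cmod (g x)) \<le> (cmod (f x))\<^sup>2 + (cmod (g x))\<^sup>2"
        using sum_squares_bound[of "cmod (f x)" "cmod (g x)"] by (simp only: mult.assoc)
      ultimately show ?thesis by linarith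
    qed
    then show "AE x in M. norm (f x * g x) \<le> norm ((cmod (f x))\<^sup>2 + (cmod (g x))\<^sup>2)"
      by (auto simp: norm_mult)
  qed measurable
  define A B X where "A = (LINT x|M. (cmod (f x))\<^sup>2)" and "B = (LINT x|M. (cmod (g x))\<^sup>2)"
    and "X = (LINT x|M. cmod (f x * g x))"
  have AB: "0 \<le> A" "0 \<le> B" by (auto simp: A_def B_def)
  have X: "integrable M (\<lambda>x. cmod (f x * g x))" by (rule integrable_norm[OF fg])
  have quad: "0 \<le> A + 2 * t * X + t\<^sup>2 * B" for t
  proof -
    have "0 \<le> (LINT x|M. (cmod (f x) + t * cmod (g x))\<^sup>2)" by simp
    also have "\<dots> = (LINT x|M. (cmod (f x))\<^sup>2 + 2 * t * cmod (f x * g x) + t\<^sup>2 * (cmod (g x))\<^sup>2)"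
      by (intro Bochner_Integration.integral_cong) (auto simp: power2_eq_square algebra_simps norm_mult)
    also have "\<dots> = A + 2 * t * X + t\<^sup>2 * B"
      using f g X by (simp add: A_def B_def X_def)
    finally show ?thesis .
  qed
  have "X\<^sup>2 \<le> A * B"
  proof (cases "B = 0")
    case True
    have "X = 0"
    proof (rule ccontr)
      assume "X \<noteq> 0"
      then show False using quad[of "- (A + 1) / (2 * X)"] True AB by (simp add: field_simps)
    qed
    then show ?thesis using AB by simp
  next
    case False
    then show ?thesis using quad[of "- X / B"] AB
      by (simp add: field_simps power2_eq_square)
  qed
  then have "X \<le> sqrt (A * B)" by (rule real_le_rsqrt)
  then show "(LINT x|M. cmod (f x * g x)) \<le> sqrt (LINT x|M. (cmod (f x))\<^sup>2) * sqrt (LINT x|M. (cmod (g x))\<^sup>2)"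
    by (simp add: A_def B_def X_def real_sqrt_mult)
  then show "cmod (LINT x|M. f x * g x) \<le> sqrt (LINT x|M. (cmod (f x))\<^sup>2) * sqrt (LINT x|M. (cmod (g x))\<^sup>2)"
    using integral_norm_bound[of M "\<lambda>x. f x * g x"] by linarith
qed

text \<open>For \<open>j = n = 0\<close> this is the standard smooth bump function supported in \<open>[-a, a]\<close>. The parameters
  make the family closed, up to linear combinations, under differentiation.\<close>

definition bump :: "real \<Rightarrow> nat \<Rightarrow> nat \<Rightarrow> real \<Rightarrow> real" where
  "bump a j n x = (if \<bar>x\<bar> < a then x ^ j * exp (- 1 / (a\<^sup>2 - x\<^sup>2)) / (a\<^sup>2 - x\<^sup>2) ^ n else 0)"

lemma bump_flat:
  assumes "a > 0"
  shows "\<bar>bump a j n x\<bar> \<le> a ^ j * fact (n + 2) * (a\<^sup>2 - x\<^sup>2)\<^sup>2"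
proof (cases "\<bar>x\<bar> < a")
  case True
  define y where "y = a\<^sup>2 - x\<^sup>2"
  have y: "y > 0" using True unfolding y_def
    by (metis abs_ge_zero diff_gt_0_iff_gt power2_abs power_strict_mono zero_less_numeral)
  \<comment> \<open>a single term of the exponential series absorbs the negative powers\<close>
  have "(1 / y) ^ (n + 2) / fact (n + 2) \<le> exp (1 / y)"
  proof -
    have "(\<Sum>k\<in>{n + 2}. inverse (fact k) * (1 / y) ^ k) \<le> (\<Sum>k. inverse (fact k) * (1 / y) ^ k)"
      using y summable_exp[of "1 / y"] by (intro sum_le_suminf) auto
    then show ?thesis by (simp add: exp_def divide_inverse mult.commute)
  qed
  moreover define P where "P = y ^ (n + 2)"
  moreover define F :: real where "F = fact (n + 2)"
  ultimately have "1 / P / F \<le> exp (1 / y)" by (simp only: power_divide power_one)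
  moreover have "P > 0" "F > 0" using y by (simp_all add: P_def F_def)
  ultimately have "exp (- 1 / y) \<le> F * P"
    by (simp add: exp_minus field_simps)
  moreover have "P = y ^ n * y\<^sup>2" unfolding P_def by (rule power_add)
  ultimately have "exp (- 1 / y) \<le> (F * y\<^sup>2) * y ^ n" by (simp only: mult_ac)
  then have e: "exp (- 1 / y) / y ^ n \<le> fact (n + 2) * y\<^sup>2"
    using y unfolding F_def[symmetric] by (simp add: pos_divide_le_eq)
  have "\<bar>bump a j n x\<bar> = \<bar>x\<bar> ^ j * (exp (- 1 / y) / y ^ n)"
    using True y by (simp add: bump_def y_def[symmetric] abs_mult power_abs)
  also have "\<dots> \<le> a ^ j * (fact (n + 2) * y\<^sup>2)"
    using True y assms by (intro mult_mono e power_mono) auto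
  finally show ?thesis by (simp add: y_def)
qed (use assms in \<open>auto simp: bump_def\<close>)

text \<open>Away from \<open>\<bar>x\<bar> = a\<close> this is the chain rule; at \<open>\<bar>x\<bar> = a\<close> the quadratic flatness of the previous
  lemma makes the derivative vanish.\<close>

lemma bump_has_derivative:
  assumes a: "a > 0"
  shows "(bump a j n has_real_derivative
     real j * bump a (j - 1) n x - 2 * bump a (j + 1) (n + 2) x + 2 * real n * bump a (j + 1) (n + 1) x) (at x)"
proof -
  consider "\<bar>x\<bar> < a" | "\<bar>x\<bar> > a" | "\<bar>x\<bar> = a" by linarith
  then show ?thesis
  proof cases
    case 1
    define y where "y = a\<^sup>2 - x\<^sup>2"
    have y: "y > 0" using 1 unfolding y_def
      by (metis abs_ge_zero diff_gt_0_iff_gt power2_abs power_strict_mono zero_less_numeral)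
    have "((\<lambda>x. x ^ j * (exp (- 1 / (a\<^sup>2 - x\<^sup>2)) / (a\<^sup>2 - x\<^sup>2) ^ n)) has_real_derivative
        real j * (x ^ (j - 1) * exp (- 1 / y) / y ^ n) - 2 * (x ^ (j + 1) * exp (- 1 / y) / y ^ (n + 2))
        + 2 * real n * (x ^ (j + 1) * exp (- 1 / y) / y ^ (n + 1))) (at x)"
    proof -
      have dy: "((\<lambda>x. a\<^sup>2 - x\<^sup>2) has_real_derivative (- 2 * x)) (at x)"
        by (auto intro!: derivative_eq_intros)
      have dE: "((\<lambda>x. exp (- 1 / (a\<^sup>2 - x\<^sup>2))) has_real_derivative exp (- 1 / y) * (- 2 * x / y\<^sup>2)) (at x)"
        using y by (auto intro!: derivative_eq_intros dy simp: y_def power2_eq_square[of "a\<^sup>2 - x\<^sup>2"])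
      have dp: "((\<lambda>x. (a\<^sup>2 - x\<^sup>2) ^ n) has_real_derivative real n * y ^ (n - 1) * (- 2 * x)) (at x)"
        using DERIV_power[OF dy, of n] by (simp add: y_def mult_ac)
      have dj: "((\<lambda>x. x ^ j) has_real_derivative real j * x ^ (j - 1)) (at x)"
        using DERIV_pow[of j x] by simp
      have ny: "(a\<^sup>2 - x\<^sup>2) ^ n \<noteq> 0" using y by (simp add: y_def)
      have n1: "real n * y ^ (n - 1) = real n * y ^ n / y" using y by (cases n) auto
      show ?thesis
      proof (rule DERIV_cong[OF DERIV_mult[OF dj DERIV_divide[OF dE dp ny]]])
        define Y where "Y = y ^ n"
        have Y2: "y ^ (n + 2) = Y * y\<^sup>2" by (simp only: Y_def power_add)
        have Y: "Y > 0" "y ^ (n + 1) = Y * y" "(a\<^sup>2 - x\<^sup>2) ^ n = Y"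
          "real n * y ^ (n - 1) = real n * Y / y"
          using y n1 by (simp_all add: Y_def y_def power_add)
        define E where "E = exp (- 1 / y)"
        have E: "exp (- 1 / (a\<^sup>2 - x\<^sup>2)) = E" by (simp add: E_def y_def)
        show "real j * x ^ (j - 1) * (exp (- 1 / (a\<^sup>2 - x\<^sup>2)) / (a\<^sup>2 - x\<^sup>2) ^ n) +
          (exp (- 1 / y) * (- 2 * x / y\<^sup>2) * (a\<^sup>2 - x\<^sup>2) ^ n - exp (- 1 / (a\<^sup>2 - x\<^sup>2)) * (real n * y ^ (n - 1) * (- 2 * x))) /
          ((a\<^sup>2 - x\<^sup>2) ^ n * (a\<^sup>2 - x\<^sup>2) ^ n) * x ^ j =
          real j * (x ^ (j - 1) * exp (- 1 / y) / y ^ n) - 2 * (x ^ (j + 1) * exp (- 1 / y) / y ^ (n + 2)) +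
          2 * real n * (x ^ (j + 1) * exp (- 1 / y) / y ^ (n + 1))"
          unfolding Y Y2 E unfolding Y_def[symmetric] E_def[symmetric] using Y(1) y
          by (simp add: divide_simps power2_eq_square) (simp add: algebra_simps)
      qed
    qed
    then have "(bump a j n has_real_derivative
        real j * (x ^ (j - 1) * exp (- 1 / y) / y ^ n) - 2 * (x ^ (j + 1) * exp (- 1 / y) / y ^ (n + 2))
        + 2 * real n * (x ^ (j + 1) * exp (- 1 / y) / y ^ (n + 1))) (at x)"
      by (rule has_field_derivative_transform_within_open[where S = "{-a<..<a}"])
         (use 1 in \<open>auto simp: bump_def\<close>)
    then show ?thesis using 1 by (simp add: bump_def y_def)
  next
    case 2
    have "((\<lambda>x. 0) has_real_derivative 0) (at x)" by simp
    then have "(bump a j n has_real_derivative 0) (at x)"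
      by (rule has_field_derivative_transform_within_open[where S = "{x. a < \<bar>x\<bar>}"])
         (use 2 in \<open>auto simp: bump_def intro!: open_Collect_less continuous_intros\<close>)
    then show ?thesis using 2 by (simp add: bump_def)
  next
    case 3
    define C where "C = a ^ j * fact (n + 2) * (2 * a)\<^sup>2"
    have bnd: "\<bar>bump a j n z\<bar> \<le> C * \<bar>z - x\<bar>\<^sup>2" for z
    proof (cases "\<bar>z\<bar> < a")
      case True
      have "(a\<^sup>2 - z\<^sup>2) = (a - \<bar>z\<bar>) * (a + \<bar>z\<bar>)"
        by (simp add: power2_eq_square algebra_simps abs_mult_self_eq)
      also have "\<dots> \<le> \<bar>z - x\<bar> * (2 * a)"
        using True 3 by (intro mult_mono) auto
      finally have "(a\<^sup>2 - z\<^sup>2)\<^sup>2 \<le> (\<bar>z - x\<bar> * (2 * a))\<^sup>2"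
      proof (rule power_mono)
        show "0 \<le> a\<^sup>2 - z\<^sup>2" using True by (simp add: abs_le_square_iff[symmetric])
      qed
      then have "a ^ j * fact (n + 2) * (a\<^sup>2 - z\<^sup>2)\<^sup>2 \<le> a ^ j * fact (n + 2) * (\<bar>z - x\<bar> * (2 * a))\<^sup>2"
        using a by (intro mult_left_mono) auto
      moreover have "a ^ j * fact (n + 2) * (\<bar>z - x\<bar> * (2 * a))\<^sup>2 = C * \<bar>z - x\<bar>\<^sup>2"
        by (simp only: C_def power_mult_distrib mult_ac)
      ultimately show ?thesis
        using bump_flat[OF a, of j n z] by linarith
    next
      case False
      then show ?thesis using a by (simp add: bump_def C_def)
    qed
    have "((\<lambda>z. norm (bump a j n z - bump a j n x - (\<lambda>h. 0) (z - x)) / norm (z - x)) \<longlongrightarrow> 0) (at x)"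
    proof (rule Lim_null_comparison)
      show "\<forall>\<^sub>F z in at x. norm (norm (bump a j n z - bump a j n x - (\<lambda>h. 0) (z - x)) / norm (z - x)) \<le> C * \<bar>z - x\<bar>"
        unfolding eventually_at_filter
      proof (intro always_eventually allI impI)
        fix z assume "z \<noteq> x"
        have "bump a j n x = 0" using 3 by (simp add: bump_def)
        then show "norm (norm (bump a j n z - bump a j n x - (\<lambda>h. 0) (z - x)) / norm (z - x)) \<le> C * \<bar>z - x\<bar>"
          using bnd[of z] \<open>z \<noteq> x\<close> by (simp add: divide_simps power2_eq_square mult_ac)
      qed
      show "((\<lambda>z. C * \<bar>z - x\<bar>) \<longlongrightarrow> 0) (at x)"
        by (auto intro!: tendsto_eq_intros)
    qed
    then have "(bump a j n has_derivative (\<lambda>h. 0)) (at x)"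
      unfolding has_derivative_iff_norm by simp
    moreover have "(*) (0::real) = (\<lambda>h. 0)" by auto
    ultimately have "(bump a j n has_real_derivative 0) (at x)"
      unfolding has_field_derivative_def by simp
    then show ?thesis using 3 by (simp add: bump_def)
  qed
qed

inductive_set bump_span :: "real \<Rightarrow> (real \<Rightarrow> complex) set" for a where
  base: "(\<lambda>x. of_real (bump a j n x)) \<in> bump_span a"
| lin: "f \<in> bump_span a \<Longrightarrow> g \<in> bump_span a \<Longrightarrow> (\<lambda>x. of_real c * f x + of_real d * g x) \<in> bump_span a"

lemma bump_schwartz:
  assumes a: "a > 0"
  shows "(\<lambda>x. of_real (bump a j n x)) \<in> schwartz"
proof (rule schwartz_coinduct[where S = "bump_span a"])
  show "(\<lambda>x. of_real (bump a j n x)) \<in> bump_span a" by (rule bump_span.base)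
next
  fix g assume "g \<in> bump_span a"
  then show "\<exists>g'\<in>bump_span a. \<forall>x. (g has_vector_derivative g' x) (at x)"
  proof induction
    case (base j n)
    let ?d = "\<lambda>x. complex_of_real 1 * (complex_of_real (real j) * complex_of_real (bump a (j - 1) n x) + complex_of_real (- 2) * complex_of_real (bump a (j + 1) (n + 2) x))
        + complex_of_real (2 * real n) * complex_of_real (bump a (j + 1) (n + 1) x)"
    have "?d \<in> bump_span a" by (intro bump_span.lin bump_span.base)
    moreover have "((\<lambda>x. complex_of_real (bump a j n x)) has_vector_derivative ?d x) (at x)" for x
      using has_vector_derivative_of_real[OF bump_has_derivative[OF a, of j n x]] by simp
    ultimately show ?case by (intro bexI[where x = ?d] allI)
  next
    case (lin f g c d)
    then obtain f' g' where fg: "f' \<in> bump_span a" "g' \<in> bump_span a"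
      "\<And>x. (f has_vector_derivative f' x) (at x)" "\<And>x. (g has_vector_derivative g' x) (at x)" by blast
    show ?case
      by (rule bexI[OF _ bump_span.lin[OF fg(1,2), of c d]])
         (intro allI has_vector_derivative_add has_vector_derivative_mult_right fg(3,4))
  qed
next
  fix g m assume "g \<in> bump_span a"
  then show "\<exists>B. \<forall>x. \<bar>x\<bar> ^ m * cmod (g x) \<le> B"
  proof induction
    case (base j n)
    have "\<bar>x\<bar> ^ m * cmod (of_real (bump a j n x)) \<le> a ^ m * (a ^ j * fact (n + 2) * (a\<^sup>2)\<^sup>2)" for x
    proof (cases "\<bar>x\<bar> < a")
      case True
      have "(a\<^sup>2 - x\<^sup>2)\<^sup>2 \<le> (a\<^sup>2)\<^sup>2"
        using True by (intro power_mono) (auto simp: abs_le_square_iff[symmetric])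
      then have "a ^ j * fact (n + 2) * (a\<^sup>2 - x\<^sup>2)\<^sup>2 \<le> a ^ j * fact (n + 2) * (a\<^sup>2)\<^sup>2"
        using a by (intro mult_left_mono) auto
      then have "\<bar>bump a j n x\<bar> \<le> a ^ j * fact (n + 2) * (a\<^sup>2)\<^sup>2"
        using bump_flat[OF a, of j n x] by linarith
      then show ?thesis using True a by (intro mult_mono power_mono) auto
    next
      case False then show ?thesis using a by (simp add: bump_def)
    qed
    then show ?case by blast
  next
    case (lin f g c d)
    then obtain B C where B: "\<And>x. \<bar>x\<bar> ^ m * cmod (f x) \<le> B" "\<And>x. \<bar>x\<bar> ^ m * cmod (g x) \<le> C" by blast
    have "\<bar>x\<bar> ^ m * cmod (of_real c * f x + of_real d * g x) \<le> \<bar>c\<bar> * B + \<bar>d\<bar> * C" for x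
    proof -
      have "\<bar>x\<bar> ^ m * cmod (of_real c * f x + of_real d * g x) \<le> \<bar>x\<bar> ^ m * (\<bar>c\<bar> * cmod (f x) + \<bar>d\<bar> * cmod (g x))"
        by (intro mult_left_mono norm_triangle_le) (auto simp: norm_mult)
      also have "\<dots> = \<bar>c\<bar> * (\<bar>x\<bar> ^ m * cmod (f x)) + \<bar>d\<bar> * (\<bar>x\<bar> ^ m * cmod (g x))"
        by (simp add: algebra_simps)
      also have "\<dots> \<le> \<bar>c\<bar> * B + \<bar>d\<bar> * C"
        by (intro add_mono mult_left_mono B) auto
      finally show ?thesis .
    qed
    then show ?case by blast
  qed
qed

lemma schwartz_mult_polynomial:
  assumes "real_polynomial_function q" "\<psi> \<in> schwartz"
  shows "(\<lambda>x. complex_of_real (q x) * \<psi> x) \<in> schwartz"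
  using assms
proof (induction q arbitrary: \<psi> rule: real_polynomial_function.induct)
  case (linear f)
  have fx: "f x = f 1 * x" for x
    using linear_scale[OF bounded_linear.linear[OF linear(1)], of x 1] by simp
  have "(\<lambda>x. complex_of_real (f x) * \<psi> x) = (\<lambda>x. complex_of_real (f 1) * (complex_of_real x * \<psi> x))"
    by (intro ext, subst fx) simp
  then show ?case using schwartz_cmult[OF schwartz_mult_x[OF linear(2)]] by simp
next
  case (const c) then show ?case by (rule schwartz_cmult)
next
  case (add f g)
  show ?case using schwartz_add[OF add(3)[OF add(5)] add(4)[OF add(5)]] by (simp add: algebra_simps)
next
  case (mult f g)
  show ?case using mult(3)[OF mult(4)[OF mult(5)]] by (simp add: mult_ac)
qed

text \<open>Weierstrass approximation on a compact interval of the quotient of \<open>g\<close> by a bump function, whose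
  support \<open>[-a, a]\<close> is larger than that of \<open>g\<close>; the product of the bump with a polynomial is Schwartz.\<close>

lemma schwartz_uniform_approx:
  assumes cont: "continuous_on UNIV g" and supp: "\<And>x. M \<le> \<bar>x\<bar> \<Longrightarrow> g x = 0"
    and M: "0 < M" "M < a" and e: "e > 0"
  shows "\<exists>\<phi>\<in>schwartz. (\<forall>x. cmod (\<phi> x - g x) \<le> e) \<and> (\<forall>x. a \<le> \<bar>x\<bar> \<longrightarrow> \<phi> x = 0)"
proof -
  have a: "a > 0" using M by simp
  define bmp where "bmp = bump a 0 0"
  have bmppos: "bmp x > 0" if "\<bar>x\<bar> < a" for x using that by (simp add: bmp_def bump_def)
  have bmp0: "bmp x = 0" if "a \<le> \<bar>x\<bar>" for x using that by (simp add: bmp_def bump_def)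
  have bmp1: "bmp x \<le> 1" "0 \<le> bmp x" for x
    unfolding bmp_def bump_def by (auto simp: abs_le_square_iff[symmetric])
  have cbmp: "continuous_on S bmp" for S
    unfolding bmp_def by (rule DERIV_continuous_on[OF has_field_derivative_at_within[OF bump_has_derivative[OF a]]])
  let ?q = "\<lambda>x. if \<bar>x\<bar> \<le> M then g x / of_real (bmp x) else 0"
  have "continuous_on ({x. \<bar>x\<bar> \<le> M} \<union> {x. M \<le> \<bar>x\<bar>}) ?q"
  proof (rule continuous_on_cases)
    show "closed {x. \<bar>x\<bar> \<le> M}" "closed {x. M \<le> \<bar>x\<bar>}"
      by (intro closed_Collect_le continuous_intros)+
    have "bmp x \<noteq> 0" if "\<bar>x\<bar> \<le> M" for x using bmppos[of x] that M by simp
    then show "continuous_on {x. \<bar>x\<bar> \<le> M} (\<lambda>x. g x / of_real (bmp x))"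
      by (intro continuous_intros cbmp continuous_on_subset[OF cont]) auto
  qed (use supp in auto)
  then have "continuous_on {-a..a} ?q" by (rule continuous_on_subset) auto
  then obtain P where P: "polynomial_function P" "\<And>x. x \<in> {-a..a} \<Longrightarrow> norm (?q x - P x) < e"
    using Stone_Weierstrass_polynomial_function[of "{-a..a}" ?q e] e by auto
  have "real_polynomial_function (Re \<circ> P)" "real_polynomial_function (Im \<circ> P)"
    using P(1) bounded_linear_Re bounded_linear_Im unfolding polynomial_function_def by auto
  note sp = schwartz_mult_polynomial[OF this(1) bump_schwartz[OF a, of 0 0]]
            schwartz_mult_polynomial[OF this(2) bump_schwartz[OF a, of 0 0]]
  have "(\<lambda>x. of_real (bmp x) * P x) \<in> schwartz"
  proof -
    have "complex_of_real (bmp x) * P x = 1 * (complex_of_real ((Re \<circ> P) x) * of_real (bmp x)) + \<i> * (complex_of_real ((Im \<circ> P) x) * of_real (bmp x))" for x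
      by (subst (1) complex_eq[of "P x"]) (simp add: algebra_simps)
    then show ?thesis using schwartz_lincomb[OF sp, of 1 \<i>] by (simp add: bmp_def)
  qed
  moreover have "cmod (of_real (bmp x) * P x - g x) \<le> e" for x
  proof (cases "\<bar>x\<bar> < a")
    case True
    define Q where "Q = ?q x"
    have "g x = of_real (bmp x) * Q" using bmppos[OF True] supp[of x] by (auto simp: Q_def)
    then have "of_real (bmp x) * P x - g x = - (of_real (bmp x) * (Q - P x))"
      by (simp add: algebra_simps)
    then have "cmod (of_real (bmp x) * P x - g x) = bmp x * cmod (Q - P x)"
      using bmp1(2)[of x] by (simp only: norm_minus_cancel norm_mult norm_of_real abs_of_nonneg)
    also have "\<dots> \<le> 1 * e"
    proof (intro mult_mono bmp1)
      have "x \<in> {-a..a}" using True by auto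
      from P(2)[OF this] show "cmod (Q - P x) \<le> e" unfolding Q_def by (rule less_imp_le)
    qed auto
    finally show ?thesis by simp
  next
    case False
    then show ?thesis using bmp0[of x] supp[of x] M e by simp
  qed
  ultimately show ?thesis using bmp0 by (intro bexI[where x = "\<lambda>x. of_real (bmp x) * P x"]) auto
qed

text \<open>A measurable function is almost everywhere the limit of continuous functions. Clipping and cutting
  them off preserves the limit and provides the uniform bound and the common support that dominated
  convergence needs.\<close>

lemma schwartz_ae_approx:
  fixes \<phi> :: "real \<Rightarrow> complex"
  assumes meas: "\<phi> \<in> borel_measurable lebesgue" and B: "\<And>x. cmod (\<phi> x) \<le> B"
    and supp: "\<And>x. M < \<bar>x\<bar> \<Longrightarrow> \<phi> x = 0" and M: "M > 0"
  obtains \<psi> where "\<And>n. \<psi> n \<in> schwartz" "\<And>n x. cmod (\<psi> n x) \<le> B + 1"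
    "\<And>n x. M + 2 \<le> \<bar>x\<bar> \<Longrightarrow> \<psi> n x = 0" "AE x in lebesgue. (\<lambda>n. \<psi> n x) \<longlonglongrightarrow> \<phi> x"
proof -
  have B0: "0 \<le> B" using B[of 0] norm_ge_zero order_trans by blast
  have "\<phi> measurable_on UNIV"
    using meas measurable_on_iff_borel_measurable[of UNIV \<phi>] by simp
  then obtain N g where N: "negligible N" and g: "\<And>n. continuous_on UNIV (g n)"
    and lim: "\<And>x. x \<notin> N \<Longrightarrow> (\<lambda>n. g n x) \<longlonglongrightarrow> \<phi> x"
    unfolding measurable_on_def by auto
  define clip where "clip = closest_point (cball (0::complex) B)"
  define cut where "cut x = max 0 (min 1 (M + 1 - \<bar>x\<bar>))" for x :: real
  have cball: "convex (cball (0::complex) B)" "closed (cball (0::complex) B)" "cball (0::complex) B \<noteq> {}"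
    using B0 by auto
  have cc: "continuous_on S clip" for S
    unfolding clip_def using continuous_on_closest_point[OF cball] by blast
  have clipB: "cmod (clip z) \<le> B" for z
    using closest_point_in_set[OF cball(2,3), of z] by (simp add: clip_def)
  have "\<exists>\<psi>\<in>schwartz. (\<forall>x. cmod (\<psi> x - of_real (cut x) * clip (g n x)) \<le> inverse (real (Suc n))) \<and> (\<forall>x. M + 2 \<le> \<bar>x\<bar> \<longrightarrow> \<psi> x = 0)" for n
  proof (rule schwartz_uniform_approx[where M = "M + 1"])
    show "continuous_on UNIV (\<lambda>x. of_real (cut x) * clip (g n x))"
      unfolding cut_def by (intro continuous_intros continuous_on_compose2[OF cc[of UNIV] g]) auto
    show "of_real (cut x) * clip (g n x) = 0" if "M + 1 \<le> \<bar>x\<bar>" for x using that by (simp add: cut_def)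
  qed (use M in auto)
  then obtain \<psi> where \<psi>: "\<And>n. \<psi> n \<in> schwartz"
    "\<And>n x. cmod (\<psi> n x - of_real (cut x) * clip (g n x)) \<le> inverse (real (Suc n))"
    "\<And>n x. M + 2 \<le> \<bar>x\<bar> \<Longrightarrow> \<psi> n x = 0" by metis
  show ?thesis
  proof (rule that[of \<psi>])
    show "cmod (\<psi> n x) \<le> B + 1" for n x
    proof -
      have "cmod (\<psi> n x) \<le> cmod (\<psi> n x - of_real (cut x) * clip (g n x)) + cmod (of_real (cut x) * clip (g n x))"
        by (metis diff_add_cancel norm_triangle_ineq)
      also have "\<dots> \<le> inverse (real (Suc n)) + 1 * B"
        unfolding norm_mult by (intro add_mono \<psi>(2) mult_mono clipB) (auto simp: cut_def)
      also have "\<dots> \<le> B + 1" by (simp add: field_simps)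
      finally show ?thesis .
    qed
    have "(\<lambda>n. \<psi> n x) \<longlonglongrightarrow> \<phi> x" if "x \<notin> N" for x
    proof -
      have "isCont clip (\<phi> x)"
        using cc[of UNIV] by (simp add: continuous_on_eq_continuous_at)
      then have "(\<lambda>n. clip (g n x)) \<longlonglongrightarrow> clip (\<phi> x)"
        using lim[OF that] by (rule isCont_tendsto_compose)
      also have "clip (\<phi> x) = \<phi> x"
        unfolding clip_def using B[of x] by (intro closest_point_self) auto
      finally have "(\<lambda>n. of_real (cut x) * clip (g n x)) \<longlonglongrightarrow> of_real (cut x) * \<phi> x"
        by (intro tendsto_mult tendsto_const)
      moreover have "of_real (cut x) * \<phi> x = \<phi> x"
        using supp[of x] by (cases "M < \<bar>x\<bar>") (auto simp: cut_def)
      moreover have "(\<lambda>n. \<psi> n x - of_real (cut x) * clip (g n x)) \<longlonglongrightarrow> 0"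
        by (rule Lim_null_comparison[OF _ LIMSEQ_inverse_real_of_nat]) (use \<psi>(2) in auto)
      ultimately show ?thesis using Lim_transform[of "\<lambda>n. of_real (cut x) * clip (g n x)" "\<phi> x" sequentially "\<lambda>n. \<psi> n x"]
        by simp
    qed
    moreover have "N \<in> null_sets lebesgue" using N by (simp add: negligible_iff_null_sets)
    ultimately show "AE x in lebesgue. (\<lambda>n. \<psi> n x) \<longlonglongrightarrow> \<phi> x"
      by (intro AE_I'[of N]) auto
  qed (use \<psi> in auto)
qed

lemma integrable_against_schwartz_local:
  fixes g :: "real \<Rightarrow> complex"
  assumes [measurable]: "g \<in> borel_measurable lebesgue" and int: "\<And>\<phi>. \<phi> \<in> schwartz \<Longrightarrow> integrable lebesgue (\<lambda>x. g x * \<phi> x)"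
    and R: "R > 0"
  shows "integrable lebesgue (\<lambda>x. indicator {-R..R} x * cmod (g x))"
proof -
  define a where "a = R + 1"
  define c where "c = exp (1 / (a\<^sup>2 - R\<^sup>2))"
  have a: "a > 0" "R < a" using R by (auto simp: a_def)
  have "integrable lebesgue (\<lambda>x. g x * of_real (bump a 0 0 x))"
    by (rule int[OF bump_schwartz[OF a(1)]])
  then have i: "integrable lebesgue (\<lambda>x. c * cmod (g x * of_real (bump a 0 0 x)))"
    by (intro integrable_mult_right integrable_norm)
  show ?thesis
  proof (rule Bochner_Integration.integrable_bound[OF i])
    have "indicator {-R..R} x * cmod (g x) \<le> c * cmod (g x * of_real (bump a 0 0 x))" for x
    proof (cases "\<bar>x\<bar> \<le> R")
      case True
      have "R\<^sup>2 < a\<^sup>2" using a R by (intro power_strict_mono) auto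
      moreover have "x\<^sup>2 \<le> R\<^sup>2" using True R by (simp add: abs_le_square_iff[symmetric])
      ultimately have "1 / (a\<^sup>2 - x\<^sup>2) \<le> 1 / (a\<^sup>2 - R\<^sup>2)"
        by (intro divide_left_mono mult_pos_pos) auto
      then have "1 \<le> c * bump a 0 0 x"
        using True a by (simp add: c_def bump_def exp_add[symmetric])
      then have "1 * cmod (g x) \<le> (c * bump a 0 0 x) * cmod (g x)"
        by (rule mult_right_mono) simp
      moreover have "0 \<le> bump a 0 0 x" using True a by (simp add: bump_def)
      moreover have "indicator {-R..R} x = (1::real)" using True by (simp add: indicator_def abs_le_iff)
      ultimately show ?thesis by (simp add: norm_mult mult_ac)
    next
      case False
      then have "indicator {-R..R} x = (0::real)" by (auto simp: indicator_def)
      then show ?thesis by (simp add: c_def)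
    qed
    then show "AE x in lebesgue. norm (indicator {-R..R} x * cmod (g x)) \<le> norm (c * cmod (g x * of_real (bump a 0 0 x)))"
      by (auto simp: c_def abs_mult intro!: AE_I2)
    show "(\<lambda>x. indicator {-R..R} x * cmod (g x)) \<in> borel_measurable lebesgue"
      by (intro borel_measurable_times borel_measurable_indicator borel_measurable_norm assms) auto
  qed
qed


text \<open>Testing the density against Schwartz approximations of its truncated complex conjugate bounds the
  square integrals of all truncations by the same constant; monotone convergence removes the truncation.\<close>

lemma schwartz_duality:
  fixes g :: "real \<Rightarrow> complex"
  assumes meas: "g \<in> borel_measurable lebesgue"
    and int: "\<And>\<phi>. \<phi> \<in> schwartz \<Longrightarrow> integrable lebesgue (\<lambda>x. g x * \<phi> x)"
    and bnd: "\<And>\<phi>. \<phi> \<in> schwartz \<Longrightarrow> cmod (LINT x|lebesgue. g x * \<phi> x) \<le> K * sqrt (LINT x|lebesgue. (cmod (\<phi> x))\<^sup>2)"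
    and K: "K \<ge> 0"
  shows "integrable lebesgue (\<lambda>x. (cmod (g x))\<^sup>2)" and "(LINT x|lebesgue. (cmod (g x))\<^sup>2) \<le> K\<^sup>2"
proof -
  note [measurable] = meas
  define A where "A n = {x. cmod (g x) \<le> real n} \<inter> {- real n..real n}" for n :: nat
  have [measurable]: "A n \<in> sets lebesgue" for n
  proof -
    have "{x \<in> space lebesgue. cmod (g x) \<le> real n} \<in> sets lebesgue" by measurable
    then show ?thesis unfolding A_def by auto
  qed
  define G where "G n x = indicator (A n) x * (cmod (g x))\<^sup>2" for n :: nat and x
  have I: "integrable lebesgue (G n) \<and> (LINT x|lebesgue. G n x) \<le> K\<^sup>2" for n
  proof -
    \<comment> \<open>testing against (approximations of) this function computes the truncated square integral\<close>
    define \<phi> where "\<phi> x = indicator (A n) x * cnj (g x)" for x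
    have \<phi>: "\<phi> \<in> borel_measurable lebesgue" "\<And>x. cmod (\<phi> x) \<le> real n" "\<And>x. real n + 1 < \<bar>x\<bar> \<Longrightarrow> \<phi> x = 0"
    proof -
      have [measurable]: "(\<lambda>x. cnj (g x)) \<in> borel_measurable lebesgue"
        by (rule borel_measurable_continuous_on[OF _ meas]) (intro continuous_intros)
      show "\<phi> \<in> borel_measurable lebesgue" unfolding \<phi>_def[abs_def] by measurable
    qed (auto simp: \<phi>_def A_def indicator_def)
    obtain \<psi> where \<psi>: "\<And>k. \<psi> k \<in> schwartz" "\<And>k x. cmod (\<psi> k x) \<le> real n + 1"
      "\<And>k x. real n + 1 + 2 \<le> \<bar>x\<bar> \<Longrightarrow> \<psi> k x = 0" "AE x in lebesgue. (\<lambda>k. \<psi> k x) \<longlonglongrightarrow> \<phi> x"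
      by (rule schwartz_ae_approx[where M = "real n + 1", OF \<phi>]) auto
    define R where "R = real n + 3"
    have [measurable]: "\<psi> k \<in> borel_measurable lebesgue" "\<phi> \<in> borel_measurable lebesgue" for k
      using schwartz_borel_lebesgue[OF \<psi>(1)] \<phi>(1) by auto
    have dom: "cmod (\<psi> k x) \<le> (real n + 1) * indicator {- R..R} x" for k x
      using \<psi>(2)[of k x] \<psi>(3)[of x k] by (auto simp: R_def indicator_def)
    have loc: "integrable lebesgue (\<lambda>x. (real n + 1) * (indicator {- R..R} x * cmod (g x)))"
      by (intro integrable_mult_right integrable_against_schwartz_local meas int) (auto simp: R_def)
    have lim1: "(\<lambda>k. LINT x|lebesgue. g x * \<psi> k x) \<longlonglongrightarrow> (LINT x|lebesgue. g x * \<phi> x)"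
      and int1: "integrable lebesgue (\<lambda>x. g x * \<phi> x)"
    proof -
      have m: "(\<lambda>x. g x * \<phi> x) \<in> borel_measurable lebesgue" "\<And>k. (\<lambda>x. g x * \<psi> k x) \<in> borel_measurable lebesgue"
        by measurable
      have l: "AE x in lebesgue. (\<lambda>k. g x * \<psi> k x) \<longlonglongrightarrow> g x * \<phi> x"
        using \<psi>(4) by eventually_elim (intro tendsto_mult tendsto_const)
      have d: "AE x in lebesgue. norm (g x * \<psi> k x) \<le> (real n + 1) * (indicator {- R..R} x * cmod (g x))" for k
        using mult_left_mono[OF dom, of "cmod (g _)"] by (intro AE_I2) (simp add: norm_mult mult_ac)
      show "(\<lambda>k. LINT x|lebesgue. g x * \<psi> k x) \<longlonglongrightarrow> (LINT x|lebesgue. g x * \<phi> x)"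
        by (rule integral_dominated_convergence[OF m loc l d])
      show "integrable lebesgue (\<lambda>x. g x * \<phi> x)"
        by (rule integrable_dominated_convergence[OF m loc l d])
    qed
    have lim2: "(\<lambda>k. LINT x|lebesgue. (cmod (\<psi> k x))\<^sup>2) \<longlonglongrightarrow> (LINT x|lebesgue. (cmod (\<phi> x))\<^sup>2)"
    proof (rule integral_dominated_convergence[where w = "\<lambda>x. (real n + 1)\<^sup>2 * indicator {- R..R} x"])
      show "integrable lebesgue (\<lambda>x. (real n + 1)\<^sup>2 * indicator {- R..R} x)"
        by (intro integrable_mult_right integrable_real_indicator) (auto simp: emeasure_lborel_Icc_eq)
      show "AE x in lebesgue. (\<lambda>k. (cmod (\<psi> k x))\<^sup>2) \<longlonglongrightarrow> (cmod (\<phi> x))\<^sup>2"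
        using \<psi>(4) by eventually_elim (intro tendsto_intros)
      have "(cmod (\<psi> k x))\<^sup>2 \<le> ((real n + 1) * indicator {- R..R} x)\<^sup>2" for k x
        by (intro power_mono dom) auto
      moreover have "((real n + 1) * indicator {- R..R} x)\<^sup>2 = (real n + 1)\<^sup>2 * indicator {- R..R} x" for x
        by (simp add: power_mult_distrib indicator_def)
      ultimately have "norm ((cmod (\<psi> k x))\<^sup>2) \<le> (real n + 1)\<^sup>2 * indicator {- R..R} x" for k x
        by (simp only: real_norm_def abs_of_nonneg[OF zero_le_power2])
      then show "AE x in lebesgue. norm ((cmod (\<psi> k x))\<^sup>2) \<le> (real n + 1)\<^sup>2 * indicator {- R..R} x" for k
        by (rule AE_I2)
    qed measurable
    have g\<phi>: "g x * \<phi> x = complex_of_real (G n x)" for x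
      unfolding \<phi>_def G_def by (simp add: indicator_def complex_norm_square[symmetric] del: of_real_power)
    have \<phi>2: "(cmod (\<phi> x))\<^sup>2 = G n x" for x
      unfolding \<phi>_def G_def by (simp add: indicator_def)
    have "cmod (LINT x|lebesgue. g x * \<phi> x) \<le> K * sqrt (LINT x|lebesgue. (cmod (\<phi> x))\<^sup>2)"
      by (rule LIMSEQ_le[OF tendsto_norm[OF lim1] tendsto_mult[OF tendsto_const tendsto_real_sqrt[OF lim2]]])
         (use bnd[OF \<psi>(1)] in auto)
    moreover have "0 \<le> (LINT x|lebesgue. G n x)" by (auto simp: G_def)
    ultimately have *: "(LINT x|lebesgue. G n x) \<le> K * sqrt (LINT x|lebesgue. G n x)"
      unfolding g\<phi> \<phi>2 by simp
    define J where "J = (LINT x|lebesgue. G n x)"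
    have J: "0 \<le> J" "J \<le> K * sqrt J" using * by (auto simp: J_def G_def)
    have "J \<le> K\<^sup>2"
    proof (cases "J = 0")
      case False
      then have "sqrt J > 0" using J by simp
      moreover have "sqrt J * sqrt J \<le> K * sqrt J" using J by simp
      ultimately have "sqrt J \<le> K" using mult_right_le_imp_le by blast
      then have "(sqrt J)\<^sup>2 \<le> K\<^sup>2" using J by (intro power_mono) auto
      then show ?thesis using J by simp
    qed simp
    moreover have "integrable lebesgue (G n)"
      using int1 unfolding g\<phi> complex_of_real_integrable_eq .
    ultimately show ?thesis by (simp add: J_def)
  qed
  have mono: "AE x in lebesgue. mono (\<lambda>n. G n x)"
    by (intro AE_I2 monoI) (auto simp: G_def A_def indicator_def)
  have lim: "AE x in lebesgue. (\<lambda>n. G n x) \<longlonglongrightarrow> (cmod (g x))\<^sup>2"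
  proof (rule AE_I2)
    fix x
    obtain N where N: "max (cmod (g x)) \<bar>x\<bar> \<le> real N" using real_arch_simple by blast
    have "G n x = (cmod (g x))\<^sup>2" if "n \<ge> N" for n
    proof -
      have "real N \<le> real n" using that by simp
      then show ?thesis using N by (auto simp: G_def A_def indicator_def)
    qed
    then show "(\<lambda>n. G n x) \<longlonglongrightarrow> (cmod (g x))\<^sup>2"
      by (intro tendsto_eventually eventually_sequentiallyI[of N])
  qed
  have "incseq (\<lambda>n. LINT x|lebesgue. G n x)"
  proof (rule incseq_SucI, rule integral_mono_AE)
    fix n
    show "AE x in lebesgue. G n x \<le> G (Suc n) x"
      using mono by eventually_elim (rule incseq_SucD)
  qed (use I in auto)
  then obtain L where L: "(\<lambda>n. LINT x|lebesgue. G n x) \<longlonglongrightarrow> L"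
    using incseq_convergent[of _ "K\<^sup>2"] I by blast
  have "L \<le> K\<^sup>2" by (rule LIMSEQ_le_const2[OF L]) (use I in auto)
  moreover have m: "(\<lambda>x. (cmod (g x))\<^sup>2) \<in> borel_measurable lebesgue" by measurable
  moreover have GI: "integrable lebesgue (G n)" for n using I by blast
  ultimately show "(LINT x|lebesgue. (cmod (g x))\<^sup>2) \<le> K\<^sup>2"
    using integral_monotone_convergence[OF GI mono lim L m] by simp
  show "integrable lebesgue (\<lambda>x. (cmod (g x))\<^sup>2)"
    by (rule integrable_monotone_convergence[OF GI mono lim L m])
qed

text \<open>The difference of two densities annihilates all Schwartz functions, so the duality estimate applies
  to it with the constant 0.\<close>

lemma has_density_unique:
  assumes g: "has_density \<Lambda> g" and h: "has_density \<Lambda> h"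
  shows "AE x in lebesgue. g x = h x"
proof -
  have [measurable]: "g \<in> borel_measurable lebesgue" "h \<in> borel_measurable lebesgue"
    using g h by (auto simp: has_density_def)
  have int: "integrable lebesgue (\<lambda>x. (g x - h x) * \<phi> x)" "(LINT x|lebesgue. (g x - h x) * \<phi> x) = 0"
    if "\<phi> \<in> schwartz" for \<phi>
    using g h that by (auto simp: has_density_def left_diff_distrib)
  have m: "(\<lambda>x. g x - h x) \<in> borel_measurable lebesgue" by measurable
  note d = schwartz_duality[OF m int(1), of 0]
  have "integrable lebesgue (\<lambda>x. (cmod (g x - h x))\<^sup>2)" "(LINT x|lebesgue. (cmod (g x - h x))\<^sup>2) \<le> 0"
    using d int(2) by auto
  moreover have "0 \<le> (LINT x|lebesgue. (cmod (g x - h x))\<^sup>2)" by simp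
  ultimately have "AE x in lebesgue. (cmod (g x - h x))\<^sup>2 = 0"
    using integral_nonneg_eq_0_iff_AE[of lebesgue "\<lambda>x. (cmod (g x - h x))\<^sup>2"] by auto
  then show ?thesis by eventually_elim simp
qed

lemma has_density_density_of: "has_density \<Lambda> g \<Longrightarrow> has_density \<Lambda> (density_of \<Lambda>)"
  unfolding density_of_def by (rule someI[of "has_density \<Lambda>"])

lemma has_density_cong_AE:
  assumes "has_density \<Lambda> g" "AE x in lebesgue. g x = h x" "h \<in> borel_measurable lebesgue"
  shows "has_density \<Lambda> h"
  unfolding has_density_def
proof (intro conjI ballI assms(3))
  have [measurable]: "g \<in> borel_measurable lebesgue" "h \<in> borel_measurable lebesgue"
    using assms by (auto simp: has_density_def)
  fix \<phi> assume \<phi>: "\<phi> \<in> schwartz"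
  have [measurable]: "\<phi> \<in> borel_measurable lebesgue" by (rule schwartz_borel_lebesgue[OF \<phi>])
  have ae: "AE x in lebesgue. g x * \<phi> x = h x * \<phi> x" using assms(2) by eventually_elim simp
  have "integrable lebesgue (\<lambda>x. g x * \<phi> x)" "\<Lambda> \<phi> = (LINT x|lebesgue. g x * \<phi> x)"
    using assms(1) \<phi> by (auto simp: has_density_def)
  then show "integrable lebesgue (\<lambda>x. h x * \<phi> x)" "\<Lambda> \<phi> = (LINT x|lebesgue. h x * \<phi> x)"
    using integrable_cong_AE[OF _ _ ae] integral_cong_AE[OF _ _ ae] by auto
qed

section \<open>Distributions with a given Fourier transform\<close>

lemma tempered_eqI:
  assumes "\<And>\<phi>. \<phi> \<in> schwartz \<Longrightarrow> pair f \<phi> = pair g \<phi>"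
  shows "f = g"
proof -
  have "pair f \<phi> = pair g \<phi>" for \<phi>
    using assms pair[of f] pair[of g] by (cases "\<phi> \<in> schwartz") auto
  then show ?thesis by (simp add: pair_inject[symmetric] fun_eq_iff)
qed

lemma ex_tempered:
  assumes lin: "\<And>\<phi> \<psi> a b. \<phi> \<in> schwartz \<Longrightarrow> \<psi> \<in> schwartz \<Longrightarrow> \<Lambda> (\<lambda>x. a * \<phi> x + b * \<psi> x) = a * \<Lambda> \<phi> + b * \<Lambda> \<psi>"
    and bnd: "\<And>\<phi>. \<phi> \<in> schwartz \<Longrightarrow> cmod (\<Lambda> \<phi>) \<le> B * schwartz_norm N \<phi>"
  obtains f where "\<And>\<phi>. \<phi> \<in> schwartz \<Longrightarrow> pair f \<phi> = \<Lambda> \<phi>"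
proof -
  let ?L = "\<lambda>\<phi>. if \<phi> \<in> schwartz then \<Lambda> \<phi> else 0"
  have "tempered_functional ?L"
    unfolding tempered_functional_def
    using lin bnd schwartz_lincomb by (auto intro!: exI[of _ B] exI[of _ N])
  then have "pair (Abs_tempered ?L) = ?L"
    by (intro Abs_tempered_inverse) auto
  then show ?thesis by (intro that[of "Abs_tempered ?L"]) simp
qed

text \<open>Cauchy-Schwarz after distributing the weight: \<open>(1 + \<xi>\<^sup>2) powr (s / 2)\<close> goes to \<open>g\<close>, its inverse to \<open>\<psi>\<close>,
  and one spare factor \<open>(1 + \<xi>\<^sup>2)\<^sup>-\<^sup>1\<close> provides integrability.\<close>

lemma weighted_pairing:
  fixes g \<psi> :: "real \<Rightarrow> complex"
  assumes [measurable]: "g \<in> borel_measurable lebesgue" "\<psi> \<in> borel_measurable lebesgue"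
    and W: "integrable lebesgue (\<lambda>\<xi>. (1 + \<xi>\<^sup>2) powr s * (cmod (g \<xi>))\<^sup>2)"
    and N: "- s \<le> real N" and D: "\<And>\<xi>. cmod (\<psi> \<xi>) * (1 + \<xi>\<^sup>2) ^ (N + 1) \<le> D"
  shows "integrable lebesgue (\<lambda>\<xi>. g \<xi> * \<psi> \<xi>)"
    and "cmod (LINT \<xi>|lebesgue. g \<xi> * \<psi> \<xi>) \<le> sqrt (LINT \<xi>|lebesgue. (1 + \<xi>\<^sup>2) powr s * (cmod (g \<xi>))\<^sup>2) * sqrt pi * D"
proof -
  have j: "1 \<le> 1 + \<xi>\<^sup>2" "0 < 1 + \<xi>\<^sup>2" for \<xi> :: real by (auto simp: add_pos_nonneg)
  have D0: "0 \<le> D" using order_trans[OF _ D[of 0]] by simp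
  have [measurable]: "(\<lambda>\<xi>::real. (1 + \<xi>\<^sup>2) powr t) \<in> borel_measurable lebesgue" for t
    by (rule measurable_completion) measurable
  define f where "f \<xi> = complex_of_real ((1 + \<xi>\<^sup>2) powr (s / 2)) * g \<xi>" for \<xi>
  define h where "h \<xi> = complex_of_real ((1 + \<xi>\<^sup>2) powr (- s / 2)) * \<psi> \<xi>" for \<xi>
  have [measurable]: "f \<in> borel_measurable lebesgue" "h \<in> borel_measurable lebesgue"
    unfolding f_def h_def by measurable
  have fh: "f \<xi> * h \<xi> = g \<xi> * \<psi> \<xi>" for \<xi>
  proof -
    have "(1 + \<xi>\<^sup>2) powr (s / 2) * (1 + \<xi>\<^sup>2) powr (- s / 2) = 1"
      using j[of \<xi>] by (simp add: powr_add[symmetric])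
    then have "complex_of_real ((1 + \<xi>\<^sup>2) powr (s / 2)) * complex_of_real ((1 + \<xi>\<^sup>2) powr (- s / 2)) = 1"
      unfolding of_real_mult[symmetric] by simp
    moreover have "f \<xi> * h \<xi> = (complex_of_real ((1 + \<xi>\<^sup>2) powr (s / 2)) * complex_of_real ((1 + \<xi>\<^sup>2) powr (- s / 2))) * (g \<xi> * \<psi> \<xi>)"
      unfolding f_def h_def by (simp only: mult_ac)
    ultimately show ?thesis by simp
  qed
  have f2: "(cmod (f \<xi>))\<^sup>2 = (1 + \<xi>\<^sup>2) powr s * (cmod (g \<xi>))\<^sup>2" for \<xi>
    using j[of \<xi>] by (simp add: f_def norm_mult power_mult_distrib powr_power)
  have h2: "(cmod (h \<xi>))\<^sup>2 \<le> D\<^sup>2 * (1 / (1 + \<xi>\<^sup>2))" for \<xi>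
  proof -
    have "(cmod (h \<xi>))\<^sup>2 = (1 + \<xi>\<^sup>2) powr (- s) * (cmod (\<psi> \<xi>))\<^sup>2"
      using j[of \<xi>] by (simp add: h_def norm_mult power_mult_distrib powr_power)
    also have "\<dots> \<le> (1 + \<xi>\<^sup>2) powr (2 * real N + 1) * (cmod (\<psi> \<xi>))\<^sup>2"
      using j[of \<xi>] N by (intro mult_right_mono powr_mono) auto
    also have "\<dots> = (cmod (\<psi> \<xi>) * (1 + \<xi>\<^sup>2) ^ (N + 1))\<^sup>2 / (1 + \<xi>\<^sup>2)"
    proof -
      have "(1 + \<xi>\<^sup>2) powr (2 * real N + 1) = (1 + \<xi>\<^sup>2) ^ (2 * N + 1)"
        using powr_realpow[OF j(2)[of \<xi>], of "2 * N + 1"] by (simp add: add.commute)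
      moreover have "(cmod (\<psi> \<xi>) * (1 + \<xi>\<^sup>2) ^ (N + 1))\<^sup>2 = (1 + \<xi>\<^sup>2) ^ (2 * N + 1) * (cmod (\<psi> \<xi>))\<^sup>2 * (1 + \<xi>\<^sup>2)"
      proof -
        define y where "y = 1 + \<xi>\<^sup>2"
        show ?thesis unfolding y_def[symmetric]
          by (simp add: power_mult_distrib power2_eq_square power_add mult_2 mult_2_right mult_ac)
      qed
      ultimately show ?thesis using j(2)[of \<xi>] by simp
    qed
    also have "\<dots> \<le> D\<^sup>2 / (1 + \<xi>\<^sup>2)"
      using j[of \<xi>] D[of \<xi>] by (intro divide_right_mono power_mono) auto
    finally show ?thesis by simp
  qed
  have inv: "integrable lebesgue (\<lambda>\<xi>::real. 1 / (1 + \<xi>\<^sup>2))" "(LINT \<xi>|lebesgue. 1 / (1 + \<xi>\<^sup>2)) = pi"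
    using integrable_inverse_one_plus_square LBINT_inverse_1_plus_square
    by (simp_all add: integrable_completion integral_completion interval_lebesgue_integral_def einterval_def set_lebesgue_integral_def inverse_eq_divide)
  have hi: "integrable lebesgue (\<lambda>\<xi>. (cmod (h \<xi>))\<^sup>2)"
    by (rule Bochner_Integration.integrable_bound[OF integrable_mult_right[OF inv(1), of "D\<^sup>2"]]) (use h2 j in \<open>auto intro!: AE_I2\<close>)
  have fi: "integrable lebesgue (\<lambda>\<xi>. (cmod (f \<xi>))\<^sup>2)" unfolding f2 by (rule W)
  have fm: "f \<in> borel_measurable lebesgue" "h \<in> borel_measurable lebesgue" by measurable
  note sq = square_integrable_product[OF fm fi hi]
  show "integrable lebesgue (\<lambda>\<xi>. g \<xi> * \<psi> \<xi>)" using sq(1) unfolding fh .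
  have "(LINT \<xi>|lebesgue. (cmod (h \<xi>))\<^sup>2) \<le> (LINT \<xi>|lebesgue. D\<^sup>2 * (1 / (1 + \<xi>\<^sup>2)))"
    by (intro integral_mono hi integrable_mult_right inv h2)
  also have "\<dots> = D\<^sup>2 * pi" unfolding integral_mult_right_zero inv(2) ..
  finally have "sqrt (LINT \<xi>|lebesgue. (cmod (h \<xi>))\<^sup>2) \<le> sqrt (D\<^sup>2 * pi)" by (rule real_sqrt_le_mono)
  also have "\<dots> = sqrt pi * D" using D0 by (simp add: real_sqrt_mult mult.commute)
  finally have "sqrt (LINT \<xi>|lebesgue. (cmod (f \<xi>))\<^sup>2) * sqrt (LINT \<xi>|lebesgue. (cmod (h \<xi>))\<^sup>2)
      \<le> sqrt (LINT \<xi>|lebesgue. (cmod (f \<xi>))\<^sup>2) * (sqrt pi * D)"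
    by (rule mult_left_mono) simp
  then show "cmod (LINT \<xi>|lebesgue. g \<xi> * \<psi> \<xi>) \<le> sqrt (LINT \<xi>|lebesgue. (1 + \<xi>\<^sup>2) powr s * (cmod (g \<xi>))\<^sup>2) * sqrt pi * D"
    using sq(3) unfolding fh f2 by (simp add: mult.assoc)
qed

text \<open>The distribution is \<open>\<phi> \<mapsto> \<integral> g (ift \<phi>)\<close>.\<close>

lemma ex_fourier_density:
  assumes g: "g \<in> borel_measurable lebesgue"
    and W: "integrable lebesgue (\<lambda>\<xi>. (1 + \<xi>\<^sup>2) powr s * (cmod (g \<xi>))\<^sup>2)"
  shows "\<exists>f. has_density (fourier_dist f) g"
proof -
  obtain N :: nat where N: "- s \<le> real N" using real_arch_simple by blast
  define W where "W = (LINT \<xi>|lebesgue. (1 + \<xi>\<^sup>2) powr s * (cmod (g \<xi>))\<^sup>2)"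
  define \<Lambda> where "\<Lambda> \<phi> = (LINT \<xi>|lebesgue. g \<xi> * ift \<phi> \<xi>)" for \<phi>
  have wp: "integrable lebesgue (\<lambda>\<xi>. g \<xi> * ift \<phi> \<xi>)"
      "cmod (\<Lambda> \<phi>) \<le> (sqrt W * sqrt pi * (2 * 2 ^ (N + 1))) * schwartz_norm (2 * (N + 1) + 2) \<phi>"
    if \<phi>: "\<phi> \<in> schwartz" for \<phi>
    using weighted_pairing[OF g schwartz_borel_lebesgue[OF schwartz_ift[OF \<phi>]] W N ift_decay_schwartz_norm[OF \<phi>]]
    by (simp_all add: W_def \<Lambda>_def mult.assoc)
  obtain f where f: "\<And>\<phi>. \<phi> \<in> schwartz \<Longrightarrow> pair f \<phi> = \<Lambda> \<phi>"
  proof (rule ex_tempered[of \<Lambda>])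
    fix \<phi> \<psi> :: "real \<Rightarrow> complex" and a b assume s: "\<phi> \<in> schwartz" "\<psi> \<in> schwartz"
    have "ift (\<lambda>x. a * \<phi> x + b * \<psi> x) \<xi> = a * ift \<phi> \<xi> + b * ift \<psi> \<xi>" for \<xi>
    proof -
      have "ft (\<lambda>x. a * \<phi> x + b * \<psi> x) \<xi> = (LINT x|lborel. a * (wave x \<xi> * \<phi> x)
          + b * (wave x \<xi> * \<psi> x))" for \<xi>
        unfolding ft_def by (intro Bochner_Integration.integral_cong) (auto simp: algebra_simps)
      also have "\<dots> \<xi> = a * ft \<phi> \<xi> + b * ft \<psi> \<xi>" for \<xi>
        using fourier_integrable[OF schwartz_integrable[OF s(1)], of \<xi>] fourier_integrable[OF schwartz_integrable[OF s(2)], of \<xi>]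
        by (simp add: ft_def)
      finally show ?thesis by (simp add: ift_def add_divide_distrib)
    qed
    then have "\<Lambda> (\<lambda>x. a * \<phi> x + b * \<psi> x) = (LINT \<xi>|lebesgue. a * (g \<xi> * ift \<phi> \<xi>) + b * (g \<xi> * ift \<psi> \<xi>))"
      unfolding \<Lambda>_def by (intro Bochner_Integration.integral_cong) (auto simp: algebra_simps)
    then show "\<Lambda> (\<lambda>x. a * \<phi> x + b * \<psi> x) = a * \<Lambda> \<phi> + b * \<Lambda> \<psi>"
      using wp(1)[OF s(1)] wp(1)[OF s(2)] by (simp add: \<Lambda>_def)
  qed (use wp(2) in auto)
  have "has_density (fourier_dist f) g"
    unfolding has_density_def fourier_dist_def
  proof (intro conjI ballI g)
    fix \<phi> assume \<phi>: "\<phi> \<in> schwartz"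
    show "integrable lebesgue (\<lambda>x. g x * \<phi> x)" "pair f (fourier \<phi>) = (LINT x|lebesgue. g x * \<phi> x)"
      using wp(1)[OF schwartz_fourier[OF \<phi>]] f[OF schwartz_fourier[OF \<phi>]] ift_fourier[OF \<phi>]
      by (simp_all add: \<Lambda>_def)
  qed
  then show ?thesis by blast
qed

lemma pair_fourier_density:
  assumes "has_density (fourier_dist f) g" "\<phi> \<in> schwartz"
  shows "integrable lebesgue (\<lambda>\<xi>. g \<xi> * ift \<phi> \<xi>)" "pair f \<phi> = (LINT \<xi>|lebesgue. g \<xi> * ift \<phi> \<xi>)"
  using assms schwartz_ift[OF assms(2)] fourier_ift[OF assms(2)]
  by (auto simp: has_density_def fourier_dist_def)

lemma fourier_density_inject:
  assumes "has_density (fourier_dist f) g" "has_density (fourier_dist f') g"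
  shows "f = f'"
  using pair_fourier_density(2)[OF assms(1)] pair_fourier_density(2)[OF assms(2)]
  by (intro tempered_eqI) simp

section \<open>Smooth dependence of the solution of a quadratic equation\<close>

text \<open>The sum of \<open>\<phi> I J\<close> over all \<open>2\<^sup>n\<close> ways to distribute a list of length \<open>n\<close> over two complementary
  sublists. This is the shape of the Leibniz rule: if \<open>G\<close> lists the derivatives of a map, then the
  derivatives of \<open>q (G, G)\<close> for a bilinear \<open>q\<close> are the sums \<open>sumsplit (\<lambda>I J. q (G I) (G J))\<close>.\<close>

fun sumsplit :: "('a list \<Rightarrow> 'a list \<Rightarrow> 'e::real_normed_vector) \<Rightarrow> 'a list \<Rightarrow> 'e" where
  "sumsplit \<phi> [] = \<phi> [] []"
| "sumsplit \<phi> (v # vs) = sumsplit (\<lambda>I J. \<phi> (v # I) J + \<phi> I (v # J)) vs"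

lemma sumsplit_cong:
  assumes "\<And>I J. set I \<subseteq> set vs \<Longrightarrow> set J \<subseteq> set vs \<Longrightarrow> length I + length J = length vs \<Longrightarrow> \<phi> I J = \<psi> I J"
  shows "sumsplit \<phi> vs = sumsplit \<psi> vs"
  using assms
proof (induction vs arbitrary: \<phi> \<psi>)
  case (Cons v vs)
  have "sumsplit (\<lambda>I J. \<phi> (v # I) J + \<phi> I (v # J)) vs = sumsplit (\<lambda>I J. \<psi> (v # I) J + \<psi> I (v # J)) vs"
    by (rule Cons.IH) (intro arg_cong2[where f = "(+)"] Cons.prems; auto)
  then show ?case by simp
qed auto

lemma sumsplit_fundef_cong [fundef_cong]:
  assumes "vs = ws" "\<And>I J. length I + length J = length ws \<Longrightarrow> \<phi> I J = \<psi> I J"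
  shows "sumsplit \<phi> vs = sumsplit \<psi> ws"
  using assms by (auto intro: sumsplit_cong)

lemma sumsplit_add: "sumsplit (\<lambda>I J. \<phi> I J + \<psi> I J) vs = sumsplit \<phi> vs + sumsplit \<psi> vs"
proof (induction vs arbitrary: \<phi> \<psi>)
  case (Cons v vs)
  have "sumsplit (\<lambda>I J. \<phi> I J + \<psi> I J) (v # vs)
      = sumsplit (\<lambda>I J. (\<phi> (v # I) J + \<phi> I (v # J)) + (\<psi> (v # I) J + \<psi> I (v # J))) vs"
    by (simp add: algebra_simps)
  then show ?case by (simp only: Cons.IH sumsplit.simps)
qed simp

lemma sumsplit_scaleR: "sumsplit (\<lambda>I J. c *\<^sub>R \<phi> I J) vs = c *\<^sub>R sumsplit \<phi> vs"
  by (induction vs arbitrary: \<phi>) (simp_all flip: scaleR_add_right)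

lemma sumsplit_diff: "sumsplit (\<lambda>I J. \<phi> I J - \<psi> I J) vs = sumsplit \<phi> vs - sumsplit \<psi> vs"
  using sumsplit_add[of \<phi> "\<lambda>I J. (- 1) *\<^sub>R \<psi> I J" vs] sumsplit_scaleR[of "- 1" \<psi> vs] by simp

lemma sumsplit_left_empty: "sumsplit (\<lambda>I J. if I = [] then \<phi> I J else 0) vs = \<phi> [] vs"
proof (induction vs arbitrary: \<phi>)
  case (Cons v vs)
  show ?case using Cons.IH[of "\<lambda>I J. \<phi> I (v # J)"] by simp
qed simp

lemma sumsplit_right_empty: "sumsplit (\<lambda>I J. if J = [] then \<phi> I J else 0) vs = \<phi> vs []"
proof (induction vs arbitrary: \<phi>)
  case (Cons v vs)
  show ?case using Cons.IH[of "\<lambda>I J. \<phi> (v # I) J"] by simp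
qed simp

text \<open>Without the two trivial splittings, in which one part is the whole list.\<close>

definition proper_part :: "('a list \<Rightarrow> 'a list \<Rightarrow> 'e::real_normed_vector) \<Rightarrow> 'a list \<Rightarrow> 'a list \<Rightarrow> 'e" where
  "proper_part \<phi> I J = (if I = [] then 0 else if J = [] then 0 else \<phi> I J)"

lemma sumsplit_proper:
  assumes "vs \<noteq> []"
  shows "sumsplit \<phi> vs = sumsplit (proper_part \<phi>) vs + \<phi> [] vs + \<phi> vs []"
proof -
  have "sumsplit \<phi> vs = sumsplit (\<lambda>I J. (proper_part \<phi> I J + (if I = [] then \<phi> I J else 0)) + (if J = [] then \<phi> I J else 0)) vs"
    by (rule sumsplit_cong) (use assms in \<open>auto simp: proper_part_def\<close>)
  then show ?thesis
    by (simp only: sumsplit_add sumsplit_left_empty sumsplit_right_empty)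
qed

lemma sumsplit_norm_le:
  assumes "\<And>I J. set I \<subseteq> set vs \<Longrightarrow> set J \<subseteq> set vs \<Longrightarrow> length I + length J = length vs \<Longrightarrow>
      norm (\<phi> I J) \<le> K * prod_list (map N I) * prod_list (map N J)"
  shows "norm (sumsplit \<phi> vs) \<le> 2 ^ length vs * K * prod_list (map N vs)"
  using assms
proof (induction vs arbitrary: \<phi> K)
  case Nil then show ?case by simp
next
  case (Cons v vs)
  have "norm (sumsplit (\<lambda>I J. \<phi> (v # I) J + \<phi> I (v # J)) vs) \<le> 2 ^ length vs * (2 * K * N v) * prod_list (map N vs)"
  proof (rule Cons.IH)
    fix I J assume IJ: "set I \<subseteq> set vs" "set J \<subseteq> set vs" "length I + length J = length vs"
    have "norm (\<phi> (v # I) J + \<phi> I (v # J)) \<le> K * prod_list (map N (v # I)) * prod_list (map N J) + K * prod_list (map N I) * prod_list (map N (v # J))"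
      by (intro norm_triangle_le add_mono Cons.prems) (use IJ in auto)
    then show "norm (\<phi> (v # I) J + \<phi> I (v # J)) \<le> 2 * K * N v * prod_list (map N I) * prod_list (map N J)"
      by (simp add: algebra_simps)
  qed
  then show ?case by (simp add: algebra_simps)
qed

text \<open>The equation \<open>f = q (u, f) (u, f)\<close> for a bounded bilinear \<open>q\<close>, with datum \<open>u\<close> in a normed space \<open>X\<close> given
  by a carrier and a norm and with unknown \<open>f\<close> in a Banach space. Smallness of \<open>\<alpha> b R\<close> makes it a
  contraction on the ball of radius \<open>M\<close> below, uniformly for data in the ball \<open>U\<close> of radius \<open>R\<close>.\<close>

locale quadratic_equation =
  fixes X :: "'a::real_vector set" and NX :: "'a \<Rightarrow> real"
    and q :: "'a \<times> 'e::banach \<Rightarrow> 'a \<times> 'e \<Rightarrow> 'e" and \<alpha> b R :: real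
  assumes X_zero: "0 \<in> X" and X_lin: "x \<in> X \<Longrightarrow> y \<in> X \<Longrightarrow> c *\<^sub>R x + d *\<^sub>R y \<in> X"
    and NX_zero: "NX 0 = 0" and NX_nonneg: "x \<in> X \<Longrightarrow> 0 \<le> NX x"
    and q_left: "fst z \<in> X \<Longrightarrow> fst z' \<in> X \<Longrightarrow> fst w \<in> X \<Longrightarrow> q (c *\<^sub>R z + d *\<^sub>R z') w = c *\<^sub>R q z w + d *\<^sub>R q z' w"
    and q_right: "fst z \<in> X \<Longrightarrow> fst z' \<in> X \<Longrightarrow> fst w \<in> X \<Longrightarrow> q w (c *\<^sub>R z + d *\<^sub>R z') = c *\<^sub>R q w z + d *\<^sub>R q w z'"
    and q_bound: "fst z \<in> X \<Longrightarrow> fst w \<in> X \<Longrightarrow>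
      norm (q z w) \<le> (\<alpha> * NX (fst z) + b * norm (snd z)) * (\<alpha> * NX (fst w) + b * norm (snd w))"
    and pos: "0 \<le> \<alpha>" "0 \<le> b" "0 < R" and small: "8 * \<alpha> * b * R \<le> 1"
begin

definition N :: "'a \<times> 'e \<Rightarrow> real" where "N z = \<alpha> * NX (fst z) + b * norm (snd z)"

definition U :: "'a set" where "U = {u \<in> X. NX u \<le> R}"

abbreviation P :: "'a list \<Rightarrow> real" where "P vs \<equiv> prod_list (map NX vs)"

lemma q_le: "fst z \<in> X \<Longrightarrow> fst w \<in> X \<Longrightarrow> norm (q z w) \<le> N z * N w"
  unfolding N_def by (rule q_bound)

lemma N_nonneg: "fst z \<in> X \<Longrightarrow> 0 \<le> N z"
  unfolding N_def using pos NX_nonneg by simp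

lemma N_snd: "N (0, e) = b * norm e"
  by (simp add: N_def NX_zero)

lemma q_add: "fst z \<in> X \<Longrightarrow> fst z' \<in> X \<Longrightarrow> fst w \<in> X \<Longrightarrow> q (z + z') w = q z w + q z' w"
   "fst z \<in> X \<Longrightarrow> fst z' \<in> X \<Longrightarrow> fst w \<in> X \<Longrightarrow> q w (z + z') = q w z + q w z'"
  using q_left[of z z' w 1 1] q_right[of z z' w 1 1] by auto

lemma q_diff: "fst z \<in> X \<Longrightarrow> fst z' \<in> X \<Longrightarrow> fst w \<in> X \<Longrightarrow> q (z - z') w = q z w - q z' w"
   "fst z \<in> X \<Longrightarrow> fst z' \<in> X \<Longrightarrow> fst w \<in> X \<Longrightarrow> q w (z - z') = q w z - q w z'"
  using q_left[of z z' w 1 "-1"] q_right[of z z' w 1 "-1"] by auto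

lemma X_diff: "x \<in> X \<Longrightarrow> y \<in> X \<Longrightarrow> x - y \<in> X"
  using X_lin[of x y 1 "-1"] by simp

lemma X_add: "x \<in> X \<Longrightarrow> y \<in> X \<Longrightarrow> x + y \<in> X"
  using X_lin[of x y 1 1] by simp

lemma P_nonneg: "vs \<in> lists X \<Longrightarrow> 0 \<le> P vs"
  by (induction vs) (auto intro!: mult_nonneg_nonneg NX_nonneg)

definition M :: real where "M = 4 * \<alpha>\<^sup>2 * R\<^sup>2"

lemma bM: "b * M \<le> \<alpha> * R"
proof -
  have "b * M = (8 * \<alpha> * b * R) * (\<alpha> * R) / 2" by (simp add: M_def power2_eq_square)
  also have "\<dots> \<le> 1 * (\<alpha> * R) / 2"
    using small pos by (intro divide_right_mono mult_right_mono) auto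
  also have "\<dots> \<le> \<alpha> * R" using pos by simp
  finally show ?thesis .
qed

lemma N_ball: "u \<in> U \<Longrightarrow> norm f \<le> M \<Longrightarrow> N (u, f) \<le> 2 * \<alpha> * R"
  using mult_left_mono[of "NX u" R \<alpha>] mult_left_mono[of "norm f" M b] bM pos
  by (auto simp: N_def U_def)

lemma ex_sol:
  assumes "u \<in> U"
  shows "\<exists>!f. f \<in> cball 0 M \<and> q (u, f) (u, f) = f"
proof (rule Banach_fix[where c = "1/2" and f = "\<lambda>f. q (u, f) (u, f)"])
  have uX: "u \<in> X" using assms by (simp add: U_def)
  have M0: "0 \<le> M" by (simp add: M_def)
  show "uniform_space_class.complete (cball 0 M :: 'e set)" by (simp add: complete_eq_closed)
  show "(cball 0 M :: 'e set) \<noteq> {}" using M0 by auto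
  show "(\<lambda>f. q (u, f) (u, f)) ` cball 0 M \<subseteq> cball 0 M"
  proof clarsimp
    fix f :: 'e assume f: "norm f \<le> M"
    have "norm (q (u, f) (u, f)) \<le> N (u, f) * N (u, f)" by (rule q_le) (use uX in auto)
    also have "\<dots> \<le> (2 * \<alpha> * R) * (2 * \<alpha> * R)"
      using N_ball[OF assms f] N_nonneg[of "(u, f)"] uX pos by (intro mult_mono) auto
    finally show "norm (q (u, f) (u, f)) \<le> M" by (simp add: M_def power2_eq_square mult_ac)
  qed
  show "dist (q (u, f) (u, f)) (q (u, g) (u, g)) \<le> 1 / 2 * dist f g"
    if "f \<in> cball 0 M" "g \<in> cball 0 M" for f g
  proof -
    from that have f: "norm f \<le> M" "norm g \<le> M" by auto
    have "q (0, f - g) (u, f) = q (u, f) (u, f) - q (u, g) (u, f)" "q (u, g) (0, f - g) = q (u, g) (u, f) - q (u, g) (u, g)"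
      using uX q_diff(1)[of "(u, f)" "(u, g)" "(u, f)"] q_diff(2)[of "(u, f)" "(u, g)" "(u, g)"] by simp_all
    then have "q (u, f) (u, f) - q (u, g) (u, g) = q (0, f - g) (u, f) + q (u, g) (0, f - g)" by simp
    then have "norm (q (u, f) (u, f) - q (u, g) (u, g)) \<le> N (0, f - g) * N (u, f) + N (u, g) * N (0, f - g)"
      using uX X_zero by (simp only:) (intro norm_triangle_le add_mono q_le; simp)
    also have "\<dots> \<le> N (0, f - g) * (2 * \<alpha> * R) + (2 * \<alpha> * R) * N (0, f - g)"
      using N_ball[OF assms f(1)] N_ball[OF assms f(2)] N_nonneg[of "(0, f - g)"] X_zero
      by (intro add_mono mult_left_mono mult_right_mono) auto
    also have "\<dots> = (8 * \<alpha> * b * R) * norm (f - g) / 2" by (simp add: N_snd)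
    also have "\<dots> \<le> 1 * norm (f - g) / 2"
      using small by (intro divide_right_mono mult_right_mono) auto
    finally show "dist (q (u, f) (u, f)) (q (u, g) (u, g)) \<le> 1 / 2 * dist f g"
      by (simp add: dist_norm)
  qed
qed auto

definition sol :: "'a \<Rightarrow> 'e" where "sol u = (THE f. f \<in> cball 0 M \<and> q (u, f) (u, f) = f)"

lemma sol: "u \<in> U \<Longrightarrow> norm (sol u) \<le> M" "u \<in> U \<Longrightarrow> q (u, sol u) (u, sol u) = sol u"
  using theI'[OF ex_sol, of u] by (auto simp: sol_def)

lemma N_sol: "u \<in> U \<Longrightarrow> N (u, sol u) \<le> 2 * \<alpha> * R"
  by (intro N_ball sol)

text \<open>The linearisation at a solution has norm at most 1/2 in the unknown; hence all linearised equations
  are solvable with uniform bounds. The two solutions may differ because difference quotients involve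
  both \<open>u\<close> and \<open>u + h\<close>.\<close>

lemma lin_contract:
  assumes u: "u \<in> U" and u': "u' \<in> U"
  shows "norm (q (u, sol u) (0, e) + q (0, e) (u', sol u')) \<le> norm e / 2"
proof -
  have uX: "u \<in> X" "u' \<in> X" using u u' by (auto simp: U_def)
  have "norm (q (u, sol u) (0, e) + q (0, e) (u', sol u')) \<le> N (u, sol u) * N (0, e) + N (0, e) * N (u', sol u')"
    by (intro norm_triangle_le add_mono q_le) (use uX X_zero in auto)
  also have "\<dots> \<le> (2 * \<alpha> * R) * N (0, e) + N (0, e) * (2 * \<alpha> * R)"
    using N_sol[OF u] N_sol[OF u'] N_nonneg[of "(0, e)"] X_zero by (intro add_mono mult_left_mono mult_right_mono) auto
  also have "\<dots> = (8 * \<alpha> * b * R) * norm e / 2" by (simp add: N_snd)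
  also have "\<dots> \<le> 1 * norm e / 2"
    using small by (intro divide_right_mono mult_right_mono) auto
  finally show ?thesis by simp
qed

lemma q_split_pair:
  assumes "x \<in> X" "fst w \<in> X"
  shows "q w (x, e) = q w (x, 0) + q w (0, e)" "q (x, e) w = q (x, 0) w + q (0, e) w"
proof -
  have "(x, e) = (x, 0) + (0, e)" by simp
  then show "q w (x, e) = q w (x, 0) + q w (0, e)" "q (x, e) w = q (x, 0) w + q (0, e) w"
    using assms X_zero by (metis fst_conv q_add)+
qed

lemma ex_lin_sol:
  assumes u: "u \<in> U" and x: "x \<in> X"
  shows "\<exists>!f. f = r + q (u, sol u) (x, f) + q (x, f) (u, sol u)"
proof -
  let ?T = "\<lambda>f. r + q (u, sol u) (x, f) + q (x, f) (u, sol u)"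
  have uX: "u \<in> X" using u by (simp add: U_def)
  have "\<exists>!f. ?T f = f"
  proof (rule banach_fix_type[where c = "1/2"])
    show "\<forall>f g. dist (?T f) (?T g) \<le> 1 / 2 * dist f g"
    proof (intro allI)
      fix f g
      have "?T f - ?T g = q (u, sol u) (0, f - g) + q (0, f - g) (u, sol u)"
      proof -
        have "q (u, sol u) (x, f) - q (u, sol u) (x, g) = q (u, sol u) (0, f - g)"
          using uX x q_diff(2)[of "(x, f)" "(x, g)" "(u, sol u)"] by simp
        moreover have "q (x, f) (u, sol u) - q (x, g) (u, sol u) = q (0, f - g) (u, sol u)"
          using uX x q_diff(1)[of "(x, f)" "(x, g)" "(u, sol u)"] by simp
        ultimately show ?thesis by (simp add: algebra_simps)
      qed
      then show "dist (?T f) (?T g) \<le> 1 / 2 * dist f g"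
        using lin_contract[OF u u, of "f - g"] by (simp add: dist_norm)
    qed
  qed auto
  then show ?thesis by metis
qed

definition lin_sol :: "'a \<Rightarrow> 'a \<Rightarrow> 'e \<Rightarrow> 'e" where
  "lin_sol u x r = (THE f. f = r + q (u, sol u) (x, f) + q (x, f) (u, sol u))"

lemma lin_sol: "u \<in> U \<Longrightarrow> x \<in> X \<Longrightarrow>
    lin_sol u x r = r + q (u, sol u) (x, lin_sol u x r) + q (x, lin_sol u x r) (u, sol u)"
  unfolding lin_sol_def by (rule theI'[OF ex_lin_sol])

lemma lin_estimate:
  assumes u: "u \<in> U" "u' \<in> U" and e: "e = r + q (u, sol u) (0, e) + q (0, e) (u', sol u')"
  shows "norm e \<le> 2 * norm r"
proof -
  have "e = r + (q (u, sol u) (0, e) + q (0, e) (u', sol u'))"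
    using e by (simp only: add.assoc[symmetric])
  then have "norm e \<le> norm r + norm (q (u, sol u) (0, e) + q (0, e) (u', sol u'))"
    by (metis norm_triangle_ineq)
  then show ?thesis using lin_contract[OF u, of e] by linarith
qed

text \<open>The derivatives of the identity \<open>u \<mapsto> u\<close> in the directions \<open>vs\<close>.\<close>

definition base :: "'a \<Rightarrow> 'a list \<Rightarrow> 'a" where
  "base u vs = (case vs of [] \<Rightarrow> u | [v] \<Rightarrow> v | _ \<Rightarrow> 0)"

lemma base_simps [simp]: "base u [] = u" "base u [v] = v" "base u (v # w # vs) = 0"
  by (auto simp: base_def)

lemma base_X: "u \<in> U \<Longrightarrow> vs \<in> lists X \<Longrightarrow> base u vs \<in> X"
  by (auto simp: base_def U_def X_zero split: list.splits)

text \<open>The derivatives of \<open>sol\<close> at \<open>u\<close> in the directions \<open>vs\<close>. Formal differentiation of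
  \<open>sol u = q (u, sol u) (u, sol u)\<close> yields a linear equation for the highest derivative, whose source
  consists of the derivatives of lower order.\<close>

function dsol :: "'a \<Rightarrow> 'a list \<Rightarrow> 'e" where
  "dsol u vs = (if vs = [] then sol u else
     lin_sol u (base u vs) (sumsplit (\<lambda>I J. if I = [] then 0 else if J = [] then 0 else
       q (base u I, dsol u I) (base u J, dsol u J)) vs))"
  by pat_completeness auto
termination
proof (relation "Wellfounded.measure (length \<circ> snd)", goal_cases)
  case (2 u vs I J)
  then have "length J \<noteq> 0" by simp
  with 2 show ?case unfolding in_measure o_def snd_conv by linarith
next
  case (3 u vs I J)
  then have "length I \<noteq> 0" by simp
  with 3 show ?case unfolding in_measure o_def snd_conv by linarith
qed auto

declare dsol.simps [simp del]

text \<open>The derivatives of \<open>u \<mapsto> (u, sol u)\<close>.\<close>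

definition G :: "'a \<Rightarrow> 'a list \<Rightarrow> 'a \<times> 'e" where "G u vs = (base u vs, dsol u vs)"

lemma fst_G: "fst (G u vs) = base u vs" by (simp add: G_def)

lemma G_X: "u \<in> U \<Longrightarrow> vs \<in> lists X \<Longrightarrow> fst (G u vs) \<in> X"
  by (simp add: fst_G base_X)

lemma G_Nil: "G u [] = (u, sol u)"
  by (simp add: G_def dsol.simps)

lemma dsol_lin_sol:
  "vs \<noteq> [] \<Longrightarrow> dsol u vs = lin_sol u (base u vs) (sumsplit (proper_part (\<lambda>I J. q (G u I) (G u J))) vs)"
  by (subst dsol.simps) (simp add: proper_part_def[abs_def] G_def)

lemma dsol_eq:
  assumes "u \<in> U" "vs \<in> lists X"
  shows "dsol u vs = sumsplit (\<lambda>I J. q (G u I) (G u J)) vs"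
proof (cases "vs = []")
  case True
  then show ?thesis using sol(2)[OF assms(1)] by (simp add: G_Nil dsol.simps[of u "[]"])
next
  case False
  have gv: "(base u vs, dsol u vs) = G u vs" by (simp add: G_def)
  have "dsol u vs = sumsplit (proper_part (\<lambda>I J. q (G u I) (G u J))) vs + q (G u []) (G u vs) + q (G u vs) (G u [])"
    using lin_sol[OF assms(1) base_X[OF assms], of "sumsplit (proper_part (\<lambda>I J. q (G u I) (G u J))) vs"]
    unfolding dsol_lin_sol[OF False, symmetric] gv G_Nil[symmetric] .
  then show ?thesis
    by (rule trans[OF _ sumsplit_proper[OF False, symmetric]])
qed

lemma dsol_eq_proper:
  assumes "u \<in> U" "vs \<in> lists X" "vs \<noteq> []"
  shows "dsol u vs = sumsplit (proper_part (\<lambda>I J. q (G u I) (G u J))) vs + q (u, sol u) (G u vs) + q (G u vs) (u, sol u)"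
  using trans[OF dsol_eq[OF assms(1,2)] sumsplit_proper[OF assms(3)]] unfolding G_Nil .

lemma NX_base_le:
  assumes "u \<in> U" "vs \<in> lists X"
  shows "NX (base u vs) \<le> max 1 R * P vs"
proof -
  consider "vs = []" | v where "vs = [v]" | v w ws where "vs = v # w # ws"
    by (metis list.exhaust)
  then show ?thesis
  proof cases
    case 1 then show ?thesis using assms by (auto simp: U_def)
  next
    case 2
    then have "1 * NX v \<le> max 1 R * NX v" using assms by (intro mult_right_mono NX_nonneg) auto
    with 2 show ?thesis by simp
  next
    case 3
    then have "0 \<le> P vs" using P_nonneg assms by blast
    with 3 show ?thesis by (simp add: NX_zero)
  qed
qed

lemma sub_lists: "vs \<in> lists X \<Longrightarrow> set I \<subseteq> set vs \<Longrightarrow> I \<in> lists X"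
  by (auto simp: in_lists_conv_set)

text \<open>All the families of differences and remainders below solve this linearisation of the equation between
  the data \<open>u\<close> and \<open>u'\<close>, with a source \<open>\<rho>\<close>. By induction on the length of the list, the terms that contain the
  family at the full list are absorbed by the contraction; the others involve shorter lists only.\<close>

abbreviation linear_family :: "'a \<Rightarrow> 'a \<Rightarrow> ('a list \<Rightarrow> 'e) \<Rightarrow> ('a list \<Rightarrow> 'a list \<Rightarrow> 'e) \<Rightarrow> bool" where
  "linear_family u u' e \<rho> \<equiv> \<forall>vs\<in>lists X. e vs = sumsplit (\<lambda>I J. q (0, e I) (G u' J) + q (G u I) (0, e J) + \<rho> I J) vs"

abbreviation source_bound :: "nat \<Rightarrow> real \<Rightarrow> real \<Rightarrow> ('a list \<Rightarrow> 'a list \<Rightarrow> 'e) \<Rightarrow> bool" where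
  "source_bound n K H \<rho> \<equiv> \<forall>I\<in>lists X. \<forall>J\<in>lists X. length I + length J \<le> n \<longrightarrow> norm (\<rho> I J) \<le> K * H * P I * P J"

lemma G_bound: "\<exists>C\<ge>0. \<forall>u\<in>U. \<forall>vs\<in>lists X. length vs \<le> n \<longrightarrow> norm (dsol u vs) \<le> C * P vs \<and> N (G u vs) \<le> C * P vs"
proof (induction n)
  case 0
  have "norm (dsol u []) \<le> M \<and> N (G u []) \<le> 2 * \<alpha> * R" if "u \<in> U" for u
    using sol(1)[OF that] N_sol[OF that] by (simp add: G_Nil dsol.simps[of u "[]"])
  then show ?case
    by (intro exI[of _ "max M (2 * \<alpha> * R)"]) (auto simp: M_def le_max_iff_disj)
next
  case (Suc n)
  then obtain C where C: "C \<ge> 0" "\<And>u vs. u \<in> U \<Longrightarrow> vs \<in> lists X \<Longrightarrow> length vs \<le> n \<Longrightarrow> norm (dsol u vs) \<le> C * P vs \<and> N (G u vs) \<le> C * P vs"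
    by blast
  define K where "K = 2 * (2 ^ Suc n * C\<^sup>2 + 2 * ((2 * \<alpha> * R) * (\<alpha> * max 1 R)))"
  define C' where "C' = C + K + (\<alpha> * max 1 R + b * K)"
  have K: "0 \<le> K" using pos by (simp add: K_def)
  have C': "C \<le> C'" "K \<le> C'" "\<alpha> * max 1 R + b * K \<le> C'" "0 \<le> C'"
    using C K pos by (auto simp: C'_def intro!: add_nonneg_nonneg mult_nonneg_nonneg)
  have "norm (dsol u vs) \<le> C' * P vs \<and> N (G u vs) \<le> C' * P vs"
    if u: "u \<in> U" and vs: "vs \<in> lists X" and len: "length vs \<le> Suc n" for u vs
  proof (cases "length vs \<le> n")
    case True
    then show ?thesis using C(2)[OF u vs True] mult_right_mono[OF C'(1) P_nonneg[OF vs]] by linarith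
  next
    case False
    then have ne: "vs \<noteq> []" and l: "length vs = Suc n" using len by auto
    let ?p = "proper_part (\<lambda>I J. q (G u I) (G u J))"
    have uX: "u \<in> X" using u by (simp add: U_def)
    have bX: "base u vs \<in> X" by (rule base_X[OF u vs])
    have sp: "norm (sumsplit ?p vs) \<le> 2 ^ length vs * C\<^sup>2 * P vs"
    proof (rule sumsplit_norm_le)
      fix I J assume IJ: "set I \<subseteq> set vs" "set J \<subseteq> set vs" "length I + length J = length vs"
      note X = sub_lists[OF vs IJ(1)] sub_lists[OF vs IJ(2)]
      show "norm (?p I J) \<le> C\<^sup>2 * P I * P J"
      proof (cases "I = [] \<or> J = []")
        case True then show ?thesis using C(1) P_nonneg X by (auto simp: proper_part_def)
      next
        case False
        then have IJn: "length I \<noteq> 0" "length J \<noteq> 0" by auto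
        have "length I \<le> n" "length J \<le> n" using IJ(3) IJn l by linarith+
        then have "N (G u I) * N (G u J) \<le> (C * P I) * (C * P J)"
          using C X u by (intro mult_mono) (auto intro!: N_nonneg G_X mult_nonneg_nonneg P_nonneg)
        then show ?thesis
          using q_le[OF G_X[OF u X(1)] G_X[OF u X(2)]] False
          by (auto simp: proper_part_def power2_eq_square mult_ac)
      qed
    qed
    define x where "x = base u vs"
    have xb: "NX x \<le> max 1 R * P vs" unfolding x_def by (rule NX_base_le[OF u vs])
    have xX: "x \<in> X" by (simp add: x_def bX)
    let ?r = "sumsplit ?p vs + (q (u, sol u) (x, 0) + q (x, 0) (u, sol u))"
    have gv: "G u vs = (x, dsol u vs)" by (simp add: G_def x_def)
    have uX': "fst (u, sol u) \<in> X" using uX by simp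
    have "dsol u vs = sumsplit ?p vs + q (u, sol u) (x, dsol u vs) + q (x, dsol u vs) (u, sol u)"
      using dsol_eq_proper[OF u vs ne] unfolding gv .
    also have "\<dots> = ?r + q (u, sol u) (0, dsol u vs) + q (0, dsol u vs) (u, sol u)"
      by (simp only: q_split_pair[OF xX uX', of "dsol u vs"] add_ac)
    finally have fe: "norm (dsol u vs) \<le> 2 * norm ?r" by (rule lin_estimate[OF u u])
    have "norm (q (u, sol u) (x, 0) + q (x, 0) (u, sol u)) \<le> N (u, sol u) * N (x, 0) + N (x, 0) * N (u, sol u)"
      by (intro norm_triangle_le add_mono q_le) (use uX xX in auto)
    also have "\<dots> \<le> (2 * \<alpha> * R) * (\<alpha> * max 1 R * P vs) + (\<alpha> * max 1 R * P vs) * (2 * \<alpha> * R)"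
      using N_sol[OF u] mult_left_mono[OF xb pos(1)] pos N_nonneg[of "(u, sol u)"] uX N_nonneg[of "(x, 0)"] xX P_nonneg[OF vs]
      by (intro add_mono mult_mono) (auto simp: N_def mult_ac)
    finally have "norm ?r \<le> 2 ^ length vs * C\<^sup>2 * P vs + ((2 * \<alpha> * R) * (\<alpha> * max 1 R * P vs) + (\<alpha> * max 1 R * P vs) * (2 * \<alpha> * R))"
      by (intro norm_triangle_le[of "sumsplit ?p vs"] add_mono sp)
    also have "2 * \<dots> = K * P vs" unfolding K_def l by (simp add: algebra_simps)
    finally have f: "norm (dsol u vs) \<le> K * P vs" using fe by linarith
    have "N (G u vs) = \<alpha> * NX x + b * norm (dsol u vs)" by (simp add: N_def G_def x_def)
    also have "\<dots> \<le> \<alpha> * (max 1 R * P vs) + b * (K * P vs)"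
      by (intro add_mono mult_left_mono xb f pos)
    also have "\<dots> = (\<alpha> * max 1 R + b * K) * P vs" by (simp add: algebra_simps)
    finally show ?thesis using f mult_right_mono[OF C'(2) P_nonneg[OF vs]] mult_right_mono[OF C'(3) P_nonneg[OF vs]]
      by linarith
  qed
  then show ?case using C'(4) by blast
qed

lemma linear_family_bound:
  assumes K: "0 \<le> K"
  shows "m \<le> n \<Longrightarrow> \<exists>C\<ge>0. \<forall>u\<in>U. \<forall>u'\<in>U. \<forall>e \<rho> H. 0 \<le> H \<longrightarrow>
    (linear_family u u' e \<rho>) \<longrightarrow>
    (source_bound n K H \<rho>) \<longrightarrow>
    (\<forall>vs\<in>lists X. length vs \<le> m \<longrightarrow> norm (e vs) \<le> C * H * P vs)"
proof (induction m)
  case 0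
  have main: "norm (e []) \<le> 2 * K * H"
    if u: "u \<in> U" "u' \<in> U" and H: "0 \<le> H"
      and eq: "linear_family u u' e \<rho>"
      and \<rho>: "source_bound n K H \<rho>"
    for u u' and e :: "'a list \<Rightarrow> 'e" and \<rho> H
  proof -
    have "e [] = sumsplit (\<lambda>I J. q (0, e I) (G u' J) + q (G u I) (0, e J) + \<rho> I J) []"
      by (rule bspec[OF eq]) simp
    also have "\<dots> = \<rho> [] [] + q (u, sol u) (0, e []) + q (0, e []) (u', sol u')"
      by (simp only: sumsplit.simps G_Nil add_ac)
    finally have "norm (e []) \<le> 2 * norm (\<rho> [] [])" by (rule lin_estimate[OF u])
    moreover have "norm (\<rho> [] []) \<le> K * H" using \<rho>[rule_format, of "[]" "[]"] by simp
    ultimately show ?thesis by linarith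
  qed
  show ?case
  proof (rule exI[of _ "2 * K"], intro conjI ballI allI impI)
    fix u u' and e :: "'a list \<Rightarrow> 'e" and \<rho> H and vs :: "'a list"
    assume a: "u \<in> U" "u' \<in> U" "0 \<le> H"
      "linear_family u u' e \<rho>"
      "source_bound n K H \<rho>"
      and vs: "length vs \<le> 0"
    from vs have "vs = []" by simp
    then show "norm (e vs) \<le> 2 * K * H * P vs" using main[OF a] by (simp only: list.map prod_list.Nil mult_1_right)
  qed (use K in simp)
next
  case (Suc m)
  then obtain C where C: "C \<ge> 0" and IH: "\<forall>u\<in>U. \<forall>u'\<in>U. \<forall>e \<rho> H. 0 \<le> H \<longrightarrow>
    (linear_family u u' e \<rho>) \<longrightarrow>
    (source_bound n K H \<rho>) \<longrightarrow>
    (\<forall>vs\<in>lists X. length vs \<le> m \<longrightarrow> norm (e vs) \<le> C * H * P vs)" by auto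
  obtain D where D: "D \<ge> 0" "\<And>u vs. u \<in> U \<Longrightarrow> vs \<in> lists X \<Longrightarrow> length vs \<le> Suc m \<Longrightarrow> N (G u vs) \<le> D * P vs"
    using G_bound[of "Suc m"] by blast
  define B where "B = 2 * (2 ^ Suc m * (2 * (b * C * D) + K) + 2 * (b * C * D) + 2 * K)"
  have B: "0 \<le> B" using C D K pos by (auto simp: B_def intro!: add_nonneg_nonneg mult_nonneg_nonneg)
  have main: "norm (e vs) \<le> (C + B) * H * P vs"
    if u: "u \<in> U" "u' \<in> U" and H: "0 \<le> H"
      and eq: "linear_family u u' e \<rho>"
      and \<rho>: "source_bound n K H \<rho>"
      and vs: "vs \<in> lists X" and len: "length vs \<le> Suc m"
    for u u' and e :: "'a list \<Rightarrow> 'e" and \<rho> H vs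
  proof -
    have IH': "norm (e vs) \<le> C * H * P vs" if "vs \<in> lists X" "length vs \<le> m" for vs
      using IH[THEN bspec, OF u(1), THEN bspec, OF u(2), THEN spec, of e, THEN spec, of \<rho>, THEN spec, of H,
          THEN mp, OF H, THEN mp, OF eq, THEN mp, OF \<rho>] that by blast
    have P0: "0 \<le> P vs" by (rule P_nonneg[OF vs])
    show ?thesis
    proof (cases "length vs \<le> m")
      case True
      have "C * H * P vs \<le> (C + B) * H * P vs"
        using B H P0 by (intro mult_right_mono) auto
      then show ?thesis using IH'[OF vs True] by linarith
    next
      case False
      then have l: "length vs = Suc m" and ne: "vs \<noteq> []" using len by auto
      define \<phi> where "\<phi> I J = q (0, e I) (G u' J) + q (G u I) (0, e J) + \<rho> I J" for I J
      have eI: "N (0, e I) \<le> b * C * H * P I" if "I \<in> lists X" "length I \<le> m" for I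
        using mult_left_mono[OF IH'[OF that] pos(2)] by (simp add: N_snd mult_ac)
      have GX: "fst (G u I) \<in> X" "fst (G u' I) \<in> X" if "I \<in> lists X" for I
        using G_X[OF u(1) that] G_X[OF u(2) that] by auto
      have b1: "norm (q (0, e I) (G u' J)) \<le> (b * C * D) * H * P I * P J" "norm (q (G u J) (0, e I)) \<le> (b * C * D) * H * P I * P J"
        if I: "I \<in> lists X" "length I \<le> m" and J: "J \<in> lists X" "length J \<le> Suc m" for I J
      proof -
        have 1: "N (0, e I) * N (G u' J) \<le> (b * C * H * P I) * (D * P J)" "N (G u J) * N (0, e I) \<le> (D * P J) * (b * C * H * P I)"
          using C D H pos u J I by (auto intro!: mult_mono eI N_nonneg GX X_zero mult_nonneg_nonneg P_nonneg)
        have 2: "norm (q (0, e I) (G u' J)) \<le> N (0, e I) * N (G u' J)" "norm (q (G u J) (0, e I)) \<le> N (G u J) * N (0, e I)"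
          using X_zero J by (auto intro!: q_le GX)
        show "norm (q (0, e I) (G u' J)) \<le> (b * C * D) * H * P I * P J" "norm (q (G u J) (0, e I)) \<le> (b * C * D) * H * P I * P J"
          using order.trans[OF 2(1) 1(1)] order.trans[OF 2(2) 1(2)] by (simp_all only: mult_ac)
      qed
      have sp: "norm (sumsplit (proper_part \<phi>) vs) \<le> 2 ^ length vs * ((2 * (b * C * D) + K) * H) * P vs"
      proof (rule sumsplit_norm_le)
        fix I J assume IJ: "set I \<subseteq> set vs" "set J \<subseteq> set vs" "length I + length J = length vs"
        note X = sub_lists[OF vs IJ(1)] sub_lists[OF vs IJ(2)]
        show "norm (proper_part \<phi> I J) \<le> ((2 * (b * C * D) + K) * H) * P I * P J"
        proof (cases "I = [] \<or> J = []")
          case True then show ?thesis using C D K H pos P_nonneg X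
            by (auto simp: proper_part_def intro!: mult_nonneg_nonneg add_nonneg_nonneg)
        next
          case False
          then have IJn: "length I \<noteq> 0" "length J \<noteq> 0" by auto
          have ll: "length I \<le> m" "length J \<le> m" "length I + length J \<le> n"
            using IJ(3) IJn l Suc.prems by linarith+
          have "norm (\<phi> I J) \<le> (b * C * D) * H * P I * P J + (b * C * D) * H * P J * P I + K * H * P I * P J"
            unfolding \<phi>_def using \<rho> X ll by (intro norm_triangle_le add_mono b1) auto
          then show ?thesis using False by (auto simp: proper_part_def algebra_simps)
        qed
      qed
      define r where "r = sumsplit (proper_part \<phi>) vs + (q (0, e []) (G u' vs) + q (G u vs) (0, e []) + \<rho> [] vs + \<rho> vs [])"
      have "e vs = sumsplit (proper_part \<phi>) vs + \<phi> [] vs + \<phi> vs []"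
        using trans[OF bspec[OF eq vs] sumsplit_proper[OF ne]] unfolding \<phi>_def .
      also have "\<dots> = r + q (u, sol u) (0, e vs) + q (0, e vs) (u', sol u')"
        unfolding \<phi>_def r_def G_Nil by (simp only: add_ac)
      finally have 1: "norm (e vs) \<le> 2 * norm r" by (rule lin_estimate[OF u])
      have r12: "norm (\<rho> [] vs) \<le> K * H * P [] * P vs" "norm (\<rho> vs []) \<le> K * H * P vs * P []"
        by (rule \<rho>[THEN bspec, THEN bspec, THEN mp]; use vs l Suc.prems in simp)+
      have "norm r \<le> 2 ^ length vs * ((2 * (b * C * D) + K) * H) * P vs + ((b * C * D) * H * P [] * P vs + (b * C * D) * H * P [] * P vs + K * H * P [] * P vs + K * H * P vs * P [])"
        unfolding r_def using vs l
        by (intro norm_triangle_le[of "sumsplit (proper_part \<phi>) vs"] norm_triangle_le[of "q (0, e []) (G u' vs) + q (G u vs) (0, e []) + \<rho> [] vs"]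
            norm_triangle_le[of "q (0, e []) (G u' vs) + q (G u vs) (0, e [])"] norm_triangle_le[of "q (0, e []) (G u' vs)"] add_mono sp b1 r12) auto
      also have "2 * \<dots> = B * H * P vs"
        unfolding B_def l by (simp add: algebra_simps)
      finally have "norm (e vs) \<le> B * H * P vs" using 1 by linarith
      moreover have "B * H * P vs \<le> (C + B) * H * P vs"
        using C H P0 by (intro mult_right_mono) auto
      ultimately show ?thesis by linarith
    qed
  qed
  show ?case
    by (rule exI[of _ "C + B"], intro conjI ballI allI impI, use B C in simp, rule main)
qed

text \<open>The difference of the derivatives of the identity at \<open>u + h\<close> and at \<open>u\<close>.\<close>

definition inc :: "'a \<Rightarrow> 'a list \<Rightarrow> 'a" where "inc h I = (if I = [] then h else 0)"

lemma G_diff: "G (u + h) I - G u I = (inc h I, dsol (u + h) I - dsol u I)"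
  by (cases I; cases "tl I") (auto simp: G_def inc_def base_def split: list.splits)

lemma G_second_diff: "G (u + h) I - G u I - G u (h # I) = (0, dsol (u + h) I - dsol u I - dsol u (h # I))"
  by (cases I; cases "tl I") (auto simp: G_def base_def split: list.splits)

text \<open>The differences satisfy \<open>linear_family\<close> with a source that carries the factor \<open>NX h\<close>.\<close>

lemma dsol_lipschitz:
  "\<exists>C\<ge>0. \<forall>u\<in>U. \<forall>h\<in>X. u + h \<in> U \<longrightarrow> (\<forall>vs\<in>lists X. length vs \<le> n \<longrightarrow>
     norm (dsol (u + h) vs - dsol u vs) \<le> C * NX h * P vs)"
proof -
  obtain D where D: "D \<ge> 0" "\<And>u vs. u \<in> U \<Longrightarrow> vs \<in> lists X \<Longrightarrow> length vs \<le> n \<Longrightarrow> N (G u vs) \<le> D * P vs"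
    using G_bound[of n] by blast
  define K where "K = 2 * (\<alpha> * D)"
  have K: "0 \<le> K" using D pos by (simp add: K_def)
  obtain C where C: "C \<ge> 0" and lb: "\<forall>u\<in>U. \<forall>u'\<in>U. \<forall>e \<rho> H. 0 \<le> H \<longrightarrow>
    (linear_family u u' e \<rho>) \<longrightarrow>
    (source_bound n K H \<rho>) \<longrightarrow>
    (\<forall>vs\<in>lists X. length vs \<le> n \<longrightarrow> norm (e vs) \<le> C * H * P vs)"
    using linear_family_bound[OF K order_refl[of n]] by (elim exE conjE)
  have main: "\<forall>vs\<in>lists X. length vs \<le> n \<longrightarrow> norm (dsol (u + h) vs - dsol u vs) \<le> C * NX h * P vs"
    if u: "u \<in> U" "u + h \<in> U" and h: "h \<in> X" for u h
  proof -
    define e where "e vs = dsol (u + h) vs - dsol u vs" for vs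
    define \<rho> where "\<rho> I J = q (inc h I, 0) (G (u + h) J) + q (G u I) (inc h J, 0)" for I J
    have iX: "inc h I \<in> X" for I using h X_zero by (simp add: inc_def)
    have eqs: "\<forall>vs\<in>lists X. e vs = sumsplit (\<lambda>I J. q (0, e I) (G (u + h) J) + q (G u I) (0, e J) + \<rho> I J) vs"
    proof
      fix vs assume vs: "vs \<in> lists X"
      have "e vs = sumsplit (\<lambda>I J. q (G (u + h) I) (G (u + h) J) - q (G u I) (G u J)) vs"
        unfolding e_def sumsplit_diff using dsol_eq[OF u(1) vs] dsol_eq[OF u(2) vs] by (simp only:)
      also have "\<dots> = sumsplit (\<lambda>I J. q (0, e I) (G (u + h) J) + q (G u I) (0, e J) + \<rho> I J) vs"
      proof (rule sumsplit_cong)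
        fix I J assume "set I \<subseteq> set vs" "set J \<subseteq> set vs"
        then have X: "fst (G u I) \<in> X" "fst (G u J) \<in> X" "fst (G (u + h) I) \<in> X" "fst (G (u + h) J) \<in> X"
          using sub_lists[OF vs] u by (auto intro!: G_X)
        have "q (G (u + h) I) (G (u + h) J) - q (G u I) (G u J)
            = q (G (u + h) I - G u I) (G (u + h) J) + q (G u I) (G (u + h) J - G u J)"
          using X by (simp add: q_diff)
        then show "q (G (u + h) I) (G (u + h) J) - q (G u I) (G u J)
            = q (0, e I) (G (u + h) J) + q (G u I) (0, e J) + \<rho> I J"
          unfolding G_diff e_def[symmetric] \<rho>_def q_split_pair(1)[OF iX X(1), of J "e J"] q_split_pair(2)[OF iX X(4), of I "e I"]
          by (simp only: add_ac)
      qed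
      finally show "e vs = sumsplit (\<lambda>I J. q (0, e I) (G (u + h) J) + q (G u I) (0, e J) + \<rho> I J) vs" .
    qed
    have rhos: "\<forall>I\<in>lists X. \<forall>J\<in>lists X. length I + length J \<le> n \<longrightarrow> norm (\<rho> I J) \<le> K * NX h * P I * P J"
    proof (intro ballI impI)
      fix I J assume X: "I \<in> lists X" "J \<in> lists X" and l: "length I + length J \<le> n"
      have i: "NX (inc h I) \<le> NX h * P I" if "I \<in> lists X" for I
        using NX_nonneg[OF h] P_nonneg[OF that] by (simp add: inc_def NX_zero)
      then have N: "N (inc h I, 0) \<le> \<alpha> * (NX h * P I)" if "I \<in> lists X" for I
        using mult_left_mono[OF i[OF that] pos(1)] by (simp add: N_def)
      have "norm (\<rho> I J) \<le> N (inc h I, 0) * N (G (u + h) J) + N (G u I) * N (inc h J, 0)"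
        unfolding \<rho>_def using X u iX by (intro norm_triangle_le add_mono q_le G_X) auto
      also have "\<dots> \<le> (\<alpha> * (NX h * P I)) * (D * P J) + (D * P I) * (\<alpha> * (NX h * P J))"
        using X u l D pos NX_nonneg[OF h] iX
        by (intro add_mono mult_mono N D) (auto intro!: N_nonneg G_X mult_nonneg_nonneg P_nonneg)
      also have "\<dots> = K * NX h * P I * P J" by (simp add: K_def)
      finally show "norm (\<rho> I J) \<le> K * NX h * P I * P J" .
    qed
    show ?thesis
      using lb[THEN bspec, OF u(1), THEN bspec, OF u(2), THEN spec, of e, THEN spec, of \<rho>, THEN spec, of "NX h",
          THEN mp, OF NX_nonneg[OF h], THEN mp, OF eqs, THEN mp, OF rhos]
      unfolding e_def .
  qed
  show ?thesis
  proof (rule exI[of _ C], rule conjI[OF C], intro ballI impI)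
    fix u h vs assume "u \<in> U" "h \<in> X" "u + h \<in> U" and vs: "vs \<in> lists X" "length vs \<le> n"
    then have "u \<in> U" "u + h \<in> U" "h \<in> X" by auto
    from main[OF this, THEN bspec, OF vs(1), THEN mp, OF vs(2)] show "norm (dsol (u + h) vs - dsol u vs) \<le> C * NX h * P vs" .
  qed
qed

text \<open>The remainder of the first order expansion satisfies \<open>linear_family\<close>; its source is
  the bilinear term in two differences, which is quadratic in \<open>h\<close> by the Lipschitz estimate.\<close>

lemma dsol_frechet:
  "\<exists>C\<ge>0. \<forall>u\<in>U. \<forall>h\<in>X. u + h \<in> U \<longrightarrow> (\<forall>vs\<in>lists X. length vs \<le> n \<longrightarrow>
     norm (dsol (u + h) vs - dsol u vs - dsol u (h # vs)) \<le> C * (NX h)\<^sup>2 * P vs)"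
proof -
  obtain L where L: "L \<ge> 0" "\<And>u h vs. u \<in> U \<Longrightarrow> h \<in> X \<Longrightarrow> u + h \<in> U \<Longrightarrow> vs \<in> lists X \<Longrightarrow> length vs \<le> n \<Longrightarrow>
     norm (dsol (u + h) vs - dsol u vs) \<le> L * NX h * P vs"
    using dsol_lipschitz[of n] by blast
  define K where "K = (\<alpha> + b * L)\<^sup>2"
  have K: "0 \<le> K" by (simp add: K_def)
  obtain C where C: "C \<ge> 0" and lb: "\<forall>u\<in>U. \<forall>u'\<in>U. \<forall>e \<rho> H. 0 \<le> H \<longrightarrow>
    (linear_family u u' e \<rho>) \<longrightarrow>
    (source_bound n K H \<rho>) \<longrightarrow>
    (\<forall>vs\<in>lists X. length vs \<le> n \<longrightarrow> norm (e vs) \<le> C * H * P vs)"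
    using linear_family_bound[OF K order_refl[of n]] by (elim exE conjE)
  have main: "\<forall>vs\<in>lists X. length vs \<le> n \<longrightarrow> norm (dsol (u + h) vs - dsol u vs - dsol u (h # vs)) \<le> C * (NX h)\<^sup>2 * P vs"
    if u: "u \<in> U" "u + h \<in> U" and h: "h \<in> X" for u h
  proof -
    define e where "e vs = dsol (u + h) vs - dsol u vs - dsol u (h # vs)" for vs
    define \<Gamma> where "\<Gamma> I = G (u + h) I - G u I" for I
    define \<rho> where "\<rho> I J = q (\<Gamma> I) (\<Gamma> J)" for I J
    have \<Gamma>X: "fst (\<Gamma> I) \<in> X" for I using h X_zero by (simp add: \<Gamma>_def G_diff inc_def)
    have eqs: "\<forall>vs\<in>lists X. e vs = sumsplit (\<lambda>I J. q (0, e I) (G u J) + q (G u I) (0, e J) + \<rho> I J) vs"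
    proof
      fix vs assume vs: "vs \<in> lists X"
      have hvs: "h # vs \<in> lists X" using h vs by simp
      have "e vs = sumsplit (\<lambda>I J. q (G (u + h) I) (G (u + h) J) - q (G u I) (G u J)
          - (q (G u (h # I)) (G u J) + q (G u I) (G u (h # J)))) vs"
        unfolding e_def sumsplit_diff using dsol_eq[OF u(1) vs] dsol_eq[OF u(2) vs] dsol_eq[OF u(1) hvs]
        by (simp only: sumsplit.simps)
      also have "\<dots> = sumsplit (\<lambda>I J. q (0, e I) (G u J) + q (G u I) (0, e J) + \<rho> I J) vs"
      proof (rule sumsplit_cong)
        fix I J assume "set I \<subseteq> set vs" "set J \<subseteq> set vs"
        then have IJ: "I \<in> lists X" "J \<in> lists X" "h # I \<in> lists X" "h # J \<in> lists X"
          using sub_lists[OF vs] h by auto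
        then have X: "fst (G u I) \<in> X" "fst (G u J) \<in> X" "fst (G u (h # I)) \<in> X" "fst (G u (h # J)) \<in> X"
          using u by (auto intro!: G_X)
        have G': "G (u + h) K = G u K + \<Gamma> K" for K by (simp add: \<Gamma>_def)
        have E: "(0, e K) = \<Gamma> K - G u (h # K)" for K
          unfolding \<Gamma>_def e_def using G_second_diff[of u h K] by simp
        have XG: "fst (G u I + \<Gamma> I) \<in> X" "fst (G u J + \<Gamma> J) \<in> X"
          using X \<Gamma>X by (auto intro: X_add)
        show "q (G (u + h) I) (G (u + h) J) - q (G u I) (G u J)
          - (q (G u (h # I)) (G u J) + q (G u I) (G u (h # J))) = q (0, e I) (G u J) + q (G u I) (0, e J) + \<rho> I J"
          unfolding G' E \<rho>_def using X \<Gamma>X XG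
          by (simp only: q_add q_diff) (simp add: algebra_simps)
      qed
      finally show "e vs = sumsplit (\<lambda>I J. q (0, e I) (G u J) + q (G u I) (0, e J) + \<rho> I J) vs" .
    qed
    have rhos: "\<forall>I\<in>lists X. \<forall>J\<in>lists X. length I + length J \<le> n \<longrightarrow> norm (\<rho> I J) \<le> K * (NX h)\<^sup>2 * P I * P J"
    proof (intro ballI impI)
      fix I J assume X: "I \<in> lists X" "J \<in> lists X" and l: "length I + length J \<le> n"
      have N: "N (\<Gamma> I) \<le> (\<alpha> + b * L) * NX h * P I" if I: "I \<in> lists X" "length I \<le> n" for I
      proof -
        have "NX (inc h I) \<le> NX h * P I"
          using NX_nonneg[OF h] P_nonneg[OF I(1)] by (simp add: inc_def NX_zero)
        then have "\<alpha> * NX (inc h I) + b * norm (dsol (u + h) I - dsol u I) \<le> \<alpha> * (NX h * P I) + b * (L * NX h * P I)"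
          by (intro add_mono mult_left_mono L u h I pos)
        then show ?thesis unfolding \<Gamma>_def G_diff N_def fst_conv snd_conv by (simp add: algebra_simps)
      qed
      have "norm (\<rho> I J) \<le> N (\<Gamma> I) * N (\<Gamma> J)"
        unfolding \<rho>_def by (intro q_le \<Gamma>X)
      also have "\<dots> \<le> ((\<alpha> + b * L) * NX h * P I) * ((\<alpha> + b * L) * NX h * P J)"
        using X l L pos NX_nonneg[OF h]
        by (intro mult_mono N) (auto intro!: N_nonneg \<Gamma>X mult_nonneg_nonneg P_nonneg add_nonneg_nonneg)
      also have "\<dots> = K * (NX h)\<^sup>2 * P I * P J" by (simp add: K_def power2_eq_square)
      finally show "norm (\<rho> I J) \<le> K * (NX h)\<^sup>2 * P I * P J" .
    qed
    show ?thesis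
      using lb[THEN bspec, OF u(1), THEN bspec, OF u(1), THEN spec, of e, THEN spec, of \<rho>, THEN spec, of "(NX h)\<^sup>2",
          THEN mp, OF zero_le_power2, THEN mp, OF eqs, THEN mp, OF rhos]
      unfolding e_def .
  qed
  show ?thesis
  proof (rule exI[of _ C], rule conjI[OF C], intro ballI impI)
    fix u h vs assume "u \<in> U" "h \<in> X" "u + h \<in> U" and vs: "vs \<in> lists X" "length vs \<le> n"
    then have "u \<in> U" "u + h \<in> U" "h \<in> X" by auto
    from main[OF this, THEN bspec, OF vs(1), THEN mp, OF vs(2)] show "norm (dsol (u + h) vs - dsol u vs - dsol u (h # vs)) \<le> C * (NX h)\<^sup>2 * P vs" .
  qed
qed

text \<open>The lists agree except in one place, where the first has the linear combination of the others. The
  relation is inherited by one of the two parts of any splitting, so multilinearity of the derivatives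
  follows by induction along the recursion that defines them.\<close>

inductive lin3 :: "real \<Rightarrow> real \<Rightarrow> 'a list \<Rightarrow> 'a list \<Rightarrow> 'a list \<Rightarrow> bool" for c d where
  here: "x \<in> X \<Longrightarrow> y \<in> X \<Longrightarrow> vs \<in> lists X \<Longrightarrow> lin3 c d ((c *\<^sub>R x + d *\<^sub>R y) # vs) (x # vs) (y # vs)"
| there: "z \<in> X \<Longrightarrow> lin3 c d v1 v2 v3 \<Longrightarrow> lin3 c d (z # v1) (z # v2) (z # v3)"

lemma lin3_update:
  "vs \<in> lists X \<Longrightarrow> i < length vs \<Longrightarrow> x \<in> X \<Longrightarrow> y \<in> X \<Longrightarrow>
    lin3 c d (vs[i := c *\<^sub>R x + d *\<^sub>R y]) (vs[i := x]) (vs[i := y])"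
  by (induction vs arbitrary: i) (auto simp: nth_Cons split: nat.splits intro: lin3.intros)

lemma lin3_lists: "lin3 c d v1 v2 v3 \<Longrightarrow> v1 \<in> lists X \<and> v2 \<in> lists X \<and> v3 \<in> lists X"
  by (induction rule: lin3.induct) (auto intro: X_lin)

lemma lin3_length: "lin3 c d v1 v2 v3 \<Longrightarrow> length v2 = length v1 \<and> length v3 = length v1 \<and> v1 \<noteq> []"
  by (induction rule: lin3.induct) auto

lemma lin3_base: "lin3 c d v1 v2 v3 \<Longrightarrow> base u v1 = c *\<^sub>R base u v2 + d *\<^sub>R base u v3"
proof (induction rule: lin3.induct)
  case (here x y vs) then show ?case by (cases vs) auto
next
  case (there z v1 v2 v3)
  then have "v1 \<noteq> []" "v2 \<noteq> []" "v3 \<noteq> []" using lin3_length by fastforce+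
  then show ?case by (auto simp: neq_Nil_conv)
qed

lemma sumsplit_lin3:
  assumes "lin3 c d v1 v2 v3"
    and "\<And>I1 I2 I3 J. lin3 c d I1 I2 I3 \<Longrightarrow> J \<in> lists X \<Longrightarrow> length I1 + length J = length v1 \<Longrightarrow> \<phi> I1 J = c *\<^sub>R \<phi> I2 J + d *\<^sub>R \<phi> I3 J"
    and "\<And>I1 I2 I3 J. lin3 c d I1 I2 I3 \<Longrightarrow> J \<in> lists X \<Longrightarrow> length I1 + length J = length v1 \<Longrightarrow> \<phi> J I1 = c *\<^sub>R \<phi> J I2 + d *\<^sub>R \<phi> J I3"
  shows "sumsplit \<phi> v1 = c *\<^sub>R sumsplit \<phi> v2 + d *\<^sub>R sumsplit \<phi> v3"
  using assms
proof (induction arbitrary: \<phi> rule: lin3.induct)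
  case (here x y vs)
  have "sumsplit (\<lambda>I J. \<phi> ((c *\<^sub>R x + d *\<^sub>R y) # I) J + \<phi> I ((c *\<^sub>R x + d *\<^sub>R y) # J)) vs
     = sumsplit (\<lambda>I J. c *\<^sub>R (\<phi> (x # I) J + \<phi> I (x # J)) + d *\<^sub>R (\<phi> (y # I) J + \<phi> I (y # J))) vs"
  proof (rule sumsplit_cong)
    fix I J assume IJ: "set I \<subseteq> set vs" "set J \<subseteq> set vs" "length I + length J = length vs"
    have X: "I \<in> lists X" "J \<in> lists X" using IJ sub_lists[OF here(3)] by auto
    have "\<phi> ((c *\<^sub>R x + d *\<^sub>R y) # I) J = c *\<^sub>R \<phi> (x # I) J + d *\<^sub>R \<phi> (y # I) J"
      by (rule here.prems(1)) (use here.hyps X IJ in \<open>auto intro: lin3.here\<close>)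
    moreover have "\<phi> I ((c *\<^sub>R x + d *\<^sub>R y) # J) = c *\<^sub>R \<phi> I (x # J) + d *\<^sub>R \<phi> I (y # J)"
      by (rule here.prems(2)) (use here.hyps X IJ in \<open>auto intro: lin3.here\<close>)
    ultimately show "\<phi> ((c *\<^sub>R x + d *\<^sub>R y) # I) J + \<phi> I ((c *\<^sub>R x + d *\<^sub>R y) # J)
      = c *\<^sub>R (\<phi> (x # I) J + \<phi> I (x # J)) + d *\<^sub>R (\<phi> (y # I) J + \<phi> I (y # J))"
      by (simp add: algebra_simps)
  qed
  then show ?case by (simp only: sumsplit.simps sumsplit_add sumsplit_scaleR)
next
  case (there z v1 v2 v3)
  have "sumsplit (\<lambda>I J. \<phi> (z # I) J + \<phi> I (z # J)) v1
      = c *\<^sub>R sumsplit (\<lambda>I J. \<phi> (z # I) J + \<phi> I (z # J)) v2 + d *\<^sub>R sumsplit (\<lambda>I J. \<phi> (z # I) J + \<phi> I (z # J)) v3"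
  proof (rule there.IH)
    fix I1 I2 I3 J assume a: "lin3 c d I1 I2 I3" "J \<in> lists X" "length I1 + length J = length v1"
    have "\<phi> (z # I1) J = c *\<^sub>R \<phi> (z # I2) J + d *\<^sub>R \<phi> (z # I3) J"
      "\<phi> I1 (z # J) = c *\<^sub>R \<phi> I2 (z # J) + d *\<^sub>R \<phi> I3 (z # J)"
      "\<phi> (z # J) I1 = c *\<^sub>R \<phi> (z # J) I2 + d *\<^sub>R \<phi> (z # J) I3"
      "\<phi> J (z # I1) = c *\<^sub>R \<phi> J (z # I2) + d *\<^sub>R \<phi> J (z # I3)"
      using a there.hyps by (auto intro!: there.prems lin3.there)
    then show "\<phi> (z # I1) J + \<phi> I1 (z # J) = c *\<^sub>R (\<phi> (z # I2) J + \<phi> I2 (z # J)) + d *\<^sub>R (\<phi> (z # I3) J + \<phi> I3 (z # J))"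
      "\<phi> (z # J) I1 + \<phi> J (z # I1) = c *\<^sub>R (\<phi> (z # J) I2 + \<phi> J (z # I2)) + d *\<^sub>R (\<phi> (z # J) I3 + \<phi> J (z # I3))"
      by (simp_all add: algebra_simps)
  qed
  then show ?case by simp
qed

lemma dsol_lin3:
  assumes u: "u \<in> U"
  shows "lin3 c d v1 v2 v3 \<Longrightarrow> G u v1 = c *\<^sub>R G u v2 + d *\<^sub>R G u v3"
proof (induction "length v1" arbitrary: v1 v2 v3 rule: less_induct)
  case less
  note l3 = lin3_lists[OF less(2)] and ln = lin3_length[OF less(2)]
  have ne: "v1 \<noteq> []" "v2 \<noteq> []" "v3 \<noteq> []" using ln by auto
  have uX: "fst (u, sol u) \<in> X" using u by (simp add: U_def)
  let ?p = "proper_part (\<lambda>I J. q (G u I) (G u J))"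
  define F where "F = c *\<^sub>R G u v2 + d *\<^sub>R G u v3"
  have GX: "fst (G u v2) \<in> X" "fst (G u v3) \<in> X" using l3 u by (auto intro!: G_X)
  have sp: "sumsplit ?p v1 = c *\<^sub>R sumsplit ?p v2 + d *\<^sub>R sumsplit ?p v3"
  proof (rule sumsplit_lin3[OF less(2)])
    fix I1 I2 I3 J assume a: "lin3 c d I1 I2 I3" "J \<in> lists X" "length I1 + length J = length v1"
    note b = lin3_lists[OF a(1)] lin3_length[OF a(1)]
    have ne: "I1 \<noteq> []" "I2 \<noteq> []" "I3 \<noteq> []" using b(2) by auto
    have X: "fst (G u I2) \<in> X" "fst (G u I3) \<in> X" "fst (G u J) \<in> X" using b a u by (auto intro!: G_X)
    have "?p I1 J = c *\<^sub>R ?p I2 J + d *\<^sub>R ?p I3 J \<and> ?p J I1 = c *\<^sub>R ?p J I2 + d *\<^sub>R ?p J I3"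
    proof (cases "J = []")
      case False
      then have "length I1 < length v1" using a(3) by (cases J) auto
      then have "G u I1 = c *\<^sub>R G u I2 + d *\<^sub>R G u I3" by (rule less(1)[OF _ a(1)])
      then show ?thesis using False ne X by (simp add: proper_part_def q_left q_right)
    qed (simp add: proper_part_def)
    then show "?p I1 J = c *\<^sub>R ?p I2 J + d *\<^sub>R ?p I3 J" "?p J I1 = c *\<^sub>R ?p J I2 + d *\<^sub>R ?p J I3" by auto
  qed
  have bF: "fst F = base u v1" by (simp add: F_def fst_G lin3_base[OF less(2)])
  have F: "F = (base u v1, snd F)" using bF by (metis prod.collapse)
  have "snd F = c *\<^sub>R dsol u v2 + d *\<^sub>R dsol u v3" by (simp add: F_def G_def)
  also have "\<dots> = c *\<^sub>R (sumsplit ?p v2 + q (u, sol u) (G u v2) + q (G u v2) (u, sol u))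
      + d *\<^sub>R (sumsplit ?p v3 + q (u, sol u) (G u v3) + q (G u v3) (u, sol u))"
    using dsol_eq_proper[OF u _ ne(2)] dsol_eq_proper[OF u _ ne(3)] l3 by (simp only:)
  also have "\<dots> = sumsplit ?p v1 + q (u, sol u) F + q F (u, sol u)"
    unfolding sp F_def q_left[OF GX uX] q_right[OF GX uX] by (simp add: algebra_simps)
  finally have 1: "snd F = sumsplit ?p v1 + q (u, sol u) (base u v1, snd F) + q (base u v1, snd F) (u, sol u)"
    using F by metis
  have bX: "base u v1 \<in> X" using base_X[OF u] l3 by blast
  have "snd F = lin_sol u (base u v1) (sumsplit ?p v1)"
    unfolding lin_sol_def by (rule the1_equality[OF ex_lin_sol[OF u bX] 1, symmetric])
  then have "snd F = dsol u v1" by (simp only: dsol_lin_sol[OF ne(1)])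
  then have "G u v1 = F" using F by (metis G_def)
  then show ?case unfolding F_def .
qed

text \<open>A bounded linear image \<open>j\<close> of \<open>(u, sol u)\<close> inherits all derivatives.\<close>

theorem solution_frechet_smooth:
  fixes Y :: "('i \<Rightarrow> 'b::real_vector) set" and j :: "'a \<times> 'e \<Rightarrow> 'i \<Rightarrow> 'b"
  assumes V: "V \<subseteq> U"
    and j_lin: "\<And>z w c d t. fst z \<in> X \<Longrightarrow> fst w \<in> X \<Longrightarrow> j (c *\<^sub>R z + d *\<^sub>R w) t = c *\<^sub>R j z t + d *\<^sub>R j w t"
    and j_Y: "\<And>z. fst z \<in> X \<Longrightarrow> j z \<in> Y"
    and j_bound: "\<And>z. fst z \<in> X \<Longrightarrow> NY (j z) \<le> A * (NX (fst z) + norm (snd z))" and A: "0 \<le> A"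
  shows "frechet_smooth_on X NX Y NY V (\<lambda>u. j (u, sol u))"
  unfolding frechet_smooth_on_def
proof (intro exI[of _ "\<lambda>k u vs. j (G u vs)"] conjI ballI allI impI)
  fix u assume "u \<in> V" show "j (G u []) = j (u, sol u)" by (simp add: G_Nil)
next
  fix k u assume "u \<in> V"
  then have u: "u \<in> U" using V by auto
  obtain C where C: "C \<ge> 0" "\<And>vs. vs \<in> lists X \<Longrightarrow> length vs \<le> k \<Longrightarrow> norm (dsol u vs) \<le> C * P vs"
    using G_bound[of k] u by blast
  show "bounded_multilinear_on X NX Y NY k (\<lambda>vs. j (G u vs))"
    unfolding bounded_multilinear_on_def
  proof (intro conjI ballI impI allI)
    fix vs assume "vs \<in> lists X" then show "j (G u vs) \<in> Y" by (intro j_Y G_X u)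
  next
    fix vs i x y c d t assume a: "vs \<in> lists X" "length vs = k" "i < k" "x \<in> X" "y \<in> X"
    have l: "lin3 c d (vs[i := c *\<^sub>R x + d *\<^sub>R y]) (vs[i := x]) (vs[i := y])"
      using a by (intro lin3_update) auto
    show "j (G u (vs[i := c *\<^sub>R x + d *\<^sub>R y])) t = c *\<^sub>R j (G u (vs[i := x])) t + d *\<^sub>R j (G u (vs[i := y])) t"
      unfolding dsol_lin3[OF u l] by (rule j_lin) (use lin3_lists[OF l] in \<open>auto intro!: G_X u\<close>)
  next
    have "NY (j (G u vs)) \<le> A * (max 1 R + C) * P vs" if "vs \<in> lists X" "length vs = k" for vs
    proof -
      have "NX (base u vs) + norm (dsol u vs) \<le> max 1 R * P vs + C * P vs"
        using that by (intro add_mono NX_base_le u C) auto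
      then have "A * (NX (base u vs) + norm (dsol u vs)) \<le> A * (max 1 R * P vs + C * P vs)"
        by (rule mult_left_mono[OF _ A])
      then show ?thesis using j_bound[OF G_X[OF u that(1)]] by (simp add: G_def algebra_simps)
    qed
    then show "\<exists>B. \<forall>vs\<in>lists X. length vs = k \<longrightarrow> NY (j (G u vs)) \<le> B * P vs" by blast
  qed
next
  fix k u and \<epsilon> :: real assume "u \<in> V" and \<epsilon>: "\<epsilon> > 0"
  then have u: "u \<in> U" using V by auto
  obtain C where C: "C \<ge> 0" "\<And>h vs. h \<in> X \<Longrightarrow> u + h \<in> U \<Longrightarrow> vs \<in> lists X \<Longrightarrow> length vs \<le> k \<Longrightarrow>
     norm (dsol (u + h) vs - dsol u vs - dsol u (h # vs)) \<le> C * (NX h)\<^sup>2 * P vs"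
    using dsol_frechet[of k] u by blast
  have AC: "0 \<le> A * C" using A C by simp
  show "\<exists>\<delta>>0. \<forall>h\<in>X. NX h < \<delta> \<longrightarrow> u + h \<in> V \<longrightarrow> (\<forall>vs\<in>lists X. length vs = k \<longrightarrow>
      NY (\<lambda>t. j (G (u + h) vs) t - j (G u vs) t - j (G u (h # vs)) t) \<le> \<epsilon> * NX h * P vs)"
  proof (intro exI[of _ "\<epsilon> / (A * C + 1)"] conjI ballI impI)
    show "0 < \<epsilon> / (A * C + 1)" using AC \<epsilon> by simp
    fix h vs assume h: "h \<in> X" "NX h < \<epsilon> / (A * C + 1)" "u + h \<in> V" and vs: "vs \<in> lists X" "length vs = k"
    have uh: "u + h \<in> U" using h V by auto
    let ?z = "G (u + h) vs - G u vs - G u (h # vs)"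
    have X: "fst (G (u + h) vs) \<in> X" "fst (G u vs) \<in> X" "fst (G u (h # vs)) \<in> X"
      using u uh vs h by (auto intro!: G_X)
    have jd: "j (z - w) t = j z t - j w t" if "fst z \<in> X" "fst w \<in> X" for z w t
      using j_lin[OF that, of 1 "-1" t] by simp
    have "(\<lambda>t. j (G (u + h) vs) t - j (G u vs) t - j (G u (h # vs)) t) = j ?z"
      using X by (intro ext) (simp add: jd X_diff)
    moreover have z: "?z = (0, dsol (u + h) vs - dsol u vs - dsol u (h # vs))" by (rule G_second_diff)
    ultimately have "NY (\<lambda>t. j (G (u + h) vs) t - j (G u vs) t - j (G u (h # vs)) t)
        \<le> A * norm (dsol (u + h) vs - dsol u vs - dsol u (h # vs))"
      using j_bound[of ?z] X_zero by (simp add: NX_zero)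
    also have "\<dots> \<le> A * (C * (NX h)\<^sup>2 * P vs)"
      using vs by (intro mult_left_mono C h uh A) auto
    also have "\<dots> = (A * C * NX h) * (NX h * P vs)" by (simp add: power2_eq_square)
    also have "\<dots> \<le> \<epsilon> * (NX h * P vs)"
    proof (rule mult_right_mono)
      have "A * C * NX h \<le> (A * C + 1) * NX h" using NX_nonneg[OF h(1)] by (simp add: algebra_simps)
      also have "\<dots> \<le> \<epsilon>" using h(2) AC by (simp add: field_simps)
      finally show "A * C * NX h \<le> \<epsilon>" .
      show "0 \<le> NX h * P vs" using NX_nonneg[OF h(1)] P_nonneg[OF vs(1)] by simp
    qed
    finally show "NY (\<lambda>t. j (G (u + h) vs) t - j (G u vs) t - j (G u (h # vs)) t) \<le> \<epsilon> * NX h * P vs"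
      by (simp add: mult.assoc)
  qed
qed

end

section \<open>The Banach space of bounded Borel functions\<close>

text \<open>The space of the unknown. The source of the integral equation is known to be measurable in time and
  frequency only, and pointwise bounds are all that the estimates use.\<close>

typedef bounded_borel = "{f :: real \<times> real \<Rightarrow> complex. f \<in> borel_measurable borel \<and> bounded (range f)}"
  morphisms app Abs_bounded_borel
  by (rule exI[of _ "\<lambda>_. 0"]) auto

setup_lifting type_definition_bounded_borel

lemma app_measurable [measurable]: "app f \<in> borel_measurable borel"
  using app[of f] by simp

lemma app_bounded: "bounded (range (app f))"
  using app[of f] by simp

lemma bounded_borel_eqI: "(\<And>x. app f x = app g x) \<Longrightarrow> f = g"
  by (simp add: app_inject[symmetric] fun_eq_iff)

lemma bounded_rangeI: "(\<And>x. cmod (f x) \<le> B) \<Longrightarrow> bounded (range f)"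
  by (auto simp: bounded_iff)

instantiation bounded_borel :: real_normed_vector
begin

lift_definition zero_bounded_borel :: bounded_borel is "\<lambda>_. 0" by simp

lift_definition plus_bounded_borel :: "bounded_borel \<Rightarrow> bounded_borel \<Rightarrow> bounded_borel" is "\<lambda>f g x. f x + g x"
  by (auto intro!: bounded_plus_comp)

lift_definition minus_bounded_borel :: "bounded_borel \<Rightarrow> bounded_borel \<Rightarrow> bounded_borel" is "\<lambda>f g x. f x - g x"
  by (auto intro!: bounded_minus_comp)

lift_definition uminus_bounded_borel :: "bounded_borel \<Rightarrow> bounded_borel" is "\<lambda>f x. - f x"
  by (auto simp: bounded_iff)

lift_definition scaleR_bounded_borel :: "real \<Rightarrow> bounded_borel \<Rightarrow> bounded_borel" is "\<lambda>c f x. c *\<^sub>R f x"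
  by (auto intro!: bounded_scaleR_comp)

definition norm_bounded_borel :: "bounded_borel \<Rightarrow> real" where "norm_bounded_borel f = (SUP x. cmod (app f x))"

definition dist_bounded_borel :: "bounded_borel \<Rightarrow> bounded_borel \<Rightarrow> real" where "dist_bounded_borel f g = norm (f - g)"

definition sgn_bounded_borel :: "bounded_borel \<Rightarrow> bounded_borel" where "sgn_bounded_borel f = inverse (norm f) *\<^sub>R f"

definition uniformity_bounded_borel :: "(bounded_borel \<times> bounded_borel) filter" where
  "uniformity_bounded_borel = (INF e\<in>{0<..}. principal {(x, y). dist x y < e})"

definition open_bounded_borel :: "bounded_borel set \<Rightarrow> bool" where
  "open_bounded_borel S = (\<forall>x\<in>S. \<forall>\<^sub>F (x', y) in uniformity. x' = x \<longrightarrow> y \<in> S)"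

lemma app_le_norm: "cmod (app f x) \<le> norm f"
proof -
  obtain B where "\<And>x. cmod (app f x) \<le> B"
    using app_bounded[of f] by (auto simp: bounded_iff)
  then show ?thesis
    unfolding norm_bounded_borel_def by (intro cSUP_upper bdd_aboveI[of _ B]) auto
qed

lemma norm_bounded_borel_le: "(\<And>x. cmod (app f x) \<le> B) \<Longrightarrow> norm f \<le> B"
  unfolding norm_bounded_borel_def by (intro cSUP_least) auto

instance
proof
  fix f g :: bounded_borel and a b :: real
  show "f + g + h = f + (g + h)" for h by (transfer; simp add: fun_eq_iff)
  show "f + g = g + f" by (transfer; simp add: fun_eq_iff)
  show "0 + f = f" by (transfer; simp)
  show "- f + f = 0" by (transfer; simp)
  show "f - g = f + - g" by (transfer; simp)
  show "a *\<^sub>R (f + g) = a *\<^sub>R f + a *\<^sub>R g" by (transfer; simp add: scaleR_add_right)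
  show "(a + b) *\<^sub>R f = a *\<^sub>R f + b *\<^sub>R f" by (transfer; simp add: scaleR_add_left)
  show "a *\<^sub>R b *\<^sub>R f = (a * b) *\<^sub>R f" by (transfer; simp)
  show "1 *\<^sub>R f = f" by (transfer; simp)
  show "dist f g = norm (f - g)" by (rule dist_bounded_borel_def)
  show "sgn f = inverse (norm f) *\<^sub>R f" by (rule sgn_bounded_borel_def)
  show "uniformity = (INF e\<in>{0<..}. principal {(x, y::bounded_borel). dist x y < e})" by (rule uniformity_bounded_borel_def)
  show "open S = (\<forall>x\<in>S. \<forall>\<^sub>F (x', y) in uniformity. x' = x \<longrightarrow> y \<in> S)" for S :: "bounded_borel set"
    by (rule open_bounded_borel_def)
  show "(norm f = 0) = (f = 0)"
  proof
    assume "norm f = 0"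
    then have "app f x = 0" for x using app_le_norm[of f x] by simp
    then show "f = 0" by (intro bounded_borel_eqI) (simp add: zero_bounded_borel.rep_eq)
  next
    assume "f = 0" then show "norm f = 0" by (simp add: norm_bounded_borel_def zero_bounded_borel.rep_eq)
  qed
  show "norm (f + g) \<le> norm f + norm g"
    by (rule norm_bounded_borel_le) (auto simp: plus_bounded_borel.rep_eq intro!: norm_triangle_le add_mono app_le_norm)
  have le: "norm (a *\<^sub>R f) \<le> \<bar>a\<bar> * norm f" for a and f :: bounded_borel
    by (rule norm_bounded_borel_le) (auto simp: scaleR_bounded_borel.rep_eq intro!: mult_left_mono app_le_norm)
  show "norm (a *\<^sub>R f) = \<bar>a\<bar> * norm f"
  proof (cases "a = 0")
    case True
    then have "a *\<^sub>R f = 0" by (transfer; simp)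
    then show ?thesis using True by (simp add: norm_bounded_borel_def zero_bounded_borel.rep_eq)
  next
    case False
    then have "f = inverse a *\<^sub>R (a *\<^sub>R f)" by (transfer; simp)
    then have "norm f \<le> \<bar>inverse a\<bar> * norm (a *\<^sub>R f)" using le[of "inverse a" "a *\<^sub>R f"] by simp
    then have "\<bar>a\<bar> * norm f \<le> norm (a *\<^sub>R f)" using False by (simp add: field_simps)
    then show ?thesis using le[of a f] by simp
  qed
qed

end

instance bounded_borel :: banach
proof
  fix X :: "nat \<Rightarrow> bounded_borel" assume X: "Cauchy X"
  have pt: "cmod (app (X m) x - app (X n) x) \<le> norm (X m - X n)" for m n x
    using app_le_norm[of "X m - X n" x] by (simp add: minus_bounded_borel.rep_eq)
  have "Cauchy (\<lambda>n. app (X n) x)" for x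
  proof (rule CauchyI)
    fix e :: real assume "e > 0"
    then obtain M where "\<And>m n. m \<ge> M \<Longrightarrow> n \<ge> M \<Longrightarrow> norm (X m - X n) < e"
      using CauchyD[OF X] by blast
    then show "\<exists>M. \<forall>m\<ge>M. \<forall>n\<ge>M. norm (app (X m) x - app (X n) x) < e"
      by (intro exI[of _ M] allI impI le_less_trans[OF pt])
  qed
  then have "\<exists>l. (\<lambda>n. app (X n) x) \<longlonglongrightarrow> l" for x
    using Cauchy_convergent[of "\<lambda>n. app (X n) x"] unfolding convergent_def by blast
  then have "\<exists>g. \<forall>x. (\<lambda>n. app (X n) x) \<longlonglongrightarrow> g x" by (intro choice) blast
  then obtain g where g: "\<And>x. (\<lambda>n. app (X n) x) \<longlonglongrightarrow> g x" by blast
  have [measurable]: "g \<in> borel_measurable borel"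
    by (rule borel_measurable_LIMSEQ_metric[of "\<lambda>n. app (X n)"]) (use g in auto)
  have close: "\<exists>M. \<forall>n\<ge>M. \<forall>x. cmod (app (X n) x - g x) \<le> e" if e: "e > 0" for e
  proof -
    obtain M where M: "\<And>m n. m \<ge> M \<Longrightarrow> n \<ge> M \<Longrightarrow> norm (X m - X n) < e"
      using CauchyD[OF X e] by blast
    have "cmod (app (X n) x - g x) \<le> e" if n: "n \<ge> M" for n x
    proof (rule LIMSEQ_le_const2)
      show "(\<lambda>m. cmod (app (X n) x - app (X m) x)) \<longlonglongrightarrow> cmod (app (X n) x - g x)"
        by (intro tendsto_intros g)
      show "\<exists>N. \<forall>m\<ge>N. cmod (app (X n) x - app (X m) x) \<le> e"
        by (intro exI[of _ M] allI impI order_trans[OF pt] less_imp_le[OF M[OF n]])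
    qed
    then show ?thesis by blast
  qed
  obtain M where M: "\<And>x. cmod (app (X M) x - g x) \<le> 1" using close[of 1] by auto
  have gbd: "cmod (g x) \<le> norm (X M) + 1" for x
    using norm_triangle_ineq4[of "app (X M) x" "app (X M) x - g x"] M[of x] app_le_norm[of "X M" x] by simp
  have gb: "app (Abs_bounded_borel g) = g"
    using bounded_rangeI[of g, OF gbd] by (intro Abs_bounded_borel_inverse) simp
  have "X \<longlonglongrightarrow> Abs_bounded_borel g"
  proof (rule LIMSEQ_I)
    fix e :: real assume "e > 0"
    then obtain M where M: "\<And>n x. n \<ge> M \<Longrightarrow> cmod (app (X n) x - g x) \<le> e / 2" using close[of "e / 2"] by auto
    have "norm (X n - Abs_bounded_borel g) \<le> e / 2" if "n \<ge> M" for n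
      by (rule norm_bounded_borel_le) (use M[OF that] in \<open>simp add: minus_bounded_borel.rep_eq gb\<close>)
    then show "\<exists>no. \<forall>n\<ge>no. norm (X n - Abs_bounded_borel g) < e"
      using \<open>e > 0\<close> by (intro exI[of _ M]) force
  qed
  then show "convergent X" by (auto simp: convergent_def)
qed

lemma app_Abs_bounded_borel:
  assumes "f \<in> borel_measurable borel" "\<And>x. cmod (f x) \<le> B"
  shows "app (Abs_bounded_borel f) = f" "norm (Abs_bounded_borel f) \<le> B"
proof -
  show 1: "app (Abs_bounded_borel f) = f"
    using bounded_rangeI[of f, OF assms(2)] assms(1) by (intro Abs_bounded_borel_inverse) simp
  show "norm (Abs_bounded_borel f) \<le> B" by (rule norm_bounded_borel_le) (simp add: 1 assms(2))
qed

section \<open>Weights, square integrable functions, convolutions and time integrals\<close>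

text \<open>The Japanese bracket, of size \<open>1 + \<bar>\<xi>\<bar>\<close> and equal to the square root of the Sobolev weight.\<close>

definition bracket :: "real \<Rightarrow> real" where "bracket \<xi> = sqrt (1 + \<xi>\<^sup>2)"

lemma bracket_ge_1: "1 \<le> bracket \<xi>"
  by (simp add: bracket_def)

lemma bracket_pos [simp]: "0 < bracket \<xi>"
  using bracket_ge_1[of \<xi>] by linarith

lemma bracket_nonneg [simp]: "0 \<le> bracket \<xi>" and bracket_nonzero [simp]: "bracket \<xi> \<noteq> 0"
  using bracket_pos[of \<xi>] by (auto simp del: bracket_pos)

lemma abs_le_bracket: "\<bar>\<xi>\<bar> \<le> bracket \<xi>"
  by (auto simp: bracket_def intro!: real_le_rsqrt)

lemma bracket_square: "(bracket \<xi>)\<^sup>2 = 1 + \<xi>\<^sup>2"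
  by (simp add: bracket_def add_nonneg_nonneg)

lemma bracket_measurable [measurable]: "bracket \<in> borel_measurable borel"
  unfolding bracket_def by measurable

lemma bracket_powr_square: "(1 + \<xi>\<^sup>2) powr s = (bracket \<xi> powr s)\<^sup>2"
proof -
  have "(1 + \<xi>\<^sup>2) powr s = ((bracket \<xi>) powr 2) powr s"
    by (simp add: powr_numeral bracket_square)
  also have "\<dots> = (bracket \<xi> powr s)\<^sup>2"
    by (simp add: powr_powr powr_power mult.commute del: powr_numeral)
  finally show ?thesis .
qed

lemma bracket_powr_mono: "a \<le> b \<Longrightarrow> bracket \<xi> powr a \<le> bracket \<xi> powr b"
  by (intro powr_mono bracket_ge_1)

lemma bracket_powr_le_1: "a \<le> 0 \<Longrightarrow> bracket \<xi> powr a \<le> 1"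
  using bracket_powr_mono[of a 0 \<xi>] by simp

lemma bracket_powr_ge_1: "0 \<le> a \<Longrightarrow> 1 \<le> bracket \<xi> powr a"
  using bracket_powr_mono[of 0 a \<xi>] by simp

abbreviation weighted :: "real \<Rightarrow> (real \<Rightarrow> complex) \<Rightarrow> real \<Rightarrow> complex" where
  "weighted \<sigma> g \<equiv> \<lambda>\<xi>. of_real (bracket \<xi> powr \<sigma>) * g \<xi>"

text \<open>Peetre's inequality, which lets a weight pass through a convolution.\<close>

lemma bracket_peetre: "bracket \<xi> \<le> sqrt 2 * bracket (\<xi> - \<zeta>) * bracket \<zeta>"
proof -
  define a where "a = \<xi> - \<zeta>"
  have "0 \<le> (a - \<zeta>)\<^sup>2 + 1 + 2 * (a * \<zeta>)\<^sup>2" by simp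
  then have "1 + (a + \<zeta>)\<^sup>2 \<le> 2 * (1 + a\<^sup>2) * (1 + \<zeta>\<^sup>2)"
    by (simp add: power2_eq_square algebra_simps)
  then have "sqrt (1 + (a + \<zeta>)\<^sup>2) \<le> sqrt (2 * (1 + a\<^sup>2) * (1 + \<zeta>\<^sup>2))"
    by (rule real_sqrt_le_mono)
  then show ?thesis by (simp only: bracket_def a_def real_sqrt_mult diff_add_cancel)
qed

lemma integrable_lborel_of_HK:
  fixes f :: "real \<Rightarrow> real"
  assumes "(f has_integral I) S" "\<And>x. x \<in> S \<Longrightarrow> 0 \<le> f x" "S \<in> sets borel" "f \<in> borel_measurable borel"
  shows "integrable lborel (\<lambda>x. indicator S x * f x)" "(LINT x|lborel. indicator S x * f x) = I"
proof -
  have [measurable]: "S \<in> sets borel" "f \<in> borel_measurable borel" using assms by auto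
  have m: "(\<lambda>x. indicator S x * f x) \<in> borel_measurable lborel" by measurable
  have "f absolutely_integrable_on S"
    using assms(1,2) by (intro nonnegative_absolutely_integrable_1) (auto simp: integrable_on_def)
  then show i: "integrable lborel (\<lambda>x. indicator S x * f x)"
    using integrable_completion[OF m] by (simp add: set_integrable_def)
  have "((\<lambda>x. indicator S x * f x) has_integral (LINT x|lborel. indicator S x * f x)) UNIV"
    by (rule has_integral_integral_lborel[OF i])
  moreover have "((\<lambda>x. indicator S x * f x) has_integral I) UNIV"
  proof -
    have "(\<lambda>x. indicator S x * f x) = (\<lambda>x. if x \<in> S then f x else 0)" by (auto simp: indicator_def)
    then show ?thesis using assms(1) has_integral_restrict_UNIV[of S f I] by simp
  qed
  ultimately show "(LINT x|lborel. indicator S x * f x) = I" by (rule has_integral_unique)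
qed

lemma integrable_reflect:
  fixes f :: "real \<Rightarrow> 'b::{banach, second_countable_topology}"
  assumes "integrable lborel f"
  shows "integrable lborel (\<lambda>x. f (t - x))"
  using lborel_integrable_real_affine[OF assms, of "-1" t] by simp

lemma integral_reflect_shift:
  fixes f :: "real \<Rightarrow> 'b::{banach, second_countable_topology}"
  shows "(LINT x|lborel. f (t - x)) = (LINT x|lborel. f x)"
  using lborel_integral_real_affine[of "-1" f t] by simp

lemma integrable_bracket:
  assumes b: "b > 1"
  shows "integrable lborel (\<lambda>\<xi>. bracket \<xi> powr (- b))"
proof -
  let ?g = "\<lambda>\<xi>::real. indicator {1..} \<xi> * \<xi> powr (- b)"
  have g: "integrable lborel ?g"
    using has_integral_powr_to_inf[of "- b" 1] b by (intro integrable_lborel_of_HK(1)) auto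
  have g': "integrable lborel (\<lambda>\<xi>. ?g (0 - \<xi>))" by (rule integrable_reflect[OF g])
  have c: "integrable lborel (\<lambda>\<xi>::real. indicator {-1..1} \<xi> :: real)"
    by (intro integrable_real_indicator) (auto simp: emeasure_lborel_Icc_eq)
  show ?thesis
  proof (rule Bochner_Integration.integrable_bound)
    show "integrable lborel (\<lambda>\<xi>. indicator {-1..1} \<xi> + (?g \<xi> + ?g (0 - \<xi>)))"
      by (intro Bochner_Integration.integrable_add c g g')
    have "bracket \<xi> powr (- b) \<le> indicator {-1..1} \<xi> + (?g \<xi> + ?g (0 - \<xi>))" for \<xi>
    proof (cases "\<bar>\<xi>\<bar> \<le> 1")
      case True
      then have "indicator {-1..1} \<xi> = (1::real)" by (auto simp: indicator_def)
      moreover have "bracket \<xi> powr (- b) \<le> 1" using b by (intro bracket_powr_le_1) auto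
      moreover have "0 \<le> ?g \<xi> + ?g (0 - \<xi>)" by simp
      ultimately show ?thesis by linarith
    next
      case False
      then have "bracket \<xi> powr (- b) \<le> \<bar>\<xi>\<bar> powr (- b)"
        using b by (intro powr_mono2') (auto simp: abs_le_bracket)
      then show ?thesis using False by (auto simp: indicator_def abs_if split: if_splits)
    qed
    then show "AE \<xi> in lborel. norm (bracket \<xi> powr (- b)) \<le> norm (indicator {-1..1} \<xi> + (?g \<xi> + ?g (0 - \<xi>)))"
      by (intro AE_I2) (simp add: order_trans[OF _ abs_ge_self])
  qed measurable
qed

definition L2_fun :: "(real \<Rightarrow> complex) \<Rightarrow> bool" where
  "L2_fun F \<longleftrightarrow> F \<in> borel_measurable borel \<and> integrable lborel (\<lambda>x. (cmod (F x))\<^sup>2)"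

definition L2_norm :: "(real \<Rightarrow> complex) \<Rightarrow> real" where
  "L2_norm F = sqrt (LINT x|lborel. (cmod (F x))\<^sup>2)"

lemma L2_norm_nonneg [simp]: "0 \<le> L2_norm F"
  by (simp add: L2_norm_def)

lemma L2_fun_measurable [measurable_dest]: "L2_fun F \<Longrightarrow> F \<in> borel_measurable borel"
  by (simp add: L2_fun_def)

lemma L2_fun_dominated:
  assumes G: "L2_fun G" and F: "F \<in> borel_measurable borel" and le: "\<And>x. cmod (F x) \<le> cmod (G x)"
  shows "L2_fun F" "L2_norm F \<le> L2_norm G"
proof -
  have sq: "(cmod (F x))\<^sup>2 \<le> (cmod (G x))\<^sup>2" for x by (intro power_mono le) auto
  have i: "integrable lborel (\<lambda>x. (cmod (F x))\<^sup>2)"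
    by (rule Bochner_Integration.integrable_bound[of _ "\<lambda>x. (cmod (G x))\<^sup>2"]) (use G F sq in \<open>auto simp: L2_fun_def\<close>)
  then show "L2_fun F" using F by (simp add: L2_fun_def)
  show "L2_norm F \<le> L2_norm G"
    unfolding L2_norm_def using i G sq by (intro real_sqrt_le_mono integral_mono) (auto simp: L2_fun_def)
qed

lemma L2_fun_product:
  assumes "L2_fun F" "L2_fun G"
  shows "integrable lborel (\<lambda>x. F x * G x)" "(LINT x|lborel. cmod (F x * G x)) \<le> L2_norm F * L2_norm G"
    "cmod (LINT x|lborel. F x * G x) \<le> L2_norm F * L2_norm G"
  using square_integrable_product[of F lborel G] assms by (auto simp: L2_fun_def L2_norm_def)

lemma L2_fun_add:
  assumes F: "L2_fun F" and G: "L2_fun G"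
  shows "L2_fun (\<lambda>x. F x + G x)" "L2_norm (\<lambda>x. F x + G x) \<le> L2_norm F + L2_norm G"
proof -
  have [measurable]: "F \<in> borel_measurable borel" "G \<in> borel_measurable borel"
    using F G by (auto simp: L2_fun_def)
  have i: "integrable lborel (\<lambda>x. (cmod (F x))\<^sup>2)" "integrable lborel (\<lambda>x. (cmod (G x))\<^sup>2)"
    "integrable lborel (\<lambda>x. cmod (F x * G x))"
    using F G integrable_norm[OF L2_fun_product(1)[OF F G]] by (auto simp: L2_fun_def)
  let ?b = "\<lambda>x. (cmod (F x))\<^sup>2 + 2 * cmod (F x * G x) + (cmod (G x))\<^sup>2"
  have bi: "integrable lborel ?b" using i by auto
  have le: "(cmod (F x + G x))\<^sup>2 \<le> ?b x" for x
  proof -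
    have "(cmod (F x + G x))\<^sup>2 \<le> (cmod (F x) + cmod (G x))\<^sup>2"
      by (intro power_mono norm_triangle_ineq) auto
    then show ?thesis by (simp add: power2_eq_square algebra_simps norm_mult)
  qed
  have fi: "integrable lborel (\<lambda>x. (cmod (F x + G x))\<^sup>2)"
    by (rule Bochner_Integration.integrable_bound[OF bi]) (use le in \<open>auto intro!: AE_I2 order_trans[OF _ abs_ge_self]\<close>)
  then show "L2_fun (\<lambda>x. F x + G x)" by (simp add: L2_fun_def)
  have "(LINT x|lborel. (cmod (F x + G x))\<^sup>2) \<le> (LINT x|lborel. ?b x)"
    by (intro integral_mono fi bi le)
  also have "\<dots> = (L2_norm F)\<^sup>2 + 2 * (LINT x|lborel. cmod (F x * G x)) + (L2_norm G)\<^sup>2"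
    using i by (simp add: L2_norm_def)
  also have "\<dots> \<le> (L2_norm F)\<^sup>2 + 2 * (L2_norm F * L2_norm G) + (L2_norm G)\<^sup>2"
    using L2_fun_product(2)[OF F G] by simp
  also have "\<dots> = (L2_norm F + L2_norm G)\<^sup>2" by (simp add: power2_eq_square algebra_simps)
  finally show "L2_norm (\<lambda>x. F x + G x) \<le> L2_norm F + L2_norm G"
    unfolding L2_norm_def[of "\<lambda>x. F x + G x"] by (intro real_le_lsqrt) auto
qed

lemma L2_fun_cmult:
  assumes "L2_fun F"
  shows "L2_fun (\<lambda>x. c * F x)" "L2_norm (\<lambda>x. c * F x) = cmod c * L2_norm F"
  using assms by (auto simp: L2_fun_def L2_norm_def norm_mult power_mult_distrib real_sqrt_mult)

lemma L2_fun_bound2: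
  assumes F: "L2_fun F" and G: "L2_fun G" and H: "H \<in> borel_measurable borel" and c: "0 \<le> c" "0 \<le> d"
    and le: "\<And>x. cmod (H x) \<le> c * cmod (F x) + d * cmod (G x)"
  shows "L2_fun H" "L2_norm H \<le> c * L2_norm F + d * L2_norm G"
proof -
  have n: "L2_fun (\<lambda>x. of_real (cmod (F x)))" "L2_fun (\<lambda>x. of_real (cmod (G x)))"
    "L2_norm (\<lambda>x. of_real (cmod (F x))) = L2_norm F" "L2_norm (\<lambda>x. of_real (cmod (G x))) = L2_norm G"
    using F G by (auto simp: L2_fun_def L2_norm_def)
  note a = L2_fun_add[OF L2_fun_cmult(1)[OF n(1), of "of_real c"] L2_fun_cmult(1)[OF n(2), of "of_real d"]]
  have le': "cmod (H x) \<le> cmod (of_real c * of_real (cmod (F x)) + of_real d * of_real (cmod (G x)))" for x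
  proof -
    have "of_real c * of_real (cmod (F x)) + of_real d * complex_of_real (cmod (G x)) = of_real (c * cmod (F x) + d * cmod (G x))"
      by simp
    then show ?thesis using order_trans[OF le abs_ge_self] by (simp only: norm_of_real)
  qed
  show "L2_fun H" by (rule L2_fun_dominated(1)[OF a(1) H le'])
  show "L2_norm H \<le> c * L2_norm F + d * L2_norm G"
    using L2_fun_dominated(2)[OF a(1) H le'] a(2) c by (simp add: L2_fun_cmult(2)[OF n(1)] L2_fun_cmult(2)[OF n(2)] n)
qed

lemma L2_fun_bound1:
  assumes F: "L2_fun F" and H: "H \<in> borel_measurable borel" and c: "0 \<le> c"
    and le: "\<And>x. cmod (H x) \<le> c * cmod (F x)"
  shows "L2_fun H" "L2_norm H \<le> c * L2_norm F"
  using L2_fun_bound2[OF F F H c order_refl, of ] le by auto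

lemma L2_fun_bracket:
  assumes "b > 1 / 2"
  shows "L2_fun (\<lambda>\<xi>. of_real (bracket \<xi> powr (- b)))"
  using integrable_bracket[of "2 * b"] assms by (simp add: L2_fun_def powr_power)

lemma L2_fun_cong_AE:
  assumes "L2_fun F" "G \<in> borel_measurable borel" "AE x in lborel. F x = G x"
  shows "L2_fun G" "L2_norm G = L2_norm F"
proof -
  have [measurable]: "F \<in> borel_measurable borel" "G \<in> borel_measurable borel"
    using assms by (auto simp: L2_fun_def)
  have ae: "AE x in lborel. (cmod (F x))\<^sup>2 = (cmod (G x))\<^sup>2"
    using assms(3) by eventually_elim simp
  show "L2_fun G" "L2_norm G = L2_norm F"
    using assms(1) integrable_cong_AE[OF _ _ ae] integral_cong_AE[OF _ _ ae]
    by (auto simp: L2_fun_def L2_norm_def)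
qed

definition conv :: "(real \<Rightarrow> complex) \<Rightarrow> (real \<Rightarrow> complex) \<Rightarrow> real \<Rightarrow> complex" where
  "conv F G \<xi> = (LINT \<zeta>|lborel. F (\<xi> - \<zeta>) * G \<zeta>)"

lemma L2_fun_reflect:
  assumes "L2_fun F" shows "L2_fun (\<lambda>\<zeta>. F (\<xi> - \<zeta>))" "L2_norm (\<lambda>\<zeta>. F (\<xi> - \<zeta>)) = L2_norm F"
proof -
  have [measurable]: "F \<in> borel_measurable borel" using assms by (auto simp: L2_fun_def)
  show "L2_fun (\<lambda>\<zeta>. F (\<xi> - \<zeta>))" "L2_norm (\<lambda>\<zeta>. F (\<xi> - \<zeta>)) = L2_norm F"
    using assms integrable_reflect[of "\<lambda>x. (cmod (F x))\<^sup>2" \<xi>] integral_reflect_shift[of "\<lambda>x. (cmod (F x))\<^sup>2" \<xi>]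
    by (auto simp: L2_fun_def L2_norm_def)
qed

lemma conv_integrable: "L2_fun F \<Longrightarrow> L2_fun G \<Longrightarrow> integrable lborel (\<lambda>\<zeta>. F (\<xi> - \<zeta>) * G \<zeta>)"
  by (rule L2_fun_product(1)[OF L2_fun_reflect(1)])

text \<open>Cauchy-Schwarz, after distributing the weight with Peetre's inequality.\<close>

lemma conv_weighted_bound:
  assumes k: "0 \<le> k" and F: "F \<in> borel_measurable borel" and G: "G \<in> borel_measurable borel"
    and Fk: "L2_fun (weighted k F)" and Gk: "L2_fun (weighted k G)"
  shows "bracket \<xi> powr k * cmod (conv F G \<xi>)
    \<le> sqrt 2 powr k * L2_norm (weighted k F) * L2_norm (weighted k G)"
proof -
  let ?F = "\<lambda>\<xi>. of_real (bracket \<xi> powr k) * F \<xi>" and ?G = "\<lambda>\<xi>. of_real (bracket \<xi> powr k) * G \<xi>"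
  have [measurable]: "F \<in> borel_measurable borel" "G \<in> borel_measurable borel" using F G by auto
  have i: "integrable lborel (\<lambda>\<zeta>. cmod (?F (\<xi> - \<zeta>) * ?G \<zeta>))"
    by (rule integrable_norm[OF conv_integrable[OF Fk Gk]])
  have pt: "bracket \<xi> powr k * cmod (F (\<xi> - \<zeta>) * G \<zeta>) \<le> sqrt 2 powr k * cmod (?F (\<xi> - \<zeta>) * ?G \<zeta>)" for \<zeta>
  proof -
    have "bracket \<xi> powr k \<le> (sqrt 2 * bracket (\<xi> - \<zeta>) * bracket \<zeta>) powr k"
      using bracket_pos[of \<xi>] k by (intro powr_mono2 bracket_peetre) auto
    also have "\<dots> = sqrt 2 powr k * (bracket (\<xi> - \<zeta>) powr k * bracket \<zeta> powr k)"
      using bracket_pos[of \<zeta>] bracket_pos[of "\<xi> - \<zeta>"] by (simp add: powr_mult mult.assoc)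
    finally have "bracket \<xi> powr k * cmod (F (\<xi> - \<zeta>) * G \<zeta>) \<le> (sqrt 2 powr k * (bracket (\<xi> - \<zeta>) powr k * bracket \<zeta> powr k)) * cmod (F (\<xi> - \<zeta>) * G \<zeta>)"
      by (rule mult_right_mono) simp
    then show ?thesis by (simp add: norm_mult mult_ac)
  qed
  have "bracket \<xi> powr k * cmod (conv F G \<xi>) \<le> bracket \<xi> powr k * (LINT \<zeta>|lborel. cmod (F (\<xi> - \<zeta>) * G \<zeta>))"
    unfolding conv_def by (intro mult_left_mono integral_norm_bound) auto
  also have "\<dots> = (LINT \<zeta>|lborel. bracket \<xi> powr k * cmod (F (\<xi> - \<zeta>) * G \<zeta>))" by simp
  also have "\<dots> \<le> (LINT \<zeta>|lborel. sqrt 2 powr k * cmod (?F (\<xi> - \<zeta>) * ?G \<zeta>))"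
  proof (rule integral_mono)
    show i2: "integrable lborel (\<lambda>\<zeta>. sqrt 2 powr k * cmod (?F (\<xi> - \<zeta>) * ?G \<zeta>))"
      by (rule integrable_mult_right[OF i])
    show "integrable lborel (\<lambda>\<zeta>. bracket \<xi> powr k * cmod (F (\<xi> - \<zeta>) * G \<zeta>))"
      by (rule Bochner_Integration.integrable_bound[OF i2])
         (measurable, use pt in \<open>auto intro!: AE_I2 order_trans[OF _ abs_ge_self] simp del: norm_mult\<close>)
  qed (rule pt)
  also have "\<dots> = sqrt 2 powr k * (LINT \<zeta>|lborel. cmod (?F (\<xi> - \<zeta>) * ?G \<zeta>))" by simp
  also have "\<dots> \<le> sqrt 2 powr k * (L2_norm ?F * L2_norm ?G)"
    using L2_fun_product(2)[OF L2_fun_reflect(1)[OF Fk, of \<xi>] Gk] by (intro mult_left_mono) (simp_all add: L2_fun_reflect(2)[OF Fk])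
  finally show ?thesis by (simp add: mult.assoc)
qed

lemma integral_powr_0:
  fixes b t :: real
  assumes "b < 1" "0 < t"
  shows "integrable lborel (\<lambda>r. indicator {0<..<t} r * r powr (- b))"
    "(LINT r|lborel. indicator {0<..<t} r * r powr (- b)) = t powr (1 - b) / (1 - b)"
proof -
  have hi: "((\<lambda>x. x powr (- b)) has_integral (t powr (- b + 1) / (- b + 1))) {0..t}"
    using assms by (intro has_integral_powr_from_0) auto
  then have hi: "((\<lambda>x. x powr (- b)) has_integral (t powr (- b + 1) / (- b + 1))) {0<..<t}"
    using has_integral_Icc_iff_Ioo by blast
  have e: "- b + 1 = 1 - b" by simp
  show "integrable lborel (\<lambda>r. indicator {0<..<t} r * r powr (- b))"
    "(LINT r|lborel. indicator {0<..<t} r * r powr (- b)) = t powr (1 - b) / (1 - b)"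
    using integrable_lborel_of_HK[OF hi] unfolding e by auto
qed

text \<open>Each half of \<open>(0, t)\<close> contains one of the two singularities; on it the other factor is bounded.\<close>

lemma time_integral:
  fixes a b t :: real
  assumes a: "0 \<le> a" "a < 1" and b: "0 \<le> b" "b < 1" and t: "0 < t"
  shows "integrable lborel (\<lambda>r. indicator {0<..<t} r * ((t - r) powr (- a) * r powr (- b)))"
    "(LINT r|lborel. indicator {0<..<t} r * ((t - r) powr (- a) * r powr (- b)))
       \<le> (2 powr a / (1 - b) + 2 powr b / (1 - a)) * t powr (1 - a - b)"
proof -
  let ?h = "\<lambda>r. (t / 2) powr (- a) * (indicator {0<..<t} r * r powr (- b)) + (t / 2) powr (- b) * (indicator {0<..<t} r * (t - r) powr (- a))"
  have ind: "indicator {0<..<t} (t - r) = (indicator {0<..<t} r :: real)" for r by (auto simp: indicator_def)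
  have i1: "integrable lborel (\<lambda>r. indicator {0<..<t} r * r powr (- b))"
    "(LINT r|lborel. indicator {0<..<t} r * r powr (- b)) = t powr (1 - b) / (1 - b)"
    using integral_powr_0[of b t] b t by auto
  have i2: "integrable lborel (\<lambda>r. indicator {0<..<t} r * (t - r) powr (- a))"
    "(LINT r|lborel. indicator {0<..<t} r * (t - r) powr (- a)) = t powr (1 - a) / (1 - a)"
    using integrable_reflect[OF integral_powr_0(1)[of a t], of t] integral_powr_0(2)[of a t] a t
      integral_reflect_shift[of "\<lambda>r. indicator {0<..<t} r * r powr (- a)" t] by (auto simp: ind)
  have hi: "integrable lborel ?h"
    by (intro Bochner_Integration.integrable_add integrable_mult_right i1 i2)
  have le: "indicator {0<..<t} r * ((t - r) powr (- a) * r powr (- b)) \<le> ?h r" for r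
  proof (cases "r \<in> {0<..<t}")
    case True
    show ?thesis
    proof (cases "r \<le> t / 2")
      case l: True
      have "(t - r) powr (- a) \<le> (t / 2) powr (- a)" using True l a by (intro powr_mono2') auto
      then have "(t - r) powr (- a) * r powr (- b) \<le> (t / 2) powr (- a) * r powr (- b)" by (rule mult_right_mono) simp
      then show ?thesis using True by (simp add: add_increasing2)
    next
      case l: False
      have "r powr (- b) \<le> (t / 2) powr (- b)" using True l b by (intro powr_mono2') auto
      then have "(t - r) powr (- a) * r powr (- b) \<le> (t - r) powr (- a) * (t / 2) powr (- b)" by (rule mult_left_mono) simp
      then show ?thesis using True by (simp add: add_increasing mult.commute)
    qed
  qed simp
  show ii: "integrable lborel (\<lambda>r. indicator {0<..<t} r * ((t - r) powr (- a) * r powr (- b)))"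
    by (rule Bochner_Integration.integrable_bound[OF hi]) (measurable, use le in \<open>auto intro!: AE_I2 order_trans[OF _ abs_ge_self]\<close>)
  have "(LINT r|lborel. indicator {0<..<t} r * ((t - r) powr (- a) * r powr (- b))) \<le> (LINT r|lborel. ?h r)"
    by (intro integral_mono ii hi le)
  also have "\<dots> = (t / 2) powr (- a) * (t powr (1 - b) / (1 - b)) + (t / 2) powr (- b) * (t powr (1 - a) / (1 - a))"
    using i1 i2 by (simp only: Bochner_Integration.integral_add integrable_mult_right integral_mult_right_zero)
  also have "\<dots> = (2 powr a / (1 - b) + 2 powr b / (1 - a)) * t powr (1 - a - b)"
  proof -
    have 1: "(t / 2) powr (- a) * t powr (1 - b) = 2 powr a * t powr (1 - a - b)"
      using t by (simp add: powr_divide powr_minus_divide powr_diff powr_add field_simps)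
    have 2: "(t / 2) powr (- b) * t powr (1 - a) = 2 powr b * t powr (1 - a - b)"
      using t by (simp add: powr_divide powr_minus_divide powr_diff powr_add field_simps)
    have "(t / 2) powr (- a) * (t powr (1 - b) / (1 - b)) + (t / 2) powr (- b) * (t powr (1 - a) / (1 - a))
        = (2 powr a * t powr (1 - a - b)) / (1 - b) + (2 powr b * t powr (1 - a - b)) / (1 - a)"
      by (simp only: times_divide_eq_right 1 2)
    then show ?thesis by (simp add: algebra_simps)
  qed
  finally show "(LINT r|lborel. indicator {0<..<t} r * ((t - r) powr (- a) * r powr (- b)))
       \<le> (2 powr a / (1 - b) + 2 powr b / (1 - a)) * t powr (1 - a - b)" .
qed

lemma polynomial_exp_bound:
  fixes b c :: real
  assumes b: "0 \<le> b" and c: "0 < c"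
  obtains K where "0 \<le> K" "\<And>y. 0 \<le> y \<Longrightarrow> (1 + y) powr b * exp (- c * y) \<le> K"
proof -
  define \<delta> where "\<delta> = c / (b + 1)"
  have \<delta>: "0 < \<delta>" "\<delta> * b \<le> c" using b c by (auto simp: \<delta>_def field_simps)
  have "(1 + y) powr b * exp (- c * y) \<le> inverse \<delta> powr b * exp (\<delta> * b)" if y: "0 \<le> y" for y
  proof -
    have "\<delta> * (1 + y) \<le> exp (\<delta> * (1 + y))" using exp_ge_add_one_self[of "\<delta> * (1 + y)"] by linarith
    then have "1 + y \<le> inverse \<delta> * exp (\<delta> * (1 + y))" using \<delta> by (simp add: field_simps)
    then have "(1 + y) powr b \<le> (inverse \<delta> * exp (\<delta> * (1 + y))) powr b" using y b by (intro powr_mono2) auto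
    also have "\<dots> = inverse \<delta> powr b * exp (\<delta> * b * (1 + y))"
      using \<delta> by (simp add: powr_mult exp_powr_real mult_ac)
    finally have "(1 + y) powr b * exp (- c * y) \<le> inverse \<delta> powr b * exp (\<delta> * b * (1 + y)) * exp (- c * y)"
      by (rule mult_right_mono) simp
    also have "\<dots> = inverse \<delta> powr b * exp (\<delta> * b + (\<delta> * b - c) * y)"
      by (simp add: mult.assoc exp_add[symmetric] algebra_simps)
    also have "\<dots> \<le> inverse \<delta> powr b * exp (\<delta> * b)"
      using \<delta> y by (intro mult_left_mono) (auto simp: mult_nonpos_nonneg)
    finally show ?thesis .
  qed
  then show ?thesis by (intro that[of "inverse \<delta> powr b * exp (\<delta> * b)"]) auto
qed

section \<open>The propagator and the Duhamel integral on the Fourier side\<close>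

lemma app_measurable_pair [measurable]: "app f \<in> borel_measurable (borel \<Otimes>\<^sub>M borel)"
  using app_measurable[of f] by (simp add: borel_prod)

lemma integrable_dominated:
  fixes f :: "'a \<Rightarrow> 'b::{banach, second_countable_topology}" and g :: "'a \<Rightarrow> real"
  assumes "integrable M g" "f \<in> borel_measurable M" "\<And>x. norm (f x) \<le> g x"
  shows "integrable M f"
proof (rule Bochner_Integration.integrable_bound[OF assms(1,2)])
  show "AE x in M. norm (f x) \<le> norm (g x)"
    using order_trans[OF assms(3) abs_ge_self] by simp
qed

text \<open>A Borel symbol with dissipation of order \<open>p\<close>: the perturbation of lower order is absorbed in the constants
  \<open>A0\<close> and \<open>c0\<close>.\<close>

locale dissipative =
  fixes \<eta> p s A0 c0 :: real and \<Phi> :: "real \<Rightarrow> real"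
  assumes \<Phi>_measurable [measurable]: "\<Phi> \<in> borel_measurable borel"
    and A0: "0 \<le> A0" and c0: "0 < c0" and p: "p > 3" and s: "s > 1 - p / 2"
    and upper: "\<And>\<xi>. \<eta> * \<Phi> \<xi> \<le> A0 - c0 * \<bar>\<xi>\<bar> powr p"
begin

text \<open>The Fourier multiplier of the propagator \<open>V(t)\<close>.\<close>

definition m :: "real \<Rightarrow> real \<Rightarrow> complex" where
  "m t \<xi> = exp (\<i> * of_real (t * \<xi> ^ 3) + of_real (\<eta> * t * \<Phi> \<xi>))"

text \<open>The exponents of the scheme. The source \<open>(u\<^sub>x)\<^sup>2\<close> has a Fourier transform bounded by
  \<open>t powr (- 2 \<beta>) * bracket \<xi> powr (- k)\<close>: \<open>\<beta>\<close> is the rate at which the flow gains the \<open>1 - s\<close> derivatives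
  missing in the datum, and \<open>k\<close> counts the derivatives in excess. The hypothesis \<open>s > 1 - p / 2\<close> says that
  \<open>2 \<beta> < 1\<close>, so that the singularity at \<open>t = 0\<close> is integrable. The number \<open>\<gamma>\<close> lies strictly between
  \<open>3 / (2 p)\<close> and \<open>1 / 2\<close>, an interval that is nonempty because \<open>p > 3\<close>: above the first bound
  \<open>bracket \<xi> powr (1 - p \<gamma>)\<close> is square integrable, below the second \<open>t powr (- \<gamma>)\<close> is square integrable near 0.\<close>

definition k :: real where "k = max 0 (s - 1)"
definition \<beta> :: real where "\<beta> = max 0 ((1 - s) / p)"
definition \<gamma> :: real where "\<gamma> = (3 / (2 * p) + 1 / 2) / 2"

lemma p_pos: "0 < p" using p by simp

lemma k_nonneg: "0 \<le> k" by (simp add: k_def)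

lemma \<beta>: "0 \<le> \<beta>" "2 * \<beta> < 1"
  using p s by (auto simp: \<beta>_def field_simps max_def)

lemma k_\<beta>: "k + 1 - p * \<beta> = s"
  using p by (auto simp: k_def \<beta>_def max_def field_simps)

lemma \<gamma>: "0 \<le> \<gamma>" "2 * \<gamma> < 1" "3 / 2 < p * \<gamma>"
  using p by (auto simp: \<gamma>_def field_simps)

lemma m_measurable [measurable]: "(\<lambda>(t, \<xi>). m t \<xi>) \<in> borel_measurable (borel \<Otimes>\<^sub>M borel)"
  unfolding m_def by measurable

lemma m_measurable2 [measurable (raw)]:
  assumes [measurable]: "f \<in> borel_measurable M" "g \<in> borel_measurable M"
  shows "(\<lambda>x. m (f x) (g x)) \<in> borel_measurable M"
  unfolding m_def by measurable

lemma m_le_exp: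
  assumes "0 \<le> t" "t \<le> 1"
  shows "cmod (m t \<xi>) \<le> exp A0 * exp (- c0 * (t * \<bar>\<xi>\<bar> powr p))"
proof -
  have "t * (\<eta> * \<Phi> \<xi>) \<le> t * (A0 - c0 * \<bar>\<xi>\<bar> powr p)" by (intro mult_left_mono upper assms)
  also have "\<dots> \<le> A0 + - c0 * (t * \<bar>\<xi>\<bar> powr p)"
    using mult_right_mono[OF assms(2) A0] by (simp add: algebra_simps)
  finally show ?thesis by (simp add: m_def exp_add[symmetric] mult_ac)
qed

lemma m_le:
  assumes "0 \<le> t" "t \<le> 1"
  shows "cmod (m t \<xi>) \<le> exp A0"
proof -
  have "exp (- c0 * (t * \<bar>\<xi>\<bar> powr p)) \<le> 1" using assms c0 by simp
  then have "exp A0 * exp (- c0 * (t * \<bar>\<xi>\<bar> powr p)) \<le> exp A0 * 1" by (intro mult_left_mono) auto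
  then show ?thesis using m_le_exp[OF assms, of \<xi>] by linarith
qed

lemma m_continuous: "continuous_on UNIV (\<lambda>t. m t \<xi>)"
  unfolding m_def by (intro continuous_intros)

abbreviation decay_bound :: "real \<Rightarrow> real \<Rightarrow> bool" where
  "decay_bound a C \<equiv> \<forall>t \<xi>. 0 < t \<longrightarrow> t \<le> 1 \<longrightarrow> cmod (m t \<xi>) \<le> C * (t powr (- (a / p)) * bracket \<xi> powr (- a))"

text \<open>The smoothing estimate behind all others: a factor \<open>bracket \<xi> powr a\<close> costs \<open>t powr (- a / p)\<close>.\<close>

lemma m_decay:
  assumes a: "0 \<le> a"
  shows "\<exists>C\<ge>0. decay_bound a C"
proof -
  obtain K where K: "0 \<le> K" "\<And>y. 0 \<le> y \<Longrightarrow> (1 + y) powr (a / p) * exp (- c0 * y) \<le> K"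
    using polynomial_exp_bound[of "a / p" c0] a p_pos c0 by (metis divide_nonneg_pos)
  have "cmod (m t \<xi>) \<le> (2 powr a * exp A0 * K) * (t powr (- (a / p)) * bracket \<xi> powr (- a))"
    if t: "0 < t" "t \<le> 1" for t \<xi>
  proof -
    define y where "y = t * \<bar>\<xi>\<bar> powr p"
    have y: "0 \<le> y" using t by (simp add: y_def)
    have "bracket \<xi> \<le> 2 * max 1 \<bar>\<xi>\<bar>"
    proof -
      have "1 + \<xi>\<^sup>2 \<le> (1 + \<bar>\<xi>\<bar>)\<^sup>2" by (simp add: power2_eq_square algebra_simps)
      then have "bracket \<xi> \<le> 1 + \<bar>\<xi>\<bar>" unfolding bracket_def by (intro real_le_lsqrt) auto
      then show ?thesis by linarith
    qed
    then have "bracket \<xi> powr p \<le> (2 * max 1 \<bar>\<xi>\<bar>) powr p" using p_pos by (intro powr_mono2) auto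
    also have "\<dots> = 2 powr p * (max 1 \<bar>\<xi>\<bar>) powr p" by (simp add: powr_mult)
    also have "\<dots> \<le> 2 powr p * (1 + \<bar>\<xi>\<bar> powr p)"
      by (intro mult_left_mono) (auto simp: max_def)
    finally have "t * bracket \<xi> powr p \<le> t * (2 powr p * (1 + \<bar>\<xi>\<bar> powr p))" using t by (intro mult_left_mono) auto
    also have "\<dots> = 2 powr p * (t + y)" by (simp add: y_def algebra_simps)
    also have "\<dots> \<le> 2 powr p * (1 + y)" using t by (intro mult_left_mono) auto
    finally have "(t * bracket \<xi> powr p) powr (a / p) \<le> (2 powr p * (1 + y)) powr (a / p)"
      using t a p_pos by (intro powr_mono2) auto
    then have 1: "t powr (a / p) * bracket \<xi> powr a \<le> 2 powr a * (1 + y) powr (a / p)"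
      using t y p_pos by (simp add: powr_mult powr_powr)
    have "t powr (a / p) * bracket \<xi> powr a * cmod (m t \<xi>) \<le> (2 powr a * (1 + y) powr (a / p)) * (exp A0 * exp (- c0 * y))"
      using m_le_exp[of t \<xi>] t by (intro mult_mono 1) (auto simp: y_def)
    also have "\<dots> = 2 powr a * exp A0 * ((1 + y) powr (a / p) * exp (- c0 * y))" by simp
    also have "\<dots> \<le> 2 powr a * exp A0 * K" by (intro mult_left_mono K y) auto
    finally have "t powr (a / p) * bracket \<xi> powr a * cmod (m t \<xi>) \<le> 2 powr a * exp A0 * K" .
    moreover have "0 < t powr (a / p) * bracket \<xi> powr a" using t by simp
    ultimately show ?thesis using t by (simp add: powr_minus field_simps)
  qed
  then show ?thesis using K by (intro exI[of _ "2 powr a * exp A0 * K"]) auto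
qed

text \<open>The unknown \<open>f\<close> is the Fourier transform of the source, multiplied by \<open>r powr (2 \<beta>) * bracket \<xi> powr k\<close> so that it
  becomes a bounded function; here the weights are removed again.\<close>

definition duhamel_integrand :: "bounded_borel \<Rightarrow> real \<Rightarrow> real \<Rightarrow> real \<Rightarrow> complex" where
  "duhamel_integrand f t \<xi> r = (if 0 < r \<and> r < t then m (t - r) \<xi> * of_real (bracket \<xi> powr (- k) * r powr (- 2 * \<beta>)) * app f (r, \<xi>) else 0)"

definition duhamel :: "bounded_borel \<Rightarrow> real \<Rightarrow> real \<Rightarrow> complex" where
  "duhamel f t \<xi> = (LINT r|lborel. duhamel_integrand f t \<xi> r)"

lemma duhamel_integrand_measurable [measurable]: "(\<lambda>r. duhamel_integrand f t \<xi> r) \<in> borel_measurable borel"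
  unfolding duhamel_integrand_def by measurable

lemma duhamel_integrand_measurable2: "(\<lambda>(x, r). duhamel_integrand f (fst x) (snd x) r) \<in> borel_measurable ((borel \<Otimes>\<^sub>M borel) \<Otimes>\<^sub>M borel)"
  unfolding duhamel_integrand_def by measurable

lemma duhamel_measurable: "(\<lambda>x. duhamel f (fst x) (snd x)) \<in> borel_measurable (borel \<Otimes>\<^sub>M borel)"
  unfolding duhamel_def using duhamel_integrand_measurable2[of f]
  by (intro lborel.borel_measurable_lebesgue_integral) simp

lemma duhamel_measurable2 [measurable (raw)]:
  assumes [measurable]: "g \<in> borel_measurable M" "h \<in> borel_measurable M"
  shows "(\<lambda>x. duhamel f (g x) (h x)) \<in> borel_measurable M"
  using measurable_compose[OF measurable_Pair[OF assms] duhamel_measurable[of f]] by simp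

lemma duhamel_integrand_bound:
  assumes C: "0 \<le> C" "decay_bound a C"
    and t: "t \<le> 1"
  shows "cmod (duhamel_integrand f t \<xi> r) \<le> (C * norm f * bracket \<xi> powr (- k - a)) * (indicator {0<..<t} r * ((t - r) powr (- (a / p)) * r powr (- (2 * \<beta>))))"
proof (cases "0 < r \<and> r < t")
  case True
  have "cmod (duhamel_integrand f t \<xi> r) = cmod (m (t - r) \<xi>) * (bracket \<xi> powr (- k) * r powr (- (2 * \<beta>))) * cmod (app f (r, \<xi>))"
    using True by (simp add: duhamel_integrand_def norm_mult)
  also have "\<dots> \<le> (C * ((t - r) powr (- (a / p)) * bracket \<xi> powr (- a))) * (bracket \<xi> powr (- k) * r powr (- (2 * \<beta>))) * norm f"
    using True t C by (intro mult_mono app_le_norm) auto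
  also have "\<dots> = (C * norm f * (bracket \<xi> powr (- k) * bracket \<xi> powr (- a))) * ((t - r) powr (- (a / p)) * r powr (- (2 * \<beta>)))"
    by (simp only: mult_ac)
  also have "bracket \<xi> powr (- k) * bracket \<xi> powr (- a) = bracket \<xi> powr (- k - a)"
    by (simp add: powr_add[symmetric])
  finally show ?thesis using True by simp
next
  case False then show ?thesis by (auto simp: duhamel_integrand_def indicator_def)
qed

lemma duhamel_integrand_integrable:
  assumes t: "t \<le> 1" shows "integrable lborel (duhamel_integrand f t \<xi>)"
proof (cases "0 < t")
  case True
  obtain C where C: "0 \<le> C" "decay_bound 0 C"
    using m_decay[of 0] by auto
  have i: "integrable lborel (\<lambda>r. (C * norm f * bracket \<xi> powr (- k - 0)) * (indicator {0<..<t} r * ((t - r) powr (- (0 / p)) * r powr (- (2 * \<beta>)))))"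
    using \<beta> True by (intro integrable_mult_right time_integral(1)) auto
  show ?thesis
    by (rule integrable_dominated[OF i _ duhamel_integrand_bound[OF C t]]) measurable
next
  case False
  then have "duhamel_integrand f t \<xi> = (\<lambda>r. 0)" by (auto simp: duhamel_integrand_def)
  then show ?thesis by simp
qed

text \<open>The multiplier decays like \<open>(t - r) powr (- a / p) * bracket \<xi> powr (- a)\<close>, and the time integral of the
  singularities at both ends scales like \<open>t powr (1 - a / p - 2 \<beta>)\<close>.\<close>

lemma duhamel_bound:
  assumes a: "0 \<le> a" "a < p"
  shows "\<exists>C\<ge>0. \<forall>f t \<xi>. 0 < t \<longrightarrow> t \<le> 1 \<longrightarrow> cmod (duhamel f t \<xi>) \<le> C * norm f * t powr (1 - a / p - 2 * \<beta>) * bracket \<xi> powr (- k - a)"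
proof -
  obtain C where C: "0 \<le> C" "decay_bound a C"
    using m_decay[OF a(1)] by auto
  define D where "D = 2 powr (a / p) / (1 - 2 * \<beta>) + 2 powr (2 * \<beta>) / (1 - a / p)"
  have ap: "0 \<le> a / p" "a / p < 1" using a p_pos by auto
  have D: "0 \<le> D" using ap \<beta> by (simp add: D_def)
  have "cmod (duhamel f t \<xi>) \<le> (C * D) * norm f * t powr (1 - a / p - 2 * \<beta>) * bracket \<xi> powr (- k - a)"
    if t: "0 < t" "t \<le> 1" for f t \<xi>
  proof -
    let ?T = "\<lambda>r. indicator {0<..<t} r * ((t - r) powr (- (a / p)) * r powr (- (2 * \<beta>)))"
    have ti: "integrable lborel ?T" "(LINT r|lborel. ?T r) \<le> D * t powr (1 - a / p - 2 * \<beta>)"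
      using time_integral[of "a / p" "2 * \<beta>" t] ap \<beta> t by (auto simp: D_def)
    have "cmod (duhamel f t \<xi>) \<le> (LINT r|lborel. cmod (duhamel_integrand f t \<xi> r))"
      unfolding duhamel_def by (rule integral_norm_bound)
    also have "\<dots> \<le> (LINT r|lborel. (C * norm f * bracket \<xi> powr (- k - a)) * ?T r)"
      by (intro integral_mono integrable_norm duhamel_integrand_integrable t integrable_mult_right ti duhamel_integrand_bound[OF C])
    also have "\<dots> = (C * norm f * bracket \<xi> powr (- k - a)) * (LINT r|lborel. ?T r)"
      by (rule integral_mult_right_zero)
    also have "\<dots> \<le> (C * norm f * bracket \<xi> powr (- k - a)) * (D * t powr (1 - a / p - 2 * \<beta>))"
      using C by (intro mult_left_mono ti) auto
    finally show ?thesis by (simp add: mult_ac)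
  qed
  then show ?thesis using C D by (intro exI[of _ "C * D"]) auto
qed

lemma duhamel_nonpos:
  assumes "t \<le> 0" shows "duhamel f t \<xi> = 0"
proof -
  have "duhamel_integrand f t \<xi> = (\<lambda>r. 0)" using assms by (auto simp: duhamel_integrand_def)
  then show ?thesis by (simp add: duhamel_def)
qed

lemma duhamel_linear:
  assumes "t \<le> 1"
  shows "duhamel (c *\<^sub>R f + d *\<^sub>R g) t \<xi> = of_real c * duhamel f t \<xi> + of_real d * duhamel g t \<xi>"
proof -
  have "duhamel_integrand (c *\<^sub>R f + d *\<^sub>R g) t \<xi> r = of_real c * duhamel_integrand f t \<xi> r + of_real d * duhamel_integrand g t \<xi> r" for r
    by (simp add: duhamel_integrand_def plus_bounded_borel.rep_eq scaleR_bounded_borel.rep_eq scaleR_conv_of_real algebra_simps)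
  then have "duhamel (c *\<^sub>R f + d *\<^sub>R g) t \<xi> = (LINT r|lborel. of_real c * duhamel_integrand f t \<xi> r + of_real d * duhamel_integrand g t \<xi> r)"
    unfolding duhamel_def by (intro Bochner_Integration.integral_cong) auto
  also have "\<dots> = (LINT r|lborel. of_real c * duhamel_integrand f t \<xi> r) + (LINT r|lborel. of_real d * duhamel_integrand g t \<xi> r)"
    by (intro Bochner_Integration.integral_add integrable_mult_right duhamel_integrand_integrable assms)
  finally show ?thesis by (simp add: duhamel_def)
qed

text \<open>\<open>profile g f\<close> is the Fourier side of \<open>V(t) u\<^sub>0\<close> minus the Duhamel integral of the weighted source
  \<open>f\<close>, where \<open>g\<close> is the Fourier transform of \<open>u\<^sub>0\<close>; \<open>profile_x\<close> is that of its space derivative.\<close>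

definition profile :: "(real \<Rightarrow> complex) \<Rightarrow> bounded_borel \<Rightarrow> real \<Rightarrow> real \<Rightarrow> complex" where
  "profile g f t \<xi> = m t \<xi> * g \<xi> - duhamel f t \<xi>"

definition profile_x :: "(real \<Rightarrow> complex) \<Rightarrow> bounded_borel \<Rightarrow> real \<Rightarrow> real \<Rightarrow> complex" where
  "profile_x g f t \<xi> = \<i> * of_real \<xi> * profile g f t \<xi>"

definition Hs_density :: "(real \<Rightarrow> complex) \<Rightarrow> bool" where
  "Hs_density g \<longleftrightarrow> g \<in> borel_measurable borel \<and> L2_fun (weighted s g)"

definition Hs_norm :: "(real \<Rightarrow> complex) \<Rightarrow> real" where
  "Hs_norm g = L2_norm (weighted s g)"

lemma Hs_density_measurable [measurable_dest]: "Hs_density g \<Longrightarrow> g \<in> borel_measurable borel"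
  by (simp add: Hs_density_def)

lemma profile_measurable [measurable (raw)]:
  assumes [measurable]: "g \<in> borel_measurable borel" "h \<in> borel_measurable M" "h' \<in> borel_measurable M"
  shows "(\<lambda>x. profile g f (h x) (h' x)) \<in> borel_measurable M"
  unfolding profile_def by measurable

lemma profile_x_measurable [measurable (raw)]:
  assumes [measurable]: "g \<in> borel_measurable borel" "h \<in> borel_measurable M" "h' \<in> borel_measurable M"
  shows "(\<lambda>x. profile_x g f (h x) (h' x)) \<in> borel_measurable M"
  unfolding profile_x_def by measurable

lemma profile_weighted:
  assumes a: "0 \<le> a" "\<sigma> - a \<le> s" and a': "0 \<le> a'" "a' < p" "\<sigma> - k - a' < - 1 / 2"
  shows "\<exists>C\<ge>0. \<exists>D\<ge>0. \<forall>g f t. Hs_density g \<longrightarrow> 0 < t \<longrightarrow> t \<le> 1 \<longrightarrow>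
    L2_fun (weighted \<sigma> (profile g f t)) \<and>
    L2_norm (weighted \<sigma> (profile g f t)) \<le> C * t powr (- (a / p)) * Hs_norm g + D * t powr (1 - a' / p - 2 * \<beta>) * norm f"
proof -
  obtain C where C: "0 \<le> C" "decay_bound a C"
    using m_decay[OF a(1)] by auto
  obtain D where D: "0 \<le> D" "\<forall>f t \<xi>. 0 < t \<longrightarrow> t \<le> 1 \<longrightarrow> cmod (duhamel f t \<xi>) \<le> D * norm f * t powr (1 - a' / p - 2 * \<beta>) * bracket \<xi> powr (- k - a')"
    using duhamel_bound[OF a'(1,2)] by auto
  define w where "w = - (\<sigma> - k - a')"
  have w: "1 / 2 < w" using a' by (simp add: w_def)
  define L where "L = L2_norm (\<lambda>\<xi>. of_real (bracket \<xi> powr (- w)))"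
  have "L2_fun (weighted \<sigma> (profile g f t)) \<and>
    L2_norm (weighted \<sigma> (profile g f t)) \<le> C * t powr (- (a / p)) * Hs_norm g + (D * L) * t powr (1 - a' / p - 2 * \<beta>) * norm f"
    if g: "Hs_density g" and t: "0 < t" "t \<le> 1" for g f t
  proof -
    have [measurable]: "g \<in> borel_measurable borel" using g by (simp add: Hs_density_def)
    have m: "(weighted \<sigma> (profile g f t)) \<in> borel_measurable borel" by measurable
    let ?c = "C * t powr (- (a / p))" and ?d = "D * norm f * t powr (1 - a' / p - 2 * \<beta>)"
    have cd: "0 \<le> ?c" "0 \<le> ?d" using C D by auto
    have le: "cmod (of_real (bracket \<xi> powr \<sigma>) * profile g f t \<xi>) \<le> ?c * cmod (of_real (bracket \<xi> powr s) * g \<xi>) + ?d * cmod (of_real (bracket \<xi> powr (- w)))" for \<xi>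
    proof -
      have "cmod (of_real (bracket \<xi> powr \<sigma>) * profile g f t \<xi>) \<le> bracket \<xi> powr \<sigma> * (cmod (m t \<xi>) * cmod (g \<xi>) + cmod (duhamel f t \<xi>))"
        unfolding norm_mult profile_def using norm_triangle_ineq4[of "m t \<xi> * g \<xi>" "duhamel f t \<xi>"]
        by (intro mult_mono) (auto simp: norm_mult)
      also have "\<dots> \<le> bracket \<xi> powr \<sigma> * ((C * (t powr (- (a / p)) * bracket \<xi> powr (- a))) * cmod (g \<xi>) + ?d * bracket \<xi> powr (- k - a'))"
        using C D t by (intro mult_left_mono add_mono mult_right_mono) auto
      also have "\<dots> = ?c * ((bracket \<xi> powr \<sigma> * bracket \<xi> powr (- a)) * cmod (g \<xi>)) + ?d * (bracket \<xi> powr \<sigma> * bracket \<xi> powr (- k - a'))"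
        by (simp add: algebra_simps)
      also have "\<dots> \<le> ?c * (bracket \<xi> powr s * cmod (g \<xi>)) + ?d * bracket \<xi> powr (- w)"
      proof (intro add_mono mult_left_mono cd mult_right_mono)
        show "bracket \<xi> powr \<sigma> * bracket \<xi> powr (- a) \<le> bracket \<xi> powr s"
          unfolding powr_add[symmetric] using a by (intro bracket_powr_mono) simp
        show "bracket \<xi> powr \<sigma> * bracket \<xi> powr (- k - a') \<le> bracket \<xi> powr (- w)"
          unfolding powr_add[symmetric] by (intro bracket_powr_mono) (simp add: w_def)
      qed auto
      finally show ?thesis by (simp add: norm_mult)
    qed
    note b = L2_fun_bound2[OF _ L2_fun_bracket[OF w] m cd le]
    show ?thesis
      using b[OF g[unfolded Hs_density_def, THEN conjunct2]] by (auto simp: Hs_norm_def L_def mult_ac)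
  qed
  then show ?thesis using C D by (intro exI[of _ C] conjI exI[of _ "D * L"]) (auto simp: L_def)
qed

lemma profile_x_le: "cmod (profile_x g f t \<xi>) \<le> bracket \<xi> * cmod (profile g f t \<xi>)"
  unfolding profile_x_def norm_mult by (simp add: abs_le_bracket mult_right_mono)

lemma profile_x_weighted:
  assumes "g \<in> borel_measurable borel" "L2_fun (weighted (\<sigma> + 1) (profile g f t))"
  shows "L2_fun (weighted \<sigma> (profile_x g f t))"
    "L2_norm (weighted \<sigma> (profile_x g f t)) \<le> L2_norm (weighted (\<sigma> + 1) (profile g f t))"
proof -
  have [measurable]: "g \<in> borel_measurable borel" by fact
  have m: "(weighted \<sigma> (profile_x g f t)) \<in> borel_measurable borel" by measurable
  have le: "cmod (of_real (bracket \<xi> powr \<sigma>) * profile_x g f t \<xi>) \<le> cmod (of_real (bracket \<xi> powr (\<sigma> + 1)) * profile g f t \<xi>)" for \<xi>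
    using mult_left_mono[OF profile_x_le[of g f t \<xi>], of "bracket \<xi> powr \<sigma>"] by (simp add: norm_mult powr_add mult_ac)
  note d = L2_fun_dominated[OF assms(2) m le]
  show "L2_fun (weighted \<sigma> (profile_x g f t))" by (rule d(1))
  show "L2_norm (weighted \<sigma> (profile_x g f t)) \<le> L2_norm (weighted (\<sigma> + 1) (profile g f t))" by (rule d(2))
qed

text \<open>The fundamental estimate: the linear part gains \<open>p \<beta>\<close> derivatives and the Duhamel part \<open>p \<gamma>\<close>.\<close>

lemma profile_x_estimate:
  "\<exists>C\<ge>0. \<exists>D\<ge>0. \<forall>g f t. Hs_density g \<longrightarrow> 0 < t \<longrightarrow> t \<le> 1 \<longrightarrow>
    L2_fun (weighted k (profile_x g f t)) \<and>
    L2_norm (weighted k (profile_x g f t)) \<le> C * t powr (- \<beta>) * Hs_norm g + D * t powr (1 - \<gamma> - 2 * \<beta>) * norm f"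
proof -
  have eq: "(p * \<beta>) / p = \<beta>" "(p * \<gamma>) / p = \<gamma>" using p_pos by auto
  have "p * \<gamma> < p * 1" using p_pos \<gamma> by (intro mult_strict_left_mono) auto
  then have "0 \<le> p * \<beta>" "k + 1 - p * \<beta> \<le> s" "0 \<le> p * \<gamma>" "p * \<gamma> < p" "k + 1 - k - p * \<gamma> < - 1 / 2"
    using k_\<beta> p_pos \<beta> \<gamma> by auto
  from profile_weighted[OF this] obtain C D where C: "C \<ge> 0" "D \<ge> 0" and CD: "\<forall>g f t. Hs_density g \<longrightarrow> 0 < t \<longrightarrow> t \<le> 1 \<longrightarrow>
    L2_fun (weighted (k + 1) (profile g f t)) \<and>
    L2_norm (weighted (k + 1) (profile g f t)) \<le> C * t powr (- \<beta>) * Hs_norm g + D * t powr (1 - \<gamma> - 2 * \<beta>) * norm f"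
    unfolding eq by (elim exE conjE)
  have "L2_fun (weighted k (profile_x g f t)) \<and>
    L2_norm (weighted k (profile_x g f t)) \<le> C * t powr (- \<beta>) * Hs_norm g + D * t powr (1 - \<gamma> - 2 * \<beta>) * norm f"
    if g: "Hs_density g" and t: "0 < t" "t \<le> 1" for g f t
  proof -
    note U = CD[rule_format, OF g t, of f]
    have g': "g \<in> borel_measurable borel" using g by (simp add: Hs_density_def)
    note W = profile_x_weighted[OF g' U[THEN conjunct1]]
    show ?thesis using W(1) order_trans[OF W(2) U[THEN conjunct2]] by (rule conjI)
  qed
  then show ?thesis using C by blast
qed

lemma Hs_exponent: obtains a where "0 \<le> a" "a < p * (1 - 2 * \<beta>)" "s - k + 1 / 2 < a"
proof -
  have "max 0 (s - k + 1 / 2) < p * (1 - 2 * \<beta>)"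
  proof (cases "s < 1")
    case True
    then have "p * (1 - 2 * \<beta>) = p - 2 * (1 - s)" "k = 0"
      using p_pos by (auto simp: \<beta>_def k_def max_def field_simps)
    then show ?thesis using s p by auto
  next
    case False
    then have "\<beta> = 0" "s - k = 1" using p_pos by (auto simp: \<beta>_def k_def max_def field_simps)
    then show ?thesis using p by auto
  qed
  then obtain a where "max 0 (s - k + 1 / 2) < a" "a < p * (1 - 2 * \<beta>)" using dense by blast
  then show ?thesis by (intro that[of a]) auto
qed

lemma duhamel_Hs_bound:
  "\<exists>C\<ge>0. \<exists>w>1/2. \<forall>f t \<xi>. t \<le> 1 \<longrightarrow> bracket \<xi> powr s * cmod (duhamel f t \<xi>) \<le> C * norm f * bracket \<xi> powr (- w)"
proof -
  obtain a where a: "0 \<le> a" "a < p * (1 - 2 * \<beta>)" "s - k + 1 / 2 < a" by (rule Hs_exponent)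
  have "p * (1 - 2 * \<beta>) \<le> p * 1" using \<beta> p_pos by (intro mult_left_mono) auto
  then have ap: "a < p" using a(2) by simp
  have e: "0 \<le> 1 - a / p - 2 * \<beta>" using a(2) p_pos by (simp add: field_simps)
  obtain C where C: "0 \<le> C" "\<forall>f t \<xi>. 0 < t \<longrightarrow> t \<le> 1 \<longrightarrow> cmod (duhamel f t \<xi>) \<le> C * norm f * t powr (1 - a / p - 2 * \<beta>) * bracket \<xi> powr (- k - a)"
    using duhamel_bound[OF a(1) ap] by auto
  have "bracket \<xi> powr s * cmod (duhamel f t \<xi>) \<le> C * norm f * bracket \<xi> powr (- (a + k - s))" if t: "t \<le> 1" for f t \<xi>
  proof (cases "0 < t")
    case True
    have "t powr (1 - a / p - 2 * \<beta>) \<le> 1" using True t e by (intro powr_le1) auto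
    then have "cmod (duhamel f t \<xi>) \<le> C * norm f * 1 * bracket \<xi> powr (- k - a)"
      using C True t by (intro order_trans[OF C(2)[rule_format]] mult_right_mono mult_left_mono) auto
    then have "bracket \<xi> powr s * cmod (duhamel f t \<xi>) \<le> bracket \<xi> powr s * (C * norm f * bracket \<xi> powr (- k - a))"
      by (intro mult_left_mono) auto
    also have "\<dots> = C * norm f * (bracket \<xi> powr s * bracket \<xi> powr (- k - a))" by simp
    also have "bracket \<xi> powr s * bracket \<xi> powr (- k - a) = bracket \<xi> powr (- (a + k - s))"
      by (simp add: powr_add[symmetric] algebra_simps)
    finally show ?thesis .
  next
    case False then show ?thesis using C by (simp add: duhamel_nonpos)
  qed
  then show ?thesis using C a by (intro exI[of _ C] conjI exI[of _ "a + k - s"]) auto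
qed

lemma profile_Hs:
  "\<exists>C\<ge>0. \<forall>g f t. Hs_density g \<longrightarrow> 0 \<le> t \<longrightarrow> t \<le> 1 \<longrightarrow> L2_fun (weighted s (profile g f t)) \<and>
    L2_norm (weighted s (profile g f t)) \<le> C * (Hs_norm g + norm f)"
proof -
  obtain C w where C: "0 \<le> C" "1 / 2 < w" "\<forall>f t \<xi>. t \<le> 1 \<longrightarrow> bracket \<xi> powr s * cmod (duhamel f t \<xi>) \<le> C * norm f * bracket \<xi> powr (- w)"
    using duhamel_Hs_bound by auto
  define L where "L = L2_norm (\<lambda>\<xi>. of_real (bracket \<xi> powr (- w)))"
  have L: "0 \<le> L" by (simp add: L_def)
  have "L2_fun (weighted s (profile g f t)) \<and>
    L2_norm (weighted s (profile g f t)) \<le> (exp A0 + C * L) * (Hs_norm g + norm f)"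
    if g: "Hs_density g" and t: "0 \<le> t" "t \<le> 1" for g f t
  proof -
    have [measurable]: "g \<in> borel_measurable borel" using g by (simp add: Hs_density_def)
    have m: "(weighted s (profile g f t)) \<in> borel_measurable borel" by measurable
    have cd: "0 \<le> exp A0" "0 \<le> C * norm f" using C by auto
    have le: "cmod (of_real (bracket \<xi> powr s) * profile g f t \<xi>) \<le> exp A0 * cmod (of_real (bracket \<xi> powr s) * g \<xi>) + C * norm f * cmod (of_real (bracket \<xi> powr (- w)))" for \<xi>
    proof -
      have "cmod (of_real (bracket \<xi> powr s) * profile g f t \<xi>) \<le> bracket \<xi> powr s * (cmod (m t \<xi>) * cmod (g \<xi>) + cmod (duhamel f t \<xi>))"
        unfolding norm_mult profile_def using norm_triangle_ineq4[of "m t \<xi> * g \<xi>" "duhamel f t \<xi>"]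
        by (intro mult_mono) (auto simp: norm_mult)
      also have "\<dots> \<le> bracket \<xi> powr s * (exp A0 * cmod (g \<xi>) + cmod (duhamel f t \<xi>))"
        by (intro mult_left_mono add_mono mult_right_mono m_le t) auto
      also have "\<dots> = exp A0 * (bracket \<xi> powr s * cmod (g \<xi>)) + bracket \<xi> powr s * cmod (duhamel f t \<xi>)"
        by (simp add: algebra_simps)
      also have "\<dots> \<le> exp A0 * (bracket \<xi> powr s * cmod (g \<xi>)) + C * norm f * bracket \<xi> powr (- w)"
        using C t by (intro add_mono) auto
      finally show ?thesis by (simp add: norm_mult)
    qed
    note b = L2_fun_bound2[OF g[unfolded Hs_density_def, THEN conjunct2] L2_fun_bracket[OF C(2)] m cd le]
    have "exp A0 * Hs_norm g + C * norm f * L \<le> (exp A0 + C * L) * (Hs_norm g + norm f)"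
      using C L by (simp add: algebra_simps Hs_norm_def)
    then show ?thesis using b unfolding Hs_norm_def L_def by auto
  qed
  then show ?thesis using C L by (intro exI[of _ "exp A0 + C * L"]) auto
qed

lemma profile_x_integrable:
  assumes g: "Hs_density g" and t: "0 < t" "t \<le> 1"
  shows "integrable lborel (profile_x g f t)"
proof -
  have [measurable]: "g \<in> borel_measurable borel" using g by (simp add: Hs_density_def)
  define a where "a = max 0 (2 - s)"
  obtain C where C: "0 \<le> C" "decay_bound a C"
    using m_decay[of a] by (auto simp: a_def)
  obtain D where D: "0 \<le> D" "\<forall>f t \<xi>. 0 < t \<longrightarrow> t \<le> 1 \<longrightarrow> cmod (duhamel f t \<xi>) \<le> D * norm f * t powr (1 - 3 / p - 2 * \<beta>) * bracket \<xi> powr (- k - 3)"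
    using duhamel_bound[of 3] p by auto
  let ?c = "C * t powr (- (a / p))" and ?d = "D * norm f * t powr (1 - 3 / p - 2 * \<beta>)"
  have i1: "integrable lborel (\<lambda>\<xi>. cmod (of_real (bracket \<xi> powr (- 1)) * (of_real (bracket \<xi> powr s) * g \<xi>)))"
    using L2_fun_product(1)[OF L2_fun_bracket[of 1], of "\<lambda>\<xi>. of_real (bracket \<xi> powr s) * g \<xi>"] g by (intro integrable_norm) (auto simp: Hs_density_def)
  show ?thesis
  proof (rule integrable_dominated)
    show "integrable lborel (\<lambda>\<xi>. ?c * cmod (of_real (bracket \<xi> powr (- 1)) * (of_real (bracket \<xi> powr s) * g \<xi>)) + ?d * bracket \<xi> powr (- 2))"
      by (intro Bochner_Integration.integrable_add integrable_mult_right i1 integrable_bracket) auto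
    show "norm (profile_x g f t \<xi>) \<le> ?c * cmod (of_real (bracket \<xi> powr (- 1)) * (of_real (bracket \<xi> powr s) * g \<xi>)) + ?d * bracket \<xi> powr (- 2)" for \<xi>
    proof -
      have "cmod (profile_x g f t \<xi>) \<le> bracket \<xi> powr 1 * (cmod (m t \<xi>) * cmod (g \<xi>) + cmod (duhamel f t \<xi>))"
        using norm_triangle_ineq4[of "m t \<xi> * g \<xi>" "duhamel f t \<xi>"]
        by (intro order_trans[OF profile_x_le]) (auto simp: profile_def norm_mult intro!: mult_mono)
      also have "\<dots> \<le> bracket \<xi> powr 1 * ((C * (t powr (- (a / p)) * bracket \<xi> powr (- a))) * cmod (g \<xi>) + ?d * bracket \<xi> powr (- k - 3))"
        using C D t by (intro mult_left_mono add_mono mult_right_mono) auto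
      also have "\<dots> = ?c * ((bracket \<xi> powr 1 * bracket \<xi> powr (- a)) * cmod (g \<xi>)) + ?d * (bracket \<xi> powr 1 * bracket \<xi> powr (- k - 3))"
        by (simp only: algebra_simps)
      also have "\<dots> \<le> ?c * ((bracket \<xi> powr (- 1) * bracket \<xi> powr s) * cmod (g \<xi>)) + ?d * bracket \<xi> powr (- 2)"
      proof (intro add_mono mult_left_mono mult_right_mono)
        show "bracket \<xi> powr 1 * bracket \<xi> powr (- a) \<le> bracket \<xi> powr (- 1) * bracket \<xi> powr s"
          unfolding powr_add[symmetric] by (intro bracket_powr_mono) (simp add: a_def)
        show "bracket \<xi> powr 1 * bracket \<xi> powr (- k - 3) \<le> bracket \<xi> powr (- 2)"
          unfolding powr_add[symmetric] using k_nonneg by (intro bracket_powr_mono) simp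
      qed (use C D in auto)
      finally show ?thesis by (simp only: norm_mult norm_of_real abs_of_nonneg[OF powr_ge_zero] mult.assoc)
    qed
  qed measurable
qed

end

section \<open>A weakly singular Volterra inequality\<close>

text \<open>Differences \<open>D\<close> of two solutions satisfy \<open>D \<le> volterra C \<gamma> N D\<close> with a square integrable \<open>N\<close>. Values in \<open>ennreal\<close> avoid
  all integrability conditions.\<close>

definition volterra :: "real \<Rightarrow> real \<Rightarrow> (real \<Rightarrow> real) \<Rightarrow> (real \<Rightarrow> ennreal) \<Rightarrow> real \<Rightarrow> ennreal" where
  "volterra C \<gamma> N b t = ennreal C * (\<integral>\<^sup>+r. indicator {0<..<t} r * (ennreal ((t - r) powr (- \<gamma>)) * (ennreal (N r) * b r)) \<partial>lborel)"

lemma volterra_measurable: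
  assumes [measurable]: "N \<in> borel_measurable borel" "b \<in> borel_measurable borel"
  shows "volterra C \<gamma> N b \<in> borel_measurable borel"
proof -
  have eq: "indicator {0<..<t} r = (if 0 < r \<and> r < t then 1 else (0::ennreal))" for t r :: real
    by (auto simp: indicator_def)
  show ?thesis unfolding volterra_def eq by measurable
qed

text \<open>Cauchy-Schwarz with respect to the measure \<open>N b dr\<close>, then Tonelli. The exponential weight makes the
  integral of the squared kernel as small as desired.\<close>

lemma volterra_contraction:
  fixes \<gamma> \<tau> C lam :: real
  assumes \<tau>: "\<tau> \<le> 1" and [measurable]: "N \<in> borel_measurable borel" "b \<in> borel_measurable borel"
    and N: "\<And>r. 0 \<le> N r" and C: "0 \<le> C"
  defines "I \<equiv> \<lambda>b. \<integral>\<^sup>+t. indicator {0<..<\<tau>} t * (b t * ennreal (exp (- lam * t)))\<^sup>2 \<partial>lborel"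
  shows "I (volterra C \<gamma> N b) \<le> ennreal (C\<^sup>2) * (\<integral>\<^sup>+x. indicator {0<..<1} x * (ennreal (x powr (- \<gamma>) * exp (- lam * x)))\<^sup>2 \<partial>lborel)
     * (\<integral>\<^sup>+r. (ennreal (N r))\<^sup>2 \<partial>lborel) * I b"
proof -
  define \<kappa> where "\<kappa> x = indicator {0<..<1} x * ennreal (x powr (- \<gamma>) * exp (- lam * x))" for x
  define A where "A r = ennreal (N r) * (indicator {0<..<\<tau>} r * (b r * ennreal (exp (- lam * r))))" for r
  have [measurable]: "\<kappa> \<in> borel_measurable borel" "A \<in> borel_measurable borel"
    unfolding \<kappa>_def A_def by measurable
  define a where "a = (\<integral>\<^sup>+r. A r \<partial>lborel)"
  define kk where "kk = (\<integral>\<^sup>+x. (\<kappa> x)\<^sup>2 \<partial>lborel)"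
  have pt: "indicator {0<..<\<tau>} t * (volterra C \<gamma> N b t * ennreal (exp (- lam * t)))\<^sup>2
      \<le> ennreal (C\<^sup>2) * (a * (\<integral>\<^sup>+r. (\<kappa> (t - r))\<^sup>2 * A r \<partial>lborel))" for t
  proof (cases "t \<in> {0<..<\<tau>}")
    case True
    have "(\<integral>\<^sup>+r. indicator {0<..<t} r * (ennreal ((t - r) powr (- \<gamma>)) * (ennreal (N r) * b r)) \<partial>lborel) * ennreal (exp (- lam * t))
       = (\<integral>\<^sup>+r. (indicator {0<..<t} r * (ennreal ((t - r) powr (- \<gamma>)) * (ennreal (N r) * b r))) * ennreal (exp (- lam * t)) \<partial>lborel)"
      by (subst nn_integral_multc) auto
    also have "\<dots> \<le> (\<integral>\<^sup>+r. \<kappa> (t - r) * A r \<partial>lborel)"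
    proof (rule nn_integral_mono)
      fix r
      show "(indicator {0<..<t} r * (ennreal ((t - r) powr (- \<gamma>)) * (ennreal (N r) * b r))) * ennreal (exp (- lam * t)) \<le> \<kappa> (t - r) * A r"
      proof (cases "r \<in> {0<..<t}")
        case r: True
        have "ennreal (exp (- lam * t)) = ennreal (exp (- lam * (t - r))) * ennreal (exp (- lam * r))"
          by (simp add: ennreal_mult[symmetric] exp_add[symmetric] algebra_simps)
        then show ?thesis using r True \<tau>
          by (simp add: \<kappa>_def A_def ennreal_mult mult_ac)
      qed simp
    qed
    finally have le: "volterra C \<gamma> N b t * ennreal (exp (- lam * t)) \<le> ennreal C * (\<integral>\<^sup>+r. \<kappa> (t - r) * A r \<partial>lborel)"
      unfolding volterra_def mult.assoc by (rule mult_left_mono) simp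
    have "(\<integral>\<^sup>+r. \<kappa> (t - r) * A r \<partial>lborel) = (\<integral>\<^sup>+r. \<kappa> (t - r) * 1 \<partial>density lborel A)"
      by (subst nn_integral_density) (auto simp: mult.commute)
    then have "(\<integral>\<^sup>+r. \<kappa> (t - r) * A r \<partial>lborel)\<^sup>2 \<le> (\<integral>\<^sup>+r. (\<kappa> (t - r))\<^sup>2 \<partial>density lborel A) * (\<integral>\<^sup>+r. 1\<^sup>2 \<partial>density lborel A)"
      by (simp only:) (rule Cauchy_Schwarz_nn_integral; measurable)
    also have "(\<integral>\<^sup>+r. 1\<^sup>2 \<partial>density lborel A) = a"
      unfolding a_def by (subst nn_integral_density) auto
    also have "(\<integral>\<^sup>+r. (\<kappa> (t - r))\<^sup>2 \<partial>density lborel A) = (\<integral>\<^sup>+r. (\<kappa> (t - r))\<^sup>2 * A r \<partial>lborel)"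
      by (subst nn_integral_density) (auto simp: mult.commute)
    finally have cs: "(\<integral>\<^sup>+r. \<kappa> (t - r) * A r \<partial>lborel)\<^sup>2 \<le> (\<integral>\<^sup>+r. (\<kappa> (t - r))\<^sup>2 * A r \<partial>lborel) * a" .
    have "(volterra C \<gamma> N b t * ennreal (exp (- lam * t)))\<^sup>2 \<le> (ennreal C * (\<integral>\<^sup>+r. \<kappa> (t - r) * A r \<partial>lborel))\<^sup>2"
      by (rule power_mono[OF le]) simp
    also have "\<dots> = ennreal (C\<^sup>2) * (\<integral>\<^sup>+r. \<kappa> (t - r) * A r \<partial>lborel)\<^sup>2"
      using C by (simp add: power_mult_distrib ennreal_power)
    also have "\<dots> \<le> ennreal (C\<^sup>2) * ((\<integral>\<^sup>+r. (\<kappa> (t - r))\<^sup>2 * A r \<partial>lborel) * a)"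
      by (rule mult_left_mono[OF cs]) simp
    finally show ?thesis using True by (simp add: mult_ac)
  qed simp
  have "I (volterra C \<gamma> N b) \<le> (\<integral>\<^sup>+t. ennreal (C\<^sup>2) * (a * (\<integral>\<^sup>+r. (\<kappa> (t - r))\<^sup>2 * A r \<partial>lborel)) \<partial>lborel)"
    unfolding I_def by (intro nn_integral_mono pt)
  also have "\<dots> = ennreal (C\<^sup>2) * (a * (\<integral>\<^sup>+t. (\<integral>\<^sup>+r. (\<kappa> (t - r))\<^sup>2 * A r \<partial>lborel) \<partial>lborel))"
    by (simp add: nn_integral_cmult)
  also have "(\<integral>\<^sup>+t. (\<integral>\<^sup>+r. (\<kappa> (t - r))\<^sup>2 * A r \<partial>lborel) \<partial>lborel) = (\<integral>\<^sup>+r. (\<integral>\<^sup>+t. (\<kappa> (t - r))\<^sup>2 * A r \<partial>lborel) \<partial>lborel)"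
    by (rule lborel_pair.Fubini') measurable
  also have "\<dots> = (\<integral>\<^sup>+r. kk * A r \<partial>lborel)"
  proof (rule nn_integral_cong)
    fix r
    have "(\<integral>\<^sup>+t. (\<kappa> (t - r))\<^sup>2 * A r \<partial>lborel) = (\<integral>\<^sup>+t. (\<kappa> (t - r))\<^sup>2 \<partial>lborel) * A r"
      by (rule nn_integral_multc) measurable
    also have "(\<integral>\<^sup>+t. (\<kappa> (t - r))\<^sup>2 \<partial>lborel) = kk"
      unfolding kk_def using nn_integral_real_affine[of "\<lambda>x. (\<kappa> x)\<^sup>2" 1 "- r"] by (simp add: add.commute)
    finally show "(\<integral>\<^sup>+t. (\<kappa> (t - r))\<^sup>2 * A r \<partial>lborel) = kk * A r" .
  qed
  also have "\<dots> = kk * a" unfolding a_def by (rule nn_integral_cmult) measurable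
  finally have "I (volterra C \<gamma> N b) \<le> ennreal (C\<^sup>2) * kk * a\<^sup>2"
    by (simp add: power2_eq_square mult_ac)
  also have "\<dots> \<le> ennreal (C\<^sup>2) * kk * ((\<integral>\<^sup>+r. (ennreal (N r))\<^sup>2 \<partial>lborel) * I b)"
  proof (rule mult_left_mono)
    have "a\<^sup>2 \<le> (\<integral>\<^sup>+r. (ennreal (N r))\<^sup>2 \<partial>lborel) * (\<integral>\<^sup>+r. (indicator {0<..<\<tau>} r * (b r * ennreal (exp (- lam * r))))\<^sup>2 \<partial>lborel)"
      unfolding a_def A_def by (rule Cauchy_Schwarz_nn_integral) measurable
    also have "(\<integral>\<^sup>+r. (indicator {0<..<\<tau>} r * (b r * ennreal (exp (- lam * r))))\<^sup>2 \<partial>lborel) = I b"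
      unfolding I_def by (intro nn_integral_cong) (simp add: indicator_def)
    finally show "a\<^sup>2 \<le> (\<integral>\<^sup>+r. (ennreal (N r))\<^sup>2 \<partial>lborel) * I b" .
  qed simp
  also have "kk = (\<integral>\<^sup>+x. indicator {0<..<1} x * (ennreal (x powr (- \<gamma>) * exp (- lam * x)))\<^sup>2 \<partial>lborel)"
    unfolding kk_def \<kappa>_def by (intro nn_integral_cong) (simp add: indicator_def)
  finally show ?thesis by (simp add: mult.assoc)
qed

text \<open>The hypothesis \<open>step\<close> only compares \<open>D\<close> with measurable upper bounds \<open>b\<close>, since \<open>D\<close> itself need not be
  measurable. The iterates of \<open>volterra\<close> starting from \<open>N\<close> are such bounds, and they tend to 0 in a
  weighted \<open>L\<^sup>2\<close> norm.\<close>

lemma volterra_zero: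
  fixes \<gamma> \<tau> C :: real and D :: "real \<Rightarrow> ennreal"
  assumes \<gamma>: "0 \<le> \<gamma>" "2 * \<gamma> < 1" and \<tau>: "\<tau> \<le> 1" and Nm[measurable]: "N \<in> borel_measurable borel"
    and N: "\<And>r. 0 \<le> N r" and N2: "integrable lborel (\<lambda>r. (N r)\<^sup>2)" and C: "0 \<le> C"
    and start: "AE r in lborel. 0 < r \<and> r < \<tau> \<longrightarrow> D r \<le> ennreal (N r)"
    and step: "\<And>b. b \<in> borel_measurable borel \<Longrightarrow> (AE r in lborel. 0 < r \<and> r < \<tau> \<longrightarrow> D r \<le> b r) \<Longrightarrow>
      (AE r in lborel. 0 < r \<and> r < \<tau> \<longrightarrow> D r \<le> volterra C \<gamma> N b r)"
  shows "AE r in lborel. 0 < r \<and> r < \<tau> \<longrightarrow> D r = 0"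
proof -
  define Nr where "Nr = (LINT r|lborel. (N r)\<^sup>2)"
  have Nr: "(\<integral>\<^sup>+r. (ennreal (N r))\<^sup>2 \<partial>lborel) = ennreal Nr" "0 \<le> Nr"
    unfolding Nr_def using nn_integral_eq_integral[OF N2] by (auto simp: ennreal_power N)
  define J where "J n = (LINT x|lborel. indicator {0<..<1} x * (x powr (- (2 * \<gamma>)) * exp (- (2 * real n) * x)))" for n :: nat
  have wi: "integrable lborel (\<lambda>x. indicator {0<..<1} x * x powr (- (2 * \<gamma>)))"
    using \<gamma> by (intro integral_powr_0(1)) auto
  have Jle: "norm (indicator {0<..<1} x * (x powr (- (2 * \<gamma>)) * exp (- (2 * real n) * x))) \<le> indicator {0<..<1} x * x powr (- (2 * \<gamma>))" for x n
    by (cases "x \<in> {0<..<1}") (auto intro!: mult_left_le)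
  have Ji: "integrable lborel (\<lambda>x. indicator {0<..<1} x * (x powr (- (2 * \<gamma>)) * exp (- (2 * real n) * x)))" for n
    by (rule Bochner_Integration.integrable_bound[OF wi]) (measurable, use Jle[of _ n] in \<open>auto intro!: AE_I2 order_trans[OF _ abs_ge_self]\<close>)
  have "J \<longlonglongrightarrow> (LINT x::real|lborel. (0::real))"
    unfolding J_def
  proof (rule integral_dominated_convergence[OF _ _ wi])
    have "(\<lambda>n. indicator {0<..<1} x * (x powr (- (2 * \<gamma>)) * exp (- (2 * real n) * x))) \<longlonglongrightarrow> 0" for x :: real
    proof (cases "x \<in> {0<..<1}")
      case True
      then have "x > 0" by simp
      then have "(\<lambda>n. exp (- (2 * real n) * x)) \<longlonglongrightarrow> 0" by real_asymp
      from tendsto_mult[OF tendsto_const[of "x powr (- (2 * \<gamma>))"] this] show ?thesis using True by simp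
    qed simp
    then show "AE x in lborel. (\<lambda>n. indicator {0<..<1} x * (x powr (- (2 * \<gamma>)) * exp (- (2 * real n) * x))) \<longlonglongrightarrow> 0" by simp
    show "AE x in lborel. norm (indicator {0<..<1} x * (x powr (- (2 * \<gamma>)) * exp (- (2 * real n) * x))) \<le> indicator {0<..<1} x * x powr (- (2 * \<gamma>))" for n
      using Jle by (intro AE_I2)
  qed measurable
  then have "(\<lambda>n. C\<^sup>2 * J n * Nr) \<longlonglongrightarrow> C\<^sup>2 * 0 * Nr" by (intro tendsto_intros) simp
  then have "\<forall>\<^sub>F n in sequentially. C\<^sup>2 * J n * Nr < 1 / 2" by (intro order_tendstoD) auto
  \<comment> \<open>the rate of the exponential weight that makes the contraction factor less than 1/2\<close>
  then obtain n where n: "C\<^sup>2 * J n * Nr < 1 / 2" by (auto simp: eventually_sequentially)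
  have J0: "0 \<le> J n" unfolding J_def by simp
  define lam where "lam = real n"
  define I where "I b = (\<integral>\<^sup>+t. indicator {0<..<\<tau>} t * (b t * ennreal (exp (- lam * t)))\<^sup>2 \<partial>lborel)" for b
  have kk: "(\<integral>\<^sup>+x. indicator {0<..<1} x * (ennreal (x powr (- \<gamma>) * exp (- lam * x)))\<^sup>2 \<partial>lborel) = ennreal (J n)"
  proof -
    have "indicator {0<..<1} x * (ennreal (x powr (- \<gamma>) * exp (- lam * x)))\<^sup>2 = ennreal (indicator {0<..<1} x * (x powr (- (2 * \<gamma>)) * exp (- (2 * real n) * x)))" for x
    proof (cases "x \<in> {0<..<1}")
      case True
      have "(x powr (- \<gamma>) * exp (- lam * x))\<^sup>2 = x powr (- (2 * \<gamma>)) * exp (- (2 * real n) * x)"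
        using True by (simp add: power_mult_distrib powr_power exp_double[symmetric] lam_def mult_ac)
      then show ?thesis using True by (simp add: ennreal_power)
    qed simp
    then have "(\<integral>\<^sup>+x. indicator {0<..<1} x * (ennreal (x powr (- \<gamma>) * exp (- lam * x)))\<^sup>2 \<partial>lborel)
      = (\<integral>\<^sup>+x. ennreal (indicator {0<..<1} x * (x powr (- (2 * \<gamma>)) * exp (- (2 * real n) * x))) \<partial>lborel)" by simp
    also have "\<dots> = ennreal (J n)" unfolding J_def by (rule nn_integral_eq_integral[OF Ji]) (auto intro!: AE_I2)
    finally show ?thesis .
  qed
  define B where "B j = (volterra C \<gamma> N ^^ j) (\<lambda>r. ennreal (N r))" for j
  have Bm[measurable]: "B j \<in> borel_measurable borel" for j
    by (induction j) (auto simp: B_def intro!: volterra_measurable)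
  have BD: "AE r in lborel. 0 < r \<and> r < \<tau> \<longrightarrow> D r \<le> B j r" for j
  proof (induction j)
    case 0 then show ?case using start by (simp add: B_def)
  next
    case (Suc j)
    from step[OF Bm Suc] show ?case by (simp add: B_def)
  qed
  have IB: "I (B j) \<le> ennreal ((1 / 2) ^ j * Nr)" for j
  proof (induction j)
    case 0
    have "I (B 0) \<le> (\<integral>\<^sup>+r. (ennreal (N r))\<^sup>2 \<partial>lborel)"
      unfolding I_def
    proof (rule nn_integral_mono)
      fix t
      show "indicator {0<..<\<tau>} t * (B 0 t * ennreal (exp (- lam * t)))\<^sup>2 \<le> (ennreal (N t))\<^sup>2"
      proof (cases "t \<in> {0<..<\<tau>}")
        case True
        have "ennreal (N t) * ennreal (exp (- lam * t)) \<le> ennreal (N t) * 1"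
          using True by (intro mult_left_mono) (auto simp: lam_def)
        then show ?thesis using True power_mono[of "ennreal (N t) * ennreal (exp (- lam * t))" "ennreal (N t)" 2] by (simp add: B_def)
      qed simp
    qed
    then show ?case using Nr by simp
  next
    case (Suc j)
    have "I (B (Suc j)) \<le> ennreal (C\<^sup>2) * ennreal (J n) * ennreal Nr * I (B j)"
      using volterra_contraction[OF \<tau> Nm Bm[of j] N C, of \<gamma> lam] unfolding kk Nr I_def[symmetric] by (simp add: B_def)
    also have "\<dots> = ennreal (C\<^sup>2 * J n * Nr) * I (B j)"
      using J0 Nr by (simp add: ennreal_mult)
    also have "\<dots> \<le> ennreal (1 / 2) * ennreal ((1 / 2) ^ j * Nr)"
      using n by (intro mult_mono Suc ennreal_leI) auto
    also have "\<dots> = ennreal ((1 / 2) * ((1 / 2) ^ j * Nr))"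
      by (rule ennreal_mult[symmetric]) (use Nr in auto)
    also have "(1 / 2) * ((1 / 2) ^ j * Nr) = (1 / 2) ^ Suc j * Nr" by simp
    finally show ?case .
  qed
  define Binf where "Binf t = (INF j. B j t)" for t
  have [measurable]: "Binf \<in> borel_measurable borel" unfolding Binf_def by measurable
  have "I Binf \<le> ennreal ((1 / 2) ^ j * Nr)" for j
  proof -
    have "I Binf \<le> I (B j)"
      unfolding I_def Binf_def by (intro nn_integral_mono mult_left_mono power_mono mult_right_mono INF_lower) auto
    then show ?thesis using IB[of j] by simp
  qed
  moreover have "(\<lambda>j. ennreal ((1 / 2) ^ j * Nr)) \<longlonglongrightarrow> ennreal 0"
  proof (rule tendsto_ennrealI)
    have "(\<lambda>j. (1 / 2) ^ j * Nr) \<longlonglongrightarrow> 0 * Nr"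
      by (intro tendsto_mult tendsto_const LIMSEQ_realpow_zero) auto
    then show "(\<lambda>j. (1 / 2) ^ j * Nr) \<longlonglongrightarrow> 0" by simp
  qed
  ultimately have "I Binf \<le> ennreal 0" by (intro LIMSEQ_le_const) auto
  then have "I Binf = 0" by simp
  then have "AE t in lborel. indicator {0<..<\<tau>} t * (Binf t * ennreal (exp (- lam * t)))\<^sup>2 = 0"
    unfolding I_def by (subst (asm) nn_integral_0_iff_AE) measurable
  moreover have "AE r in lborel. \<forall>j. 0 < r \<and> r < \<tau> \<longrightarrow> D r \<le> B j r"
    unfolding AE_all_countable using BD by blast
  ultimately show ?thesis
  proof eventually_elim
    case (elim t)
    show ?case
    proof
      assume t: "0 < t \<and> t < \<tau>"
      then have "Binf t = 0" using elim(1) by (auto simp: ennreal_eq_0_iff)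
      moreover have "D t \<le> Binf t" unfolding Binf_def using elim(2) t by (intro INF_greatest) auto
      ultimately show "D t = 0" by simp
    qed
  qed
qed

section \<open>Sobolev functions, derivatives and squares through Borel densities\<close>

lemma ex_borel_representative:
  fixes g :: "real \<Rightarrow> complex"
  assumes "g \<in> borel_measurable lebesgue"
  obtains g' where "g' \<in> borel_measurable borel" "AE x in lebesgue. g x = g' x"
proof -
  have "(\<lambda>x. Re (g x)) \<in> borel_measurable lebesgue" "(\<lambda>x. Im (g x)) \<in> borel_measurable lebesgue"
    using assms by measurable
  then obtain a b where ab: "a \<in> borel_measurable lborel" "b \<in> borel_measurable lborel"
    "AE x in lborel. Re (g x) = a x" "AE x in lborel. Im (g x) = b x"
    using completion_ex_borel_measurable_real by metis
  show ?thesis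
  proof (rule that[of "\<lambda>x. of_real (a x) + \<i> * of_real (b x)"])
    show "(\<lambda>x. of_real (a x) + \<i> * of_real (b x)) \<in> borel_measurable borel" using ab by simp
    have "AE x in lborel. g x = of_real (a x) + \<i> * of_real (b x)"
      using ab(3,4) by eventually_elim (simp add: complex_eq_iff)
    then show "AE x in lebesgue. g x = of_real (a x) + \<i> * of_real (b x)" by (rule AE_completion)
  qed
qed

lemma has_density_borel:
  assumes "has_density \<Lambda> g"
  obtains g' where "g' \<in> borel_measurable borel" "has_density \<Lambda> g'"
proof -
  have "g \<in> borel_measurable lebesgue" using assms by (simp add: has_density_def)
  then obtain g' where g': "g' \<in> borel_measurable borel" "AE x in lebesgue. g x = g' x"
    by (rule ex_borel_representative)
  have "g' \<in> borel_measurable lebesgue" using g'(1) by (simp add: measurable_completion)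
  then show ?thesis using that g' has_density_cong_AE[OF assms g'(2)] by blast
qed

lemma density_of_AE:
  assumes "has_density \<Lambda> g" "g \<in> borel_measurable borel"
  shows "AE x in lebesgue. density_of \<Lambda> x = g x" "density_of \<Lambda> \<in> borel_measurable lebesgue"
  using has_density_unique[OF has_density_density_of[OF assms(1)] assms(1)] has_density_density_of[OF assms(1)]
  by (auto simp: has_density_def)

lemma has_density_lborel:
  assumes "has_density \<Lambda> g" "g \<in> borel_measurable borel" "\<phi> \<in> schwartz"
  shows "integrable lborel (\<lambda>x. g x * \<phi> x)" "\<Lambda> \<phi> = (LINT x|lborel. g x * \<phi> x)"
proof -
  have m: "(\<lambda>x. g x * \<phi> x) \<in> borel_measurable lborel"
    using assms(2) schwartz_borel[OF assms(3)] by simp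
  show "integrable lborel (\<lambda>x. g x * \<phi> x)" "\<Lambda> \<phi> = (LINT x|lborel. g x * \<phi> x)"
    using assms(1,3) integrable_completion[OF m] integral_completion[OF m] by (auto simp: has_density_def)
qed

lemma has_densityI:
  assumes "g \<in> borel_measurable borel"
    and "\<And>\<phi>. \<phi> \<in> schwartz \<Longrightarrow> integrable lborel (\<lambda>x. g x * \<phi> x)"
    and "\<And>\<phi>. \<phi> \<in> schwartz \<Longrightarrow> \<Lambda> \<phi> = (LINT x|lborel. g x * \<phi> x)"
  shows "has_density \<Lambda> g"
  unfolding has_density_def
proof (intro conjI ballI)
  show "g \<in> borel_measurable lebesgue" using assms(1) by (simp add: measurable_completion)
  fix \<phi> assume \<phi>: "\<phi> \<in> schwartz"
  have m: "(\<lambda>x. g x * \<phi> x) \<in> borel_measurable lborel"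
    using assms(1) schwartz_borel[OF \<phi>] by simp
  show "integrable lebesgue (\<lambda>x. g x * \<phi> x)" "\<Lambda> \<phi> = (LINT x|lebesgue. g x * \<phi> x)"
    using assms(2,3)[OF \<phi>] integrable_completion[OF m] integral_completion[OF m] by auto
qed

lemma lebesgue_square_density:
  fixes w :: "real \<Rightarrow> real"
  assumes d: "has_density \<Lambda> g" and g: "g \<in> borel_measurable borel" and w: "w \<in> borel_measurable borel"
  shows "integrable lebesgue (\<lambda>x. w x * (cmod (density_of \<Lambda> x))\<^sup>2) \<longleftrightarrow> integrable lborel (\<lambda>x. w x * (cmod (g x))\<^sup>2)"
    "(LINT x|lebesgue. w x * (cmod (density_of \<Lambda> x))\<^sup>2) = (LINT x|lborel. w x * (cmod (g x))\<^sup>2)"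
proof -
  have m: "(\<lambda>x. w x * (cmod (g x))\<^sup>2) \<in> borel_measurable lborel" using g w by simp
  have ae: "AE x in lebesgue. w x * (cmod (density_of \<Lambda> x))\<^sup>2 = w x * (cmod (g x))\<^sup>2"
    using density_of_AE(1)[OF d g] by eventually_elim simp
  have [measurable]: "w \<in> borel_measurable lebesgue" "g \<in> borel_measurable lebesgue" "density_of \<Lambda> \<in> borel_measurable lebesgue"
    using w g density_of_AE(2)[OF d g] by (auto simp: measurable_completion)
  have m1: "(\<lambda>x. w x * (cmod (density_of \<Lambda> x))\<^sup>2) \<in> borel_measurable lebesgue" by measurable
  have m2: "(\<lambda>x. w x * (cmod (g x))\<^sup>2) \<in> borel_measurable lebesgue" by measurable
  show "integrable lebesgue (\<lambda>x. w x * (cmod (density_of \<Lambda> x))\<^sup>2) \<longleftrightarrow> integrable lborel (\<lambda>x. w x * (cmod (g x))\<^sup>2)"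
    using integrable_cong_AE[OF m1 m2 ae] integrable_completion[OF m] by simp
  show "(LINT x|lebesgue. w x * (cmod (density_of \<Lambda> x))\<^sup>2) = (LINT x|lborel. w x * (cmod (g x))\<^sup>2)"
    using integral_cong_AE[OF m1 m2 ae] integral_completion[OF m] by simp
qed

lemma sobolev_density:
  assumes d: "has_density (fourier_dist f) g" and g: "g \<in> borel_measurable borel"
  shows "f \<in> sobolev \<sigma> \<longleftrightarrow> L2_fun (weighted \<sigma> g)"
    "sobolev_norm \<sigma> f = L2_norm (weighted \<sigma> g)"
proof -
  have [measurable]: "g \<in> borel_measurable borel" by (rule g)
  have sq: "(1 + \<xi>\<^sup>2) powr \<sigma> * (cmod (g \<xi>))\<^sup>2 = (cmod (of_real (bracket \<xi> powr \<sigma>) * g \<xi>))\<^sup>2" for \<xi>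
    by (simp add: bracket_powr_square norm_mult power_mult_distrib)
  have w: "(\<lambda>\<xi>::real. (1 + \<xi>\<^sup>2) powr \<sigma>) \<in> borel_measurable borel" by measurable
  have m: "(weighted \<sigma> g) \<in> borel_measurable borel" by measurable
  show "f \<in> sobolev \<sigma> \<longleftrightarrow> L2_fun (weighted \<sigma> g)"
    using d m by (auto simp: sobolev_def L2_fun_def lebesgue_square_density(1)[OF d g w] sq)
  show "sobolev_norm \<sigma> f = L2_norm (weighted \<sigma> g)"
    by (simp add: sobolev_norm_def L2_norm_def lebesgue_square_density(2)[OF d g w] sq)
qed

lemma ex_fourier_density_borel:
  assumes "g \<in> borel_measurable borel" "L2_fun (weighted \<sigma> g)"
  shows "\<exists>f. has_density (fourier_dist f) g"
proof (rule ex_fourier_density[of _ \<sigma>])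
  show "g \<in> borel_measurable lebesgue" using assms(1) by (simp add: measurable_completion)
  have [measurable]: "g \<in> borel_measurable borel" by fact
  have m: "(\<lambda>\<xi>. (1 + \<xi>\<^sup>2) powr \<sigma> * (cmod (g \<xi>))\<^sup>2) \<in> borel_measurable lborel" by measurable
  have sq: "(1 + \<xi>\<^sup>2) powr \<sigma> * (cmod (g \<xi>))\<^sup>2 = (cmod (of_real (bracket \<xi> powr \<sigma>) * g \<xi>))\<^sup>2" for \<xi>
    by (simp add: bracket_powr_square norm_mult power_mult_distrib)
  show "integrable lebesgue (\<lambda>\<xi>. (1 + \<xi>\<^sup>2) powr \<sigma> * (cmod (g \<xi>))\<^sup>2)"
    using integrable_completion[OF m] assms(2) by (simp add: sq L2_fun_def)
qed

text \<open>A Borel measurable Fourier transform. Densities of distributions are determined up to Lebesgue null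
  sets only, so a Borel one can be chosen, which product measures require.\<close>

definition hat :: "tempered \<Rightarrow> real \<Rightarrow> complex" where
  "hat f = (SOME g. g \<in> borel_measurable borel \<and> has_density (fourier_dist f) g)"

lemma hat_eqI_AE:
  assumes "has_density (fourier_dist f) g" "g \<in> borel_measurable borel"
  shows "hat f \<in> borel_measurable borel" "has_density (fourier_dist f) (hat f)" "AE \<xi> in lborel. hat f \<xi> = g \<xi>"
proof -
  have "hat f \<in> borel_measurable borel \<and> has_density (fourier_dist f) (hat f)"
    unfolding hat_def by (rule someI[of _ g]) (use assms in auto)
  then show 1: "hat f \<in> borel_measurable borel" "has_density (fourier_dist f) (hat f)" by auto
  have "AE \<xi> in lebesgue. hat f \<xi> = g \<xi>" by (rule has_density_unique[OF 1(2) assms(1)])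
  then show "AE \<xi> in lborel. hat f \<xi> = g \<xi>" by (simp add: AE_completion_iff)
qed

lemma hat_sobolev:
  assumes "f \<in> sobolev \<sigma>"
  shows "hat f \<in> borel_measurable borel" "has_density (fourier_dist f) (hat f)"
    "L2_fun (weighted \<sigma> (hat f))" "sobolev_norm \<sigma> f = L2_norm (weighted \<sigma> (hat f))"
proof -
  obtain g0 where "has_density (fourier_dist f) g0" using assms by (auto simp: sobolev_def)
  then obtain g where "g \<in> borel_measurable borel" "has_density (fourier_dist f) g" by (rule has_density_borel)
  from hat_eqI_AE[OF this(2,1)] show h: "hat f \<in> borel_measurable borel" "has_density (fourier_dist f) (hat f)" by auto
  show "L2_fun (weighted \<sigma> (hat f))" "sobolev_norm \<sigma> f = L2_norm (weighted \<sigma> (hat f))"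
    using sobolev_density[OF h(2,1)] assms by auto
qed

lemma pair_lincomb: "pair (a *\<^sub>R f + b *\<^sub>R g) \<phi> = of_real a * pair f \<phi> + of_real b * pair g \<phi>"
  by (simp add: plus_tempered.rep_eq scaleR_tempered.rep_eq)

lemma fourier_density_lincomb:
  assumes f: "has_density (fourier_dist f) g" "g \<in> borel_measurable borel"
    and f': "has_density (fourier_dist f') g'" "g' \<in> borel_measurable borel"
  shows "has_density (fourier_dist (a *\<^sub>R f + b *\<^sub>R f')) (\<lambda>\<xi>. of_real a * g \<xi> + of_real b * g' \<xi>)"
proof (rule has_densityI)
  fix \<phi> assume \<phi>: "\<phi> \<in> schwartz"
  note i = has_density_lborel[OF f \<phi>] has_density_lborel[OF f' \<phi>]
  have eq: "(of_real a * g \<xi> + of_real b * g' \<xi>) * \<phi> \<xi> = of_real a * (g \<xi> * \<phi> \<xi>) + of_real b * (g' \<xi> * \<phi> \<xi>)" for \<xi>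
    by (simp add: algebra_simps)
  show "integrable lborel (\<lambda>\<xi>. (of_real a * g \<xi> + of_real b * g' \<xi>) * \<phi> \<xi>)"
    unfolding eq using i by auto
  show "fourier_dist (a *\<^sub>R f + b *\<^sub>R f') \<phi> = (LINT \<xi>|lborel. (of_real a * g \<xi> + of_real b * g' \<xi>) * \<phi> \<xi>)"
    unfolding eq using i by (simp add: fourier_dist_def pair_lincomb)
qed (use assms in auto)

definition from_fourier :: "(real \<Rightarrow> complex) \<Rightarrow> tempered" where
  "from_fourier g = (THE f. has_density (fourier_dist f) g)"

lemma from_fourier_eqI: "has_density (fourier_dist f) g \<Longrightarrow> from_fourier g = f"
  unfolding from_fourier_def by (rule the_equality) (auto intro: fourier_density_inject)

lemma from_fourier:
  assumes "g \<in> borel_measurable borel" "L2_fun (weighted \<sigma> g)"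
  shows "has_density (fourier_dist (from_fourier g)) g"
  using ex_fourier_density_borel[OF assms] from_fourier_eqI by metis

lemma fourier_density_AE:
  assumes "has_density (fourier_dist f) g" "AE x in lborel. g x = h x" "h \<in> borel_measurable borel"
  shows "has_density (fourier_dist f) h"
  using has_density_cong_AE[OF assms(1) AE_completion[OF assms(2)]] assms(3) by (simp add: measurable_completion)

lemma pair_density:
  assumes "has_density (fourier_dist f) g" "g \<in> borel_measurable borel" "\<phi> \<in> schwartz"
  shows "integrable lborel (\<lambda>\<xi>. g \<xi> * ift \<phi> \<xi>)" "pair f \<phi> = (LINT \<xi>|lborel. g \<xi> * ift \<phi> \<xi>)"
  using has_density_lborel[OF assms(1,2) schwartz_ift[OF assms(3)]] fourier_ift[OF assms(3)]
  by (auto simp: fourier_dist_def)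

lemma deriv_dist_density:
  assumes "has_density (fourier_dist f) g" "g \<in> borel_measurable borel" "\<phi> \<in> schwartz"
  shows "integrable lborel (\<lambda>\<xi>. (\<i> * of_real \<xi> * g \<xi>) * ift \<phi> \<xi>)"
    "deriv_dist f \<phi> = (LINT \<xi>|lborel. (\<i> * of_real \<xi> * g \<xi>) * ift \<phi> \<xi>)"
proof -
  note p = pair_density[OF assms(1,2) schwartz_vderiv[OF assms(3)]]
  have eq: "(\<i> * of_real \<xi> * g \<xi>) * ift \<phi> \<xi> = - (g \<xi> * ift (vderiv \<phi>) \<xi>)" for \<xi>
    by (simp add: ift_vderiv[OF assms(3)] mult_ac)
  show "integrable lborel (\<lambda>\<xi>. (\<i> * of_real \<xi> * g \<xi>) * ift \<phi> \<xi>)" unfolding eq using p(1) by simp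
  show "deriv_dist f \<phi> = (LINT \<xi>|lborel. (\<i> * of_real \<xi> * g \<xi>) * ift \<phi> \<xi>)"
    unfolding eq using p(2) by (simp add: deriv_dist_def)
qed

lemma ift_multiplication:
  assumes f: "integrable lborel f" and g: "integrable lborel g"
  shows "(LINT x|lborel. ift f x * g x) = (LINT \<xi>|lborel. f \<xi> * ift g \<xi>)"
proof -
  have g': "integrable lborel (\<lambda>x. g (0 - x))" by (rule integrable_reflect[OF g])
  have "ft (\<lambda>x. g (0 - x)) \<xi> = ft g (- \<xi>)" for \<xi>
    using integral_reflect_shift[of "\<lambda>x. (wave (- x) \<xi>) * g x" 0] by (simp add: ft_def)
  then have "(LINT \<xi>|lborel. ft f \<xi> * g (0 - \<xi>)) = (LINT x|lborel. f x * ft g (- x))"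
    using ft_multiplication[OF f g'] by simp
  moreover have "(LINT \<xi>|lborel. ft f \<xi> * g (0 - \<xi>)) = (LINT x|lborel. ft f (- x) * g x)"
    using integral_reflect_shift[of "\<lambda>x. ft f (- x) * g x" 0] by simp
  ultimately have "(LINT x|lborel. ft f (- x) * g x) = (LINT x|lborel. f x * ft g (- x))" by simp
  then show ?thesis by (simp add: ift_def)
qed

lemma ift_borel [measurable]:
  assumes [measurable]: "f \<in> borel_measurable borel"
  shows "ift f \<in> borel_measurable borel"
proof -
  have "(\<lambda>x. ft f (- x)) \<in> borel_measurable borel"
    by (rule measurable_compose[OF _ borel_measurable_ft[OF assms]]) measurable
  then show ?thesis unfolding ift_def by (intro borel_measurable_divide) auto
qed

lemma ift_le_L1: "cmod (ift f x) \<le> (LINT x|lborel. cmod (f x))"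
proof -
  have "cmod (ift f x) = cmod (ft f (- x)) / (2 * pi)"
    by (simp add: ift_def norm_divide norm_mult)
  also have "\<dots> \<le> cmod (ft f (- x)) / 1"
    using pi_gt3 by (intro divide_left_mono) auto
  finally show ?thesis using ft_le_L1[of f "- x"] by simp
qed

lemma L2_norm_ift_schwartz: "\<phi> \<in> schwartz \<Longrightarrow> L2_norm (ift \<phi>) \<le> L2_norm \<phi>"
proof -
  assume \<phi>: "\<phi> \<in> schwartz"
  have "(LINT x|lborel. (cmod (\<phi> x))\<^sup>2) / (2 * pi) \<le> (LINT x|lborel. (cmod (\<phi> x))\<^sup>2) / 1"
    using pi_gt3 by (intro divide_left_mono) auto
  then show ?thesis by (simp add: L2_norm_def plancherel_schwartz[OF \<phi>])
qed

lemma L2_fun_schwartz: "\<phi> \<in> schwartz \<Longrightarrow> L2_fun \<phi>"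
  by (simp add: L2_fun_def schwartz_borel schwartz_square_integrable)

text \<open>This turns estimates of pairings with test functions into \<open>L\<^sup>2\<close> bounds; a mild solution,
  which is known through its pairings only, is estimated in this way.\<close>

lemma L2_duality:
  assumes h: "has_density \<Lambda> h" "h \<in> borel_measurable borel" and K: "0 \<le> K"
    and bnd: "\<And>\<phi>. \<phi> \<in> schwartz \<Longrightarrow> cmod (\<Lambda> \<phi>) \<le> K * L2_norm \<phi>"
  shows "L2_fun h" "L2_norm h \<le> K"
proof -
  have m: "h \<in> borel_measurable lebesgue" using h(2) by (simp add: measurable_completion)
  have i: "integrable lebesgue (\<lambda>x. h x * \<phi> x)" "\<Lambda> \<phi> = (LINT x|lebesgue. h x * \<phi> x)" if "\<phi> \<in> schwartz" for \<phi>
    using h(1) that by (auto simp: has_density_def)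
  have b: "cmod (LINT x|lebesgue. h x * \<phi> x) \<le> K * sqrt (LINT x|lebesgue. (cmod (\<phi> x))\<^sup>2)" if \<phi>: "\<phi> \<in> schwartz" for \<phi>
  proof -
    have "(\<lambda>x. (cmod (\<phi> x))\<^sup>2) \<in> borel_measurable lborel" using schwartz_borel[OF \<phi>] by simp
    then show ?thesis using bnd[OF \<phi>] i(2)[OF \<phi>] by (simp add: L2_norm_def integral_completion)
  qed
  note d = schwartz_duality[OF m i(1) b K]
  have m2: "(\<lambda>x. (cmod (h x))\<^sup>2) \<in> borel_measurable lborel" using h(2) by simp
  show "L2_fun h" using d(1) h(2) integrable_completion[OF m2] by (simp add: L2_fun_def)
  have "(LINT x|lborel. (cmod (h x))\<^sup>2) \<le> K\<^sup>2" using d(2) integral_completion[OF m2] by simp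
  then show "L2_norm h \<le> K" unfolding L2_norm_def using K by (intro real_le_lsqrt) auto
qed

lemma L2_dist_density:
  assumes d: "has_density \<Lambda> h" and h: "h \<in> borel_measurable borel"
  shows "\<Lambda> \<in> L2_dist \<longleftrightarrow> L2_fun h" "L2_dist_norm \<Lambda> = L2_norm h"
  using lebesgue_square_density[OF d h, of "\<lambda>_. 1"] d h
  by (auto simp: L2_dist_def L2_dist_norm_def L2_fun_def L2_norm_def)

lemma L2_dist_borel:
  assumes "\<Lambda> \<in> L2_dist"
  obtains h where "has_density \<Lambda> h" "L2_fun h" "L2_dist_norm \<Lambda> = L2_norm h"
proof -
  obtain h0 where "has_density \<Lambda> h0" using assms by (auto simp: L2_dist_def)
  then obtain h where h: "h \<in> borel_measurable borel" "has_density \<Lambda> h" by (rule has_density_borel)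
  then show ?thesis using that[OF h(2)] L2_dist_density[OF h(2,1)] assms by auto
qed

text \<open>The multiplication formula moves the inverse transform from \<open>F\<close> to the test function; the \<open>L\<^sup>2\<close> bound then
  follows by duality from Plancherel for Schwartz functions.\<close>

lemma deriv_dist_ift:
  assumes d: "has_density (fourier_dist f) g" and g: "g \<in> borel_measurable borel"
    and F: "F = (\<lambda>\<xi>. \<i> * of_real \<xi> * g \<xi>)" and i: "integrable lborel F" and q: "L2_fun F"
  shows "has_density (deriv_dist f) (ift F)" "L2_fun (ift F)" "L2_norm (ift F) \<le> L2_norm F"
proof -
  have [measurable]: "F \<in> borel_measurable borel" using q by (simp add: L2_fun_def)
  show 1: "has_density (deriv_dist f) (ift F)"
  proof (rule has_densityI)
    fix \<phi> assume \<phi>: "\<phi> \<in> schwartz"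
    show "integrable lborel (\<lambda>x. ift F x * \<phi> x)"
    proof (rule integrable_dominated)
      show "integrable lborel (\<lambda>x. (LINT x|lborel. cmod (F x)) * cmod (\<phi> x))"
        by (intro integrable_mult_right integrable_norm schwartz_integrable \<phi>)
      show "norm (ift F x * \<phi> x) \<le> (LINT x|lborel. cmod (F x)) * cmod (\<phi> x)" for x
        unfolding norm_mult by (intro mult_right_mono ift_le_L1) auto
      show "(\<lambda>x. ift F x * \<phi> x) \<in> borel_measurable lborel" using schwartz_borel[OF \<phi>] by measurable
    qed
    show "deriv_dist f \<phi> = (LINT x|lborel. ift F x * \<phi> x)"
      using deriv_dist_density(2)[OF d g \<phi>] ift_multiplication[OF i schwartz_integrable[OF \<phi>]] by (simp add: F)
  qed measurable
  have b: "cmod (deriv_dist f \<phi>) \<le> L2_norm F * L2_norm \<phi>" if \<phi>: "\<phi> \<in> schwartz" for \<phi>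
  proof -
    have "cmod (deriv_dist f \<phi>) \<le> L2_norm F * L2_norm (ift \<phi>)"
      using deriv_dist_density(2)[OF d g \<phi>] L2_fun_product(3)[OF q L2_fun_schwartz[OF schwartz_ift[OF \<phi>]]] by (simp add: F)
    also have "\<dots> \<le> L2_norm F * L2_norm \<phi>" by (intro mult_left_mono L2_norm_ift_schwartz \<phi>) auto
    finally show ?thesis .
  qed
  have m: "ift F \<in> borel_measurable borel" by measurable
  show "L2_fun (ift F)" "L2_norm (ift F) \<le> L2_norm F"
    using L2_duality[OF 1 m L2_norm_nonneg b] by auto
qed

lemma ex_L1_tempered:
  assumes h: "integrable lborel h"
  obtains v where "has_density (pair v) h"
proof -
  have [measurable]: "h \<in> borel_measurable borel" using h by auto
  have b: "cmod (\<phi> x) \<le> schwartz_norm 0 \<phi>" if "\<phi> \<in> schwartz" for \<phi> x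
    using schwartz_norm_bound[OF that, of 0 0 0 x] by simp
  have i: "integrable lborel (\<lambda>x. h x * \<phi> x)" if \<phi>: "\<phi> \<in> schwartz" for \<phi>
  proof (rule integrable_dominated)
    show "integrable lborel (\<lambda>x. schwartz_norm 0 \<phi> * cmod (h x))" using h by auto
    show "norm (h x * \<phi> x) \<le> schwartz_norm 0 \<phi> * cmod (h x)" for x
      using mult_right_mono[OF b[OF \<phi>, of x], of "cmod (h x)"] by (simp add: norm_mult mult.commute)
    show "(\<lambda>x. h x * \<phi> x) \<in> borel_measurable lborel" using schwartz_borel[OF \<phi>] by measurable
  qed
  obtain v where v: "\<And>\<phi>. \<phi> \<in> schwartz \<Longrightarrow> pair v \<phi> = (LINT x|lborel. h x * \<phi> x)"
  proof (rule ex_tempered[of "\<lambda>\<phi>. LINT x|lborel. h x * \<phi> x"])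
    fix \<phi> \<psi> :: "real \<Rightarrow> complex" and a c assume s: "\<phi> \<in> schwartz" "\<psi> \<in> schwartz"
    have "(LINT x|lborel. h x * (a * \<phi> x + c * \<psi> x)) = (LINT x|lborel. a * (h x * \<phi> x) + c * (h x * \<psi> x))"
      by (intro Bochner_Integration.integral_cong) (auto simp: algebra_simps)
    then show "(LINT x|lborel. h x * (a * \<phi> x + c * \<psi> x)) = a * (LINT x|lborel. h x * \<phi> x) + c * (LINT x|lborel. h x * \<psi> x)"
      using i[OF s(1)] i[OF s(2)] by simp
  next
    fix \<phi> :: "real \<Rightarrow> complex" assume \<phi>: "\<phi> \<in> schwartz"
    have "cmod (LINT x|lborel. h x * \<phi> x) \<le> (LINT x|lborel. cmod (h x * \<phi> x))" by (rule integral_norm_bound)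
    also have "\<dots> \<le> (LINT x|lborel. cmod (h x) * schwartz_norm 0 \<phi>)"
    proof (rule integral_mono)
      show "integrable lborel (\<lambda>x. cmod (h x * \<phi> x))" by (rule integrable_norm[OF i[OF \<phi>]])
      show "integrable lborel (\<lambda>x. cmod (h x) * schwartz_norm 0 \<phi>)"
        by (rule integrable_mult_left[OF integrable_norm[OF h]])
      show "cmod (h x * \<phi> x) \<le> cmod (h x) * schwartz_norm 0 \<phi>" for x
        unfolding norm_mult by (intro mult_left_mono b \<phi>) auto
    qed
    finally show "cmod (LINT x|lborel. h x * \<phi> x) \<le> (LINT x|lborel. cmod (h x)) * schwartz_norm 0 \<phi>" by simp
  qed auto
  have "has_density (pair v) h" by (rule has_densityI) (use i v in auto)
  then show ?thesis by (rule that)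
qed

lemma deriv_square:
  assumes d: "has_density (deriv_dist f) h" and h: "L2_fun h"
  shows "has_density (pair (deriv_square f)) (\<lambda>x. (h x)\<^sup>2)"
proof -
  have hm[measurable]: "h \<in> borel_measurable borel" using h by (simp add: L2_fun_def)
  have "integrable lborel (\<lambda>x. (h x)\<^sup>2)" using L2_fun_product(1)[OF h h] by (simp add: power2_eq_square)
  then obtain v where v: "has_density (pair v) (\<lambda>x. (h x)\<^sup>2)" by (rule ex_L1_tempered)
  have ae: "AE x in lebesgue. (h x)\<^sup>2 = (density_of (deriv_dist f) x)\<^sup>2"
    using density_of_AE(1)[OF d hm] by eventually_elim simp
  have m: "(\<lambda>x. (density_of (deriv_dist f) x)\<^sup>2) \<in> borel_measurable lebesgue"
    using density_of_AE(2)[OF d hm] by measurable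
  have v': "has_density (pair v) (\<lambda>x. (density_of (deriv_dist f) x)\<^sup>2)"
    by (rule has_density_cong_AE[OF v ae m])
  have "deriv_square f = v"
    unfolding deriv_square_def
  proof (rule the_equality)
    show "has_density (pair v) (\<lambda>x. (density_of (deriv_dist f) x)\<^sup>2)" by (rule v')
    fix w assume w: "has_density (pair w) (\<lambda>x. (density_of (deriv_dist f) x)\<^sup>2)"
    show "w = v" by (rule tempered_eqI) (use w v' in \<open>auto simp: has_density_def\<close>)
  qed
  then show ?thesis using v by simp
qed

text \<open>For \<open>h\<close> in \<open>L\<^sup>2\<close> the square is integrable, and pairing it with a Fourier transform is the
  multiplication formula.\<close>

lemma deriv_square_fourier:
  assumes d: "has_density (deriv_dist f) h" and h: "L2_fun h"
  shows "has_density (fourier_dist (deriv_square f)) (ft (\<lambda>x. (h x)\<^sup>2))"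
proof (rule has_densityI)
  have [measurable]: "h \<in> borel_measurable borel" using h by (simp add: L2_fun_def)
  have i: "integrable lborel (\<lambda>x. (h x)\<^sup>2)" using L2_fun_product(1)[OF h h] by (simp add: power2_eq_square)
  show m: "ft (\<lambda>x. (h x)\<^sup>2) \<in> borel_measurable borel" by measurable
  fix \<phi> assume \<phi>: "\<phi> \<in> schwartz"
  have \<phi>m[measurable]: "\<phi> \<in> borel_measurable borel" by (rule schwartz_borel[OF \<phi>])
  show "integrable lborel (\<lambda>\<xi>. ft (\<lambda>x. (h x)\<^sup>2) \<xi> * \<phi> \<xi>)"
  proof (rule integrable_dominated)
    show "integrable lborel (\<lambda>x. (LINT x|lborel. cmod ((h x)\<^sup>2)) * cmod (\<phi> x))"
      by (intro integrable_mult_right integrable_norm schwartz_integrable \<phi>)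
    show "norm (ft (\<lambda>x. (h x)\<^sup>2) \<xi> * \<phi> \<xi>) \<le> (LINT x|lborel. cmod ((h x)\<^sup>2)) * cmod (\<phi> \<xi>)" for \<xi>
      unfolding norm_mult by (intro mult_right_mono ft_le_L1) auto
    show "(\<lambda>\<xi>. ft (\<lambda>x. (h x)\<^sup>2) \<xi> * \<phi> \<xi>) \<in> borel_measurable lborel" by measurable
  qed
  have "pair (deriv_square f) (fourier \<phi>) = (LINT x|lborel. (h x)\<^sup>2 * fourier \<phi> x)"
    by (rule has_density_lborel(2)[OF deriv_square[OF d h] _ schwartz_fourier[OF \<phi>]]) measurable
  also have "\<dots> = (LINT \<xi>|lborel. ft (\<lambda>x. (h x)\<^sup>2) \<xi> * \<phi> \<xi>)"
    using ft_multiplication[OF i schwartz_integrable[OF \<phi>]] by (simp add: fourier_eq_ft[OF \<phi>])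
  finally show "fourier_dist (deriv_square f) \<phi> = (LINT \<xi>|lborel. ft (\<lambda>x. (h x)\<^sup>2) \<xi> * \<phi> \<xi>)"
    by (simp add: fourier_dist_def)
qed

lemma conv_L1:
  assumes F: "integrable lborel F" and G: "integrable lborel G"
  shows "integrable (lborel \<Otimes>\<^sub>M lborel) (\<lambda>(\<zeta>, \<xi>). F (\<xi> - \<zeta>) * G \<zeta>)" "integrable lborel (conv F G)"
proof -
  have [measurable]: "F \<in> borel_measurable borel" "G \<in> borel_measurable borel" using F G by auto
  have sh: "integrable lborel (\<lambda>\<xi>. F (\<xi> - \<zeta>))" "(LINT \<xi>|lborel. cmod (F (\<xi> - \<zeta>))) = (LINT \<xi>|lborel. cmod (F \<xi>))" for \<zeta>
    using lborel_integrable_real_affine[OF F, of 1 "- \<zeta>"] lborel_integral_real_affine[of 1 "\<lambda>\<xi>. cmod (F \<xi>)" "- \<zeta>"]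
    by (simp_all add: algebra_simps)
  show 1: "integrable (lborel \<Otimes>\<^sub>M lborel) (\<lambda>(\<zeta>, \<xi>). F (\<xi> - \<zeta>) * G \<zeta>)"
  proof (rule lborel_pair.Fubini_integrable)
    show "AE \<zeta> in lborel. integrable lborel (\<lambda>\<xi>. case (\<zeta>, \<xi>) of (\<zeta>, \<xi>) \<Rightarrow> F (\<xi> - \<zeta>) * G \<zeta>)"
      using sh(1) by simp
    have "(LINT \<xi>|lborel. norm (F (\<xi> - \<zeta>) * G \<zeta>)) = (LINT \<xi>|lborel. cmod (F \<xi>)) * cmod (G \<zeta>)" for \<zeta>
      using sh by (simp add: norm_mult)
    then show "integrable lborel (\<lambda>\<zeta>. LINT \<xi>|lborel. norm (case (\<zeta>, \<xi>) of (\<zeta>, \<xi>) \<Rightarrow> F (\<xi> - \<zeta>) * G \<zeta>))"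
      using G by simp
  qed measurable
  show "integrable lborel (conv F G)"
    unfolding conv_def by (rule lborel_pair.integrable_snd[OF 1])
qed

text \<open>Fubini, followed by a translation of the inner variable.\<close>

lemma ft_conv:
  assumes F: "integrable lborel F" and G: "integrable lborel G"
  shows "ft (conv F G) y = ft F y * ft G y"
proof -
  have [measurable]: "F \<in> borel_measurable borel" "G \<in> borel_measurable borel" using F G by auto
  let ?e = "\<lambda>x. (wave x y)"
  have i: "integrable (lborel \<Otimes>\<^sub>M lborel) (\<lambda>(\<zeta>, \<xi>). ?e \<xi> * (F (\<xi> - \<zeta>) * G \<zeta>))"
  proof (rule Bochner_Integration.integrable_bound[OF conv_L1(1)[OF F G]])
    show "AE x in lborel \<Otimes>\<^sub>M lborel. norm (case x of (\<zeta>, \<xi>) \<Rightarrow> ?e \<xi> * (F (\<xi> - \<zeta>) * G \<zeta>)) \<le> norm (case x of (\<zeta>, \<xi>) \<Rightarrow> F (\<xi> - \<zeta>) * G \<zeta>)"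
      by (intro AE_I2) (auto simp: norm_mult)
  qed measurable
  have "ft (conv F G) y = (LINT \<xi>|lborel. LINT \<zeta>|lborel. ?e \<xi> * (F (\<xi> - \<zeta>) * G \<zeta>))"
    unfolding ft_def conv_def by simp
  also have "\<dots> = (LINT \<zeta>|lborel. LINT \<xi>|lborel. ?e \<xi> * (F (\<xi> - \<zeta>) * G \<zeta>))"
    by (rule lborel_pair.Fubini_integral[OF i])
  also have "\<dots> = (LINT \<zeta>|lborel. ft F y * (?e \<zeta> * G \<zeta>))"
  proof (rule Bochner_Integration.integral_cong[OF refl])
    fix \<zeta>
    have "(LINT \<xi>|lborel. ?e \<xi> * (F (\<xi> - \<zeta>) * G \<zeta>)) = (LINT \<xi>|lborel. ?e (\<xi> + \<zeta>) * (F \<xi> * G \<zeta>))"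
      using lborel_integral_real_affine[of 1 "\<lambda>\<xi>. ?e \<xi> * (F (\<xi> - \<zeta>) * G \<zeta>)" \<zeta>] by (simp add: add.commute)
    also have "\<dots> = (LINT \<xi>|lborel. (?e \<xi> * F \<xi>) * (?e \<zeta> * G \<zeta>))"
      by (intro Bochner_Integration.integral_cong) (auto simp: algebra_simps exp_add[symmetric] exp_diff exp_minus divide_inverse)
    also have "\<dots> = ft F y * (?e \<zeta> * G \<zeta>)" unfolding ft_def by (rule integral_mult_left_zero)
    finally show "(LINT \<xi>|lborel. ?e \<xi> * (F (\<xi> - \<zeta>) * G \<zeta>)) = ft F y * (?e \<zeta> * G \<zeta>)" .
  qed
  also have "\<dots> = ft F y * ft G y" unfolding ft_def[of G] by (rule integral_mult_right_zero)
  finally show ?thesis .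
qed

lemma ift_conv:
  assumes "integrable lborel F" "integrable lborel G"
  shows "ift (\<lambda>\<xi>. conv F G \<xi> / (2 * pi)) x = ift F x * ift G x"
proof -
  have "ft (\<lambda>\<xi>. conv F G \<xi> / (2 * pi)) y = ft (conv F G) y / (2 * pi)" for y
  proof -
    have "ft (\<lambda>\<xi>. conv F G \<xi> / (2 * pi)) y = (LINT x|lborel. (wave x y * conv F G x) / (2 * pi))"
      unfolding ft_def by simp
    also have "\<dots> = ft (conv F G) y / (2 * pi)" unfolding ft_def[of "conv F G"] by (rule integral_divide_zero)
    finally show ?thesis .
  qed
  then show ?thesis by (simp add: ift_def ft_conv[OF assms])
qed

text \<open>By \<open>ift_conv\<close> the square of the derivative is the inverse transform of the convolution square.\<close>

lemma deriv_square_conv: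
  assumes d: "has_density (fourier_dist f) g" and g: "g \<in> borel_measurable borel"
    and F: "F = (\<lambda>\<xi>. \<i> * of_real \<xi> * g \<xi>)" and i: "integrable lborel F" and q: "L2_fun F"
  shows "has_density (fourier_dist (deriv_square f)) (\<lambda>\<xi>. conv F F \<xi> / (2 * pi))"
proof (rule has_densityI)
  note D = deriv_dist_ift[OF assms]
  have [measurable]: "F \<in> borel_measurable borel" using q by (simp add: L2_fun_def)
  let ?C = "\<lambda>\<xi>. conv F F \<xi> / (2 * pi)"
  have c: "integrable lborel ?C" using conv_L1(2)[OF i i] by simp
  then show m[measurable]: "?C \<in> borel_measurable borel" by auto
  fix \<phi> assume \<phi>: "\<phi> \<in> schwartz"
  have [measurable]: "\<phi> \<in> borel_measurable borel" by (rule schwartz_borel[OF \<phi>])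
  obtain B where B: "0 \<le> B" "\<And>x. cmod (\<phi> x) \<le> B" using schwartz_bounded[OF \<phi>] by blast
  show "integrable lborel (\<lambda>\<xi>. ?C \<xi> * \<phi> \<xi>)"
  proof (rule integrable_dominated)
    show "integrable lborel (\<lambda>\<xi>. B * cmod (?C \<xi>))" by (intro integrable_mult_right integrable_norm c)
    show "norm (?C \<xi> * \<phi> \<xi>) \<le> B * cmod (?C \<xi>)" for \<xi>
      using mult_right_mono[OF B(2), of "cmod (?C \<xi>)" \<xi>] by (simp only: norm_mult norm_ge_zero mult.commute)
    show "(\<lambda>\<xi>. ?C \<xi> * \<phi> \<xi>) \<in> borel_measurable lborel"
      using borel_measurable_times[OF m schwartz_borel[OF \<phi>]] by simp
  qed
  have "pair (deriv_square f) (fourier \<phi>) = (LINT x|lborel. (ift F x)\<^sup>2 * fourier \<phi> x)"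
    by (rule has_density_lborel(2)[OF deriv_square[OF D(1,2)] _ schwartz_fourier[OF \<phi>]]) measurable
  also have "\<dots> = (LINT x|lborel. ift ?C x * fourier \<phi> x)"
    by (simp only: ift_conv[OF i i] power2_eq_square)
  also have "\<dots> = (LINT \<xi>|lborel. ?C \<xi> * \<phi> \<xi>)"
    using ift_multiplication[OF c schwartz_integrable[OF schwartz_fourier[OF \<phi>]]] by (simp add: ift_fourier[OF \<phi>])
  finally show "fourier_dist (deriv_square f) \<phi> = (LINT \<xi>|lborel. ?C \<xi> * \<phi> \<xi>)"
    by (simp add: fourier_dist_def)
qed

text \<open>Changing the symbol on a null set does not change the propagator.\<close>

lemma propagator_density:
  assumes d: "has_density (fourier_dist w) g" and g: "g \<in> borel_measurable borel"
    and \<Phi>0: "\<Phi>0 \<in> borel_measurable lebesgue" and ae: "AE \<xi> in lebesgue. \<Phi>0 \<xi> = \<Phi> \<xi>"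
    and M: "M = (\<lambda>\<xi>. exp (\<i> * of_real (t * \<xi> ^ 3) + of_real (\<eta> * t * \<Phi> \<xi>)) * g \<xi>)"
    and Mb: "M \<in> borel_measurable borel" and q: "L2_fun (weighted \<sigma> M)"
  shows "has_density (fourier_dist (propagator \<eta> \<Phi>0 t w)) M"
proof -
  let ?M0 = "\<lambda>\<xi>. exp (\<i> * of_real (t * \<xi> ^ 3) + of_real (\<eta> * t * \<Phi>0 \<xi>)) * density_of (fourier_dist w) \<xi>"
  have ae': "AE \<xi> in lebesgue. M \<xi> = ?M0 \<xi>"
    using ae density_of_AE(1)[OF d g] by eventually_elim (simp add: M)
  have [measurable]: "\<Phi>0 \<in> borel_measurable lebesgue" "density_of (fourier_dist w) \<in> borel_measurable lebesgue"
    using \<Phi>0 density_of_AE(2)[OF d g] by auto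
  have [measurable]: "(\<lambda>\<xi>. complex_of_real (t * \<xi> ^ 3)) \<in> borel_measurable lebesgue"
    by (rule measurable_completion) measurable
  have m: "?M0 \<in> borel_measurable lebesgue" by measurable
  have T: "has_density (fourier_dist (from_fourier M)) M" by (rule from_fourier[OF Mb q])
  have T0: "has_density (fourier_dist (from_fourier M)) ?M0" by (rule has_density_cong_AE[OF T ae' m])
  have "propagator \<eta> \<Phi>0 t w = from_fourier M"
    unfolding propagator_def using T0 by (intro the_equality) (auto intro: fourier_density_inject)
  then show ?thesis using T by simp
qed

lemma conv_bound: "L2_fun F \<Longrightarrow> L2_fun G \<Longrightarrow> cmod (conv F G \<xi>) \<le> L2_norm F * L2_norm G"
  unfolding conv_def using L2_fun_product(3)[OF L2_fun_reflect(1), of F G \<xi>] by (simp add: L2_fun_reflect(2))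

lemma conv_linear:
  assumes F: "L2_fun F" "L2_fun F'" and G: "L2_fun G"
  shows "conv (\<lambda>\<xi>. c * F \<xi> + d * F' \<xi>) G \<xi> = c * conv F G \<xi> + d * conv F' G \<xi>"
    "conv G (\<lambda>\<xi>. c * F \<xi> + d * F' \<xi>) \<xi> = c * conv G F \<xi> + d * conv G F' \<xi>"
proof -
  note i = conv_integrable[OF F(1) G, of \<xi>] conv_integrable[OF F(2) G, of \<xi>]
    conv_integrable[OF G F(1), of \<xi>] conv_integrable[OF G F(2), of \<xi>]
  have "conv (\<lambda>\<xi>. c * F \<xi> + d * F' \<xi>) G \<xi> = (LINT \<zeta>|lborel. c * (F (\<xi> - \<zeta>) * G \<zeta>) + d * (F' (\<xi> - \<zeta>) * G \<zeta>))"
    unfolding conv_def by (intro Bochner_Integration.integral_cong) (auto simp: algebra_simps)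
  then show "conv (\<lambda>\<xi>. c * F \<xi> + d * F' \<xi>) G \<xi> = c * conv F G \<xi> + d * conv F' G \<xi>"
    using i by (simp add: conv_def)
  have "conv G (\<lambda>\<xi>. c * F \<xi> + d * F' \<xi>) \<xi> = (LINT \<zeta>|lborel. c * (G (\<xi> - \<zeta>) * F \<zeta>) + d * (G (\<xi> - \<zeta>) * F' \<zeta>))"
    unfolding conv_def by (intro Bochner_Integration.integral_cong) (auto simp: algebra_simps)
  then show "conv G (\<lambda>\<xi>. c * F \<xi> + d * F' \<xi>) \<xi> = c * conv G F \<xi> + d * conv G F' \<xi>"
    using i by (simp add: conv_def)
qed

lemma L2_fun_lincomb: "L2_fun F \<Longrightarrow> L2_fun G \<Longrightarrow> L2_fun (\<lambda>x. c * F x + d * G x)"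
  by (intro L2_fun_add L2_fun_cmult)

lemma conv_cong_AE:
  assumes F: "L2_fun F" "L2_fun F'" and G: "L2_fun G" and ae: "AE \<xi> in lborel. F \<xi> = F' \<xi>"
  shows "conv F G \<xi> = conv F' G \<xi>" "conv G F \<xi> = conv G F' \<xi>"
proof -
  let ?D = "\<lambda>\<xi>. 1 * F \<xi> + (- 1) * F' \<xi>"
  have D: "L2_fun ?D" by (rule L2_fun_lincomb[OF F])
  have z: "L2_fun (\<lambda>\<xi>. 0)" by (simp add: L2_fun_def)
  have "AE \<xi> in lborel. 0 = ?D \<xi>" using ae by eventually_elim simp
  then have "L2_norm ?D = L2_norm (\<lambda>\<xi>. 0)" using D by (intro L2_fun_cong_AE(2)[OF z]) (auto simp: L2_fun_def)
  then have l: "L2_norm ?D = 0" by (simp add: L2_norm_def)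
  have "conv ?D G \<xi> = 0" "conv G ?D \<xi> = 0"
    using conv_bound[OF D G, of \<xi>] conv_bound[OF G D, of \<xi>] unfolding l by auto
  then show "conv F G \<xi> = conv F' G \<xi>" "conv G F \<xi> = conv G F' \<xi>"
    unfolding conv_linear[OF F G] by auto
qed

lemma sobolev_lincomb:
  assumes "x \<in> sobolev \<sigma>" "y \<in> sobolev \<sigma>"
  shows "c *\<^sub>R x + d *\<^sub>R y \<in> sobolev \<sigma>"
    "AE \<xi> in lborel. hat (c *\<^sub>R x + d *\<^sub>R y) \<xi> = of_real c * hat x \<xi> + of_real d * hat y \<xi>"
proof -
  note x = hat_sobolev[OF assms(1)] and y = hat_sobolev[OF assms(2)]
  have d: "has_density (fourier_dist (c *\<^sub>R x + d *\<^sub>R y)) (\<lambda>\<xi>. of_real c * hat x \<xi> + of_real d * hat y \<xi>)"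
    by (rule fourier_density_lincomb[OF x(2,1) y(2,1)])
  have m: "(\<lambda>\<xi>. of_real c * hat x \<xi> + of_real d * hat y \<xi>) \<in> borel_measurable borel" using x(1) y(1) by simp
  show "AE \<xi> in lborel. hat (c *\<^sub>R x + d *\<^sub>R y) \<xi> = of_real c * hat x \<xi> + of_real d * hat y \<xi>"
    by (rule hat_eqI_AE(3)[OF d m])
  have "L2_fun (\<lambda>\<xi>. of_real c * (of_real (bracket \<xi> powr \<sigma>) * hat x \<xi>) + of_real d * (of_real (bracket \<xi> powr \<sigma>) * hat y \<xi>))"
    by (intro L2_fun_lincomb x y)
  then show "c *\<^sub>R x + d *\<^sub>R y \<in> sobolev \<sigma>"
    unfolding sobolev_density(1)[OF d m] by (simp add: algebra_simps)
qed

lemma zero_sobolev: "0 \<in> sobolev s" "sobolev_norm s 0 = 0"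
proof -
  have d: "has_density (fourier_dist 0) (\<lambda>\<xi>. 0)"
    by (rule has_densityI) (auto simp: fourier_dist_def zero_tempered.rep_eq)
  show "0 \<in> sobolev s" "sobolev_norm s 0 = 0"
    using sobolev_density[OF d, of s] by (auto simp: L2_fun_def L2_norm_def)
qed

lemma sobolev_norm_add:
  assumes x: "x \<in> sobolev \<sigma>" and y: "y \<in> sobolev \<sigma>"
  shows "sobolev_norm \<sigma> (x + y) \<le> sobolev_norm \<sigma> x + sobolev_norm \<sigma> y"
proof -
  have xy: "x + y \<in> sobolev \<sigma>" and h: "AE \<xi> in lborel. hat (x + y) \<xi> = hat x \<xi> + hat y \<xi>"
    using sobolev_lincomb[OF x y, of 1 1] by simp_all
  note hx = hat_sobolev(3)[OF x] and hy = hat_sobolev(3)[OF y] and hxy = hat_sobolev(3)[OF xy]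
  note add = L2_fun_add[OF hx hy]
  have "AE \<xi> in lborel. of_real (bracket \<xi> powr \<sigma>) * hat x \<xi> + of_real (bracket \<xi> powr \<sigma>) * hat y \<xi> = of_real (bracket \<xi> powr \<sigma>) * hat (x + y) \<xi>"
    using h by eventually_elim (simp add: algebra_simps)
  from L2_fun_cong_AE(2)[OF add(1) L2_fun_measurable[OF hxy] this] add(2) show ?thesis
    by (simp add: hat_sobolev(4)[OF x] hat_sobolev(4)[OF y] hat_sobolev(4)[OF xy])
qed

context dissipative
begin

text \<open>The power of the life span \<open>\<tau>\<close> that the nonlinear estimate gains for the unknown \<open>f\<close>. Since it is positive, a
  short time makes the quadratic equation contractive.\<close>

definition \<theta> :: real where "\<theta> = 1 - \<gamma> - \<beta>"

lemma \<theta>_pos: "0 < \<theta>" using \<beta> \<gamma> by (simp add: \<theta>_def)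

text \<open>The bilinear form behind the fixed point equation: the Fourier transform of the product of two space
  derivatives, multiplied by the weight that makes it bounded.\<close>

definition weighted_source :: "real \<Rightarrow> (real \<Rightarrow> complex) \<Rightarrow> bounded_borel \<Rightarrow> (real \<Rightarrow> complex) \<Rightarrow> bounded_borel \<Rightarrow> real \<times> real \<Rightarrow> complex" where
  "weighted_source \<tau> g f g' f' x = (if 0 < fst x \<and> fst x \<le> \<tau> then
     of_real (fst x powr (2 * \<beta>) * bracket (snd x) powr k / (2 * pi)) * conv (profile_x g f (fst x)) (profile_x g' f' (fst x)) (snd x) else 0)"

lemma weighted_source_measurable:
  assumes [measurable]: "g \<in> borel_measurable borel" "g' \<in> borel_measurable borel"
  shows "weighted_source \<tau> g f g' f' \<in> borel_measurable borel"
proof -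
  have m: "(\<lambda>(x, \<zeta>). profile_x g f (fst x) (snd x - \<zeta>) * profile_x g' f' (fst x) \<zeta>) \<in> borel_measurable ((borel \<Otimes>\<^sub>M borel) \<Otimes>\<^sub>M borel)"
    by measurable
  then have [measurable]: "(\<lambda>x. conv (profile_x g f (fst x)) (profile_x g' f' (fst x)) (snd x)) \<in> borel_measurable (borel \<Otimes>\<^sub>M borel)"
    unfolding conv_def by (intro lborel.borel_measurable_lebesgue_integral) simp
  have "weighted_source \<tau> g f g' f' \<in> borel_measurable (borel \<Otimes>\<^sub>M borel)"
    unfolding weighted_source_def by measurable
  then show ?thesis by (simp add: borel_prod)
qed

text \<open>The weights match: \<open>t powr \<beta>\<close> compensates the singularity of the linear part in each factor and turns that of the
  Duhamel part into \<open>t powr \<theta>\<close>.\<close>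

lemma weighted_source_bound:
  "\<exists>\<alpha>\<ge>0. \<exists>b\<ge>0. \<forall>\<tau> g f g' f' x. 0 < \<tau> \<longrightarrow> \<tau> \<le> 1 \<longrightarrow> Hs_density g \<longrightarrow> Hs_density g' \<longrightarrow>
    cmod (weighted_source \<tau> g f g' f' x) \<le> (\<alpha> * Hs_norm g + b * \<tau> powr \<theta> * norm f) * (\<alpha> * Hs_norm g' + b * \<tau> powr \<theta> * norm f')"
proof -
  obtain C D where CD: "0 \<le> C" "0 \<le> D" "\<forall>g f t. Hs_density g \<longrightarrow> 0 < t \<longrightarrow> t \<le> 1 \<longrightarrow>
    L2_fun (weighted k (profile_x g f t)) \<and>
    L2_norm (weighted k (profile_x g f t)) \<le> C * t powr (- \<beta>) * Hs_norm g + D * t powr (1 - \<gamma> - 2 * \<beta>) * norm f"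
    using profile_x_estimate by blast
  define c where "c = sqrt (sqrt 2 powr k / (2 * pi))"
  have c: "0 \<le> c" "c\<^sup>2 = sqrt 2 powr k / (2 * pi)" by (auto simp: c_def)
  have "cmod (weighted_source \<tau> g f g' f' x) \<le> ((c * C) * Hs_norm g + (c * D) * \<tau> powr \<theta> * norm f) * ((c * C) * Hs_norm g' + (c * D) * \<tau> powr \<theta> * norm f')"
    if \<tau>: "0 < \<tau>" "\<tau> \<le> 1" and g: "Hs_density g" "Hs_density g'" for \<tau> g f g' f' x
  proof (cases "0 < fst x \<and> fst x \<le> \<tau>")
    case True
    define t \<xi> where "t = fst x" and "\<xi> = snd x"
    have t: "0 < t" "t \<le> 1" "t \<le> \<tau>" using True \<tau> by (auto simp: t_def)
    let ?l = "\<lambda>g f. L2_norm (weighted k (profile_x g f t))"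
    have gm: "g \<in> borel_measurable borel" "g' \<in> borel_measurable borel" using g by (auto simp: Hs_density_def)
    have l: "t powr \<beta> * ?l g f \<le> C * Hs_norm g + D * \<tau> powr \<theta> * norm f" if "Hs_density g" for g f
    proof -
      have "t powr \<beta> * ?l g f \<le> t powr \<beta> * (C * t powr (- \<beta>) * Hs_norm g + D * t powr (1 - \<gamma> - 2 * \<beta>) * norm f)"
        using CD(3) that t by (intro mult_left_mono) auto
      also have "\<dots> = C * (t powr \<beta> * t powr (- \<beta>)) * Hs_norm g + D * (t powr \<beta> * t powr (1 - \<gamma> - 2 * \<beta>)) * norm f"
        by (simp only: algebra_simps)
      also have "t powr \<beta> * t powr (- \<beta>) = 1" using t by (simp add: powr_add[symmetric])
      also have "t powr \<beta> * t powr (1 - \<gamma> - 2 * \<beta>) = t powr \<theta>" by (simp add: powr_add[symmetric] \<theta>_def)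
      also have "C * 1 * Hs_norm g + D * t powr \<theta> * norm f \<le> C * Hs_norm g + D * \<tau> powr \<theta> * norm f"
        using t \<theta>_pos CD by (auto intro!: mult_right_mono mult_left_mono powr_mono2)
      finally show ?thesis .
    qed
    have cb: "bracket \<xi> powr k * cmod (conv (profile_x g f t) (profile_x g' f' t) \<xi>) \<le> sqrt 2 powr k * ?l g f * ?l g' f'"
      using CD(3) g t gm by (intro conv_weighted_bound k_nonneg) auto
    have "cmod (weighted_source \<tau> g f g' f' x) = t powr (2 * \<beta>) / (2 * pi) * (bracket \<xi> powr k * cmod (conv (profile_x g f t) (profile_x g' f' t) \<xi>))"
      using True by (simp add: weighted_source_def norm_mult t_def \<xi>_def norm_divide)
    also have "\<dots> \<le> t powr (2 * \<beta>) / (2 * pi) * (sqrt 2 powr k * ?l g f * ?l g' f')"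
      by (intro mult_left_mono cb) auto
    also have "\<dots> = c\<^sup>2 * ((t powr \<beta> * ?l g f) * (t powr \<beta> * ?l g' f'))"
    proof -
      have "t powr (2 * \<beta>) = t powr \<beta> * t powr \<beta>" by (simp add: powr_add[symmetric])
      then show ?thesis unfolding c(2) by simp
    qed
    also have "\<dots> \<le> c\<^sup>2 * ((C * Hs_norm g + D * \<tau> powr \<theta> * norm f) * (C * Hs_norm g' + D * \<tau> powr \<theta> * norm f'))"
      using l g CD by (intro mult_left_mono mult_mono) (auto simp: Hs_norm_def)
    also have "\<dots> = ((c * C) * Hs_norm g + (c * D) * \<tau> powr \<theta> * norm f) * ((c * C) * Hs_norm g' + (c * D) * \<tau> powr \<theta> * norm f')"
      by (simp add: power2_eq_square algebra_simps)
    finally show ?thesis .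
  next
    case False
    then have "weighted_source \<tau> g f g' f' x = 0" by (auto simp: weighted_source_def)
    then show ?thesis using c CD by (auto simp: Hs_norm_def intro!: mult_nonneg_nonneg add_nonneg_nonneg)
  qed
  then show ?thesis using c CD by (intro exI[of _ "c * C"] exI[of _ "c * D"] conjI) auto
qed

lemma Hs_density_hat: "x \<in> sobolev s \<Longrightarrow> Hs_density (hat x)" and Hs_norm_hat: "x \<in> sobolev s \<Longrightarrow> Hs_norm (hat x) = sobolev_norm s x"
  using hat_sobolev[of x s] by (auto simp: Hs_density_def Hs_norm_def)

lemma profile_lincomb_AE:
  assumes "x \<in> sobolev s" "y \<in> sobolev s" "t \<le> 1"
  shows "AE \<xi> in lborel. profile (hat (c *\<^sub>R x + d *\<^sub>R y)) (c *\<^sub>R f + d *\<^sub>R h) t \<xi>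
    = of_real c * profile (hat x) f t \<xi> + of_real d * profile (hat y) h t \<xi>"
  using sobolev_lincomb(2)[OF assms(1,2), of c d]
  by eventually_elim (simp add: profile_def duhamel_linear[OF assms(3)] algebra_simps)

lemma profile_x_L2_fun:
  assumes g: "Hs_density g" and t: "0 < t" "t \<le> 1"
  shows "L2_fun (profile_x g f t)" "L2_norm (profile_x g f t) \<le> L2_norm (weighted k (profile_x g f t))"
    "L2_fun (weighted k (profile_x g f t))"
proof -
  have [measurable]: "g \<in> borel_measurable borel" using g by (simp add: Hs_density_def)
  show 1: "L2_fun (weighted k (profile_x g f t))" using profile_x_estimate g t by blast
  have le: "cmod (profile_x g f t \<xi>) \<le> cmod (of_real (bracket \<xi> powr k) * profile_x g f t \<xi>)" for \<xi>
    using mult_right_mono[OF bracket_powr_ge_1[OF k_nonneg, of \<xi>], of "cmod (profile_x g f t \<xi>)"] by (simp add: norm_mult)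
  have m: "profile_x g f t \<in> borel_measurable borel" by measurable
  show "L2_fun (profile_x g f t)" "L2_norm (profile_x g f t) \<le> L2_norm (weighted k (profile_x g f t))"
    using L2_fun_dominated[OF 1 m le] by auto
qed

definition source_form :: "real \<Rightarrow> tempered \<times> bounded_borel \<Rightarrow> tempered \<times> bounded_borel \<Rightarrow> bounded_borel" where
  "source_form \<tau> z w = Abs_bounded_borel (weighted_source \<tau> (hat (fst z)) (snd z) (hat (fst w)) (snd w))"

lemma app_source_form:
  assumes "0 < \<tau>" "\<tau> \<le> 1" "fst z \<in> sobolev s" "fst w \<in> sobolev s"
  shows "app (source_form \<tau> z w) = weighted_source \<tau> (hat (fst z)) (snd z) (hat (fst w)) (snd w)"
proof -
  obtain \<alpha> b where "\<forall>\<tau> g f g' f' x. 0 < \<tau> \<longrightarrow> \<tau> \<le> 1 \<longrightarrow> Hs_density g \<longrightarrow> Hs_density g' \<longrightarrow>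
    cmod (weighted_source \<tau> g f g' f' x) \<le> (\<alpha> * Hs_norm g + b * \<tau> powr \<theta> * norm f) * (\<alpha> * Hs_norm g' + b * \<tau> powr \<theta> * norm f')"
    using weighted_source_bound by blast
  then have b: "cmod (weighted_source \<tau> (hat (fst z)) (snd z) (hat (fst w)) (snd w) x) \<le>
      (\<alpha> * Hs_norm (hat (fst z)) + b * \<tau> powr \<theta> * norm (snd z)) * (\<alpha> * Hs_norm (hat (fst w)) + b * \<tau> powr \<theta> * norm (snd w))" for x
    using assms Hs_density_hat by blast
  show ?thesis
    unfolding source_form_def by (rule app_Abs_bounded_borel(1)[OF weighted_source_measurable b]) (use assms hat_sobolev(1) in auto)
qed

lemma weighted_source_linear:
  assumes \<tau>: "\<tau> \<le> 1" and x: "x \<in> sobolev s" "y \<in> sobolev s" and g: "Hs_density g"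
  shows "weighted_source \<tau> (hat (c *\<^sub>R x + d *\<^sub>R y)) (c *\<^sub>R f + d *\<^sub>R h) g f' v = of_real c * weighted_source \<tau> (hat x) f g f' v + of_real d * weighted_source \<tau> (hat y) h g f' v"
    "weighted_source \<tau> g f' (hat (c *\<^sub>R x + d *\<^sub>R y)) (c *\<^sub>R f + d *\<^sub>R h) v = of_real c * weighted_source \<tau> g f' (hat x) f v + of_real d * weighted_source \<tau> g f' (hat y) h v"
proof -
  have "weighted_source \<tau> (hat (c *\<^sub>R x + d *\<^sub>R y)) (c *\<^sub>R f + d *\<^sub>R h) g f' v = of_real c * weighted_source \<tau> (hat x) f g f' v + of_real d * weighted_source \<tau> (hat y) h g f' v \<and>
    weighted_source \<tau> g f' (hat (c *\<^sub>R x + d *\<^sub>R y)) (c *\<^sub>R f + d *\<^sub>R h) v = of_real c * weighted_source \<tau> g f' (hat x) f v + of_real d * weighted_source \<tau> g f' (hat y) h v"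
  proof (cases "0 < fst v \<and> fst v \<le> \<tau>")
    case True
    then have t: "0 < fst v" "fst v \<le> 1" using \<tau> by auto
    have a: "Hs_density (hat x)" "Hs_density (hat y)" "Hs_density (hat (c *\<^sub>R x + d *\<^sub>R y))"
      using x sobolev_lincomb(1) by (auto intro!: Hs_density_hat)
    note S = profile_x_L2_fun(1)[OF a(1) t, of f] profile_x_L2_fun(1)[OF a(2) t, of h] profile_x_L2_fun(1)[OF a(3) t, of "c *\<^sub>R f + d *\<^sub>R h"] profile_x_L2_fun(1)[OF g t, of f']
    have L: "L2_fun (\<lambda>\<xi>. of_real c * profile_x (hat x) f (fst v) \<xi> + of_real d * profile_x (hat y) h (fst v) \<xi>)"
      by (intro L2_fun_lincomb S)
    have "AE \<xi> in lborel. profile_x (hat (c *\<^sub>R x + d *\<^sub>R y)) (c *\<^sub>R f + d *\<^sub>R h) (fst v) \<xi> = of_real c * profile_x (hat x) f (fst v) \<xi> + of_real d * profile_x (hat y) h (fst v) \<xi>"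
      using profile_lincomb_AE[OF x t(2), of c d f h] by eventually_elim (simp add: profile_x_def algebra_simps)
    note e = conv_cong_AE[OF S(3) L S(4) this, of "snd v"]
    have q1: "weighted_source \<tau> g1 f1 g2 f2 v = of_real (fst v powr (2 * \<beta>) * bracket (snd v) powr k / (2 * pi)) * conv (profile_x g1 f1 (fst v)) (profile_x g2 f2 (fst v)) (snd v)" for g1 f1 g2 f2
      unfolding weighted_source_def using True by (rule if_P)
    show ?thesis unfolding q1 e conv_linear[OF S(1,2,4)] by (simp only: algebra_simps)
  qed (auto simp: weighted_source_def)
  then show "weighted_source \<tau> (hat (c *\<^sub>R x + d *\<^sub>R y)) (c *\<^sub>R f + d *\<^sub>R h) g f' v = of_real c * weighted_source \<tau> (hat x) f g f' v + of_real d * weighted_source \<tau> (hat y) h g f' v"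
    "weighted_source \<tau> g f' (hat (c *\<^sub>R x + d *\<^sub>R y)) (c *\<^sub>R f + d *\<^sub>R h) v = of_real c * weighted_source \<tau> g f' (hat x) f v + of_real d * weighted_source \<tau> g f' (hat y) h v"
    by auto
qed

lemma quadratic_instance:
  "\<exists>\<alpha>\<ge>0. \<exists>b\<ge>0. \<forall>\<tau> R. 0 < \<tau> \<longrightarrow> \<tau> \<le> 1 \<longrightarrow> 0 < R \<longrightarrow> 8 * \<alpha> * (b * \<tau> powr \<theta>) * R \<le> 1 \<longrightarrow>
    quadratic_equation (sobolev s) (sobolev_norm s) (source_form \<tau>) \<alpha> (b * \<tau> powr \<theta>) R"
proof -
  obtain \<alpha> b where ab: "0 \<le> \<alpha>" "0 \<le> b" and bnd: "\<forall>\<tau> g f g' f' x. 0 < \<tau> \<longrightarrow> \<tau> \<le> 1 \<longrightarrow> Hs_density g \<longrightarrow> Hs_density g' \<longrightarrow>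
    cmod (weighted_source \<tau> g f g' f' x) \<le> (\<alpha> * Hs_norm g + b * \<tau> powr \<theta> * norm f) * (\<alpha> * Hs_norm g' + b * \<tau> powr \<theta> * norm f')"
    using weighted_source_bound by blast
  have "quadratic_equation (sobolev s) (sobolev_norm s) (source_form \<tau>) \<alpha> (b * \<tau> powr \<theta>) R"
    if \<tau>: "0 < \<tau>" "\<tau> \<le> 1" and R: "0 < R" "8 * \<alpha> * (b * \<tau> powr \<theta>) * R \<le> 1" for \<tau> R
  proof
    show "0 \<in> sobolev s" "sobolev_norm s 0 = 0" by (rule zero_sobolev)+
    show "c *\<^sub>R x + d *\<^sub>R y \<in> sobolev s" if "x \<in> sobolev s" "y \<in> sobolev s" for x y c d
      by (rule sobolev_lincomb(1)[OF that])
    show "0 \<le> sobolev_norm s x" if "x \<in> sobolev s" for x by (simp add: sobolev_norm_def)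
    show "source_form \<tau> (c *\<^sub>R z + d *\<^sub>R z') w = c *\<^sub>R source_form \<tau> z w + d *\<^sub>R source_form \<tau> z' w"
      if X: "fst z \<in> sobolev s" "fst z' \<in> sobolev s" "fst w \<in> sobolev s" for z z' w c d
      using sobolev_lincomb(1)[OF X(1,2)]
      by (intro bounded_borel_eqI) (simp add: app_source_form \<tau> X plus_bounded_borel.rep_eq scaleR_bounded_borel.rep_eq weighted_source_linear(1)[OF \<tau>(2) X(1,2) Hs_density_hat[OF X(3)]] scaleR_conv_of_real)
    show "source_form \<tau> w (c *\<^sub>R z + d *\<^sub>R z') = c *\<^sub>R source_form \<tau> w z + d *\<^sub>R source_form \<tau> w z'"
      if X: "fst z \<in> sobolev s" "fst z' \<in> sobolev s" "fst w \<in> sobolev s" for z z' w c d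
      using sobolev_lincomb(1)[OF X(1,2)]
      by (intro bounded_borel_eqI) (simp add: app_source_form \<tau> X plus_bounded_borel.rep_eq scaleR_bounded_borel.rep_eq weighted_source_linear(2)[OF \<tau>(2) X(1,2) Hs_density_hat[OF X(3)]] scaleR_conv_of_real)
    show "norm (source_form \<tau> z w) \<le> (\<alpha> * sobolev_norm s (fst z) + b * \<tau> powr \<theta> * norm (snd z)) * (\<alpha> * sobolev_norm s (fst w) + b * \<tau> powr \<theta> * norm (snd w))"
      if X: "fst z \<in> sobolev s" "fst w \<in> sobolev s" for z w
    proof (rule norm_bounded_borel_le)
      fix x show "cmod (app (source_form \<tau> z w) x) \<le> (\<alpha> * sobolev_norm s (fst z) + b * \<tau> powr \<theta> * norm (snd z)) * (\<alpha> * sobolev_norm s (fst w) + b * \<tau> powr \<theta> * norm (snd w))"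
        unfolding app_source_form[OF \<tau> X] Hs_norm_hat[OF X(1), symmetric] Hs_norm_hat[OF X(2), symmetric]
        using bnd \<tau> Hs_density_hat[OF X(1)] Hs_density_hat[OF X(2)] by blast
    qed
  qed (use ab R in auto)
  then show ?thesis using ab by blast
qed

definition trajectory :: "real \<Rightarrow> tempered \<times> bounded_borel \<Rightarrow> real \<Rightarrow> tempered" where
  "trajectory \<tau> z t = (if 0 \<le> t \<and> t \<le> \<tau> then from_fourier (profile (hat (fst z)) (snd z) t) else 0)"

lemma trajectory_density:
  assumes "fst z \<in> sobolev s" "0 \<le> t" "t \<le> \<tau>" "\<tau> \<le> 1"
  shows "has_density (fourier_dist (trajectory \<tau> z t)) (profile (hat (fst z)) (snd z) t)"
    "profile (hat (fst z)) (snd z) t \<in> borel_measurable borel"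
proof -
  have [measurable]: "hat (fst z) \<in> borel_measurable borel" using hat_sobolev(1)[OF assms(1)] .
  show m: "profile (hat (fst z)) (snd z) t \<in> borel_measurable borel" by measurable
  have "L2_fun (weighted s (profile (hat (fst z)) (snd z) t))"
    using profile_Hs Hs_density_hat[OF assms(1)] assms by (meson order_trans)
  from from_fourier[OF m this] show "has_density (fourier_dist (trajectory \<tau> z t)) (profile (hat (fst z)) (snd z) t)"
    using assms by (simp add: trajectory_def)
qed

lemma trajectory_linear:
  assumes "fst z \<in> sobolev s" "fst w \<in> sobolev s" "\<tau> \<le> 1"
  shows "trajectory \<tau> (c *\<^sub>R z + d *\<^sub>R w) t = c *\<^sub>R trajectory \<tau> z t + d *\<^sub>R trajectory \<tau> w t"
proof (cases "0 \<le> t \<and> t \<le> \<tau>")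
  case True
  note z = trajectory_density[OF assms(1) True[THEN conjunct1] True[THEN conjunct2] assms(3)]
    and w = trajectory_density[OF assms(2) True[THEN conjunct1] True[THEN conjunct2] assms(3)]
  have X: "fst (c *\<^sub>R z + d *\<^sub>R w) \<in> sobolev s" using sobolev_lincomb(1)[OF assms(1,2)] by simp
  note zw = trajectory_density[OF X True[THEN conjunct1] True[THEN conjunct2] assms(3)]
  have "AE \<xi> in lborel. profile (hat (fst (c *\<^sub>R z + d *\<^sub>R w))) (snd (c *\<^sub>R z + d *\<^sub>R w)) t \<xi> = of_real c * profile (hat (fst z)) (snd z) t \<xi> + of_real d * profile (hat (fst w)) (snd w) t \<xi>"
    using profile_lincomb_AE[OF assms(1,2), of t c d "snd z" "snd w"] True assms(3) by simp
  from fourier_density_AE[OF zw(1) this] have "has_density (fourier_dist (trajectory \<tau> (c *\<^sub>R z + d *\<^sub>R w) t)) (\<lambda>\<xi>. of_real c * profile (hat (fst z)) (snd z) t \<xi> + of_real d * profile (hat (fst w)) (snd w) t \<xi>)"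
    using z(2) w(2) by simp
  then show ?thesis using fourier_density_lincomb[OF z w, of c d] by (rule fourier_density_inject)
qed (auto simp: trajectory_def)

lemma duhamel_continuous:
  assumes X: "\<And>i::nat. X i \<in> {0..1}" and lim: "X \<longlonglongrightarrow> t" and t: "t \<in> {0..1}"
  shows "(\<lambda>i. duhamel f (X i) \<xi>) \<longlonglongrightarrow> duhamel f t \<xi>"
  unfolding duhamel_def
proof (rule integral_dominated_convergence)
  define w where "w r = (exp A0 * norm f * bracket \<xi> powr (- k)) * (indicator {0<..<1} r * r powr (- (2 * \<beta>)))" for r :: real
  show "integrable lborel w"
    unfolding w_def using \<beta> by (intro integrable_mult_right integral_powr_0(1)) auto
  have "cmod (duhamel_integrand f (X i) \<xi> r) \<le> w r" for i r
  proof (cases "0 < r \<and> r < X i")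
    case True
    then have r: "0 < r" "r < 1" "r < X i" using X[of i] by auto
    have "cmod (duhamel_integrand f (X i) \<xi> r) = cmod (m (X i - r) \<xi>) * (bracket \<xi> powr (- k) * r powr (- (2 * \<beta>))) * cmod (app f (r, \<xi>))"
      using r by (simp add: duhamel_integrand_def norm_mult)
    also have "\<dots> \<le> exp A0 * (bracket \<xi> powr (- k) * r powr (- (2 * \<beta>))) * norm f"
      using r X[of i] by (intro mult_mono m_le app_le_norm) auto
    finally show ?thesis using r by (simp add: w_def mult_ac)
  next
    case False then show ?thesis by (auto simp: duhamel_integrand_def w_def)
  qed
  then show "AE r in lborel. norm (duhamel_integrand f (X i) \<xi> r) \<le> w r" for i by simp
  have "(\<lambda>i. duhamel_integrand f (X i) \<xi> r) \<longlonglongrightarrow> duhamel_integrand f t \<xi> r" if "r \<noteq> t" for r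
  proof (cases "0 < r \<and> r < t")
    case True
    have "isCont (\<lambda>t. m t \<xi>) (t - r)"
      using m_continuous[of \<xi>] by (simp add: continuous_on_eq_continuous_at)
    then have "(\<lambda>i. m (X i - r) \<xi>) \<longlonglongrightarrow> m (t - r) \<xi>"
      by (rule isCont_tendsto_compose) (intro tendsto_intros lim)
    then have "(\<lambda>i. m (X i - r) \<xi> * of_real (bracket \<xi> powr (- k) * r powr (- 2 * \<beta>)) * app f (r, \<xi>)) \<longlonglongrightarrow> duhamel_integrand f t \<xi> r"
      using True by (auto simp: duhamel_integrand_def intro!: tendsto_mult tendsto_const)
    moreover have "\<forall>\<^sub>F i in sequentially. r < X i" using lim True by (intro order_tendstoD) auto
    then have "\<forall>\<^sub>F i in sequentially. m (X i - r) \<xi> * of_real (bracket \<xi> powr (- k) * r powr (- 2 * \<beta>)) * app f (r, \<xi>) = duhamel_integrand f (X i) \<xi> r"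
      by eventually_elim (use True in \<open>simp add: duhamel_integrand_def\<close>)
    ultimately show ?thesis by (rule Lim_transform_eventually)
  next
    case False
    then have "r \<le> 0 \<or> t < r" using that by auto
    then have "\<forall>\<^sub>F i in sequentially. duhamel_integrand f (X i) \<xi> r = duhamel_integrand f t \<xi> r"
    proof
      assume "t < r"
      then have "\<forall>\<^sub>F i in sequentially. X i < r" using lim by (intro order_tendstoD) auto
      then show ?thesis by eventually_elim (use \<open>t < r\<close> in \<open>simp add: duhamel_integrand_def\<close>)
    qed (auto simp: duhamel_integrand_def)
    then show ?thesis by (rule tendsto_eventually)
  qed
  moreover have "AE r in lborel. r \<noteq> t" by (rule AE_lborel_singleton)
  ultimately show "AE r in lborel. (\<lambda>i. duhamel_integrand f (X i) \<xi> r) \<longlonglongrightarrow> duhamel_integrand f t \<xi> r" by auto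
qed measurable

lemma profile_tendsto:
  assumes X: "\<And>i::nat. X i \<in> {0..1}" and lim: "X \<longlonglongrightarrow> t" and t: "t \<in> {0..1}"
  shows "(\<lambda>i. profile g f (X i) \<xi>) \<longlonglongrightarrow> profile g f t \<xi>"
proof -
  have "isCont (\<lambda>t. m t \<xi>) t"
    using m_continuous[of \<xi>] by (simp add: continuous_on_eq_continuous_at)
  from isCont_tendsto_compose[OF this lim] show ?thesis
    unfolding profile_def by (intro tendsto_intros duhamel_continuous assms)
qed

text \<open>The profile is continuous in time for every frequency; a square integrable majorant near each time
  gives continuity in \<open>H\<^sup>\<sigma>\<close> by dominated convergence.\<close>

lemma trajectory_continuous:
  assumes z: "fst z \<in> sobolev s" and \<tau>: "\<tau> \<le> 1" and I: "I \<subseteq> {0..\<tau>}" and H: "\<And>t. t \<in> I \<Longrightarrow> \<exists>J H. t \<in> J \<and> open J \<and> L2_fun H \<and>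
      (\<forall>r\<in>I \<inter> J. \<forall>\<xi>. bracket \<xi> powr \<sigma> * cmod (profile (hat (fst z)) (snd z) r \<xi>) \<le> cmod (H \<xi>))"
  shows "continuous_sobolev \<sigma> I (trajectory \<tau> z)"
  unfolding continuous_sobolev_def
proof (intro ballI conjI)
  fix t assume tI: "t \<in> I"
  obtain J H where J: "t \<in> J" "open J" and Hs: "L2_fun H"
    and dom: "\<And>r \<xi>. r \<in> I \<Longrightarrow> r \<in> J \<Longrightarrow> bracket \<xi> powr \<sigma> * cmod (profile (hat (fst z)) (snd z) r \<xi>) \<le> cmod (H \<xi>)"
    using H[OF tI] by blast
  let ?U = "profile (hat (fst z)) (snd z)"
  have [measurable]: "hat (fst z) \<in> borel_measurable borel" using hat_sobolev(1)[OF z] .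
  have d: "has_density (fourier_dist (trajectory \<tau> z r)) (?U r)" "?U r \<in> borel_measurable borel" if "r \<in> I" for r
    using trajectory_density[OF z, of r \<tau>] that I \<tau> by auto
  have sq: "L2_fun (weighted \<sigma> (?U r))" if "r \<in> I" "r \<in> J" for r
  proof (rule L2_fun_dominated(1)[OF Hs])
    show "(weighted \<sigma> (?U r)) \<in> borel_measurable borel" by measurable
  qed (use dom[OF that] in \<open>simp add: norm_mult\<close>)
  show "trajectory \<tau> z t \<in> sobolev \<sigma>"
    using sobolev_density(1)[OF d[OF tI]] sq[OF tI J(1)] by simp
  show "((\<lambda>r. sobolev_norm \<sigma> (trajectory \<tau> z r - trajectory \<tau> z t)) \<longlongrightarrow> 0) (at t within I)"
    unfolding tendsto_at_iff_sequentially o_def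
  proof (intro allI impI)
    fix X :: "nat \<Rightarrow> real" assume XI: "\<forall>i. X i \<in> I - {t}" and lim: "X \<longlonglongrightarrow> t"
    have n: "sobolev_norm \<sigma> (trajectory \<tau> z (X i) - trajectory \<tau> z t) = L2_norm (\<lambda>\<xi>. of_real (bracket \<xi> powr \<sigma>) * (?U (X i) \<xi> - ?U t \<xi>))" for i
    proof -
      have Xi: "X i \<in> I" using XI by auto
      have "has_density (fourier_dist (1 *\<^sub>R trajectory \<tau> z (X i) + (- 1) *\<^sub>R trajectory \<tau> z t)) (\<lambda>\<xi>. of_real 1 * ?U (X i) \<xi> + of_real (- 1) * ?U t \<xi>)"
        by (rule fourier_density_lincomb[OF d[OF Xi] d[OF tI]])
      then have "has_density (fourier_dist (trajectory \<tau> z (X i) - trajectory \<tau> z t)) (\<lambda>\<xi>. ?U (X i) \<xi> - ?U t \<xi>)" by simp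
      from sobolev_density(2)[OF this, of \<sigma>] show ?thesis using d[OF Xi] d[OF tI] by simp
    qed
    have ev: "\<forall>\<^sub>F i in sequentially. X i \<in> J" using lim J by (simp add: topological_tendstoD)
    let ?S = "\<lambda>i. if X i \<in> J then ?U (X i) else ?U t"
    have "(\<lambda>i. LINT \<xi>|lborel. (cmod (of_real (bracket \<xi> powr \<sigma>) * (?S i \<xi> - ?U t \<xi>)))\<^sup>2) \<longlonglongrightarrow> (LINT \<xi>::real|lborel. (0::real))"
    proof (rule integral_dominated_convergence[where w = "\<lambda>\<xi>. 4 * (cmod (H \<xi>))\<^sup>2"])
      show "integrable lborel (\<lambda>\<xi>. 4 * (cmod (H \<xi>))\<^sup>2)" using Hs by (simp add: L2_fun_def)
      have "(\<lambda>i. ?S i \<xi>) \<longlonglongrightarrow> ?U t \<xi>" for \<xi>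
      proof (rule Lim_transform_eventually)
        show "(\<lambda>i. ?U (X i) \<xi>) \<longlonglongrightarrow> ?U t \<xi>"
        proof (rule profile_tendsto[OF _ lim])
          show "X i \<in> {0..1}" for i using XI I \<tau> by (meson Diff_iff atLeastAtMost_iff order_trans subsetD)
          show "t \<in> {0..1}" using tI I \<tau> by auto
        qed
        show "\<forall>\<^sub>F i in sequentially. ?U (X i) \<xi> = ?S i \<xi>" using ev by eventually_elim simp
      qed
      then have "(\<lambda>i. of_real (bracket \<xi> powr \<sigma>) * (?S i \<xi> - ?U t \<xi>)) \<longlonglongrightarrow> of_real (bracket \<xi> powr \<sigma>) * (?U t \<xi> - ?U t \<xi>)" for \<xi>
        by (intro tendsto_intros)
      then have "(\<lambda>i. (cmod (of_real (bracket \<xi> powr \<sigma>) * (?S i \<xi> - ?U t \<xi>)))\<^sup>2) \<longlonglongrightarrow> (cmod (of_real (bracket \<xi> powr \<sigma>) * (?U t \<xi> - ?U t \<xi>)))\<^sup>2" for \<xi>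
        by (intro tendsto_power tendsto_norm)
      then show "AE \<xi> in lborel. (\<lambda>i. (cmod (of_real (bracket \<xi> powr \<sigma>) * (?S i \<xi> - ?U t \<xi>)))\<^sup>2) \<longlonglongrightarrow> 0" by simp
      have "(cmod (of_real (bracket \<xi> powr \<sigma>) * (?S i \<xi> - ?U t \<xi>)))\<^sup>2 \<le> 4 * (cmod (H \<xi>))\<^sup>2" for i \<xi>
      proof -
        have "bracket \<xi> powr \<sigma> * cmod (?S i \<xi>) \<le> cmod (H \<xi>)" using dom[of "X i" \<xi>] dom[OF tI J(1), of \<xi>] XI by auto
        then have "bracket \<xi> powr \<sigma> * cmod (?S i \<xi>) + bracket \<xi> powr \<sigma> * cmod (?U t \<xi>) \<le> 2 * cmod (H \<xi>)"
          using dom[OF tI J(1), of \<xi>] by linarith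
        moreover have "cmod (of_real (bracket \<xi> powr \<sigma>) * (?S i \<xi> - ?U t \<xi>)) \<le> bracket \<xi> powr \<sigma> * (cmod (?S i \<xi>) + cmod (?U t \<xi>))"
          unfolding norm_mult norm_of_real abs_of_nonneg[OF powr_ge_zero] by (intro mult_left_mono norm_triangle_ineq4) auto
        ultimately have "cmod (of_real (bracket \<xi> powr \<sigma>) * (?S i \<xi> - ?U t \<xi>)) \<le> 2 * cmod (H \<xi>)"
          by (simp only: distrib_left)
        then have "(cmod (of_real (bracket \<xi> powr \<sigma>) * (?S i \<xi> - ?U t \<xi>)))\<^sup>2 \<le> (2 * cmod (H \<xi>))\<^sup>2"
          by (intro power_mono) auto
        then show ?thesis by (simp add: power_mult_distrib)
      qed
      then show "AE \<xi> in lborel. norm ((cmod (of_real (bracket \<xi> powr \<sigma>) * (?S i \<xi> - ?U t \<xi>)))\<^sup>2) \<le> 4 * (cmod (H \<xi>))\<^sup>2" for i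
        by simp
      have [measurable]: "?S i \<in> borel_measurable borel" for i by simp
      show "(\<lambda>\<xi>. (cmod (of_real (bracket \<xi> powr \<sigma>) * (?S i \<xi> - ?U t \<xi>)))\<^sup>2) \<in> borel_measurable lborel" for i by measurable
    qed simp
    then have "(\<lambda>i. L2_norm (\<lambda>\<xi>. of_real (bracket \<xi> powr \<sigma>) * (?S i \<xi> - ?U t \<xi>))) \<longlonglongrightarrow> sqrt 0"
      unfolding L2_norm_def by (intro tendsto_real_sqrt) simp
    moreover have "\<forall>\<^sub>F i in sequentially. L2_norm (\<lambda>\<xi>. of_real (bracket \<xi> powr \<sigma>) * (?S i \<xi> - ?U t \<xi>)) = sobolev_norm \<sigma> (trajectory \<tau> z (X i) - trajectory \<tau> z t)"
      using ev by eventually_elim (simp add: n)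
    ultimately show "(\<lambda>i. sobolev_norm \<sigma> (trajectory \<tau> z (X i) - trajectory \<tau> z t)) \<longlonglongrightarrow> 0"
      by (simp add: Lim_transform_eventually)
  qed
qed

section \<open>Solutions from fixed points\<close>

lemma trajectory_deriv:
  assumes z: "fst z \<in> sobolev s" and t: "0 < t" "t \<le> \<tau>" "\<tau> \<le> 1"
  shows "has_density (deriv_dist (trajectory \<tau> z t)) (ift (profile_x (hat (fst z)) (snd z) t))"
    "L2_fun (ift (profile_x (hat (fst z)) (snd z) t))" "L2_norm (ift (profile_x (hat (fst z)) (snd z) t)) \<le> L2_norm (profile_x (hat (fst z)) (snd z) t)"
    "has_density (fourier_dist (deriv_square (trajectory \<tau> z t))) (\<lambda>\<xi>. conv (profile_x (hat (fst z)) (snd z) t) (profile_x (hat (fst z)) (snd z) t) \<xi> / (2 * pi))"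
    "deriv_dist (trajectory \<tau> z t) \<in> L2_dist" "L2_dist_norm (deriv_dist (trajectory \<tau> z t)) = L2_norm (ift (profile_x (hat (fst z)) (snd z) t))"
proof -
  let ?g = "hat (fst z)" and ?f = "snd z"
  have t': "0 \<le> t" "t \<le> 1" using t by auto
  note d = trajectory_density[OF z t'(1) t(2,3)]
  have F: "profile_x ?g ?f t = (\<lambda>\<xi>. \<i> * of_real \<xi> * profile ?g ?f t \<xi>)" by (auto simp: profile_x_def)
  note i = profile_x_integrable[OF Hs_density_hat[OF z] t(1) t'(2), of ?f] and q = profile_x_L2_fun(1)[OF Hs_density_hat[OF z] t(1) t'(2), of ?f]
  note D = deriv_dist_ift[OF d F i q]
  show "has_density (deriv_dist (trajectory \<tau> z t)) (ift (profile_x ?g ?f t))" "L2_fun (ift (profile_x ?g ?f t))" "L2_norm (ift (profile_x ?g ?f t)) \<le> L2_norm (profile_x ?g ?f t)"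
    by (rule D)+
  show "has_density (fourier_dist (deriv_square (trajectory \<tau> z t))) (\<lambda>\<xi>. conv (profile_x ?g ?f t) (profile_x ?g ?f t) \<xi> / (2 * pi))"
    by (rule deriv_square_conv[OF d F i q])
  have m: "ift (profile_x ?g ?f t) \<in> borel_measurable borel" using D(2) by (simp add: L2_fun_def)
  show "deriv_dist (trajectory \<tau> z t) \<in> L2_dist" "L2_dist_norm (deriv_dist (trajectory \<tau> z t)) = L2_norm (ift (profile_x ?g ?f t))"
    using L2_dist_density[OF D(1) m] D(2) by auto
qed

lemma trajectory_L2_bound:
  "\<exists>C\<ge>0. \<forall>\<tau> z t. fst z \<in> sobolev s \<longrightarrow> 0 < t \<longrightarrow> t \<le> \<tau> \<longrightarrow> \<tau> \<le> 1 \<longrightarrow>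
    L2_dist_norm (deriv_dist (trajectory \<tau> z t)) \<le> C * t powr (- \<beta>) * (sobolev_norm s (fst z) + norm (snd z))"
proof -
  obtain C D where CD: "0 \<le> C" "0 \<le> D" "\<forall>g f t. Hs_density g \<longrightarrow> 0 < t \<longrightarrow> t \<le> 1 \<longrightarrow>
    L2_fun (weighted k (profile_x g f t)) \<and>
    L2_norm (weighted k (profile_x g f t)) \<le> C * t powr (- \<beta>) * Hs_norm g + D * t powr (1 - \<gamma> - 2 * \<beta>) * norm f"
    using profile_x_estimate by blast
  have "L2_dist_norm (deriv_dist (trajectory \<tau> z t)) \<le> (C + D) * t powr (- \<beta>) * (sobolev_norm s (fst z) + norm (snd z))"
    if z: "fst z \<in> sobolev s" and t: "0 < t" "t \<le> \<tau>" "\<tau> \<le> 1" for \<tau> z t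
  proof -
    have t1: "t \<le> 1" using t by simp
    let ?F = "profile_x (hat (fst z)) (snd z) t"
    have sn: "0 \<le> sobolev_norm s (fst z)" by (simp add: sobolev_norm_def)
    have "L2_dist_norm (deriv_dist (trajectory \<tau> z t)) \<le> L2_norm (weighted k ?F)"
      using trajectory_deriv(3,6)[OF z t] profile_x_L2_fun(2)[OF Hs_density_hat[OF z] t(1) t1, of "snd z"] by linarith
    also have "\<dots> \<le> C * t powr (- \<beta>) * sobolev_norm s (fst z) + D * t powr (1 - \<gamma> - 2 * \<beta>) * norm (snd z)"
      using CD(3)[rule_format, OF Hs_density_hat[OF z] t(1) t1, of "snd z"] unfolding Hs_norm_hat[OF z] by (rule conjunct2)
    also have "\<dots> \<le> C * t powr (- \<beta>) * sobolev_norm s (fst z) + D * t powr (- \<beta>) * norm (snd z)"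
      using CD t t1 \<beta> \<gamma> by (intro add_left_mono mult_right_mono mult_left_mono powr_mono') auto
    also have "\<dots> \<le> (C + D) * t powr (- \<beta>) * sobolev_norm s (fst z) + (C + D) * t powr (- \<beta>) * norm (snd z)"
      using CD sn by (intro add_mono mult_right_mono) auto
    finally show ?thesis by (simp add: algebra_simps)
  qed
  then show ?thesis using CD by (intro exI[of _ "C + D"]) auto
qed

lemma trajectory_continuous_s:
  assumes z: "fst z \<in> sobolev s" and \<tau>: "\<tau> \<le> 1"
  shows "continuous_sobolev s {0..\<tau>} (trajectory \<tau> z)"
proof (rule trajectory_continuous[OF z \<tau> order_refl])
  obtain C w where C: "0 \<le> C" "1 / 2 < w" "\<forall>f t \<xi>. t \<le> 1 \<longrightarrow> bracket \<xi> powr s * cmod (duhamel f t \<xi>) \<le> C * norm f * bracket \<xi> powr (- w)"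
    using duhamel_Hs_bound by auto
  let ?g = "hat (fst z)" and ?f = "snd z"
  let ?H = "\<lambda>\<xi>. complex_of_real (exp A0) * of_real (cmod (of_real (bracket \<xi> powr s) * ?g \<xi>)) + of_real (C * norm ?f) * of_real (bracket \<xi> powr (- w))"
  fix t assume "t \<in> {0..\<tau>}"
  have a: "L2_fun (weighted s ?g)" using Hs_density_hat[OF z] by (simp add: Hs_density_def)
  then have a': "L2_fun (\<lambda>\<xi>. complex_of_real (cmod (of_real (bracket \<xi> powr s) * ?g \<xi>)))" by (auto simp: L2_fun_def)
  have H: "L2_fun ?H" by (intro L2_fun_lincomb a' L2_fun_bracket C)
  have le: "bracket \<xi> powr s * cmod (profile ?g ?f r \<xi>) \<le> cmod (?H \<xi>)" if r: "r \<in> {0..\<tau>}" for r \<xi>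
  proof -
    have r': "0 \<le> r" "r \<le> 1" using r \<tau> by auto
    have "bracket \<xi> powr s * cmod (profile ?g ?f r \<xi>) \<le> bracket \<xi> powr s * (exp A0 * cmod (?g \<xi>) + cmod (duhamel ?f r \<xi>))"
      unfolding profile_def using norm_triangle_ineq4[of "m r \<xi> * ?g \<xi>" "duhamel ?f r \<xi>"] mult_right_mono[OF m_le[OF r', of \<xi>], of "cmod (?g \<xi>)"]
      by (intro mult_left_mono) (auto simp: norm_mult)
    also have "\<dots> = exp A0 * cmod (of_real (bracket \<xi> powr s) * ?g \<xi>) + bracket \<xi> powr s * cmod (duhamel ?f r \<xi>)"
      by (simp add: norm_mult algebra_simps)
    also have "\<dots> \<le> exp A0 * cmod (of_real (bracket \<xi> powr s) * ?g \<xi>) + C * norm ?f * bracket \<xi> powr (- w)"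
      using C(3) r' by simp
    also have "\<dots> = cmod (complex_of_real (exp A0 * cmod (of_real (bracket \<xi> powr s) * ?g \<xi>) + C * norm ?f * bracket \<xi> powr (- w)))"
      using C(1) unfolding norm_of_real by (intro abs_of_nonneg[symmetric] add_nonneg_nonneg mult_nonneg_nonneg) auto
    also have "complex_of_real (exp A0 * cmod (of_real (bracket \<xi> powr s) * ?g \<xi>) + C * norm ?f * bracket \<xi> powr (- w)) = ?H \<xi>"
      by (simp only: of_real_add of_real_mult)
    finally show ?thesis .
  qed
  show "\<exists>J H. t \<in> J \<and> open J \<and> L2_fun H \<and> (\<forall>r\<in>{0..\<tau>} \<inter> J. \<forall>\<xi>. bracket \<xi> powr s * cmod (profile ?g ?f r \<xi>) \<le> cmod (H \<xi>))"
    using H le by (intro exI[of _ UNIV] exI[of _ ?H]) auto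
qed

text \<open>The \<open>L\<^sup>2\<close> norm of the space derivative grows at most like \<open>t powr (- \<beta>)\<close>, and \<open>\<beta> \<le> (1 + \<bar>s\<bar>) / p\<close>.\<close>

lemma trajectory_CY:
  "\<exists>C\<ge>0. \<forall>\<tau> z. fst z \<in> sobolev s \<longrightarrow> 0 < \<tau> \<longrightarrow> \<tau> \<le> 1 \<longrightarrow>
    trajectory \<tau> z \<in> CY_space p s \<tau> \<and> Y_norm p s \<tau> (trajectory \<tau> z) \<le> C * (sobolev_norm s (fst z) + norm (snd z))"
proof -
  obtain C where C: "0 \<le> C" "\<forall>\<tau> z t. fst z \<in> sobolev s \<longrightarrow> 0 < t \<longrightarrow> t \<le> \<tau> \<longrightarrow> \<tau> \<le> 1 \<longrightarrow>
    L2_dist_norm (deriv_dist (trajectory \<tau> z t)) \<le> C * t powr (- \<beta>) * (sobolev_norm s (fst z) + norm (snd z))"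
    using trajectory_L2_bound by auto
  obtain D where D: "0 \<le> D" "\<forall>g f t. Hs_density g \<longrightarrow> 0 \<le> t \<longrightarrow> t \<le> 1 \<longrightarrow> L2_fun (weighted s (profile g f t)) \<and>
    L2_norm (weighted s (profile g f t)) \<le> D * (Hs_norm g + norm f)"
    using profile_Hs by auto
  have "trajectory \<tau> z \<in> CY_space p s \<tau> \<and> Y_norm p s \<tau> (trajectory \<tau> z) \<le> (D + C) * (sobolev_norm s (fst z) + norm (snd z))"
    if z: "fst z \<in> sobolev s" and \<tau>: "0 < \<tau>" "\<tau> \<le> 1" for \<tau> z
  proof -
    let ?n = "sobolev_norm s (fst z) + norm (snd z)"
    have n0: "0 \<le> ?n" by (simp add: sobolev_norm_def)
    have w: "Y_weight p s (trajectory \<tau> z) t \<le> (D + C) * ?n" if t: "t \<in> {0..\<tau>}" for t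
    proof -
      have t': "0 \<le> t" "t \<le> \<tau>" "t \<le> 1" using t \<tau> by auto
      note d = trajectory_density[OF z t'(1,2) \<tau>(2)]
      have "sobolev_norm s (trajectory \<tau> z t) \<le> D * ?n"
        unfolding sobolev_density(2)[OF d] Hs_norm_hat[OF z, symmetric] using D(2) Hs_density_hat[OF z] t' by blast
      moreover have "t powr ((1 + \<bar>s\<bar>) / p) * L2_dist_norm (deriv_dist (trajectory \<tau> z t)) \<le> C * ?n"
      proof (cases "t = 0")
        case False
        then have t0: "0 < t" using t' by simp
        have e: "0 \<le> (1 + \<bar>s\<bar>) / p - \<beta>"
          using p_pos by (auto simp: \<beta>_def max_def divide_right_mono)
        have "t powr ((1 + \<bar>s\<bar>) / p) * L2_dist_norm (deriv_dist (trajectory \<tau> z t)) \<le> t powr ((1 + \<bar>s\<bar>) / p) * (C * t powr (- \<beta>) * ?n)"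
          by (rule mult_left_mono[OF C(2)[rule_format, OF z t0 t'(2) \<tau>(2)]]) simp
        also have "\<dots> = (t powr ((1 + \<bar>s\<bar>) / p) * t powr (- \<beta>)) * (C * ?n)" by (simp only: mult_ac)
        also have "t powr ((1 + \<bar>s\<bar>) / p) * t powr (- \<beta>) = t powr ((1 + \<bar>s\<bar>) / p - \<beta>)"
          by (simp add: powr_add[symmetric])
        also have "\<dots> * (C * ?n) \<le> 1 * (C * ?n)"
          using t0 t' e C n0 by (intro mult_right_mono powr_le1) auto
        finally show ?thesis by simp
      qed (use C n0 in simp)
      ultimately show ?thesis by (simp add: Y_weight_def algebra_simps)
    qed
    have bdd: "bdd_above (Y_weight p s (trajectory \<tau> z) ` {0..\<tau>})"
      by (rule bdd_aboveI[of _ "(D + C) * ?n"]) (use w in auto)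
    note cont = trajectory_continuous_s[OF z \<tau>(2)]
    have "trajectory \<tau> z \<in> Y_space p s \<tau>"
      unfolding Y_space_def using bdd cont trajectory_deriv(5)[OF z _ _ \<tau>(2)] by (auto simp: continuous_sobolev_def)
    moreover have "Y_norm p s \<tau> (trajectory \<tau> z) \<le> (D + C) * ?n"
      unfolding Y_norm_def using w \<tau> by (intro cSUP_least) auto
    ultimately show ?thesis using cont by (simp add: CY_space_def)
  qed
  then show ?thesis using C D by (intro exI[of _ "D + C"]) auto
qed

lemma profile_x_norm_measurable:
  assumes [measurable]: "g \<in> borel_measurable borel"
  shows "(\<lambda>t. (L2_norm (ift (profile_x g f t)))\<^sup>2) \<in> borel_measurable borel"
proof -
  have "(\<lambda>(x, \<xi>). (wave \<xi> (- snd x)) * profile_x g f (fst x) \<xi>) \<in> borel_measurable ((borel \<Otimes>\<^sub>M borel) \<Otimes>\<^sub>M borel)"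
    by measurable
  then have [measurable]: "(\<lambda>x. ft (profile_x g f (fst x)) (- snd x)) \<in> borel_measurable (borel \<Otimes>\<^sub>M borel)"
    unfolding ft_def by (intro lborel.borel_measurable_lebesgue_integral) simp
  have "(\<lambda>x. (cmod (ft (profile_x g f (fst x)) (- snd x) / complex_of_real (2 * pi)))\<^sup>2) \<in> borel_measurable (borel \<Otimes>\<^sub>M borel)"
    by measurable
  then have "(\<lambda>t. LINT x|lborel. (cmod (ft (profile_x g f t) (- x) / complex_of_real (2 * pi)))\<^sup>2) \<in> borel_measurable borel"
    by (intro lborel.borel_measurable_lebesgue_integral) (simp add: case_prod_beta')
  then show ?thesis by (simp add: L2_norm_def ift_def)
qed

end

lemma lebesgue_lborel_AE:
  fixes f g :: "real \<Rightarrow> 'b::euclidean_space"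
  assumes g: "integrable lborel g" and ae: "AE x in lborel. f x = g x"
  shows "integrable lebesgue f" "(LINT x|lebesgue. f x) = (LINT x|lborel. g x)"
proof -
  have gm: "g \<in> borel_measurable lborel" using g by auto
  then have gl: "g \<in> borel_measurable lebesgue" by (simp add: measurable_completion)
  have ae': "AE x in lebesgue. g x = f x" using AE_completion[OF ae] by eventually_elim simp
  have gi: "integrable lebesgue g" using integrable_completion[OF gm] g by simp
  have fm: "f \<in> borel_measurable lebesgue" by (rule borel_measurable_AE[OF gl ae'])
  show "integrable lebesgue f" "(LINT x|lebesgue. f x) = (LINT x|lborel. g x)"
    using integrable_cong_AE[OF gl fm ae'] integral_cong_AE[OF gl fm ae'] gi integral_completion[OF gm] by auto
qed

text \<open>The symbol of the problem is Lebesgue measurable; it is replaced by a Borel function that agrees with it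
  almost everywhere, which changes neither the propagator nor the notion of solution.\<close>

locale dissipative_rep = dissipative +
  fixes \<Phi>0 :: "real \<Rightarrow> real"
  assumes \<Phi>0_measurable: "\<Phi>0 \<in> borel_measurable lebesgue" and \<Phi>0_AE: "AE \<xi> in lebesgue. \<Phi>0 \<xi> = \<Phi> \<xi>"
begin

lemma propagator_fourier:
  assumes d: "has_density (fourier_dist w) g" and g: "g \<in> borel_measurable borel"
    and q: "L2_fun (weighted \<sigma> g)" and t: "0 \<le> t" "t \<le> 1"
  shows "has_density (fourier_dist (propagator \<eta> \<Phi>0 t w)) (\<lambda>\<xi>. m t \<xi> * g \<xi>)"
proof (rule propagator_density[OF d g \<Phi>0_measurable \<Phi>0_AE])
  have [measurable]: "g \<in> borel_measurable borel" by (rule g)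
  show "(\<lambda>\<xi>. m t \<xi> * g \<xi>) \<in> borel_measurable borel" by measurable
  show "(\<lambda>\<xi>. m t \<xi> * g \<xi>) = (\<lambda>\<xi>. exp (\<i> * of_real (t * \<xi> ^ 3) + of_real (\<eta> * t * \<Phi> \<xi>)) * g \<xi>)"
    by (simp add: m_def)
  show "L2_fun (\<lambda>\<xi>. of_real (bracket \<xi> powr \<sigma>) * (m t \<xi> * g \<xi>))"
  proof (rule L2_fun_bound1(1)[OF q])
    show "cmod (of_real (bracket \<xi> powr \<sigma>) * (m t \<xi> * g \<xi>)) \<le> exp A0 * cmod (of_real (bracket \<xi> powr \<sigma>) * g \<xi>)" for \<xi>
      using mult_right_mono[OF m_le[OF t, of \<xi>], of "cmod (of_real (bracket \<xi> powr \<sigma>) * g \<xi>)"] by (simp add: norm_mult mult_ac)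
    show "(\<lambda>\<xi>. of_real (bracket \<xi> powr \<sigma>) * (m t \<xi> * g \<xi>)) \<in> borel_measurable borel" by measurable
  qed simp
qed

lemma propagator_pair_bounded:
  assumes d: "has_density (fourier_dist w) c" and c: "c \<in> borel_measurable borel"
    and B: "\<And>\<xi>. cmod (c \<xi>) \<le> B" and t: "0 \<le> t" "t \<le> 1" and \<phi>: "\<phi> \<in> schwartz"
  shows "pair (propagator \<eta> \<Phi>0 t w) \<phi> = (LINT \<xi>|lborel. m t \<xi> * c \<xi> * ift \<phi> \<xi>)"
    "integrable lborel (\<lambda>\<xi>. m t \<xi> * c \<xi> * ift \<phi> \<xi>)"
proof -
  have [measurable]: "c \<in> borel_measurable borel" by (rule c)
  have B0: "0 \<le> B" using order_trans[OF norm_ge_zero B] .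
  have q: "L2_fun (weighted (- 1) c)"
  proof (rule L2_fun_bound1(1)[OF L2_fun_bracket[of 1]])
    show "cmod (of_real (bracket \<xi> powr (- 1)) * c \<xi>) \<le> B * cmod (complex_of_real (bracket \<xi> powr - 1))" for \<xi>
      using mult_left_mono[OF B, of "bracket \<xi> powr (- 1)" \<xi>] by (simp only: norm_mult norm_of_real abs_of_nonneg[OF powr_ge_zero] mult.commute powr_ge_zero)
    show "(weighted (- 1) c) \<in> borel_measurable borel" by measurable
  qed (use B0 in auto)
  have p: "has_density (fourier_dist (propagator \<eta> \<Phi>0 t w)) (\<lambda>\<xi>. m t \<xi> * c \<xi>)"
    by (rule propagator_fourier[OF d c q t])
  have mm: "(\<lambda>\<xi>. m t \<xi> * c \<xi>) \<in> borel_measurable borel" by measurable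
  show "pair (propagator \<eta> \<Phi>0 t w) \<phi> = (LINT \<xi>|lborel. m t \<xi> * c \<xi> * ift \<phi> \<xi>)"
    "integrable lborel (\<lambda>\<xi>. m t \<xi> * c \<xi> * ift \<phi> \<xi>)"
    using pair_density[OF p mm \<phi>] by auto
qed

lemma duhamel_integrand_simple_bound:
  assumes "t \<le> 1"
  shows "cmod (duhamel_integrand f t \<xi> r) \<le> exp A0 * norm f * (indicator {0<..<1} r * r powr (- (2 * \<beta>)))"
proof (cases "0 < r \<and> r < t")
  case True
  then have r: "0 < r" "r < 1" "r < t" using assms by auto
  have "cmod (duhamel_integrand f t \<xi> r) = cmod (m (t - r) \<xi>) * (bracket \<xi> powr (- k) * r powr (- (2 * \<beta>))) * cmod (app f (r, \<xi>))"
    using r by (simp add: duhamel_integrand_def norm_mult)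
  also have "\<dots> \<le> exp A0 * (1 * r powr (- (2 * \<beta>))) * norm f"
    using r assms k_nonneg by (intro mult_mono m_le app_le_norm bracket_powr_le_1) auto
  finally show ?thesis using r by (simp add: mult_ac)
next
  case False then show ?thesis by (auto simp: duhamel_integrand_def)
qed

text \<open>A fixed point is the weighted Fourier transform of its own source.\<close>

lemma fixed_point_source:
  assumes x: "x \<in> sobolev s" and \<tau>: "0 < \<tau>" "\<tau> \<le> 1" and fp: "source_form \<tau> (x, f) (x, f) = f" and r: "0 < r" "r \<le> \<tau>"
  shows "conv (profile_x (hat x) f r) (profile_x (hat x) f r) \<xi> / (2 * pi) = of_real (bracket \<xi> powr (- k) * r powr (- 2 * \<beta>)) * app f (r, \<xi>)"
proof -
  let ?c = "conv (profile_x (hat x) f r) (profile_x (hat x) f r) \<xi>"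
  have "app f (r, \<xi>) = weighted_source \<tau> (hat x) f (hat x) f (r, \<xi>)"
    using app_source_form[OF \<tau>, of "(x, f)" "(x, f)"] x fp by simp
  also have "\<dots> = of_real (r powr (2 * \<beta>) * bracket \<xi> powr k / (2 * pi)) * ?c"
    using r by (simp add: weighted_source_def)
  finally have "of_real (bracket \<xi> powr (- k) * r powr (- 2 * \<beta>)) * app f (r, \<xi>)
      = of_real ((bracket \<xi> powr (- k) * bracket \<xi> powr k) * (r powr (- 2 * \<beta>) * r powr (2 * \<beta>)) / (2 * pi)) * ?c"
    by (simp add: mult_ac)
  also have "bracket \<xi> powr (- k) * bracket \<xi> powr k = 1" by (simp add: powr_add[symmetric])
  also have "r powr (- 2 * \<beta>) * r powr (2 * \<beta>) = 1" using r by (simp add: powr_add[symmetric])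
  finally show ?thesis by simp
qed

text \<open>Pairing the Duhamel integral with a test function and exchanging the order of integration (the
  integrand is dominated by \<open>r powr (- 2 \<beta>)\<close> times an integrable function of \<open>\<xi>\<close>) gives the time integral
  of the pairings.\<close>

lemma fixed_point_mild:
  assumes x: "x \<in> sobolev s" and \<tau>: "0 < \<tau>" "\<tau> \<le> 1" and fp: "source_form \<tau> (x, f) (x, f) = f"
  shows "mild_solution \<eta> \<Phi>0 s \<tau> x (trajectory \<tau> (x, f))"
  unfolding mild_solution_def
proof (intro conjI ballI)
  let ?u = "trajectory \<tau> (x, f)"
  have z: "fst (x, f) \<in> sobolev s" using x by simp
  have gm[measurable]: "hat x \<in> borel_measurable borel" using hat_sobolev(1)[OF x] .
  show "continuous_sobolev s {0..\<tau>} ?u" by (rule trajectory_continuous_s[OF z \<tau>(2)])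
  note D = trajectory_deriv[OF z _ _ \<tau>(2), unfolded fst_conv snd_conv]
  have ne: "AE t in lborel. t \<noteq> c" for c :: real by (rule AE_lborel_singleton)
  have "AE t in lborel. t \<in> {0..\<tau>} \<longrightarrow> deriv_dist (?u t) \<in> L2_dist"
    using ne[of 0] by eventually_elim (auto intro!: D(5))
  then show "AE t in lebesgue. t \<in> {0..\<tau>} \<longrightarrow> deriv_dist (?u t) \<in> L2_dist" by (rule AE_completion)
  show "set_integrable lebesgue {0..\<tau>} (\<lambda>t. (L2_dist_norm (deriv_dist (?u t)))\<^sup>2)"
  proof -
    obtain C where C: "0 \<le> C" "\<forall>\<tau> z t. fst z \<in> sobolev s \<longrightarrow> 0 < t \<longrightarrow> t \<le> \<tau> \<longrightarrow> \<tau> \<le> 1 \<longrightarrow>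
      L2_dist_norm (deriv_dist (trajectory \<tau> z t)) \<le> C * t powr (- \<beta>) * (sobolev_norm s (fst z) + norm (snd z))"
      using trajectory_L2_bound by auto
    define E where "E = C * (sobolev_norm s x + norm f)"
    let ?h = "\<lambda>t. if 0 < t \<and> t < \<tau> then (L2_norm (ift (profile_x (hat x) f t)))\<^sup>2 else 0"
    have [measurable]: "(\<lambda>t. (L2_norm (ift (profile_x (hat x) f t)))\<^sup>2) \<in> borel_measurable borel"
      by (rule profile_x_norm_measurable[OF gm])
    have hi: "integrable lborel ?h"
    proof (rule integrable_dominated)
      show "integrable lborel (\<lambda>t. E\<^sup>2 * (indicator {0<..<\<tau>} t * t powr (- (2 * \<beta>))))"
        using \<beta> \<tau> by (intro integrable_mult_right integral_powr_0(1)) auto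
      show "norm (?h t) \<le> E\<^sup>2 * (indicator {0<..<\<tau>} t * t powr (- (2 * \<beta>)))" for t
      proof (cases "0 < t \<and> t < \<tau>")
        case True
        then have t: "0 < t" "t \<le> \<tau>" by auto
        have "L2_norm (ift (profile_x (hat x) f t)) \<le> E * t powr (- \<beta>)"
          using C(2)[rule_format, OF z t \<tau>(2)] unfolding D(6)[OF t] by (simp add: E_def mult_ac)
        then have "(L2_norm (ift (profile_x (hat x) f t)))\<^sup>2 \<le> (E * t powr (- \<beta>))\<^sup>2" by (intro power_mono) auto
        also have "\<dots> = E\<^sup>2 * t powr (- (2 * \<beta>))" using t by (simp add: power_mult_distrib powr_power mult.commute)
        finally show ?thesis using True by simp
      qed auto
    qed measurable
    have "AE t in lborel. indicator {0..\<tau>} t *\<^sub>R (L2_dist_norm (deriv_dist (?u t)))\<^sup>2 = ?h t"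
      using ne[of 0] ne[of \<tau>] by eventually_elim (auto simp: D(6) indicator_def)
    from lebesgue_lborel_AE(1)[OF hi this] show ?thesis by (simp add: set_integrable_def)
  qed
  fix t \<phi> assume t: "t \<in> {0..\<tau>}" and \<phi>: "\<phi> \<in> schwartz"
  have t': "0 \<le> t" "t \<le> \<tau>" "t \<le> 1" using t \<tau> by auto
  let ?p = "ift \<phi>"
  have [measurable]: "?p \<in> borel_measurable borel" by (rule schwartz_borel[OF schwartz_ift[OF \<phi>]])
  have pi': "integrable lborel (\<lambda>\<xi>. cmod (?p \<xi>))" by (intro integrable_norm schwartz_integrable schwartz_ift \<phi>)
  define K where "K r \<xi> = duhamel_integrand f t \<xi> r * ?p \<xi>" for r \<xi>
  define W where "W r = exp A0 * norm f * (indicator {0<..<1} r * r powr (- (2 * \<beta>)))" for r :: real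
  have Wi: "integrable lborel W"
    unfolding W_def using \<beta> by (intro integrable_mult_right integral_powr_0(1)) auto
  have Kb: "cmod (K r \<xi>) \<le> W r * cmod (?p \<xi>)" for r \<xi>
    unfolding K_def norm_mult W_def by (intro mult_right_mono duhamel_integrand_simple_bound t') auto
  have Km: "(\<lambda>(r, \<xi>). K r \<xi>) \<in> borel_measurable (borel \<Otimes>\<^sub>M borel)"
    unfolding K_def duhamel_integrand_def by measurable
  have Km1: "(\<lambda>\<xi>. K r \<xi>) \<in> borel_measurable borel" for r
    unfolding K_def duhamel_integrand_def by measurable
  have Ki1: "integrable lborel (K r)" for r
    by (rule integrable_dominated[OF integrable_mult_right[OF pi'] _ Kb]) (use Km1 in simp)
  have Ki: "integrable (lborel \<Otimes>\<^sub>M lborel) (\<lambda>(r, \<xi>). K r \<xi>)"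
  proof (rule lborel_pair.Fubini_integrable)
    show "(\<lambda>(r, \<xi>). K r \<xi>) \<in> borel_measurable (lborel \<Otimes>\<^sub>M lborel)" using Km by simp
    show "AE r in lborel. integrable lborel (\<lambda>\<xi>. case (r, \<xi>) of (r, \<xi>) \<Rightarrow> K r \<xi>)" using Ki1 by simp
    show "integrable lborel (\<lambda>r. LINT \<xi>|lborel. norm (case (r, \<xi>) of (r, \<xi>) \<Rightarrow> K r \<xi>))"
    proof (rule integrable_dominated)
      show "integrable lborel (\<lambda>r. W r * (LINT \<xi>|lborel. cmod (?p \<xi>)))" by (rule integrable_mult_left[OF Wi])
      have "(\<lambda>(r, \<xi>). cmod (K r \<xi>)) \<in> borel_measurable (borel \<Otimes>\<^sub>M borel)"
        using measurable_compose[OF Km borel_measurable_norm] by (simp add: case_prod_beta')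
      then show "(\<lambda>r. LINT \<xi>|lborel. norm (case (r, \<xi>) of (r, \<xi>) \<Rightarrow> K r \<xi>)) \<in> borel_measurable lborel"
        by (simp add: lborel.borel_measurable_lebesgue_integral)
      fix r
      have "(LINT \<xi>|lborel. cmod (K r \<xi>)) \<le> (LINT \<xi>|lborel. W r * cmod (?p \<xi>))"
        by (intro integral_mono integrable_norm Ki1 integrable_mult_right pi' Kb)
      then show "norm (LINT \<xi>|lborel. norm (case (r, \<xi>) of (r, \<xi>) \<Rightarrow> K r \<xi>)) \<le> W r * (LINT \<xi>|lborel. cmod (?p \<xi>))"
        by simp
    qed
  qed
  have KA: "(LINT r|lborel. K r \<xi>) = duhamel f t \<xi> * ?p \<xi>" for \<xi>
    unfolding K_def duhamel_def by simp
  define G where "G r = (LINT \<xi>|lborel. K r \<xi>)" for r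
  have Gi: "integrable lborel G" unfolding G_def by (rule lborel_pair.integrable_fst[OF Ki])
  have Ai: "integrable lborel (\<lambda>\<xi>. duhamel f t \<xi> * ?p \<xi>)"
    unfolding KA[symmetric] by (rule lborel_pair.integrable_snd[OF Ki])
  have GA: "(LINT r|lborel. G r) = (LINT \<xi>|lborel. duhamel f t \<xi> * ?p \<xi>)"
    unfolding G_def KA[symmetric] by (rule lborel_pair.Fubini_integral[OF Ki, symmetric])
  let ?R = "\<lambda>r. pair (propagator \<eta> \<Phi>0 (t - r) (deriv_square (?u r))) \<phi>"
  have RG: "?R r = G r" if r: "0 < r" "r < t" for r
  proof -
    have r': "0 < r" "r \<le> \<tau>" "r \<le> 1" using r t' by auto
    let ?F = "profile_x (hat x) f r"
    let ?c = "\<lambda>\<xi>. conv ?F ?F \<xi> / (2 * pi)"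
    note S = profile_x_L2_fun(1)[OF Hs_density_hat[OF x] r'(1,3), of f]
    note I = profile_x_integrable[OF Hs_density_hat[OF x] r'(1,3), of f]
    have cm: "?c \<in> borel_measurable borel" using conv_L1(2)[OF I I] by auto
    have cB: "cmod (?c \<xi>) \<le> L2_norm ?F * L2_norm ?F" for \<xi>
    proof -
      have "cmod (?c \<xi>) = cmod (conv ?F ?F \<xi>) / (2 * pi)" by (simp add: norm_divide norm_mult)
      also have "\<dots> \<le> cmod (conv ?F ?F \<xi>) / 1" using pi_gt3 by (intro divide_left_mono) auto
      finally show ?thesis using conv_bound[OF S S, of \<xi>] by simp
    qed
    have "?R r = (LINT \<xi>|lborel. m (t - r) \<xi> * ?c \<xi> * ?p \<xi>)"
      by (rule propagator_pair_bounded(1)[OF D(4)[OF r'(1,2)] cm cB _ _ \<phi>]) (use r t' in auto)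
    also have "\<dots> = G r"
      unfolding G_def K_def
    proof (rule Bochner_Integration.integral_cong[OF refl])
      fix \<xi>
      show "m (t - r) \<xi> * ?c \<xi> * ?p \<xi> = duhamel_integrand f t \<xi> r * ?p \<xi>"
        unfolding fixed_point_source[OF x \<tau> fp r'(1,2)] using r by (simp add: duhamel_integrand_def)
    qed
    finally show ?thesis .
  qed
  have G0: "G r = 0" if "r \<le> 0 \<or> t \<le> r" for r
    using that by (auto simp: G_def K_def duhamel_integrand_def)
  have ae: "AE r in lborel. indicator {0..t} r *\<^sub>R ?R r = G r"
    using ne[of 0] ne[of t]
  proof eventually_elim
    case (elim r)
    show ?case
    proof (cases "0 < r \<and> r < t")
      case True then show ?thesis by (simp add: RG)
    next
      case False
      then have "r \<le> 0 \<or> t \<le> r" by auto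
      then show ?thesis using elim G0 by (auto simp: indicator_def)
    qed
  qed
  note L = lebesgue_lborel_AE[OF Gi ae]
  show "set_integrable lebesgue {0..t} ?R" using L(1) by (simp add: set_integrable_def)
  have pt: "has_density (fourier_dist (propagator \<eta> \<Phi>0 t x)) (\<lambda>\<xi>. m t \<xi> * hat x \<xi>)"
    using hat_sobolev[OF x] t' by (intro propagator_fourier) auto
  have pm: "(\<lambda>\<xi>. m t \<xi> * hat x \<xi>) \<in> borel_measurable borel" by measurable
  note P = pair_density[OF pt pm \<phi>]
  note Jd = trajectory_density[OF z t'(1,2) \<tau>(2), unfolded fst_conv snd_conv]
  have "pair (?u t) \<phi> = (LINT \<xi>|lborel. profile (hat x) f t \<xi> * ?p \<xi>)" by (rule pair_density(2)[OF Jd \<phi>])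
  also have "\<dots> = (LINT \<xi>|lborel. m t \<xi> * hat x \<xi> * ?p \<xi> - duhamel f t \<xi> * ?p \<xi>)"
    by (simp add: profile_def algebra_simps)
  also have "\<dots> = pair (propagator \<eta> \<Phi>0 t x) \<phi> - (LINT r|lborel. G r)"
    using P Ai GA by simp
  also have "(LINT r|lborel. G r) = (LINT r:{0..t}|lebesgue. ?R r)"
    using L(2) by (simp add: set_lebesgue_integral_def)
  finally show "pair (?u t) \<phi> = pair (propagator \<eta> \<Phi>0 t x) \<phi> - (LINT r:{0..t}|lebesgue. ?R r)" .
qed

end

section \<open>Uniqueness\<close>

lemma L2_dist_diff:
  assumes f: "deriv_dist f \<in> L2_dist" and g: "deriv_dist g \<in> L2_dist"
  obtains hf hg where "has_density (deriv_dist f) hf" "L2_fun hf" "L2_dist_norm (deriv_dist f) = L2_norm hf"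
    "has_density (deriv_dist g) hg" "L2_fun hg" "L2_dist_norm (deriv_dist g) = L2_norm hg"
    "L2_fun (\<lambda>x. hf x - hg x)" "L2_dist_norm (deriv_dist (f - g)) = L2_norm (\<lambda>x. hf x - hg x)"
    "has_density (deriv_dist (f - g)) (\<lambda>x. hf x - hg x)"
    "L2_norm (\<lambda>x. hf x - hg x) \<le> L2_norm hf + L2_norm hg"
proof -
  obtain hf where hf: "has_density (deriv_dist f) hf" "L2_fun hf" "L2_dist_norm (deriv_dist f) = L2_norm hf"
    using L2_dist_borel[OF f] by blast
  obtain hg where hg: "has_density (deriv_dist g) hg" "L2_fun hg" "L2_dist_norm (deriv_dist g) = L2_norm hg"
    using L2_dist_borel[OF g] by blast
  have [measurable]: "hf \<in> borel_measurable borel" "hg \<in> borel_measurable borel" using hf hg by auto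
  have sd: "L2_fun (\<lambda>x. hf x - hg x)"
    using L2_fun_lincomb[OF hf(2) hg(2), of 1 "-1"] by simp
  have lg: "L2_norm (\<lambda>x. - hg x) = L2_norm hg" by (simp add: L2_norm_def)
  have l: "L2_norm (\<lambda>x. hf x - hg x) \<le> L2_norm hf + L2_norm hg"
    using L2_fun_add(2)[OF hf(2), of "\<lambda>x. - hg x"] L2_fun_cmult(1)[OF hg(2), of "-1"] lg by simp
  have dd: "has_density (deriv_dist (f - g)) (\<lambda>x. hf x - hg x)"
  proof (rule has_densityI)
    fix \<psi> :: "real \<Rightarrow> complex" assume \<psi>: "\<psi> \<in> schwartz"
    note i = has_density_lborel[OF hf(1) _ \<psi>] has_density_lborel[OF hg(1) _ \<psi>]
    show "integrable lborel (\<lambda>x. (hf x - hg x) * \<psi> x)"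
      using i by (simp add: left_diff_distrib)
    have "deriv_dist (f - g) \<psi> = deriv_dist f \<psi> - deriv_dist g \<psi>"
      by (simp add: deriv_dist_def minus_tempered.rep_eq)
    then show "deriv_dist (f - g) \<psi> = (LINT x|lborel. (hf x - hg x) * \<psi> x)"
      using i by (simp add: left_diff_distrib)
  qed measurable
  note D = L2_dist_density[OF dd]
  show ?thesis by (rule that[OF hf hg sd _ dd l]) (use D in simp)
qed

lemma L2_dist_triangle:
  assumes "deriv_dist f \<in> L2_dist" "deriv_dist g \<in> L2_dist"
  shows "L2_dist_norm (deriv_dist (f - g)) \<le> L2_dist_norm (deriv_dist f) + L2_dist_norm (deriv_dist g)"
  by (rule L2_dist_diff[OF assms]) simp

context dissipative_rep
begin

text \<open>The difference of two squares factors, so its Fourier transform is bounded by the \<open>L\<^sup>2\<close> norm of the difference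
  of the derivatives times that of their sum; the propagator contributes \<open>t powr (- \<gamma>)\<close> and \<open>p \<gamma>\<close> powers of
  \<open>bracket \<xi>\<close>.\<close>

lemma source_difference:
  assumes C: "0 \<le> C" "\<forall>t \<xi>. 0 < t \<longrightarrow> t \<le> 1 \<longrightarrow> cmod (m t \<xi>) \<le> C * (t powr (- \<gamma>) * bracket \<xi> powr (- (p * \<gamma>)))"
    and f: "deriv_dist f \<in> L2_dist" and g: "deriv_dist g \<in> L2_dist" and t: "0 < t" "t \<le> 1" and \<phi>: "\<phi> \<in> schwartz"
  shows "cmod (pair (propagator \<eta> \<Phi>0 t (deriv_square f)) \<phi> - pair (propagator \<eta> \<Phi>0 t (deriv_square g)) \<phi>)
      \<le> C * t powr (- \<gamma>) * (L2_dist_norm (deriv_dist (f - g)) * (L2_dist_norm (deriv_dist f) + L2_dist_norm (deriv_dist g)))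
        * (LINT \<xi>|lborel. bracket \<xi> powr (- (p * \<gamma>)) * cmod (ift \<phi> \<xi>))" (is "?l \<le> ?r")
proof -
  obtain hf hg where hf: "has_density (deriv_dist f) hf" "L2_fun hf" "L2_dist_norm (deriv_dist f) = L2_norm hf"
    and hg: "has_density (deriv_dist g) hg" "L2_fun hg" "L2_dist_norm (deriv_dist g) = L2_norm hg"
    and sd: "L2_fun (\<lambda>x. hf x - hg x)" and D: "L2_dist_norm (deriv_dist (f - g)) = L2_norm (\<lambda>x. hf x - hg x)"
    by (rule L2_dist_diff[OF f g])
  have [measurable]: "hf \<in> borel_measurable borel" "hg \<in> borel_measurable borel" using hf hg by auto
  have ss: "L2_fun (\<lambda>x. hf x + hg x)" using L2_fun_add(1)[OF hf(2) hg(2)] .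
  have l: "L2_norm (\<lambda>x. hf x + hg x) \<le> L2_norm hf + L2_norm hg" using L2_fun_add(2)[OF hf(2) hg(2)] .
  let ?cf = "ft (\<lambda>x. (hf x)\<^sup>2)" and ?cg = "ft (\<lambda>x. (hg x)\<^sup>2)" and ?p = "ift \<phi>"
  have sq: "integrable lborel (\<lambda>x. (h x)\<^sup>2)" if "L2_fun h" for h :: "real \<Rightarrow> complex"
    using L2_fun_product(1)[OF that that] by (simp add: power2_eq_square)
  have fm: "ft (\<lambda>x. (h x)\<^sup>2) \<in> borel_measurable borel" if [measurable]: "h \<in> borel_measurable borel" for h :: "real \<Rightarrow> complex"
    by measurable
  have cfm: "?cf \<in> borel_measurable borel" and cgm: "?cg \<in> borel_measurable borel" by (rule fm; measurable)+
  have [measurable]: "?p \<in> borel_measurable borel" by (rule schwartz_borel[OF schwartz_ift[OF \<phi>]])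
  note t' = less_imp_le[OF t(1)] t(2)
  note pf = propagator_pair_bounded[OF deriv_square_fourier[OF hf(1,2)] cfm ft_le_L1 t' \<phi>]
  note pg = propagator_pair_bounded[OF deriv_square_fourier[OF hg(1,2)] cgm ft_le_L1 t' \<phi>]
  have cd: "cmod (?cf \<xi> - ?cg \<xi>) \<le> L2_norm (\<lambda>x. hf x - hg x) * (L2_norm hf + L2_norm hg)" for \<xi>
  proof -
    have e: "integrable lborel (\<lambda>x. wave x \<xi> * (h x)\<^sup>2)" if "L2_fun h" for h :: "real \<Rightarrow> complex"
    proof (rule integrable_dominated)
      show "integrable lborel (\<lambda>x. cmod ((h x)\<^sup>2))" using sq[OF that] by (rule integrable_norm)
      have [measurable]: "h \<in> borel_measurable borel" using that by auto
      show "(\<lambda>x. wave x \<xi> * (h x)\<^sup>2) \<in> borel_measurable lborel" by measurable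
    qed (simp add: norm_mult)
    have "?cf \<xi> - ?cg \<xi> = ft (\<lambda>x. (hf x)\<^sup>2 - (hg x)\<^sup>2) \<xi>"
      using e[OF hf(2)] e[OF hg(2)] unfolding ft_def right_diff_distrib by (rule Bochner_Integration.integral_diff[symmetric])
    moreover have "(\<lambda>x. (hf x)\<^sup>2 - (hg x)\<^sup>2) = (\<lambda>x. (hf x - hg x) * (hf x + hg x))"
      by (simp add: fun_eq_iff power2_eq_square algebra_simps)
    ultimately have "cmod (?cf \<xi> - ?cg \<xi>) = cmod (ft (\<lambda>x. (hf x - hg x) * (hf x + hg x)) \<xi>)" by simp
    also have "\<dots> \<le> (LINT x|lborel. cmod ((hf x - hg x) * (hf x + hg x)))" by (rule ft_le_L1)
    also have "\<dots> \<le> L2_norm (\<lambda>x. hf x - hg x) * L2_norm (\<lambda>x. hf x + hg x)" by (rule L2_fun_product(2)[OF sd ss])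
    also have "\<dots> \<le> L2_norm (\<lambda>x. hf x - hg x) * (L2_norm hf + L2_norm hg)" by (intro mult_left_mono l) simp
    finally show ?thesis .
  qed
  let ?M = "L2_norm (\<lambda>x. hf x - hg x) * (L2_norm hf + L2_norm hg)"
  have pi': "integrable lborel (\<lambda>\<xi>. cmod (?p \<xi>))" by (intro integrable_norm schwartz_integrable schwartz_ift \<phi>)
  have wi: "integrable lborel (\<lambda>\<xi>. bracket \<xi> powr (- (p * \<gamma>)) * cmod (?p \<xi>))"
  proof (rule integrable_dominated[OF pi'])
    show "norm (bracket \<xi> powr (- (p * \<gamma>)) * cmod (?p \<xi>)) \<le> cmod (?p \<xi>)" for \<xi>
      using mult_right_mono[OF bracket_powr_le_1[of "- (p * \<gamma>)" \<xi>], of "cmod (?p \<xi>)"] \<gamma>(3) by simp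
  qed measurable
  have e: "pair (propagator \<eta> \<Phi>0 t (deriv_square f)) \<phi> - pair (propagator \<eta> \<Phi>0 t (deriv_square g)) \<phi>
      = (LINT \<xi>|lborel. m t \<xi> * ?cf \<xi> * ?p \<xi> - m t \<xi> * ?cg \<xi> * ?p \<xi>)"
    unfolding pf(1) pg(1) by (rule Bochner_Integration.integral_diff[OF pf(2) pg(2), symmetric])
  have "?l \<le> (LINT \<xi>|lborel. cmod (m t \<xi> * ?cf \<xi> * ?p \<xi> - m t \<xi> * ?cg \<xi> * ?p \<xi>))"
    unfolding e by (rule integral_norm_bound)
  also have "\<dots> \<le> (LINT \<xi>|lborel. C * t powr (- \<gamma>) * ?M * (bracket \<xi> powr (- (p * \<gamma>)) * cmod (?p \<xi>)))"
  proof (rule integral_mono)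
    show "integrable lborel (\<lambda>\<xi>. cmod (m t \<xi> * ?cf \<xi> * ?p \<xi> - m t \<xi> * ?cg \<xi> * ?p \<xi>))"
      by (rule integrable_norm[OF Bochner_Integration.integrable_diff[OF pf(2) pg(2)]])
    show "integrable lborel (\<lambda>\<xi>. C * t powr (- \<gamma>) * ?M * (bracket \<xi> powr (- (p * \<gamma>)) * cmod (?p \<xi>)))"
      by (rule integrable_mult_right[OF wi])
    fix \<xi>
    have "cmod (m t \<xi> * ?cf \<xi> * ?p \<xi> - m t \<xi> * ?cg \<xi> * ?p \<xi>) = cmod (m t \<xi>) * cmod (?cf \<xi> - ?cg \<xi>) * cmod (?p \<xi>)"
      by (simp only: norm_mult[symmetric] left_diff_distrib right_diff_distrib)
    also have "\<dots> \<le> (C * (t powr (- \<gamma>) * bracket \<xi> powr (- (p * \<gamma>)))) * ?M * cmod (?p \<xi>)"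
      using C(1) by (intro mult_right_mono mult_mono C(2)[rule_format, OF t] cd mult_nonneg_nonneg) simp_all
    finally show "cmod (m t \<xi> * ?cf \<xi> * ?p \<xi> - m t \<xi> * ?cg \<xi> * ?p \<xi>) \<le> C * t powr (- \<gamma>) * ?M * (bracket \<xi> powr (- (p * \<gamma>)) * cmod (?p \<xi>))"
      by (simp add: mult_ac)
  qed
  also have "\<dots> = C * t powr (- \<gamma>) * ?M * (LINT \<xi>|lborel. bracket \<xi> powr (- (p * \<gamma>)) * cmod (?p \<xi>))" by simp
  finally show "?l \<le> ?r" using D hf hg by simp
qed

lemma mild_difference:
  assumes C: "0 \<le> C" "\<forall>t \<xi>. 0 < t \<longrightarrow> t \<le> 1 \<longrightarrow> cmod (m t \<xi>) \<le> C * (t powr (- \<gamma>) * bracket \<xi> powr (- (p * \<gamma>)))"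
    and u: "mild_solution \<eta> \<Phi>0 s \<tau> x u" and v: "mild_solution \<eta> \<Phi>0 s \<tau> x v" and \<tau>: "\<tau> \<le> 1"
    and [measurable]: "N \<in> borel_measurable borel" "b \<in> borel_measurable borel"
    and N: "AE r in lebesgue. 0 < r \<and> r < \<tau> \<longrightarrow> L2_dist_norm (deriv_dist (u r)) + L2_dist_norm (deriv_dist (v r)) \<le> N r"
    and b: "AE r in lebesgue. 0 < r \<and> r < \<tau> \<longrightarrow> ennreal (L2_dist_norm (deriv_dist (u r - v r))) \<le> b r"
    and t: "0 \<le> t" "t \<le> \<tau>" and \<phi>: "\<phi> \<in> schwartz"
  shows "ennreal (cmod (pair (u t) \<phi> - pair (v t) \<phi>))
    \<le> ennreal (LINT \<xi>|lborel. bracket \<xi> powr (- (p * \<gamma>)) * cmod (ift \<phi> \<xi>)) * volterra C \<gamma> N b t"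
proof -
  let ?I = "LINT \<xi>|lborel. bracket \<xi> powr (- (p * \<gamma>)) * cmod (ift \<phi> \<xi>)"
  let ?R = "\<lambda>w r. indicator {0..t} r *\<^sub>R pair (propagator \<eta> \<Phi>0 (t - r) (deriv_square (w r))) \<phi>"
  have I0: "0 \<le> ?I" by simp
  have tt: "t \<in> {0..\<tau>}" using t by simp
  have i: "integrable lebesgue (?R u)" "integrable lebesgue (?R v)"
    using u v tt \<phi> unfolding mild_solution_def set_integrable_def by blast+
  have e: "pair (w t) \<phi> = pair (propagator \<eta> \<Phi>0 t x) \<phi> - (LINT r|lebesgue. ?R w r)" if "mild_solution \<eta> \<Phi>0 s \<tau> x w" for w
    using that tt \<phi> unfolding mild_solution_def set_lebesgue_integral_def by blast
  have "pair (u t) \<phi> - pair (v t) \<phi> = - (LINT r|lebesgue. ?R u r - ?R v r)"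
    using e[OF u] e[OF v] i by simp
  then have "ennreal (cmod (pair (u t) \<phi> - pair (v t) \<phi>)) = ennreal (norm (LINT r|lebesgue. ?R u r - ?R v r))" by simp
  also have "\<dots> \<le> (\<integral>\<^sup>+r. ennreal (norm (?R u r - ?R v r)) \<partial>lebesgue)"
    by (rule integral_norm_bound_ennreal) (use i in auto)
  also have "\<dots> \<le> (\<integral>\<^sup>+r. ennreal ?I * (ennreal C * (indicator {0<..<t} r * (ennreal ((t - r) powr (- \<gamma>)) * (ennreal (N r) * b r)))) \<partial>lebesgue)"
  proof (rule nn_integral_mono_AE)
    have ne: "AE r in lebesgue. r \<noteq> c" for c :: real
      by (rule AE_completion) (rule AE_lborel_singleton)
    have L: "AE r in lebesgue. r \<in> {0..\<tau>} \<longrightarrow> deriv_dist (w r) \<in> L2_dist" if "mild_solution \<eta> \<Phi>0 s \<tau> x w" for w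
      using that unfolding mild_solution_def by blast
    show "AE r in lebesgue. ennreal (norm (?R u r - ?R v r))
      \<le> ennreal ?I * (ennreal C * (indicator {0<..<t} r * (ennreal ((t - r) powr (- \<gamma>)) * (ennreal (N r) * b r))))"
      using ne[of 0] ne[of t] L[OF u] L[OF v] N b
    proof eventually_elim
      case (elim r)
      show ?case
      proof (cases "0 < r \<and> r < t")
        case True
        then have r: "r \<in> {0..\<tau>}" "0 < r \<and> r < \<tau>" "0 < t - r" "t - r \<le> 1" using t \<tau> by auto
        let ?d = "L2_dist_norm (deriv_dist (u r - v r))"
        have dL: "deriv_dist (u r) \<in> L2_dist" "deriv_dist (v r) \<in> L2_dist" using elim r by auto
        have d0: "0 \<le> ?d" by (simp add: L2_dist_norm_def)
        have n: "L2_dist_norm (deriv_dist (u r)) + L2_dist_norm (deriv_dist (v r)) \<le> N r" using elim r by blast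
        then have N0: "0 \<le> N r" using L2_dist_triangle[OF dL] d0 by linarith
        have "norm (?R u r - ?R v r) = cmod (pair (propagator \<eta> \<Phi>0 (t - r) (deriv_square (u r))) \<phi> - pair (propagator \<eta> \<Phi>0 (t - r) (deriv_square (v r))) \<phi>)"
          using True by simp
        also have "\<dots> \<le> C * (t - r) powr (- \<gamma>) * (?d * (L2_dist_norm (deriv_dist (u r)) + L2_dist_norm (deriv_dist (v r)))) * ?I"
          by (rule source_difference[OF C dL r(3,4) \<phi>])
        also have "\<dots> \<le> C * (t - r) powr (- \<gamma>) * (?d * N r) * ?I"
          using C d0 n I0 by (intro mult_right_mono mult_left_mono) auto
        finally have "ennreal (norm (?R u r - ?R v r)) \<le> ennreal (C * (t - r) powr (- \<gamma>) * (?d * N r) * ?I)" by (rule ennreal_leI)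
        also have "\<dots> = ennreal ?I * (ennreal C * (ennreal ((t - r) powr (- \<gamma>)) * (ennreal (N r) * ennreal ?d)))"
          using C d0 N0 I0 by (simp add: ennreal_mult mult_ac)
        also have "\<dots> \<le> ennreal ?I * (ennreal C * (ennreal ((t - r) powr (- \<gamma>)) * (ennreal (N r) * b r)))"
          using elim r by (intro mult_left_mono) auto
        finally show ?thesis using True by simp
      next
        case False
        then have "r \<notin> {0..t}" using elim by auto
        then show ?thesis by simp
      qed
    qed
  qed
  also have "\<dots> = (\<integral>\<^sup>+r. ennreal ?I * (ennreal C * (indicator {0<..<t} r * (ennreal ((t - r) powr (- \<gamma>)) * (ennreal (N r) * b r)))) \<partial>lborel)"
    by (rule nn_integral_completion) measurable
  also have "\<dots> = ennreal ?I * volterra C \<gamma> N b t"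
    unfolding volterra_def by (simp add: nn_integral_cmult)
  finally show ?thesis .
qed

text \<open>One power of the bracket is spent on the derivative of the test function; the remaining
  \<open>bracket \<xi> powr (1 - p \<gamma>)\<close> is square integrable because \<open>p \<gamma> > 3 / 2\<close>.\<close>

lemma ift_vderiv_L1:
  "\<exists>L\<ge>0. \<forall>\<phi>\<in>schwartz. (LINT \<xi>|lborel. bracket \<xi> powr (- (p * \<gamma>)) * cmod (ift (vderiv \<phi>) \<xi>)) \<le> L * L2_norm \<phi>"
proof (intro exI[of _ "L2_norm (\<lambda>\<xi>. of_real (bracket \<xi> powr (- (p * \<gamma> - 1))))"] conjI ballI)
  fix \<phi> :: "real \<Rightarrow> complex" assume \<phi>: "\<phi> \<in> schwartz"
  let ?w = "\<lambda>\<xi>. complex_of_real (bracket \<xi> powr (- (p * \<gamma> - 1)))"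
  have w: "L2_fun ?w" using \<gamma>(3) by (intro L2_fun_bracket) simp
  have q: "L2_fun (ift \<phi>)" by (intro L2_fun_schwartz schwartz_ift \<phi>)
  have "(LINT \<xi>|lborel. bracket \<xi> powr (- (p * \<gamma>)) * cmod (ift (vderiv \<phi>) \<xi>)) \<le> (LINT \<xi>|lborel. cmod (?w \<xi> * ift \<phi> \<xi>))"
  proof (rule integral_mono')
    show "integrable lborel (\<lambda>\<xi>. cmod (?w \<xi> * ift \<phi> \<xi>))"
      by (intro integrable_norm L2_fun_product(1) w q)
    fix \<xi>
    have "bracket \<xi> powr (- (p * \<gamma>)) * cmod (ift (vderiv \<phi>) \<xi>) = bracket \<xi> powr (- (p * \<gamma>)) * (\<bar>\<xi>\<bar> * cmod (ift \<phi> \<xi>))"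
      using ift_vderiv[OF \<phi>, of \<xi>] by (simp add: norm_mult)
    also have "\<dots> \<le> bracket \<xi> powr (- (p * \<gamma>)) * (bracket \<xi> powr 1 * cmod (ift \<phi> \<xi>))"
      by (intro mult_left_mono mult_right_mono) (auto simp: abs_le_bracket)
    also have "\<dots> = bracket \<xi> powr (- (p * \<gamma>) + 1) * cmod (ift \<phi> \<xi>)" by (simp only: powr_add mult.assoc)
    also have "- (p * \<gamma>) + 1 = - (p * \<gamma> - 1)" by simp
    finally show "bracket \<xi> powr (- (p * \<gamma>)) * cmod (ift (vderiv \<phi>) \<xi>) \<le> cmod (?w \<xi> * ift \<phi> \<xi>)" by (simp add: norm_mult)
  qed simp
  also have "\<dots> \<le> L2_norm ?w * L2_norm (ift \<phi>)" by (rule L2_fun_product(2)[OF w q])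
  also have "\<dots> \<le> L2_norm ?w * L2_norm \<phi>" by (intro mult_left_mono L2_norm_ift_schwartz \<phi>) simp
  finally show "(LINT \<xi>|lborel. bracket \<xi> powr (- (p * \<gamma>)) * cmod (ift (vderiv \<phi>) \<xi>)) \<le> L2_norm ?w * L2_norm \<phi>" .
qed simp

text \<open>Uniqueness holds in the whole class of mild solutions, for which only \<open>u\<^sub>x \<in> L\<^sup>2([0, \<tau>] \<times> \<real>)\<close> is known. By
  duality the \<open>L\<^sup>2\<close> norm of \<open>u\<^sub>x - v\<^sub>x\<close> satisfies the Volterra inequality with \<open>N\<close> the sum of the two norms, so it
  vanishes for almost every time. Then the two sources agree, and with them the solutions.\<close>

theorem mild_unique:
  assumes u: "mild_solution \<eta> \<Phi>0 s \<tau> x u" and v: "mild_solution \<eta> \<Phi>0 s \<tau> x v" and \<tau>: "\<tau> \<le> 1"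
    and t: "t \<in> {0..\<tau>}"
  shows "u t = v t"
proof -
  have "0 \<le> p * \<gamma>" using p_pos \<gamma> by simp
  then obtain C where C: "0 \<le> C" "\<forall>t \<xi>. 0 < t \<longrightarrow> t \<le> 1 \<longrightarrow> cmod (m t \<xi>) \<le> C * (t powr (- \<gamma>) * bracket \<xi> powr (- (p * \<gamma>)))"
    using m_decay[of "p * \<gamma>"] p_pos by auto
  obtain L where L: "0 \<le> L" "\<And>\<phi>. \<phi> \<in> schwartz \<Longrightarrow> (LINT \<xi>|lborel. bracket \<xi> powr (- (p * \<gamma>)) * cmod (ift (vderiv \<phi>) \<xi>)) \<le> L * L2_norm \<phi>"
    using ift_vderiv_L1 by auto
  let ?n = "\<lambda>w r. L2_dist_norm (deriv_dist (w r))"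
  have n0: "0 \<le> ?n w r" for w r by (simp add: L2_dist_norm_def)
  have ex: "\<exists>P. P \<in> borel_measurable borel \<and> (\<forall>r. 0 \<le> P r) \<and> integrable lborel (\<lambda>r. (P r)\<^sup>2) \<and> (AE r in lebesgue. 0 < r \<and> r < \<tau> \<longrightarrow> ?n w r = P r)"
    if w: "mild_solution \<eta> \<Phi>0 s \<tau> x w" for w
  proof -
    let ?g = "\<lambda>r. indicator {0..\<tau>} r *\<^sub>R (?n w r)\<^sup>2"
    have gi: "integrable lebesgue ?g" using w unfolding mild_solution_def set_integrable_def by blast
    then have "?g \<in> borel_measurable lebesgue" by auto
    then have "(\<lambda>r. complex_of_real (?g r)) \<in> borel_measurable lebesgue" by (rule measurable_compose) measurable
    then obtain P0 where P0: "P0 \<in> borel_measurable borel" "AE r in lebesgue. complex_of_real (?g r) = P0 r"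
      by (rule ex_borel_representative)
    define P where "P r = sqrt (max 0 (Re (P0 r)))" for r
    have [measurable]: "P0 \<in> borel_measurable borel" by (rule P0(1))
    have Pm: "P \<in> borel_measurable borel" unfolding P_def by measurable
    have P2: "(P r)\<^sup>2 = max 0 (Re (P0 r))" for r by (simp add: P_def)
    have ae: "AE r in lebesgue. (P r)\<^sup>2 = ?g r"
      using P0(2)
    proof eventually_elim
      case (elim r)
      then have "Re (P0 r) = ?g r" by (metis Re_complex_of_real)
      then show ?case unfolding P2 by simp
    qed
    have P2m: "(\<lambda>r. (P r)\<^sup>2) \<in> borel_measurable lborel" using Pm by simp
    have "integrable lebesgue (\<lambda>r. (P r)\<^sup>2)"
      using integrable_cong_AE[of "\<lambda>r. (P r)\<^sup>2" lebesgue ?g] gi ae P2m by (auto simp: measurable_completion)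
    then have "integrable lborel (\<lambda>r. (P r)\<^sup>2)" using integrable_completion[OF P2m] by simp
    moreover have "AE r in lebesgue. 0 < r \<and> r < \<tau> \<longrightarrow> ?n w r = P r"
      using ae
    proof eventually_elim
      case (elim r)
      show ?case
      proof
        assume "0 < r \<and> r < \<tau>"
        then have "(P r)\<^sup>2 = (?n w r)\<^sup>2" using elim by simp
        moreover have "0 \<le> P r" by (simp add: P_def)
        ultimately show "?n w r = P r" using n0[of w r] by (simp add: power2_eq_iff_nonneg)
      qed
    qed
    moreover have "\<forall>r. 0 \<le> P r" by (simp add: P_def)
    ultimately show ?thesis using Pm by blast
  qed
  \<comment> \<open>Borel versions of the two norms, which are only Lebesgue measurable in time\<close>
  obtain P where P: "P \<in> borel_measurable borel" "\<forall>r. 0 \<le> P r" "integrable lborel (\<lambda>r. (P r)\<^sup>2)" "AE r in lebesgue. 0 < r \<and> r < \<tau> \<longrightarrow> ?n u r = P r"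
    using ex[OF u] by auto
  obtain Q where Q: "Q \<in> borel_measurable borel" "\<forall>r. 0 \<le> Q r" "integrable lborel (\<lambda>r. (Q r)\<^sup>2)" "AE r in lebesgue. 0 < r \<and> r < \<tau> \<longrightarrow> ?n v r = Q r"
    using ex[OF v] by auto
  define N where "N r = P r + Q r" for r
  have [measurable]: "P \<in> borel_measurable borel" "Q \<in> borel_measurable borel" by (rule P Q)+
  have Nm: "N \<in> borel_measurable borel" unfolding N_def by measurable
  have N0: "0 \<le> N r" for r using P Q by (simp add: N_def)
  have N2: "integrable lborel (\<lambda>r. (N r)\<^sup>2)"
  proof (rule integrable_dominated)
    show "integrable lborel (\<lambda>r. 2 * (P r)\<^sup>2 + 2 * (Q r)\<^sup>2)" using P Q by simp
    show "norm ((N r)\<^sup>2) \<le> 2 * (P r)\<^sup>2 + 2 * (Q r)\<^sup>2" for r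
      using sum_squares_bound[of "P r" "Q r"] zero_le_power2[of "P r + Q r"] by (simp add: N_def power2_sum abs_of_nonneg)
    show "(\<lambda>r. (N r)\<^sup>2) \<in> borel_measurable lborel" using Nm by simp
  qed
  have Nae: "AE r in lebesgue. 0 < r \<and> r < \<tau> \<longrightarrow> ?n u r + ?n v r \<le> N r"
    using P(4) Q(4) by eventually_elim (auto simp: N_def)
  have La: "AE r in lebesgue. r \<in> {0..\<tau>} \<longrightarrow> deriv_dist (w r) \<in> L2_dist" if "mild_solution \<eta> \<Phi>0 s \<tau> x w" for w
    using that unfolding mild_solution_def by blast
  define D where "D r = ennreal (L2_dist_norm (deriv_dist (u r - v r)))" for r
  note diff = mild_difference[OF C u v \<tau> Nm _ Nae, folded D_def]
  have lb: "AE r in lborel. P r" if "AE r in lebesgue. P r" for P :: "real \<Rightarrow> bool"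
    using that by (simp add: AE_completion_iff)
  have D0: "AE r in lborel. 0 < r \<and> r < \<tau> \<longrightarrow> D r = 0"
  proof (rule volterra_zero[OF \<gamma>(1,2) \<tau> Nm N0 N2])
    show "0 \<le> L * C" using L C by simp
    have "AE r in lebesgue. 0 < r \<and> r < \<tau> \<longrightarrow> D r \<le> ennreal (N r)"
      using La[OF u] La[OF v] Nae
    proof eventually_elim
      case (elim r)
      show ?case
      proof
        assume r: "0 < r \<and> r < \<tau>"
        then have "L2_dist_norm (deriv_dist (u r - v r)) \<le> ?n u r + ?n v r"
          using elim by (intro L2_dist_triangle) auto
        also have "\<dots> \<le> N r" using elim r by blast
        finally show "D r \<le> ennreal (N r)" unfolding D_def by (rule ennreal_leI)
      qed
    qed
    then show "AE r in lborel. 0 < r \<and> r < \<tau> \<longrightarrow> D r \<le> ennreal (N r)" by (rule lb)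
    fix b :: "real \<Rightarrow> ennreal"
    assume bm: "b \<in> borel_measurable borel" and bD: "AE r in lborel. 0 < r \<and> r < \<tau> \<longrightarrow> D r \<le> b r"
    have "AE r in lebesgue. 0 < r \<and> r < \<tau> \<longrightarrow> D r \<le> volterra (L * C) \<gamma> N b r"
      using La[OF u] La[OF v]
    proof eventually_elim
      case (elim t)
      show ?case
      proof
        assume t: "0 < t \<and> t < \<tau>"
        have du: "deriv_dist (u t) \<in> L2_dist" and dv: "deriv_dist (v t) \<in> L2_dist" using elim t by auto
        obtain h where h: "has_density (deriv_dist (u t - v t)) h" "L2_fun h" "L2_dist_norm (deriv_dist (u t - v t)) = L2_norm h"
          by (rule L2_dist_diff[OF du dv]) blast
        let ?V = "volterra C \<gamma> N b t"
        have V: "volterra (L * C) \<gamma> N b t = ennreal L * ?V"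
          using L C by (simp add: volterra_def ennreal_mult mult.assoc)
        show "D t \<le> volterra (L * C) \<gamma> N b t"
        proof (cases "ennreal L * ?V = \<infinity>")
          case True then show ?thesis by (simp add: V)
        next
          case False
          then obtain K where K: "0 \<le> K" "ennreal L * ?V = ennreal K" by (cases "ennreal L * ?V") auto
          have "L2_norm h \<le> K"
          proof (rule L2_duality(2)[OF h(1) L2_fun_measurable[OF h(2)] K(1)])
            fix \<phi> :: "real \<Rightarrow> complex" assume \<phi>: "\<phi> \<in> schwartz"
            have "cmod (deriv_dist (u t - v t) \<phi>) = cmod (pair (u t) (vderiv \<phi>) - pair (v t) (vderiv \<phi>))"
              by (simp add: deriv_dist_def minus_tempered.rep_eq norm_minus_commute)
            then have "ennreal (cmod (deriv_dist (u t - v t) \<phi>))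
                \<le> ennreal (LINT \<xi>|lborel. bracket \<xi> powr (- (p * \<gamma>)) * cmod (ift (vderiv \<phi>) \<xi>)) * ?V"
              using diff[OF bm AE_completion[OF bD] _ _ schwartz_vderiv[OF \<phi>], of t] t by simp
            also have "\<dots> \<le> ennreal (L * L2_norm \<phi>) * ?V"
              by (intro mult_right_mono ennreal_leI L \<phi>) simp
            also have "\<dots> = (ennreal L * ?V) * ennreal (L2_norm \<phi>)"
              using L(1) by (simp add: ennreal_mult mult_ac)
            also have "\<dots> = ennreal (K * L2_norm \<phi>)"
              unfolding K(2) using K(1) by (simp add: ennreal_mult)
            finally show "cmod (deriv_dist (u t - v t) \<phi>) \<le> K * L2_norm \<phi>"
              using K by (simp add: ennreal_le_iff)
          qed
          then show ?thesis unfolding V K D_def h(3) by (rule ennreal_leI)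
        qed
      qed
    qed
    then show "AE r in lborel. 0 < r \<and> r < \<tau> \<longrightarrow> D r \<le> volterra (L * C) \<gamma> N b r" by (rule lb)
  qed
  show "u t = v t"
  proof (rule tempered_eqI)
    fix \<phi> :: "real \<Rightarrow> complex" assume \<phi>: "\<phi> \<in> schwartz"
    have z: "(\<lambda>_. 0 :: ennreal) \<in> borel_measurable borel" by simp
    have "AE r in lebesgue. 0 < r \<and> r < \<tau> \<longrightarrow> D r \<le> 0"
      using AE_completion[OF D0] by eventually_elim simp
    from diff[OF z this _ _ \<phi>, of t] t show "pair (u t) \<phi> = pair (v t) \<phi>"
      by (simp add: volterra_def)
  qed
qed

end

section \<open>Smoothing\<close>

lemma powr_away_from_0:
  assumes "0 < \<epsilon>" "\<epsilon> \<le> t" "t \<le> (1::real)"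
  shows "t powr e \<le> \<epsilon> powr (- \<bar>e\<bar>)"
proof -
  have "t powr e \<le> t powr (- \<bar>e\<bar>)" using assms by (intro powr_mono') auto
  also have "\<dots> \<le> \<epsilon> powr (- \<bar>e\<bar>)" using assms by (intro powr_mono2') auto
  finally show ?thesis .
qed

context dissipative_rep
begin

text \<open>Away from \<open>t = 0\<close> the linear part has any desired decay in frequency, so the decay of the Duhamel part decides.\<close>

lemma profile_smooth_bound:
  assumes \<epsilon>: "0 < \<epsilon>" and \<tau>: "\<tau> \<le> 1" and B: "0 \<le> B" "\<And>t \<xi>. \<epsilon> \<le> t \<Longrightarrow> t \<le> \<tau> \<Longrightarrow> cmod (duhamel f t \<xi>) \<le> B * bracket \<xi> powr (- N)"
    and N: "\<sigma> + 1 \<le> N"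
  shows "\<exists>C\<ge>0. \<forall>g t \<xi>. \<epsilon> \<le> t \<longrightarrow> t \<le> \<tau> \<longrightarrow>
    bracket \<xi> powr \<sigma> * cmod (profile g f t \<xi>) \<le> C * cmod (of_real (bracket \<xi> powr s) * g \<xi>) + B * bracket \<xi> powr (- 1)"
proof -
  define a where "a = max 0 (\<sigma> - s)"
  have a: "0 \<le> a" "\<sigma> - a \<le> s" by (auto simp: a_def)
  obtain C where C: "0 \<le> C" "decay_bound a C"
    using m_decay[OF a(1)] by auto
  define C' where "C' = C * \<epsilon> powr (- \<bar>- (a / p)\<bar>)"
  have "bracket \<xi> powr \<sigma> * cmod (profile g f t \<xi>) \<le> C' * cmod (of_real (bracket \<xi> powr s) * g \<xi>) + B * bracket \<xi> powr (- 1)"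
    if t: "\<epsilon> \<le> t" "t \<le> \<tau>" for g t \<xi>
  proof -
    have t': "0 < t" "t \<le> 1" using t \<epsilon> \<tau> by auto
    have "cmod (m t \<xi>) \<le> C * (t powr (- (a / p)) * bracket \<xi> powr (- a))" using C(2) t' by blast
    also have "\<dots> \<le> C * (\<epsilon> powr (- \<bar>- (a / p)\<bar>) * bracket \<xi> powr (- a))"
      using C(1) t t' \<epsilon> by (intro mult_left_mono mult_right_mono powr_away_from_0) auto
    finally have m: "cmod (m t \<xi>) \<le> C' * bracket \<xi> powr (- a)" by (simp add: C'_def mult.assoc)
    have C'0: "0 \<le> C'" using C(1) by (simp add: C'_def)
    have "bracket \<xi> powr \<sigma> * cmod (profile g f t \<xi>) \<le> bracket \<xi> powr \<sigma> * (cmod (m t \<xi>) * cmod (g \<xi>) + cmod (duhamel f t \<xi>))"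
      unfolding profile_def using norm_triangle_ineq4[of "m t \<xi> * g \<xi>" "duhamel f t \<xi>"] by (intro mult_left_mono) (auto simp: norm_mult)
    also have "\<dots> \<le> bracket \<xi> powr \<sigma> * ((C' * bracket \<xi> powr (- a)) * cmod (g \<xi>) + B * bracket \<xi> powr (- N))"
      by (intro mult_left_mono add_mono mult_right_mono m B(2) t) auto
    also have "\<dots> = C' * ((bracket \<xi> powr \<sigma> * bracket \<xi> powr (- a)) * cmod (g \<xi>)) + B * (bracket \<xi> powr \<sigma> * bracket \<xi> powr (- N))"
      by (simp add: algebra_simps)
    also have "\<dots> \<le> C' * (bracket \<xi> powr s * cmod (g \<xi>)) + B * bracket \<xi> powr (- 1)"
      unfolding powr_add[symmetric] using a N C'0 B(1)
      by (intro add_mono mult_left_mono mult_right_mono bracket_powr_mono) auto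
    finally show ?thesis by (simp only: norm_mult norm_of_real abs_of_nonneg[OF powr_ge_zero])
  qed
  moreover have "0 \<le> C'" using C(1) by (simp add: C'_def)
  ultimately show ?thesis by blast
qed

text \<open>One step of the bootstrap. Decay of order \<open>k + 3 + n\<close> after time \<open>\<epsilon>\<close> bounds the space derivative, and hence its
  convolution square, with the weight of order \<open>k + 1 + n\<close>; the loss of two orders is due to the derivative and to
  square integrability. After time \<open>2 \<epsilon>\<close> the part of the Duhamel integral with \<open>r \<le> \<epsilon>\<close> is smoothed by a time
  at least \<open>\<epsilon>\<close>, and in the rest the multiplier gains three orders at the integrable cost \<open>(t - r) powr (- 3 / p)\<close>.\<close>

lemma duhamel_gain:
  assumes x: "x \<in> sobolev s" and \<tau>: "0 < \<tau>" "\<tau> \<le> 1" and fp: "source_form \<tau> (x, f) (x, f) = f"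
    and \<epsilon>: "0 < \<epsilon>" and B: "0 \<le> B" "\<And>t \<xi>. \<epsilon> \<le> t \<Longrightarrow> t \<le> \<tau> \<Longrightarrow> cmod (duhamel f t \<xi>) \<le> B * bracket \<xi> powr (- (k + 3 + real n))"
  shows "\<exists>B'\<ge>0. \<forall>t \<xi>. 2 * \<epsilon> \<le> t \<longrightarrow> t \<le> \<tau> \<longrightarrow> cmod (duhamel f t \<xi>) \<le> B' * bracket \<xi> powr (- (k + 3 + real (Suc n)))"
proof -
  define \<mu> where "\<mu> = k + 1 + real n"
  define a where "a = k + 3 + real (Suc n)"
  have \<mu>: "0 \<le> \<mu>" and a: "0 \<le> a" and a\<mu>: "a = \<mu> + 3" using k_nonneg by (auto simp: \<mu>_def a_def)
  obtain C where C: "0 \<le> C" "\<forall>g t \<xi>. \<epsilon> \<le> t \<longrightarrow> t \<le> \<tau> \<longrightarrow>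
    bracket \<xi> powr (\<mu> + 1) * cmod (profile g f t \<xi>) \<le> C * cmod (of_real (bracket \<xi> powr s) * g \<xi>) + B * bracket \<xi> powr (- 1)"
    using profile_smooth_bound[OF \<epsilon> \<tau>(2) B, of "\<mu> + 1"] by (auto simp: \<mu>_def)
  define K where "K = C * Hs_norm (hat x) + B * L2_norm (\<lambda>\<xi>. of_real (bracket \<xi> powr (- 1)))"
  have Hs_density: "Hs_density (hat x)" by (rule Hs_density_hat[OF x])
  then have [measurable]: "hat x \<in> borel_measurable borel" by (simp add: Hs_density_def)
  define Y where "Y = sqrt 2 powr \<mu> * K * K"
  have K0: "0 \<le> K" using C B by (simp add: K_def Hs_norm_def)
  then have Y0: "0 \<le> Y" by (simp add: Y_def)
  have source: "cmod (of_real (bracket \<xi> powr (- k) * r powr (- 2 * \<beta>)) * app f (r, \<xi>)) \<le> Y * bracket \<xi> powr (- \<mu>)"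
    if r: "\<epsilon> \<le> r" "r \<le> \<tau>" for r \<xi>
  proof -
    have r0: "0 < r" using r \<epsilon> by simp
    let ?F = "profile_x (hat x) f r"
    let ?w = "\<lambda>\<xi>. complex_of_real (bracket \<xi> powr \<mu>) * ?F \<xi>"
    have w1: "L2_fun (\<lambda>\<xi>. of_real (bracket \<xi> powr (- 1)))" by (rule L2_fun_bracket) simp
    have m: "(weighted (\<mu> + 1) (profile (hat x) f r)) \<in> borel_measurable borel" by measurable
    have le: "cmod (of_real (bracket \<xi> powr (\<mu> + 1)) * profile (hat x) f r \<xi>)
        \<le> C * cmod (of_real (bracket \<xi> powr s) * hat x \<xi>) + B * cmod (complex_of_real (bracket \<xi> powr (- 1)))" for \<xi>
      using C(2)[rule_format, OF r, of \<xi> "hat x"] by (simp only: norm_mult norm_of_real abs_of_nonneg[OF powr_ge_zero])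
    have "L2_fun (weighted (\<mu> + 1) (profile (hat x) f r))"
      "L2_norm (weighted (\<mu> + 1) (profile (hat x) f r)) \<le> K"
      unfolding K_def Hs_norm_def by (rule L2_fun_bound2[OF Hs_density[unfolded Hs_density_def, THEN conjunct2] w1 m C(1) B(1) le])+
    then have w: "L2_fun ?w" "L2_norm ?w \<le> K" using profile_x_weighted[of "hat x" \<mu> f r] by auto
    have "bracket \<xi> powr \<mu> * cmod (conv ?F ?F \<xi>) \<le> sqrt 2 powr \<mu> * L2_norm ?w * L2_norm ?w"
      by (rule conv_weighted_bound[OF \<mu> _ _ w(1) w(1)]) measurable
    also have "\<dots> \<le> Y" unfolding Y_def by (intro mult_mono w mult_left_mono) (auto intro!: mult_nonneg_nonneg K0)
    finally have "bracket \<xi> powr \<mu> * cmod (conv ?F ?F \<xi>) \<le> Y" .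
    then have c: "cmod (conv ?F ?F \<xi>) \<le> Y * bracket \<xi> powr (- \<mu>)" by (simp add: powr_minus field_simps)
    have "cmod (conv ?F ?F \<xi> / (2 * pi)) = cmod (conv ?F ?F \<xi>) / (2 * pi)" by (simp add: norm_divide norm_mult)
    also have "\<dots> \<le> cmod (conv ?F ?F \<xi>) / 1" using pi_gt3 by (intro divide_left_mono) auto
    finally show ?thesis using c unfolding fixed_point_source[OF x \<tau> fp r0 r(2)] by simp
  qed
  obtain Ca where Ca: "0 \<le> Ca" "decay_bound a Ca"
    using m_decay[OF a] by auto
  obtain C3 where C3: "0 \<le> C3" "decay_bound 3 C3"
    using m_decay[of 3] by auto
  define X where "X = Ca * \<epsilon> powr (- \<bar>- (a / p)\<bar>) * norm f"
  have X0: "0 \<le> X" using Ca by (simp add: X_def)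
  let ?S = "\<lambda>r. indicator {0<..<1} r * r powr (- (2 * \<beta>)) :: real"
  let ?T = "\<lambda>t r. indicator {0<..<t} r * ((t - r) powr (- (3 / p)) * r powr (- 0)) :: real"
  have p3: "0 \<le> 3 / p" "3 / p < 1" using p by auto
  have pt: "cmod (duhamel_integrand f t \<xi> r) \<le> bracket \<xi> powr (- a) * (X * ?S r + (C3 * Y) * ?T t r)"
    if t: "2 * \<epsilon> \<le> t" "t \<le> \<tau>" for t \<xi> r
  proof (cases "0 < r \<and> r < t")
    case True
    then have r: "0 < r" "r < t" "r < 1" and tr: "0 < t - r" "t - r \<le> 1" "t \<le> 1" using t \<tau> by auto
    let ?sf = "complex_of_real (bracket \<xi> powr (- k) * r powr (- 2 * \<beta>)) * app f (r, \<xi>)"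
    have D: "cmod (duhamel_integrand f t \<xi> r) = cmod (m (t - r) \<xi>) * cmod ?sf"
      using r by (simp add: duhamel_integrand_def norm_mult)
    show ?thesis
    proof (cases "r \<le> \<epsilon>")
      case True
      have sf: "cmod ?sf \<le> r powr (- (2 * \<beta>)) * norm f"
      proof -
        have "cmod ?sf = bracket \<xi> powr (- k) * r powr (- (2 * \<beta>)) * cmod (app f (r, \<xi>))" by (simp add: norm_mult)
        also have "\<dots> \<le> 1 * r powr (- (2 * \<beta>)) * norm f"
          using k_nonneg by (intro mult_mono app_le_norm bracket_powr_le_1) auto
        finally show ?thesis by simp
      qed
      have "cmod (m (t - r) \<xi>) \<le> Ca * ((t - r) powr (- (a / p)) * bracket \<xi> powr (- a))" using Ca(2) tr by blast
      also have "\<dots> \<le> Ca * (\<epsilon> powr (- \<bar>- (a / p)\<bar>) * bracket \<xi> powr (- a))"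
        using Ca(1) \<epsilon> True t tr by (intro mult_left_mono mult_right_mono powr_away_from_0) auto
      finally have "cmod (duhamel_integrand f t \<xi> r) \<le> (Ca * (\<epsilon> powr (- \<bar>- (a / p)\<bar>) * bracket \<xi> powr (- a))) * (r powr (- (2 * \<beta>)) * norm f)"
        unfolding D using Ca(1) by (intro mult_mono sf) auto
      also have "\<dots> = bracket \<xi> powr (- a) * (X * ?S r)" using r by (simp add: X_def mult_ac)
      also have "\<dots> \<le> bracket \<xi> powr (- a) * (X * ?S r + (C3 * Y) * ?T t r)"
        using C3 Y0 by (intro mult_left_mono) auto
      finally show ?thesis .
    next
      case False
      then have "cmod ?sf \<le> Y * bracket \<xi> powr (- \<mu>)" using r t by (intro source) auto
      then have "cmod (duhamel_integrand f t \<xi> r) \<le> (C3 * ((t - r) powr (- (3 / p)) * bracket \<xi> powr (- 3))) * (Y * bracket \<xi> powr (- \<mu>))"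
        unfolding D using C3(1) by (intro mult_mono C3(2)[rule_format] tr) auto
      also have "\<dots> = (bracket \<xi> powr (- 3) * bracket \<xi> powr (- \<mu>)) * ((C3 * Y) * (t - r) powr (- (3 / p)))" by (simp add: mult_ac)
      also have "bracket \<xi> powr (- 3) * bracket \<xi> powr (- \<mu>) = bracket \<xi> powr (- a)"
        unfolding powr_add[symmetric] a\<mu> by (rule arg_cong[where f = "\<lambda>z. bracket \<xi> powr z"]) simp
      also have "bracket \<xi> powr (- a) * ((C3 * Y) * (t - r) powr (- (3 / p))) \<le> bracket \<xi> powr (- a) * (X * ?S r + (C3 * Y) * ?T t r)"
        using r X0 by (intro mult_left_mono) auto
      finally show ?thesis .
    qed
  next
    case False
    then have "duhamel_integrand f t \<xi> r = 0" by (auto simp: duhamel_integrand_def)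
    then show ?thesis using X0 C3(1) Y0 by (auto intro!: mult_nonneg_nonneg add_nonneg_nonneg)
  qed
  define E where "E = 2 powr (3 / p) / (1 - 0) + 2 powr 0 / (1 - 3 / p)"
  define B' where "B' = X * (LINT r|lborel. ?S r) + (C3 * Y) * E"
  have Si: "integrable lborel ?S" using \<beta> by (intro integral_powr_0(1)) auto
  have E0: "0 \<le> E" using p3 by (simp add: E_def)
  have "cmod (duhamel f t \<xi>) \<le> B' * bracket \<xi> powr (- a)" if t: "2 * \<epsilon> \<le> t" "t \<le> \<tau>" for t \<xi>
  proof -
    have t': "0 < t" "t \<le> 1" using t \<epsilon> \<tau> by auto
    note Ti = time_integral[OF p3, of 0 t]
    have T: "integrable lborel (?T t)" using Ti(1) t' by simp
    have "(LINT r|lborel. ?T t r) \<le> E * t powr (1 - 3 / p - 0)" using Ti(2) t' unfolding E_def by simp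
    also have "\<dots> \<le> E * 1" using t' p3 E0 by (intro mult_left_mono) (auto intro!: powr_le1)
    finally have TE: "(LINT r|lborel. ?T t r) \<le> E" by simp
    have i: "integrable lborel (\<lambda>r. X * ?S r + (C3 * Y) * ?T t r)"
      by (intro Bochner_Integration.integrable_add integrable_mult_right Si T)
    have "cmod (duhamel f t \<xi>) \<le> (LINT r|lborel. cmod (duhamel_integrand f t \<xi> r))"
      unfolding duhamel_def by (rule integral_norm_bound)
    also have "\<dots> \<le> (LINT r|lborel. bracket \<xi> powr (- a) * (X * ?S r + (C3 * Y) * ?T t r))"
      by (intro integral_mono integrable_norm duhamel_integrand_integrable t' integrable_mult_right i pt t)
    also have "\<dots> = bracket \<xi> powr (- a) * (LINT r|lborel. X * ?S r + (C3 * Y) * ?T t r)" by (rule integral_mult_right_zero)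
    also have "(LINT r|lborel. X * ?S r + (C3 * Y) * ?T t r) = (LINT r|lborel. X * ?S r) + (LINT r|lborel. (C3 * Y) * ?T t r)"
      by (rule Bochner_Integration.integral_add[OF integrable_mult_right[OF Si] integrable_mult_right[OF T]])
    also have "\<dots> = X * (LINT r|lborel. ?S r) + (C3 * Y) * (LINT r|lborel. ?T t r)"
      by (simp only: integral_mult_right_zero)
    also have "\<dots> \<le> B'" unfolding B'_def using C3(1) Y0 by (intro add_left_mono mult_left_mono TE) auto
    finally show ?thesis by (simp add: mult.commute)
  qed
  moreover have "0 \<le> B'" using X0 C3(1) Y0 E0 by (simp add: B'_def)
  ultimately show ?thesis unfolding a_def by blast
qed

lemma duhamel_rapid_decay:
  assumes x: "x \<in> sobolev s" and \<tau>: "0 < \<tau>" "\<tau> \<le> 1" and fp: "source_form \<tau> (x, f) (x, f) = f" and \<epsilon>: "0 < \<epsilon>"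
  shows "\<exists>B\<ge>0. \<forall>t \<xi>. \<epsilon> \<le> t \<longrightarrow> t \<le> \<tau> \<longrightarrow> cmod (duhamel f t \<xi>) \<le> B * bracket \<xi> powr (- (k + 3 + real n))"
  using \<epsilon>
proof (induction n arbitrary: \<epsilon>)
  case 0
  obtain C where C: "0 \<le> C" "\<forall>f t \<xi>. 0 < t \<longrightarrow> t \<le> 1 \<longrightarrow> cmod (duhamel f t \<xi>) \<le> C * norm f * t powr (1 - 3 / p - 2 * \<beta>) * bracket \<xi> powr (- k - 3)"
    using duhamel_bound[of 3] p by auto
  define B where "B = C * norm f * \<epsilon> powr (- \<bar>1 - 3 / p - 2 * \<beta>\<bar>)"
  have "cmod (duhamel f t \<xi>) \<le> B * bracket \<xi> powr (- (k + 3 + real 0))" if t: "\<epsilon> \<le> t" "t \<le> \<tau>" for t \<xi>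
  proof -
    have t': "0 < t" "t \<le> 1" using t 0 \<tau> by auto
    have "cmod (duhamel f t \<xi>) \<le> C * norm f * t powr (1 - 3 / p - 2 * \<beta>) * bracket \<xi> powr (- k - 3)" using C(2) t' by blast
    also have "\<dots> \<le> B * bracket \<xi> powr (- k - 3)"
      unfolding B_def using C(1) 0 t t' by (intro mult_left_mono mult_right_mono powr_away_from_0) auto
    finally show ?thesis by simp
  qed
  moreover have "0 \<le> B" using C(1) by (simp add: B_def)
  ultimately show ?case by blast
next
  case (Suc n)
  have e: "0 < \<epsilon> / 2" using Suc.prems by simp
  obtain B where B: "0 \<le> B" "\<forall>t \<xi>. \<epsilon> / 2 \<le> t \<longrightarrow> t \<le> \<tau> \<longrightarrow> cmod (duhamel f t \<xi>) \<le> B * bracket \<xi> powr (- (k + 3 + real n))"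
    using Suc.IH[OF e] by blast
  show ?case using duhamel_gain[OF x \<tau> fp e B(1) B(2)[rule_format]] by simp
qed

theorem fixed_point_smooth:
  assumes x: "x \<in> sobolev s" and \<tau>: "0 < \<tau>" "\<tau> \<le> 1" and fp: "source_form \<tau> (x, f) (x, f) = f"
  shows "continuous_sobolev_infinity {0<..\<tau>} (trajectory \<tau> (x, f))"
  unfolding continuous_sobolev_infinity_def
proof
  fix \<sigma> :: real
  have z: "fst (x, f) \<in> sobolev s" using x by simp
  have sub: "{0<..\<tau>} \<subseteq> {0..\<tau>}" by auto
  show "continuous_sobolev \<sigma> {0<..\<tau>} (trajectory \<tau> (x, f))"
  proof (rule trajectory_continuous[OF z \<tau>(2) sub], unfold fst_conv snd_conv)
    fix t assume t: "t \<in> {0<..\<tau>}"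
    then have e: "0 < t / 2" by simp
    obtain n :: nat where "\<sigma> + 1 < real n" using reals_Archimedean2 by blast
    then have n: "\<sigma> + 1 \<le> k + 3 + real n" using k_nonneg by simp
    obtain B where B: "0 \<le> B" "\<forall>r \<xi>. t / 2 \<le> r \<longrightarrow> r \<le> \<tau> \<longrightarrow> cmod (duhamel f r \<xi>) \<le> B * bracket \<xi> powr (- (k + 3 + real n))"
      using duhamel_rapid_decay[OF x \<tau> fp e] by blast
    obtain C where C: "0 \<le> C" "\<forall>g r \<xi>. t / 2 \<le> r \<longrightarrow> r \<le> \<tau> \<longrightarrow>
      bracket \<xi> powr \<sigma> * cmod (profile g f r \<xi>) \<le> C * cmod (of_real (bracket \<xi> powr s) * g \<xi>) + B * bracket \<xi> powr (- 1)"
      using profile_smooth_bound[OF e \<tau>(2) B(1) B(2)[rule_format] n] by blast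
    let ?w = "\<lambda>\<xi>. complex_of_real (cmod (of_real (bracket \<xi> powr s) * hat x \<xi>))"
    let ?H = "\<lambda>\<xi>. of_real C * ?w \<xi> + of_real B * of_real (bracket \<xi> powr (- 1))"
    have "L2_fun (weighted s (hat x))" using Hs_density_hat[OF x] by (simp add: Hs_density_def)
    then have "L2_fun ?w" by (auto simp: L2_fun_def)
    then have H: "L2_fun ?H" by (intro L2_fun_lincomb L2_fun_bracket) auto
    have "bracket \<xi> powr \<sigma> * cmod (profile (hat x) f r \<xi>) \<le> cmod (?H \<xi>)" if r: "r \<in> {0<..\<tau>} \<inter> {t / 2<..}" for r \<xi>
    proof -
      have r': "t / 2 \<le> r" "r \<le> \<tau>" using r by auto
      have "?H \<xi> = complex_of_real (C * cmod (of_real (bracket \<xi> powr s) * hat x \<xi>) + B * bracket \<xi> powr (- 1))"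
        by (simp only: of_real_add of_real_mult)
      also have "cmod \<dots> = C * cmod (of_real (bracket \<xi> powr s) * hat x \<xi>) + B * bracket \<xi> powr (- 1)"
        unfolding norm_of_real using C(1) B(1) by (intro abs_of_nonneg add_nonneg_nonneg mult_nonneg_nonneg) auto
      finally show ?thesis using C(2)[rule_format, OF r', of \<xi> "hat x"] by simp
    qed
    then show "\<exists>J H. t \<in> J \<and> open J \<and> L2_fun H \<and> (\<forall>r\<in>{0<..\<tau>} \<inter> J. \<forall>\<xi>. bracket \<xi> powr \<sigma> * cmod (profile (hat x) f r \<xi>) \<le> cmod (H \<xi>))"
      using H e by (intro exI[of _ "{t / 2<..}"] exI[of _ ?H]) auto
  qed
qed

end

section \<open>Local well-posedness\<close>

text \<open>Since \<open>q < p\<close>, the perturbation \<open>\<Phi>\<^sub>1\<close> is at most \<open>\<bar>\<xi>\<bar> powr p / 2\<close> for large frequencies and bounded for the others.\<close>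

lemma dissipative_representative:
  fixes \<eta> p q C :: real
  assumes \<eta>: "0 < \<eta>" and q: "0 \<le> q" "q < p" and \<Phi>1: "\<Phi>1 \<in> borel_measurable lebesgue"
    and \<Phi>: "\<And>\<xi>. \<Phi> \<xi> = - (\<bar>\<xi>\<bar> powr p) + \<Phi>1 \<xi>" and C: "\<And>\<xi>. \<bar>\<Phi>1 \<xi>\<bar> \<le> C * (1 + \<bar>\<xi>\<bar> powr q)"
  obtains A \<Phi>b where "\<Phi> \<in> borel_measurable lebesgue" "\<Phi>b \<in> borel_measurable borel" "AE \<xi> in lebesgue. \<Phi> \<xi> = \<Phi>b \<xi>"
    "0 \<le> A" "\<And>\<xi>. \<eta> * \<Phi>b \<xi> \<le> A - \<eta> / 2 * \<bar>\<xi>\<bar> powr p"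
proof -
  define M where "M = max 1 ((4 * \<bar>C\<bar>) powr (1 / (p - q)))"
  define A where "A = \<bar>C\<bar> * (1 + M powr q)"
  have A0: "0 \<le> A" by (simp add: A_def)
  have perturbation: "\<Phi>1 \<xi> \<le> A + \<bar>\<xi>\<bar> powr p / 2" for \<xi>
  proof -
    define y where "y = \<bar>\<xi>\<bar>"
    have "\<Phi>1 \<xi> \<le> C * (1 + y powr q)" using C[of \<xi>] by (simp add: y_def)
    also have "\<dots> \<le> \<bar>C\<bar> * (1 + y powr q)" by (intro mult_right_mono) auto
    also have "\<dots> \<le> A + y powr p / 2"
    proof (cases "y \<le> M")
      case True
      then have "y powr q \<le> M powr q" using q by (intro powr_mono2) (auto simp: y_def)
      then have "\<bar>C\<bar> * (1 + y powr q) \<le> A" unfolding A_def by (intro mult_left_mono) auto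
      then show ?thesis by (simp add: add_increasing2)
    next
      case False
      then have y: "1 < y" "(4 * \<bar>C\<bar>) powr (1 / (p - q)) < y" by (auto simp: M_def)
      have "4 * \<bar>C\<bar> = ((4 * \<bar>C\<bar>) powr (1 / (p - q))) powr (p - q)" using q by (simp add: powr_powr)
      also have "\<dots> \<le> y powr (p - q)" using y q by (intro powr_mono2) auto
      finally have c: "4 * \<bar>C\<bar> \<le> y powr (p - q)" .
      have "1 \<le> y powr q" using y q by (intro ge_one_powr_ge_zero) auto
      then have "\<bar>C\<bar> * (1 + y powr q) \<le> \<bar>C\<bar> * (2 * y powr q)" by (intro mult_left_mono) auto
      also have "\<dots> = (4 * \<bar>C\<bar>) * y powr q / 2" by simp
      also have "\<dots> \<le> y powr (p - q) * y powr q / 2" using c by (intro divide_right_mono mult_right_mono) auto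
      also have "\<dots> = y powr p / 2" by (simp add: powr_add[symmetric])
      finally show ?thesis using A0 by linarith
    qed
    finally show ?thesis by (simp add: y_def)
  qed
  have pm: "(\<lambda>\<xi>::real. - (\<bar>\<xi>\<bar> powr p)) \<in> borel_measurable lebesgue"
    by (rule measurable_completion) measurable
  have \<Phi>m: "\<Phi> \<in> borel_measurable lebesgue"
    unfolding \<Phi>[abs_def] by (rule borel_measurable_add[OF pm \<Phi>1])
  then have "(\<lambda>\<xi>. complex_of_real (\<Phi> \<xi>)) \<in> borel_measurable lebesgue" by (rule measurable_compose) measurable
  then obtain g where g: "g \<in> borel_measurable borel" "AE \<xi> in lebesgue. complex_of_real (\<Phi> \<xi>) = g \<xi>"
    by (rule ex_borel_representative)
  have [measurable]: "g \<in> borel_measurable borel" by (rule g)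
  \<comment> \<open>the minimum enforces the upper bound also on the null set where the Borel function is uncontrolled\<close>
  define \<Phi>b where "\<Phi>b \<xi> = min (Re (g \<xi>)) (A - \<bar>\<xi>\<bar> powr p / 2)" for \<xi>
  show ?thesis
  proof (rule that[OF \<Phi>m])
    show "\<Phi>b \<in> borel_measurable borel" unfolding \<Phi>b_def by measurable
    show "AE \<xi> in lebesgue. \<Phi> \<xi> = \<Phi>b \<xi>"
      using g(2)
    proof eventually_elim
      case (elim \<xi>)
      then have "Re (g \<xi>) = \<Phi> \<xi>" by (metis Re_complex_of_real)
      then show ?case using perturbation[of \<xi>] \<Phi>[of \<xi>] by (simp add: \<Phi>b_def)
    qed
    show "0 \<le> \<eta> * A" using \<eta> A0 by simp
    show "\<eta> * \<Phi>b \<xi> \<le> \<eta> * A - \<eta> / 2 * \<bar>\<xi>\<bar> powr p" for \<xi>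
      using mult_left_mono[of "\<Phi>b \<xi>" "A - \<bar>\<xi>\<bar> powr p / 2" \<eta>] \<eta> by (simp add: \<Phi>b_def algebra_simps)
  qed
qed

context dissipative_rep
begin

theorem local_well_posedness:
  "\<exists>T :: real \<Rightarrow> real. \<forall>u0\<in>sobolev s. \<forall>\<tau>. \<tau> = T (sobolev_norm s u0) \<longrightarrow>
    0 < \<tau> \<and> \<tau> \<le> 1 \<and>
    (\<exists>u. unique_mild_solution \<eta> \<Phi>0 s \<tau> u0 u \<and> continuous_sobolev_infinity {0<..\<tau>} u) \<and>
    (\<exists>\<delta>>0. \<exists>S :: tempered \<Rightarrow> real \<Rightarrow> tempered.
       (\<forall>v0\<in>sobolev_ball s u0 \<delta>. unique_mild_solution \<eta> \<Phi>0 s \<tau> v0 (S v0)) \<and>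
       frechet_smooth_on (sobolev s) (sobolev_norm s) (CY_space p s \<tau>) (Y_norm p s \<tau>)
         (sobolev_ball s u0 \<delta>) S)"
proof -
  obtain \<alpha> b where ab: "0 \<le> \<alpha>" "0 \<le> b" and inst: "\<forall>\<tau> R. 0 < \<tau> \<longrightarrow> \<tau> \<le> 1 \<longrightarrow> 0 < R \<longrightarrow> 8 * \<alpha> * (b * \<tau> powr \<theta>) * R \<le> 1 \<longrightarrow>
    quadratic_equation (sobolev s) (sobolev_norm s) (source_form \<tau>) \<alpha> (b * \<tau> powr \<theta>) R"
    using quadratic_instance by blast
  obtain A where A: "0 \<le> A" "\<forall>\<tau> z. fst z \<in> sobolev s \<longrightarrow> 0 < \<tau> \<longrightarrow> \<tau> \<le> 1 \<longrightarrow>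
    trajectory \<tau> z \<in> CY_space p s \<tau> \<and> Y_norm p s \<tau> (trajectory \<tau> z) \<le> A * (sobolev_norm s (fst z) + norm (snd z))"
    using trajectory_CY by blast
  \<comment> \<open>this makes the product of \<open>8 \<alpha> b R\<close> and the power \<open>\<theta>\<close> of the life span at most 1 for the radius \<open>R = n + 1\<close>, which leaves room for a unit ball around the datum\<close>
  define T where "T n = min 1 ((1 / (8 * \<alpha> * b * (n + 1) + 1)) powr (1 / \<theta>))" for n
  show ?thesis
  proof (rule exI[of _ T], intro ballI allI impI)
    fix u0 \<tau> assume u0: "u0 \<in> sobolev s" and \<tau>T: "\<tau> = T (sobolev_norm s u0)"
    define R where "R = sobolev_norm s u0 + 1"
    have n0: "0 \<le> sobolev_norm s u0" by (simp add: sobolev_norm_def)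
    then have R: "0 < R" by (simp add: R_def)
    let ?c = "8 * \<alpha> * b * R"
    have c: "0 \<le> ?c" using ab R by simp
    have \<tau>: "0 < \<tau>" "\<tau> \<le> 1" and \<tau>p: "\<tau> \<le> (1 / (?c + 1)) powr (1 / \<theta>)"
      using c by (auto simp: \<tau>T T_def R_def)
    have "\<tau> powr \<theta> \<le> ((1 / (?c + 1)) powr (1 / \<theta>)) powr \<theta>" using \<tau> \<tau>p \<theta>_pos by (intro powr_mono2) auto
    also have "\<dots> = 1 / (?c + 1)" using \<theta>_pos c by (simp add: powr_powr)
    finally have "?c * \<tau> powr \<theta> \<le> ?c * (1 / (?c + 1))" using c by (intro mult_left_mono)
    also have "\<dots> \<le> 1"
    proof -
      have "y * (1 / (y + 1)) \<le> 1" if "0 \<le> y" for y :: real using that by (simp add: field_simps)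
      from this[OF c] show ?thesis .
    qed
    finally have small: "8 * \<alpha> * (b * \<tau> powr \<theta>) * R \<le> 1" by (simp add: mult_ac)
    interpret quadratic_equation "sobolev s" "sobolev_norm s" "source_form \<tau>" \<alpha> "b * \<tau> powr \<theta>" R
      using inst \<tau> R small by blast
    define S where "S v = trajectory \<tau> (v, sol v)" for v
    have unique: "unique_mild_solution \<eta> \<Phi>0 s \<tau> v (S v)" if v: "v \<in> U" for v
    proof -
      have vs: "v \<in> sobolev s" using v by (simp add: U_def)
      have m: "mild_solution \<eta> \<Phi>0 s \<tau> v (S v)" unfolding S_def by (rule fixed_point_mild[OF vs \<tau> sol(2)[OF v]])
      then show ?thesis unfolding unique_mild_solution_def using mild_unique[OF _ m \<tau>(2)] by blast
    qed
    have u0U: "u0 \<in> U" unfolding U_def using u0 by (simp add: R_def)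
    have ball: "sobolev_ball s u0 1 \<subseteq> U"
    proof
      fix v assume "v \<in> sobolev_ball s u0 1"
      then have v: "v \<in> sobolev s" "sobolev_norm s (v - u0) < 1" by (auto simp: sobolev_ball_def)
      have "v - u0 \<in> sobolev s" using sobolev_lincomb(1)[OF v(1) u0, of 1 "-1"] by simp
      from sobolev_norm_add[OF this u0] show "v \<in> U" unfolding U_def using v by (simp add: R_def)
    qed
    show "0 < \<tau> \<and> \<tau> \<le> 1 \<and>
      (\<exists>u. unique_mild_solution \<eta> \<Phi>0 s \<tau> u0 u \<and> continuous_sobolev_infinity {0<..\<tau>} u) \<and>
      (\<exists>\<delta>>0. \<exists>S :: tempered \<Rightarrow> real \<Rightarrow> tempered.
         (\<forall>v0\<in>sobolev_ball s u0 \<delta>. unique_mild_solution \<eta> \<Phi>0 s \<tau> v0 (S v0)) \<and>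
         frechet_smooth_on (sobolev s) (sobolev_norm s) (CY_space p s \<tau>) (Y_norm p s \<tau>)
           (sobolev_ball s u0 \<delta>) S)"
    proof (intro conjI \<tau> exI[of _ "S u0"] exI[of _ "1::real"] exI[of _ S] ballI)
      show "unique_mild_solution \<eta> \<Phi>0 s \<tau> u0 (S u0)" by (rule unique[OF u0U])
      show "continuous_sobolev_infinity {0<..\<tau>} (S u0)"
        unfolding S_def by (rule fixed_point_smooth[OF u0 \<tau> sol(2)[OF u0U]])
      show "unique_mild_solution \<eta> \<Phi>0 s \<tau> v (S v)" if "v \<in> sobolev_ball s u0 1" for v
        using unique ball that by blast
      show "frechet_smooth_on (sobolev s) (sobolev_norm s) (CY_space p s \<tau>) (Y_norm p s \<tau>) (sobolev_ball s u0 1) S"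
        unfolding S_def
      proof (rule solution_frechet_smooth[OF ball _ _ _ A(1)])
        show "trajectory \<tau> (c *\<^sub>R z + d *\<^sub>R w) t = c *\<^sub>R trajectory \<tau> z t + d *\<^sub>R trajectory \<tau> w t"
          if "fst z \<in> sobolev s" "fst w \<in> sobolev s" for z w c d t
          by (rule trajectory_linear[OF that \<tau>(2)])
        show "trajectory \<tau> z \<in> CY_space p s \<tau>" "Y_norm p s \<tau> (trajectory \<tau> z) \<le> A * (sobolev_norm s (fst z) + norm (snd z))"
          if "fst z \<in> sobolev s" for z
          using A(2) that \<tau> by blast+
      qed
    qed simp
  qed
qed

end

theorem theorem1p2:
  fixes \<eta> p q C s :: real and \<Phi> \<Phi>1 :: "real \<Rightarrow> real"
  assumes "\<eta> > 0" and "p > 3" and "0 \<le> q" and "q < p"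
    and "\<Phi>1 \<in> borel_measurable lebesgue"
    and "\<And>\<xi>. \<Phi> \<xi> = - (\<bar>\<xi>\<bar> powr p) + \<Phi>1 \<xi>"
    and "\<And>\<xi>. \<bar>\<Phi>1 \<xi>\<bar> \<le> C * (1 + \<bar>\<xi>\<bar> powr q)"
    and "s > 1 - p / 2"
  shows "\<exists>T :: real \<Rightarrow> real. \<forall>u0\<in>sobolev s. \<forall>\<tau>. \<tau> = T (sobolev_norm s u0) \<longrightarrow>
    0 < \<tau> \<and> \<tau> \<le> 1 \<and>
    (\<exists>u. unique_mild_solution \<eta> \<Phi> s \<tau> u0 u \<and> continuous_sobolev_infinity {0<..\<tau>} u) \<and>
    (\<exists>\<delta>>0. \<exists>S :: tempered \<Rightarrow> real \<Rightarrow> tempered.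
       (\<forall>v0\<in>sobolev_ball s u0 \<delta>. unique_mild_solution \<eta> \<Phi> s \<tau> v0 (S v0)) \<and>
       frechet_smooth_on (sobolev s) (sobolev_norm s) (CY_space p s \<tau>) (Y_norm p s \<tau>)
         (sobolev_ball s u0 \<delta>) S)"
proof -
  obtain A \<Phi>b where "\<Phi> \<in> borel_measurable lebesgue" "\<Phi>b \<in> borel_measurable borel" "AE \<xi> in lebesgue. \<Phi> \<xi> = \<Phi>b \<xi>"
    "0 \<le> A" "\<And>\<xi>. \<eta> * \<Phi>b \<xi> \<le> A - \<eta> / 2 * \<bar>\<xi>\<bar> powr p"
    using dissipative_representative[OF assms(1,3-7)] by blast
  then interpret dissipative_rep \<eta> p s A "\<eta> / 2" \<Phi>b \<Phi>
    using assms by unfold_locales auto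
  show ?thesis by (rule local_well_posedness)
qed

end
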